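(* Let $X$ be a connected, finite, simple $3$- or $4$-valent graph equipped with an orientation at each vertex, let $k\geq l\geq 0$ be integers with $k\neq 0$, and let $X'=\mathrm{GC}_{k,l}(X)$. Let $0=\lambda_1(X)<\lambda_2(X)\leq\cdots\leq\lambda_{|V(X)|}(X)$ and $0=\lambda_1(X')<\lambda_2(X')\leq\cdots\leq\lambda_{|V(X')|}(X')$ be the Laplacian eigenvalues of $X$ and $X'$. Then for $i=1,2,\dots,|V(X)|$, $$\lambda_i(\mathrm{GC}_{k,l}(X))\leq\begin{cases}\dfrac{3k}{k^2+kl+l^2}\lambda_i(X)&\text{if $X$ is $3$-valent},\\[2mm] \dfrac{2k}{k^2+l^2}\lambda_i(X)&\text{if $X$ is $4$-valent}.\end{cases}$$ If in particular $X$ is a bipartite $3$-valent graph, then for $i=1,\dots,|V(X)|$, $$\lambda_{|V(\mathrm{GC}_{k,l}(X))|-i+1}(\mathrm{GC}_{k,l}(X))\geq 6-\frac{3k}{k^2+kl+l^2}\lambda_i(X).$$ In the case $l=0$, for $i=1,\dots,|V(X)|$, $$\lambda_{|V(\mathrm{GC}_{k,0}(X))|-i+1}(\mathrm{GC}_{k,0}(X))\geq\begin{cases}3+\sqrt{5+4\cos\frac{2\pi}{k}}&\text{if $X$ is $3$-valent},\\ 4+4\cos\frac{2\pi}{k}&\text{if $X$ is $4$-valent and $k$ is even},\\ 4+4\cos\frac{\pi}{k}&\text{if $X$ is $4$-valent and $k$ is odd}.\end{cases}$$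
   Context: Graphs are connected, finite and simple. For a graph $Y$ the Laplacian acts on $f\in\mathbb{C}^{V(Y)}$ by $(\Delta_Y f)(p)=\deg(p)f(p)-\sum_{q\sim p}f(q)$; its eigenvalues are listed with multiplicity in nondecreasing order. An orientation at each vertex is a cyclic ordering of the edges emanating from each vertex. Goldberg–Coxeter construction ($3$-valent case): let $\omega=e^{\pi i/3}$, so $\mathbb{Z}[\omega]$ is the triangular lattice with unit (upward and downward) triangles. For $(k,l)\neq(0,0)$ put $z=k+l\omega$ and let $T$ be the triangle with vertices $0,z,\omega z$. For each $p\in V(X)$ take a copy $\overline{\triangle}(p)$ of the graph whose vertices are the barycenters of the unit lattice triangles meeting the interior of $T$, adjacent when the triangles share an edge; the three sides of $T$ are matched with the three edges at $p$ so that the cyclic order at $p$ agrees with the counterclockwise order of the sides. For each edge $e=pq$, place $\overline{\triangle}(p)$ on $T$ with $e$ corresponding to the side from $z$ to $\omega z$ and $\overline{\triangle}(q)$ (preserving orientation) on the triangle with vertices $z,(1+\omega)z,\omega z$ with $e$ corresponding to the side from $\omega z$ to $z$, and identify all overlapping vertices and edges. The result is the $3$-valent graph $\mathrm{GC}_{k,l}(X)$, with $(k^2+kl+l^2)|V(X)|$ vertices. ($4$-valent case): the same with the square lattice $\mathbb{Z}[i]$, $z=k+li$, the square with vertices $0,z,(1+i)z,iz$, barycenters of unit squares meeting its interior, and for an edge $pq$ the piece of $q$ placed on the adjacent square across the side from $z$ to $(1+i)z$; the result is a $4$-valent graph $\mathrm{GC}_{k,l}(X)$ with $(k^2+l^2)|V(X)|$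 vertices.
   Formalization: In the case l=0, the bound for 3-valent X is stated only for k≥2: for k=1 one has GC_{1,0}(X)=X, and at i=|V(X)| the bound would read λ_1(X)=0≥6, which is false for every X. *)

theory Defs
  imports "HOL-Analysis.Analysis" "Jordan_Normal_Form.Char_Poly"
begin

section \<open>Finite simple graphs\<close>

text \<open>A graph is a pair (V, E) with E a set of ordered pairs (adjacency relation).\<close>

type_synonym 'v graph = "'v set \<times> ('v \<times> 'v) set"

definition simple_graph :: "'v set \<Rightarrow> ('v \<times> 'v) set \<Rightarrow> bool" where
  "simple_graph V E \<longleftrightarrow> finite V \<and> V \<noteq> {} \<and> E \<subseteq> V \<times> V \<and> sym E \<and> irrefl E"

definition connected_graph :: "'v set \<Rightarrow> ('v \<times> 'v) set \<Rightarrow> bool" where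
  "connected_graph V E \<longleftrightarrow> (\<forall>x\<in>V. \<forall>y\<in>V. (x, y) \<in> E\<^sup>*)"

definition nbrs :: "('v \<times> 'v) set \<Rightarrow> 'v \<Rightarrow> 'v set" where
  "nbrs E p = {q. (p, q) \<in> E}"

definition deg :: "('v \<times> 'v) set \<Rightarrow> 'v \<Rightarrow> nat" where
  "deg E p = card (nbrs E p)"

definition regular :: "'v set \<Rightarrow> ('v \<times> 'v) set \<Rightarrow> nat \<Rightarrow> bool" where
  "regular V E d \<longleftrightarrow> (\<forall>p\<in>V. deg E p = d)"

definition bipartite :: "'v set \<Rightarrow> ('v \<times> 'v) set \<Rightarrow> bool" where
  "bipartite V E \<longleftrightarrow> (\<exists>A. \<forall>(p, q)\<in>E. (p \<in> A \<longleftrightarrow> q \<notin> A))"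

text \<open>Orientation at each vertex: a cyclic ordering of the edges at p, given as a
  permutation of the neighbours of p consisting of a single cycle (successor map).\<close>

definition orientation :: "'v set \<Rightarrow> ('v \<times> 'v) set \<Rightarrow> ('v \<Rightarrow> 'v \<Rightarrow> 'v) \<Rightarrow> bool" where
  "orientation V E \<sigma> \<longleftrightarrow>
     (\<forall>p\<in>V. bij_betw (\<sigma> p) (nbrs E p) (nbrs E p) \<and>
        (\<forall>r\<in>nbrs E p. \<forall>r'\<in>nbrs E p. \<exists>n. (\<sigma> p ^^ n) r = r'))"

text \<open>A matching of the d edges at each vertex with the sides 0,..,d-1 of the polygon
  (listed counterclockwise) compatible with the orientation.\<close>

definition compatible_labelling ::
  "'v set \<Rightarrow> ('v \<times> 'v) set \<Rightarrow> ('v \<Rightarrow> 'v \<Rightarrow> 'v) \<Rightarrow> nat \<Rightarrow> ('v \<Rightarrow> 'v \<Rightarrow> nat) \<Rightarrow> bool" where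
  "compatible_labelling V E \<sigma> d L \<longleftrightarrow>
     (\<forall>p\<in>V. bij_betw (L p) (nbrs E p) {..<d} \<and>
        (\<forall>r\<in>nbrs E p. L p (\<sigma> p r) = (L p r + 1) mod d))"

section \<open>Laplacian eigenvalues\<close>

definition lap_mat :: "'v graph \<Rightarrow> complex mat" where
  "lap_mat G = (let V = fst G; E = snd G; n = card V;
                    f = (SOME f. bij_betw f {..<n} V)
                in mat n n (\<lambda>(i, j). if i = j then of_nat (deg E (f i))
                                      else if (f i, f j) \<in> E then -1 else 0))"

text \<open>Eigenvalues with multiplicity (roots of the characteristic polynomial), in
  nondecreasing order; they are real as the Laplacian is symmetric.\<close>

definition lap_eigs :: "'v graph \<Rightarrow> real list" where
  "lap_eigs G = sorted_list_of_multiset (image_mset Re (proots (char_poly (lap_mat G))))"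

text \<open>lambda_i, indexed from 1.\<close>
definition lap_eig :: "'v graph \<Rightarrow> nat \<Rightarrow> real" where
  "lap_eig G i = lap_eigs G ! (i - 1)"

section \<open>Generic Goldberg--Coxeter gluing\<close>

text \<open>Tiles are represented by their vertex sets (unit triangles / unit squares);
  a tile corresponds to its barycenter. The piece of a vertex is the set of tiles
  meeting the interior of the region. rho rotates the region mapping side s to
  side s+1; sig maps the region onto the adjacent one across side 1, reversing it.
  A raw vertex (r, S) with r in {p,q} is placed, for the edge pq, on the plane.\<close>

definition gc_place ::
  "(complex \<Rightarrow> complex) \<Rightarrow> (complex \<Rightarrow> complex) \<Rightarrow> nat \<Rightarrow> ('v \<Rightarrow> 'v \<Rightarrow> nat)
     \<Rightarrow> 'v \<Rightarrow> 'v \<Rightarrow> 'v \<times> complex set \<Rightarrow> complex set" where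
  "gc_place rho sig d L p q x =
     (if fst x = p then (rho ^^ ((d + 1 - L p q) mod d)) ` snd x
      else (sig \<circ> (rho ^^ ((d + 1 - L q p) mod d))) ` snd x)"

definition gc_raw :: "'v set \<Rightarrow> complex set set \<Rightarrow> ('v \<times> complex set) set" where
  "gc_raw V P = Sigma V (\<lambda>_. P)"

definition gc_glue ::
  "('v \<times> 'v) set \<Rightarrow> complex set set \<Rightarrow> (complex \<Rightarrow> complex) \<Rightarrow> (complex \<Rightarrow> complex) \<Rightarrow> nat
     \<Rightarrow> ('v \<Rightarrow> 'v \<Rightarrow> nat) \<Rightarrow> 'v set \<Rightarrow> (('v \<times> complex set) \<times> ('v \<times> complex set)) set" where
  "gc_glue E P rho sig d L V =
     {(x, y). x \<in> gc_raw V P \<and> y \<in> gc_raw V P \<and>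
        (\<exists>p q. (p, q) \<in> E \<and> fst x = p \<and> fst y = q \<and>
               gc_place rho sig d L p q x = gc_place rho sig d L p q y)}"

definition gc_equiv ::
  "('v \<times> 'v) set \<Rightarrow> complex set set \<Rightarrow> (complex \<Rightarrow> complex) \<Rightarrow> (complex \<Rightarrow> complex) \<Rightarrow> nat
     \<Rightarrow> ('v \<Rightarrow> 'v \<Rightarrow> nat) \<Rightarrow> 'v set \<Rightarrow> (('v \<times> complex set) \<times> ('v \<times> complex set)) set" where
  "gc_equiv E P rho sig d L V =
     ((gc_glue E P rho sig d L V \<union> (gc_glue E P rho sig d L V)\<inverse>)\<^sup>* \<inter> (gc_raw V P \<times> gc_raw V P))"

definition gc_graph ::
  "complex set set \<Rightarrow> (complex \<Rightarrow> complex) \<Rightarrow> (complex \<Rightarrow> complex) \<Rightarrow> nat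
     \<Rightarrow> ('v \<Rightarrow> 'v \<Rightarrow> nat) \<Rightarrow> 'v set \<Rightarrow> ('v \<times> 'v) set \<Rightarrow> ('v \<times> complex set) set graph" where
  "gc_graph P rho sig d L V E =
     (let W = gc_raw V P // gc_equiv E P rho sig d L V
      in (W, {(X, Y). X \<in> W \<and> Y \<in> W \<and> X \<noteq> Y \<and>
               (\<exists>p q x y. (p, q) \<in> E \<and> x \<in> X \<and> y \<in> Y \<and> fst x \<in> {p, q} \<and> fst y \<in> {p, q} \<and>
                  gc_place rho sig d L p q x \<noteq> gc_place rho sig d L p q y \<and>
                  card (gc_place rho sig d L p q x \<inter> gc_place rho sig d L p q y) = 2)}))"

section \<open>The 3-valent case (triangular lattice)\<close>

definition \<omega> :: complex where "\<omega> = cis (pi / 3)"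

definition tlat :: "int \<Rightarrow> int \<Rightarrow> complex" where
  "tlat a b = of_int a + of_int b * \<omega>"

definition unit_triangles :: "complex set set" where
  "unit_triangles =
     {{tlat a b, tlat (a + 1) b, tlat a (b + 1)} | a b. True} \<union>
     {{tlat (a + 1) b, tlat a (b + 1), tlat (a + 1) (b + 1)} | a b. True}"

definition gc3_z :: "nat \<Rightarrow> nat \<Rightarrow> complex" where
  "gc3_z k l = of_nat k + of_nat l * \<omega>"

definition gc3_piece :: "nat \<Rightarrow> nat \<Rightarrow> complex set set" where
  "gc3_piece k l = {S \<in> unit_triangles.
      convex hull S \<inter> interior (convex hull {0, gc3_z k l, \<omega> * gc3_z k l}) \<noteq> {}}"

definition GC3 :: "nat \<Rightarrow> nat \<Rightarrow> 'v set \<Rightarrow> ('v \<times> 'v) set \<Rightarrow> ('v \<Rightarrow> 'v \<Rightarrow> 'v)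
                     \<Rightarrow> ('v \<times> complex set) set graph" where
  "GC3 k l V E \<sigma> =
     gc_graph (gc3_piece k l)
       (\<lambda>w. gc3_z k l + \<omega>\<^sup>2 * w)
       (\<lambda>w. (1 + \<omega>) * gc3_z k l - w)
       3 (SOME L. compatible_labelling V E \<sigma> 3 L) V E"

section \<open>The 4-valent case (square lattice)\<close>

definition slat :: "int \<Rightarrow> int \<Rightarrow> complex" where
  "slat a b = of_int a + of_int b * \<i>"

definition unit_squares :: "complex set set" where
  "unit_squares = {{slat a b, slat (a + 1) b, slat (a + 1) (b + 1), slat a (b + 1)} | a b. True}"

definition gc4_z :: "nat \<Rightarrow> nat \<Rightarrow> complex" where
  "gc4_z k l = of_nat k + of_nat l * \<i>"

definition gc4_piece :: "nat \<Rightarrow> nat \<Rightarrow> complex set set" where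
  "gc4_piece k l = {S \<in> unit_squares.
      convex hull S \<inter> interior (convex hull {0, gc4_z k l, (1 + \<i>) * gc4_z k l, \<i> * gc4_z k l}) \<noteq> {}}"

definition GC4 :: "nat \<Rightarrow> nat \<Rightarrow> 'v set \<Rightarrow> ('v \<times> 'v) set \<Rightarrow> ('v \<Rightarrow> 'v \<Rightarrow> 'v)
                     \<Rightarrow> ('v \<times> complex set) set graph" where
  "GC4 k l V E \<sigma> =
     gc_graph (gc4_piece k l)
       (\<lambda>w. gc4_z k l + \<i> * w)
       (\<lambda>w. (2 + \<i>) * gc4_z k l - w)
       4 (SOME L. compatible_labelling V E \<sigma> 4 L) V E"

end

theory Submission
  imports Defs "Jordan_Normal_Form.Schur_Decomposition" "HOL-Combinatorics.List_Permutation"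
begin

text \<open>All bounds are min-max estimates with explicit test spaces. Assign each tile of the glued graph to the
  vertex of \<open>X\<close> whose piece contains its barycenter, breaking ties evenly, and lift a function on \<open>X\<close> by
  giving each tile the value at its owner, or the average of the two values for a square centred on a side.
  The energy of the lift comes only from the edges crossing between two owners; per edge of \<open>X\<close> there are at
  most \<open>3k\<close> of them for triangles and \<open>k + l\<close> for squares, while the squared norm grows by the number of
  tiles per vertex. Lifting the span of the first \<open>i\<close> eigenfunctions gives the upper bounds. If \<open>X\<close> is bipartite and
  trivalent, so is the glued graph, and multiplying the lifts by the sign of the bipartition turns energy \<open>e\<close> into
  \<open>6 - e\<close>. For \<open>l = 0\<close> the pieces are disjoint, and copies of one eigenfunction of the piece,
  supported on single pieces, are orthogonal test functions for the upper end of the spectrum.\<close>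

section \<open>Unitary diagonalization of Hermitian matrices\<close>

text \<open>The pieces overlap: a tile cut by a side of the region occurs in the pieces of both ends
  of an edge. Every side is therefore rotated to side 0, across which the neighbouring piece is seen
  through the half-turn \<open>mir\<close> about the midpoint of the side. A tile belongs to the
  neighbouring piece across at most one side, so gluing classes have at most two members. For
  triangles, two crossings per column and one per row of the parallelogram over a side give 2k + l
  <= 3k. For squares there are k + l <= 2k crossings, but tiles centred on a side cost norm. If l <
  k the slack k - l pays for them, because such tiles force k - l to be even. If k = l there is no
  slack and such tiles are adjacent at corners; then the energy bound must keep a negative term in
  the norm of \<open>laplace E f\<close>, and k = l = 1 with eigenvalue 8 is left to a trivial
  bound. The bipartite bound also needs every class to keep three distinct neighbours, since
  parallel edges would merge in a simple graph.\<close>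

definition hadj :: "complex mat \<Rightarrow> complex mat" where
  "hadj U = mat (dim_col U) (dim_row U) (\<lambda>(i, j). cnj (U $$ (j, i)))"

lemma hadj_carrier [simp]: "U \<in> carrier_mat n m \<Longrightarrow> hadj U \<in> carrier_mat m n"
  by (auto simp: hadj_def)

lemma hadj_index: "U \<in> carrier_mat n m \<Longrightarrow> i < m \<Longrightarrow> j < n \<Longrightarrow> hadj U $$ (i, j) = cnj (U $$ (j, i))"
  by (auto simp: hadj_def)

lemma mat_mult_index:
  assumes "A \<in> carrier_mat n m" "B \<in> carrier_mat m p" "i < n" "j < p"
  shows "(A * B) $$ (i, j) = (\<Sum>k<m. A $$ (i, k) * B $$ (k, j))"
  using assms by (simp add: scalar_prod_def atLeast0LessThan)

lemma hadj_mult: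
  assumes "A \<in> carrier_mat n m" "B \<in> carrier_mat m p"
  shows "hadj (A * B) = hadj B * hadj A"
proof (rule eq_matI)
  have AB: "A * B \<in> carrier_mat n p" using assms by simp
  fix i j assume "i < dim_row (hadj B * hadj A)" "j < dim_col (hadj B * hadj A)"
  then have ij: "i < p" "j < n" using assms by (auto simp: hadj_def)
  show "hadj (A * B) $$ (i, j) = (hadj B * hadj A) $$ (i, j)"
    using assms ij AB
    by (simp add: hadj_index[OF AB] mat_mult_index[OF assms] hadj_index[OF assms(1)] hadj_index[OF assms(2)]
        mat_mult_index[OF hadj_carrier[OF assms(2)] hadj_carrier[OF assms(1)]] mult.commute del: index_mult_mat)
qed (use assms in \<open>auto simp: hadj_def\<close>)

lemma hadj_hadj: "U \<in> carrier_mat n m \<Longrightarrow> hadj (hadj U) = U"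
  by (auto simp: hadj_def intro!: eq_matI)

text \<open>Gram-Schmidt applied to a basis that starts with \<open>v\<close> keeps \<open>v\<close>
  as its first vector, and dividing by the norms makes the columns orthonormal. The factor
  \<open>c\<close> is the inverse norm of \<open>v\<close>.\<close>

lemma unitary_first_column:
  fixes v :: "complex vec"
  assumes v: "v \<in> carrier_vec n" and v0: "v \<noteq> 0\<^sub>v n"
  shows "\<exists>W\<in>carrier_mat n n. hadj W * W = 1\<^sub>m n \<and> (\<exists>c. c \<noteq> 0 \<and> (\<forall>i<n. W $$ (i, 0) = c * v $ i))"
proof -
  interpret cof_vec_space n "TYPE(complex)" .
  define b where "b = basis_completion v"
  define ws where "ws = gram_schmidt n b"
  from basis_completion[OF v v0, folded b_def]
  have dist_b: "distinct b" and indep: "\<not> lin_dep (set b)" and b: "set b \<subseteq> carrier_vec n"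
    and hdb: "hd b = v" and len_b: "length b = n" by auto
  from gram_schmidt_result[OF b dist_b indep refl, folded ws_def]
  have ws: "set ws \<subseteq> carrier_vec n" "corthogonal ws" "length ws = n" by (auto simp: len_b)
  have n: "n > 0" using v v0 by (intro Nat.gr0I) auto
  have hdws: "ws ! 0 = v"
  proof -
    obtain vs where bv: "b = v # vs" using hdb len_b n by (cases b) auto
    have "hd ws = v" unfolding ws_def bv using gram_schmidt_hd[OF v, of vs] by simp
    then show ?thesis using ws(3) n by (metis hd_conv_nth list.size(3) less_irrefl)
  qed
  have wsc: "j < n \<Longrightarrow> ws ! j \<in> carrier_vec n" for j using ws by auto
  have ip: "ws ! i \<bullet>c ws ! j = (\<Sum>k<n. ws ! i $ k * cnj (ws ! j $ k))" if "i < n" "j < n" for i j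
    using wsc[OF that(1)] wsc[OF that(2)] by (simp add: scalar_prod_def atLeast0LessThan)
  define r where "r j = sqrt (\<Sum>k<n. (cmod (ws ! j $ k))\<^sup>2)" for j
  have rr: "ws ! j \<bullet>c ws ! j = complex_of_real ((r j)\<^sup>2)" if "j < n" for j
    unfolding ip[OF that that] r_def
    by (simp add: sum_nonneg complex_norm_square[symmetric] del: of_real_power)
  have r0: "r j \<noteq> 0" if "j < n" for j
    using corthogonalD[OF ws(2), of j j] rr[OF that] that ws(3) by auto
  define W where "W = mat n n (\<lambda>(i, j). ws ! j $ i / complex_of_real (r j))"
  have W: "W \<in> carrier_mat n n" by (simp add: W_def)
  have "hadj W * W = 1\<^sub>m n"
  proof (rule eq_matI)
    fix i j assume "i < dim_row (1\<^sub>m n :: complex mat)" "j < dim_col (1\<^sub>m n :: complex mat)"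
    then have ij: "i < n" "j < n" by auto
    have "(hadj W * W) $$ (i, j) = (\<Sum>k<n. cnj (W $$ (k, i)) * W $$ (k, j))"
      using ij W by (simp add: mat_mult_index[OF hadj_carrier[OF W] W] hadj_index[OF W] del: index_mult_mat)
    also have "\<dots> = (\<Sum>k<n. ws ! j $ k * cnj (ws ! i $ k)) / (complex_of_real (r i) * complex_of_real (r j))"
      using ij by (simp add: W_def sum_divide_distrib mult.commute)
    also have "\<dots> = (ws ! j \<bullet>c ws ! i) / (complex_of_real (r i) * complex_of_real (r j))"
      using ip[OF ij(2) ij(1)] by simp
    also have "\<dots> = (1\<^sub>m n) $$ (i, j)"
    proof (cases "i = j")
      case True
      then show ?thesis using rr[OF ij(1)] r0[OF ij(1)] ij by (simp add: power2_eq_square)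
    next
      case False
      then have "ws ! j \<bullet>c ws ! i = 0" using corthogonalD[OF ws(2), of j i] ij ws(3) by auto
      then show ?thesis using False ij by simp
    qed
    finally show "(hadj W * W) $$ (i, j) = (1\<^sub>m n) $$ (i, j)" .
  qed (use W in \<open>auto simp: hadj_def\<close>)
  moreover have "\<forall>i<n. W $$ (i, 0) = inverse (complex_of_real (r 0)) * v $ i"
    using n hdws by (simp add: W_def divide_inverse mult.commute)
  moreover have "inverse (complex_of_real (r 0)) \<noteq> 0" using r0[OF n] by simp
  ultimately show ?thesis using W by blast
qed

text \<open>Induction by deflation: a normalized eigenvector becomes the first column of the unitary
  \<open>W\<close>, and \<open>hadj W * (A * W)\<close> then splits off a block of size 1. The
  \<open>d j\<close> are merely complex here; that they are real is shown where the Laplacian is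
  diagonalized.\<close>

lemma hermitian_diagonalization:
  fixes A :: "complex mat"
  assumes "A \<in> carrier_mat n n" and "hadj A = A"
  shows "\<exists>U\<in>carrier_mat n n. \<exists>d. hadj U * U = 1\<^sub>m n \<and>
           (\<forall>i<n. \<forall>j<n. (A * U) $$ (i, j) = d j * U $$ (i, j))"
  using assms
proof (induction n arbitrary: A)
  case 0
  then show ?case by (intro bexI[of _ "1\<^sub>m 0"]) (auto intro!: eq_matI simp: hadj_def)
next
  case (Suc n)
  note A = Suc.prems(1)
  have "\<not> constant (poly (char_poly A))"
    using degree_monic_char_poly[OF A] by (simp add: constant_degree)
  then obtain e where "poly (char_poly A) e = 0" using fundamental_theorem_of_algebra by blast
  then have "eigenvalue A e" using eigenvalue_root_char_poly[OF A] by simp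
  then obtain v where v: "v \<in> carrier_vec (Suc n)" "v \<noteq> 0\<^sub>v (Suc n)" "A *\<^sub>v v = e \<cdot>\<^sub>v v"
    using A unfolding eigenvalue_def eigenvector_def by auto
  from unitary_first_column[OF v(1,2)] obtain W c where
    W: "W \<in> carrier_mat (Suc n) (Suc n)" "hadj W * W = 1\<^sub>m (Suc n)"
    and c: "c \<noteq> 0" "\<forall>i<Suc n. W $$ (i, 0) = c * v $ i" by auto
  note hW = hadj_carrier[OF W(1)]
  have WW: "W * hadj W = 1\<^sub>m (Suc n)" using mat_mult_left_right_inverse[OF hW W(1) W(2)] .
  define B where "B = hadj W * (A * W)"
  have AW: "A * W \<in> carrier_mat (Suc n) (Suc n)" using A W by simp
  have B: "B \<in> carrier_mat (Suc n) (Suc n)" unfolding B_def using hW AW by simp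
  have hB: "hadj B = B"
    unfolding B_def hadj_mult[OF hW AW] hadj_mult[OF A W(1)] hadj_hadj[OF W(1)] Suc.prems(2)
    using hW A W(1) by (simp add: assoc_mult_mat[of _ "Suc n" "Suc n" _ "Suc n" _ "Suc n"])
  have AW0: "(A * W) $$ (i, 0) = e * W $$ (i, 0)" if "i < Suc n" for i
  proof -
    have "(A * W) $$ (i, 0) = (\<Sum>k<Suc n. A $$ (i, k) * (c * v $ k))"
      using c that by (simp add: mat_mult_index[OF A W(1)] del: index_mult_mat sum.lessThan_Suc)
    also have "\<dots> = c * (A *\<^sub>v v) $ i"
      using A v(1) that by (simp add: scalar_prod_def atLeast0LessThan sum_distrib_left mult_ac del: sum.lessThan_Suc)
    also have "\<dots> = e * W $$ (i, 0)" using v that c by simp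
    finally show ?thesis .
  qed
  \<comment> \<open>The first column of \<open>B\<close> is \<open>e\<close> times the first column
    of \<open>hadj W * W\<close>, which is the identity. Since \<open>B\<close> is Hermitian, its
    first row follows.\<close>
  have B0: "B $$ (i, 0) = (if i = 0 then e else 0)" if "i < Suc n" for i
  proof -
    have "B $$ (i, 0) = (\<Sum>k<Suc n. hadj W $$ (i, k) * (e * W $$ (k, 0)))"
      using that AW0 by (simp add: B_def mat_mult_index[OF hW AW] del: index_mult_mat sum.lessThan_Suc)
    also have "\<dots> = e * (hadj W * W) $$ (i, 0)"
      using that by (simp add: mat_mult_index[OF hW W(1)] sum_distrib_left mult_ac del: index_mult_mat sum.lessThan_Suc)
    finally show ?thesis using that unfolding W(2) by simp
  qed
  have B0': "B $$ (0, j) = (if j = 0 then e else 0)" if "j < Suc n" for j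
  proof (cases "j = 0")
    case False
    have "B $$ (0, j) = cnj (B $$ (j, 0))" using hadj_index[OF B, of 0 j] that hB by simp
    then show ?thesis using B0[OF that] False by simp
  qed (use B0 in auto)
  define C where "C = mat n n (\<lambda>(i, j). B $$ (Suc i, Suc j))"
  have C: "C \<in> carrier_mat n n" by (simp add: C_def)
  have hC: "hadj C = C"
  proof (rule eq_matI)
    fix i j assume "i < dim_row C" "j < dim_col C"
    then have "i < n" "j < n" using C by auto
    then show "hadj C $$ (i, j) = C $$ (i, j)"
      using hadj_index[OF B, of "Suc i" "Suc j"] hB hadj_index[OF C, of i j] by (simp add: C_def)
  qed (use C in \<open>auto simp: hadj_def\<close>)
  from Suc.IH[OF C hC] obtain U d where U: "U \<in> carrier_mat n n" "hadj U * U = 1\<^sub>m n"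
    and d: "\<And>i j. i < n \<Longrightarrow> j < n \<Longrightarrow> (C * U) $$ (i, j) = d j * U $$ (i, j)" by auto
  \<comment> \<open>The block sum of 1 and \<open>U\<close>. The unitary that diagonalizes
    \<open>A\<close> is \<open>W * U'\<close>.\<close>
  define U' where "U' = mat (Suc n) (Suc n)
    (\<lambda>(i, j). if i = 0 \<and> j = 0 then 1 else if i = 0 \<or> j = 0 then 0 else U $$ (i - 1, j - 1))"
  define d' where "d' j = (if j = 0 then e else d (j - 1))" for j
  have U': "U' \<in> carrier_mat (Suc n) (Suc n)" by (simp add: U'_def)
  note hU' = hadj_carrier[OF U']
  have UU': "hadj U' * U' = 1\<^sub>m (Suc n)"
  proof (rule eq_matI)
    fix i j assume "i < dim_row (1\<^sub>m (Suc n) :: complex mat)" "j < dim_col (1\<^sub>m (Suc n) :: complex mat)"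
    then have ij: "i < Suc n" "j < Suc n" by auto
    have "(hadj U' * U') $$ (i, j) = (\<Sum>k<Suc n. cnj (U' $$ (k, i)) * U' $$ (k, j))"
      using ij by (simp add: mat_mult_index[OF hU' U'] hadj_index[OF U'] del: index_mult_mat sum.lessThan_Suc)
    also have "\<dots> = cnj (U' $$ (0, i)) * U' $$ (0, j) + (\<Sum>k<n. cnj (U' $$ (Suc k, i)) * U' $$ (Suc k, j))"
      by (rule sum.lessThan_Suc_shift)
    also have "\<dots> = (1\<^sub>m (Suc n)) $$ (i, j)"
    proof (cases "i = 0 \<or> j = 0")
      case True
      then show ?thesis using ij by (auto simp: U'_def)
    next
      case False
      then obtain i' j' where [simp]: "i = Suc i'" "j = Suc j'" by (metis not0_implies_Suc)
      have "(\<Sum>k<n. cnj (U $$ (k, i')) * U $$ (k, j')) = (hadj U * U) $$ (i', j')"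
        using ij by (simp add: mat_mult_index[OF hadj_carrier[OF U(1)] U(1)] hadj_index[OF U(1)] del: index_mult_mat)
      then show ?thesis using ij unfolding U(2) by (simp add: U'_def)
    qed
    finally show "(hadj U' * U') $$ (i, j) = (1\<^sub>m (Suc n)) $$ (i, j)" .
  qed (use U' in \<open>auto simp: hadj_def\<close>)
  have BU': "(B * U') $$ (i, j) = d' j * U' $$ (i, j)" if ij: "i < Suc n" "j < Suc n" for i j
  proof -
    have "(B * U') $$ (i, j) = (\<Sum>k<Suc n. B $$ (i, k) * U' $$ (k, j))"
      using ij by (simp add: mat_mult_index[OF B U'] del: index_mult_mat sum.lessThan_Suc)
    also have "\<dots> = B $$ (i, 0) * U' $$ (0, j) + (\<Sum>k<n. B $$ (i, Suc k) * U' $$ (Suc k, j))"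
      by (rule sum.lessThan_Suc_shift)
    also have "\<dots> = d' j * U' $$ (i, j)"
    proof (cases "i = 0 \<or> j = 0")
      case True
      then show ?thesis using ij B0 B0' by (auto simp: U'_def d'_def)
    next
      case False
      then obtain i' j' where [simp]: "i = Suc i'" "j = Suc j'" by (metis not0_implies_Suc)
      have "(\<Sum>k<n. B $$ (i, Suc k) * U $$ (k, j')) = (C * U) $$ (i', j')"
        using ij by (subst mat_mult_index[OF C U(1)]) (auto simp: C_def)
      then show ?thesis using ij d[of i' j'] by (simp add: U'_def d'_def)
    qed
    finally show ?thesis .
  qed
  define X where "X = W * U'"
  have X: "X \<in> carrier_mat (Suc n) (Suc n)" using W U' by (simp add: X_def)
  have assoc: "P * Q * R = P * (Q * R)" if "P \<in> carrier_mat (Suc n) (Suc n)" "Q \<in> carrier_mat (Suc n) (Suc n)"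
    "R \<in> carrier_mat (Suc n) (Suc n)" for P Q R :: "complex mat"
    using that by (rule assoc_mult_mat)
  have "hadj X * X = hadj U' * (hadj W * (W * U'))"
    unfolding X_def hadj_mult[OF W(1) U'] using W(1) hW U' hU' by (intro assoc) auto
  also have "hadj W * (W * U') = U'"
    unfolding assoc[OF hW W(1) U', symmetric] W(2) by (rule left_mult_one_mat[OF U'])
  finally have XX: "hadj X * X = 1\<^sub>m (Suc n)" using UU' by simp
  have WB: "W * B = A * W"
    unfolding B_def assoc[OF W(1) hW AW, symmetric] WW by (rule left_mult_one_mat[OF AW])
  have AX: "A * X = W * (B * U')"
    unfolding X_def assoc[OF W(1) B U', symmetric] WB by (rule assoc[OF A W(1) U', symmetric])
  have BUc: "B * U' \<in> carrier_mat (Suc n) (Suc n)" using B U' by simp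
  have "(A * X) $$ (i, j) = d' j * X $$ (i, j)" if ij: "i < Suc n" "j < Suc n" for i j
  proof -
    have "(A * X) $$ (i, j) = (\<Sum>k<Suc n. W $$ (i, k) * (d' j * U' $$ (k, j)))"
      unfolding AX using ij BU' by (simp add: mat_mult_index[OF W(1) BUc] del: index_mult_mat sum.lessThan_Suc)
    also have "\<dots> = d' j * X $$ (i, j)"
      unfolding X_def using ij by (simp add: mat_mult_index[OF W(1) U'] sum_distrib_left mult_ac del: index_mult_mat sum.lessThan_Suc)
    finally show ?thesis .
  qed
  then show ?case using X XX by blast
qed

section \<open>The Laplacian spectrum and test spaces\<close>

text \<open>Padding the \<open>m\<close> equations with zero rows gives a singular square matrix.
  This is the dimension count behind both min-max estimates.\<close>

lemma homogeneous_solution: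
  fixes a :: "nat \<Rightarrow> nat \<Rightarrow> 'a :: field"
  assumes "m < n"
  shows "\<exists>c. (\<exists>j<n. c j \<noteq> 0) \<and> (\<forall>i<m. (\<Sum>j<n. a i j * c j) = 0)"
proof -
  define A where "A = mat n n (\<lambda>(i, j). if i < m then a i j else 0)"
  have A: "A \<in> carrier_mat n n" by (simp add: A_def)
  have "det A = 0"
    using assms by (subst laplace_expansion_row[OF A assms]) (auto simp: A_def intro!: sum.neutral)
  then obtain v where v: "v \<in> carrier_vec n" "v \<noteq> 0\<^sub>v n" "A *\<^sub>v v = 0\<^sub>v n"
    using det_0_iff_vec_prod_zero_field[OF A] by auto
  have "\<exists>j<n. v $ j \<noteq> 0" using v(1,2) by (metis eq_vecI carrier_vecD index_zero_vec)
  moreover have "(\<Sum>j<n. a i j * v $ j) = 0" if "i < m" for i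
  proof -
    have i: "i < n" using that assms by simp
    have "(A *\<^sub>v v) $ i = (\<Sum>j<n. a i j * v $ j)"
      using i that v(1) by (simp add: A_def scalar_prod_def atLeast0LessThan)
    then show ?thesis using v(3) i by simp
  qed
  ultimately show ?thesis by (intro exI[of _ "\<lambda>j. v $ j"]) auto
qed

text \<open>The Dirichlet form. The edge relation holds both orientations of every edge, whence the
  division by 2.\<close>

definition energy :: "('w \<times> 'w) set \<Rightarrow> ('w \<Rightarrow> complex) \<Rightarrow> real" where
  "energy F g = (\<Sum>(x, y)\<in>F. (cmod (g x - g y))\<^sup>2) / 2"

definition sqnorm :: "'w set \<Rightarrow> ('w \<Rightarrow> complex) \<Rightarrow> real" where
  "sqnorm W g = (\<Sum>x\<in>W. (cmod (g x))\<^sup>2)"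

definition laplace :: "('w \<times> 'w) set \<Rightarrow> ('w \<Rightarrow> complex) \<Rightarrow> 'w \<Rightarrow> complex" where
  "laplace F g x = (\<Sum>y\<in>nbrs F x. g x - g y)"

definition finite_graph :: "'w set \<Rightarrow> ('w \<times> 'w) set \<Rightarrow> bool" where
  "finite_graph W F \<longleftrightarrow> finite W \<and> F \<subseteq> W \<times> W \<and> sym F \<and> irrefl F"

lemma finite_graphD:
  assumes "finite_graph W F"
  shows "finite W" "F \<subseteq> W \<times> W" "sym F" "irrefl F" "finite F" "finite (nbrs F x)" "nbrs F x \<subseteq> W"
proof -
  show *: "finite W" "F \<subseteq> W \<times> W" "sym F" "irrefl F" using assms by (auto simp: finite_graph_def)
  then show "finite F" by (meson finite_SigmaI finite_subset)
  show "nbrs F x \<subseteq> W" using *(2) by (auto simp: nbrs_def)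
  then show "finite (nbrs F x)" using *(1) finite_subset by blast
qed

lemma edge_sum_eq:
  assumes "finite_graph W F"
  shows "(\<Sum>(x, y)\<in>F. h x y) = (\<Sum>x\<in>W. \<Sum>y\<in>nbrs F x. h x y)"
proof -
  have "F = Sigma W (nbrs F)" using finite_graphD(2)[OF assms] by (auto simp: nbrs_def)
  then have "(\<Sum>(x, y)\<in>F. h x y) = (\<Sum>(x, y)\<in>Sigma W (nbrs F). h x y)" by simp
  then show ?thesis using finite_graphD[OF assms] by (simp add: sum.Sigma)
qed

lemma edge_sum_swap:
  assumes "finite_graph W F"
  shows "(\<Sum>(x, y)\<in>F. h x y) = (\<Sum>(x, y)\<in>F. h y x)"
  using finite_graphD(3)[OF assms]
  by (intro sum.reindex_bij_witness[of _ prod.swap prod.swap]) (auto simp: sym_def)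

text \<open>Exchanging the ends of each ordered pair shows that the two halves of
  \<open>(g x - g y) * cnj (g x - g y)\<close> have the same sum. This identifies the Dirichlet form
  with the quadratic form of the Laplacian.\<close>

lemma green:
  assumes "finite_graph W F"
  shows "complex_of_real (energy F g) = (\<Sum>x\<in>W. cnj (g x) * laplace F g x)"
proof -
  have "complex_of_real (2 * energy F g) = (\<Sum>(x, y)\<in>F. (g x - g y) * cnj (g x - g y))"
    by (simp add: energy_def complex_norm_square[symmetric] case_prod_unfold del: of_real_power complex_cnj_diff)
  also have "\<dots> = (\<Sum>(x, y)\<in>F. cnj (g x) * (g x - g y)) + (\<Sum>(x, y)\<in>F. cnj (g y) * (g y - g x))"
    unfolding sum.distrib[symmetric] by (rule sum.cong) (auto simp: algebra_simps)
  also have "(\<Sum>(x, y)\<in>F. cnj (g y) * (g y - g x)) = (\<Sum>(x, y)\<in>F. cnj (g x) * (g x - g y))"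
    by (rule edge_sum_swap[OF assms])
  also have "(\<Sum>(x, y)\<in>F. cnj (g x) * (g x - g y)) = (\<Sum>x\<in>W. cnj (g x) * laplace F g x)"
    by (simp add: edge_sum_eq[OF assms] laplace_def sum_distrib_left)
  finally show ?thesis by simp
qed

lemma proots_linear_product: "proots (\<Prod>a\<leftarrow>xs. [:- a, 1:]) = mset (xs :: complex list)"
proof (induction xs)
  case (Cons a xs)
  have "(\<Prod>a\<leftarrow>xs. [:- a, 1:]) \<noteq> (0 :: complex poly)" by (induction xs) (auto simp del: mult_pCons_left)
  then show ?case using Cons by (simp add: proots_mult del: mult_pCons_left)
qed auto

definition coef :: "'w set \<Rightarrow> (nat \<Rightarrow> 'w \<Rightarrow> complex) \<Rightarrow> ('w \<Rightarrow> complex) \<Rightarrow> nat \<Rightarrow> complex" where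
  "coef W \<phi> g j = (\<Sum>x\<in>W. cnj (\<phi> j x) * g x)"

text \<open>Orthonormality, completeness on \<open>W\<close> and the eigenvalue equation. The
  function \<open>\<phi> j\<close> belongs to eigenvalue number \<open>j + 1\<close>, so the
  enumeration follows the sorted list; the later estimates work with these functions instead of
  matrices.\<close>

definition eigenbasis :: "'w set \<Rightarrow> ('w \<times> 'w) set \<Rightarrow> (nat \<Rightarrow> 'w \<Rightarrow> complex) \<Rightarrow> bool" where
  "eigenbasis W F \<phi> \<longleftrightarrow>
     (\<forall>i<card W. \<forall>j<card W. coef W \<phi> (\<phi> i) j = (if i = j then 1 else 0)) \<and>
     (\<forall>g. \<forall>x\<in>W. g x = (\<Sum>j<card W. coef W \<phi> g j * \<phi> j x)) \<and>
     (\<forall>j<card W. \<forall>x\<in>W. laplace F (\<phi> j) x = complex_of_real (lap_eig (W, F) (j + 1)) * \<phi> j x)"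

text \<open>The matrix is written in the enumeration \<open>f\<close> of the vertices, and the
  diagonalization lists eigenvalues in no particular order. Eigenvectors are pulled back along the
  inverse \<open>g\<close> of \<open>f\<close>, and a permutation \<open>\<pi>\<close> aligns them
  with the sorted list.\<close>

lemma lap_spectrum:
  assumes G: "finite_graph W F"
  shows "length (lap_eigs (W, F)) = card W" "sorted (lap_eigs (W, F))" "\<exists>\<phi>. eigenbasis W F \<phi>"
proof -
  note G' = finite_graphD[OF G]
  define n where "n = card W"
  define f where "f = (SOME f. bij_betw f {..<n} W)"
  have "\<exists>f. bij_betw f {..<n} W"
    using ex_bij_betw_nat_finite[OF G'(1)] by (simp add: n_def atLeast0LessThan)
  then have f: "bij_betw f {..<n} W" unfolding f_def by (rule someI_ex)
  define a where "a x y = (if x = y then of_nat (deg F x) else if (x, y) \<in> F then -1 else 0 :: complex)" for x y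
  define A where "A = lap_mat (W, F)"
  have fi: "f i = f j \<longleftrightarrow> i = j" if "i < n" "j < n" for i j
    using f that by (auto simp: bij_betw_def inj_on_def)
  have A_eq: "A = mat n n (\<lambda>(i, j). a (f i) (f j))"
    unfolding A_def lap_mat_def Let_def fst_conv snd_conv n_def[symmetric] f_def[symmetric]
    by (rule cong_mat) (auto simp: a_def fi)
  have A: "A \<in> carrier_mat n n" by (simp add: A_eq)
  have hA: "hadj A = A"
    using G'(3) by (auto simp: A_eq hadj_def a_def sym_def intro!: eq_matI)
  from hermitian_diagonalization[OF A hA] obtain U d where
    U: "U \<in> carrier_mat n n" "hadj U * U = 1\<^sub>m n"
    and d: "\<And>i j. i < n \<Longrightarrow> j < n \<Longrightarrow> (A * U) $$ (i, j) = d j * U $$ (i, j)" by auto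
  note hU = hadj_carrier[OF U(1)]
  have UU: "U * hadj U = 1\<^sub>m n" using mat_mult_left_right_inverse[OF hU U(1) U(2)] .
  have orth: "(\<Sum>k<n. cnj (U $$ (k, i)) * U $$ (k, j)) = (if i = j then 1 else 0)" if "i < n" "j < n" for i j
  proof -
    have "(hadj U * U) $$ (i, j) = (\<Sum>k<n. cnj (U $$ (k, i)) * U $$ (k, j))"
      using that by (simp add: mat_mult_index[OF hU U(1)] hadj_index[OF U(1)] del: index_mult_mat)
    then show ?thesis using that by (simp add: U(2))
  qed
  have compl: "(\<Sum>k<n. U $$ (i, k) * cnj (U $$ (j, k))) = (if i = j then 1 else 0)" if "i < n" "j < n" for i j
  proof -
    have "(U * hadj U) $$ (i, j) = (\<Sum>k<n. U $$ (i, k) * cnj (U $$ (j, k)))"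
      using that by (simp add: mat_mult_index[OF U(1) hU] hadj_index[OF U(1)] del: index_mult_mat)
    then show ?thesis using that by (simp add: UU)
  qed
  define D where "D = mat n n (\<lambda>(i, j). if i = j then d i else 0)"
  have D: "D \<in> carrier_mat n n" by (simp add: D_def)
  have UD: "A * U = U * D"
  proof (rule eq_matI)
    fix i j assume "i < dim_row (U * D)" "j < dim_col (U * D)"
    then have ij: "i < n" "j < n" using U(1) D by auto
    have "(U * D) $$ (i, j) = (\<Sum>k<n. if k = j then U $$ (i, k) * d k else 0)"
    proof -
      have "(U * D) $$ (i, j) = (\<Sum>k<n. U $$ (i, k) * D $$ (k, j))"
        using ij by (subst mat_mult_index[OF U(1) D]) auto
      also have "\<dots> = (\<Sum>k<n. if k = j then U $$ (i, k) * d k else 0)"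
        using ij by (intro sum.cong) (auto simp: D_def)
      finally show ?thesis .
    qed
    then show "(A * U) $$ (i, j) = (U * D) $$ (i, j)" using ij by (simp add: d del: index_mult_mat)
  qed (use A U D in auto)
  have "A = A * (U * hadj U)" using A by (simp add: UU)
  also have "\<dots> = U * D * hadj U" unfolding UD[symmetric] by (rule assoc_mult_mat[OF A U(1) hU, symmetric])
  finally have AUD: "A = U * D * hadj U" .
  have "similar_mat A D" by (rule similar_matI[OF _ UU U(2) AUD]) (use A D U(1) hU in auto)
  then have "char_poly A = char_poly D" by (rule char_poly_similar)
  also have "\<dots> = (\<Prod>a\<leftarrow>diag_mat D. [:- a, 1:])"
    by (rule char_poly_upper_triangular[OF D]) (auto simp: D_def)
  also have "diag_mat D = map d [0..<n]" by (auto simp: diag_mat_def D_def)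
  finally have cp: "char_poly A = (\<Prod>a\<leftarrow>map d [0..<n]. [:- a, 1:])" .
  have eigs: "lap_eigs (W, F) = sort (map (\<lambda>j. Re (d j)) [0..<n])"
    unfolding lap_eigs_def A_def[symmetric] cp proots_linear_product mset_map[symmetric]
      sorted_list_of_multiset_mset by (simp add: o_def)
  show len: "length (lap_eigs (W, F)) = card W" by (simp add: eigs n_def)
  show "sorted (lap_eigs (W, F))" by (simp add: eigs)
  have "\<exists>\<pi>. bij_betw \<pi> {..<length (lap_eigs (W, F))} {..<length (map (\<lambda>j. Re (d j)) [0..<n])} \<and>
      (\<forall>i<length (lap_eigs (W, F)). lap_eigs (W, F) ! i = map (\<lambda>j. Re (d j)) [0..<n] ! \<pi> i)"
    by (rule permutation_Ex_bij) (simp add: eigs)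
  then obtain \<pi> where pi: "bij_betw \<pi> {..<n} {..<n}"
    and lam': "\<And>i. i < n \<Longrightarrow> lap_eigs (W, F) ! i = map (\<lambda>j. Re (d j)) [0..<n] ! \<pi> i"
    using len by (auto simp: n_def[symmetric])
  have pi_lt: "\<pi> j < n" if "j < n" for j using pi that by (auto simp: bij_betw_def)
  have lam: "lap_eig (W, F) (i + 1) = Re (d (\<pi> i))" if "i < n" for i
    using lam'[OF that] pi_lt[OF that] by (simp add: lap_eig_def)
  \<comment> \<open>\<open>d j\<close> is a diagonal entry of the Hermitian matrix
    \<open>hadj U * (A * U)\<close>.\<close>
  have dreal: "d j = complex_of_real (Re (d j))" if j: "j < n" for j
  proof -
    let ?M = "hadj U * (A * U)"
    have AU: "A * U \<in> carrier_mat n n" using A U by simp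
    have M: "?M \<in> carrier_mat n n" using hU AU by simp
    have hM: "hadj ?M = ?M"
      unfolding hadj_mult[OF hU AU] hadj_mult[OF A U(1)] hadj_hadj[OF U(1)] hA
      by (rule assoc_mult_mat[OF hU A U(1)])
    have "?M $$ (j, j) = (\<Sum>k<n. cnj (U $$ (k, j)) * (d j * U $$ (k, j)))"
      using j by (simp add: mat_mult_index[OF hU AU] hadj_index[OF U(1)] d del: index_mult_mat)
    also have "\<dots> = d j * (\<Sum>k<n. cnj (U $$ (k, j)) * U $$ (k, j))"
      by (simp add: sum_distrib_left mult_ac)
    finally have Mjj: "?M $$ (j, j) = d j" using orth[OF j j] by simp
    have "cnj (d j) = d j" using hadj_index[OF M j j] unfolding hM Mjj by simp
    then show ?thesis by (metis complex_is_Real_iff Reals_cnj_iff of_real_Re)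
  qed
  define g where "g = the_inv_into {..<n} f"
  have gf: "g (f i) = i" if "i < n" for i
    unfolding g_def using f that by (simp add: bij_betw_def the_inv_into_f_f)
  have gW: "g x < n" "f (g x) = x" if "x \<in> W" for x
    using f that unfolding g_def bij_betw_def
    by (metis lessThan_iff subset_refl the_inv_into_into) (metis bij_betw_def f f_the_inv_into_f_bij_betw that)
  define \<phi> where "\<phi> j x = U $$ (g x, \<pi> j)" for j x
  have sumW: "(\<Sum>x\<in>W. h x) = (\<Sum>k<n. h (f k))" for h :: "'a \<Rightarrow> complex"
    by (rule sum.reindex_bij_betw[OF f, symmetric])
  have sumpi: "(\<Sum>j<n. h (\<pi> j)) = (\<Sum>j<n. h j)" for h :: "nat \<Rightarrow> complex"
    by (rule sum.reindex_bij_betw[OF pi])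
  have o: "coef W \<phi> (\<phi> i) j = (if i = j then 1 else 0)" if "i < n" "j < n" for i j
  proof -
    have "coef W \<phi> (\<phi> i) j = (\<Sum>k<n. cnj (U $$ (k, \<pi> j)) * U $$ (k, \<pi> i))"
      unfolding coef_def sumW \<phi>_def by (rule sum.cong) (auto simp: gf)
    also have "\<dots> = (if \<pi> i = \<pi> j then 1 else 0)" using orth pi_lt that by auto
    also have "\<pi> i = \<pi> j \<longleftrightarrow> i = j" using pi that by (auto simp: bij_betw_def inj_on_def)
    finally show ?thesis .
  qed
  have c: "h x = (\<Sum>j<n. coef W \<phi> h j * \<phi> j x)" if x: "x \<in> W" for h x
  proof -
    have "(\<Sum>j<n. coef W \<phi> h j * \<phi> j x) = (\<Sum>j<n. \<Sum>y\<in>W. h y * (U $$ (g x, \<pi> j) * cnj (U $$ (g y, \<pi> j))))"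
      by (simp add: coef_def \<phi>_def sum_distrib_right sum_distrib_left mult_ac)
    also have "\<dots> = (\<Sum>y\<in>W. h y * (\<Sum>j<n. U $$ (g x, \<pi> j) * cnj (U $$ (g y, \<pi> j))))"
      by (subst sum.swap) (simp add: sum_distrib_left)
    also have "\<dots> = (\<Sum>y\<in>W. h y * (if x = y then 1 else 0))"
    proof (rule sum.cong)
      fix y assume y: "y \<in> W"
      have "(\<Sum>j<n. U $$ (g x, \<pi> j) * cnj (U $$ (g y, \<pi> j))) = (if g x = g y then 1 else 0)"
        using sumpi[of "\<lambda>j. U $$ (g x, j) * cnj (U $$ (g y, j))"] compl gW(1)[OF x] gW(1)[OF y] by simp
      also have "g x = g y \<longleftrightarrow> x = y" using gW(2)[OF x] gW(2)[OF y] by metis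
      finally show "h y * (\<Sum>j<n. U $$ (g x, \<pi> j) * cnj (U $$ (g y, \<pi> j))) = h y * (if x = y then 1 else 0)" by simp
    qed auto
    also have "\<dots> = h x" using x G'(1) by (simp add: if_distrib cong: if_cong)
    finally show ?thesis by simp
  qed
  have e: "laplace F (\<phi> j) x = complex_of_real (lap_eig (W, F) (j + 1)) * \<phi> j x" if j: "j < n" and x: "x \<in> W" for j x
  proof -
    have nb: "nbrs F x \<subseteq> W - {x}" using G'(2,4) by (auto simp: nbrs_def irrefl_def)
    have "(A * U) $$ (g x, \<pi> j) = (\<Sum>k<n. a (f (g x)) (f k) * U $$ (k, \<pi> j))"
      using gW(1)[OF x] pi_lt[OF j] by (subst mat_mult_index[OF A U(1)]) (auto simp: A_eq)
    also have "\<dots> = (\<Sum>k<n. a x (f k) * \<phi> j (f k))"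
      by (rule sum.cong) (auto simp: gW(2)[OF x] \<phi>_def gf)
    also have "\<dots> = (\<Sum>y\<in>W. a x y * \<phi> j y)" by (rule sumW[symmetric])
    also have "\<dots> = a x x * \<phi> j x + (\<Sum>y\<in>W - {x}. a x y * \<phi> j y)" using x G'(1) by (rule sum.remove[rotated])
    also have "(\<Sum>y\<in>W - {x}. a x y * \<phi> j y) = (\<Sum>y\<in>nbrs F x. - \<phi> j y)"
      using nb G'(1) by (intro sum.mono_neutral_cong_right) (auto simp: a_def nbrs_def)
    also have "a x x * \<phi> j x + \<dots> = laplace F (\<phi> j) x"
      by (simp add: a_def laplace_def deg_def sum_subtractf sum_negf)
    finally have "laplace F (\<phi> j) x = d (\<pi> j) * \<phi> j x"
      using d[OF gW(1)[OF x] pi_lt[OF j]] by (simp add: \<phi>_def)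
    then show ?thesis using dreal[OF pi_lt[OF j]] lam[OF j] by simp
  qed
  show "\<exists>\<phi>. eigenbasis W F \<phi>"
    unfolding eigenbasis_def n_def[symmetric] using o c e by blast
qed

text \<open>Parseval: in the eigenbasis norm, energy and Laplacian are diagonal, so inequalities
  between them can be checked eigenvalue by eigenvalue.\<close>

lemma eigenbasis_expand:
  assumes G: "finite_graph W F" and B: "eigenbasis W F \<phi>"
  shows sqnorm_coef: "sqnorm W g = (\<Sum>j<card W. (cmod (coef W \<phi> g j))\<^sup>2)"
    and energy_coef: "energy F g = (\<Sum>j<card W. lap_eig (W, F) (j + 1) * (cmod (coef W \<phi> g j))\<^sup>2)"
    and coef_laplace: "j < card W \<Longrightarrow> coef W \<phi> (laplace F g) j = complex_of_real (lap_eig (W, F) (j + 1)) * coef W \<phi> g j"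
    and coef_sum: "m \<le> card W \<Longrightarrow> j < card W \<Longrightarrow> coef W \<phi> (\<lambda>x. \<Sum>i<m. c i * \<phi> i x) j = (if j < m then c j else 0)"
proof -
  note G' = finite_graphD[OF G]
  have o: "coef W \<phi> (\<phi> i) j = (if i = j then 1 else 0)" if "i < card W" "j < card W" for i j
    using B that by (auto simp: eigenbasis_def)
  have ex: "g x = (\<Sum>j<card W. coef W \<phi> g j * \<phi> j x)" if "x \<in> W" for x g
    using B that unfolding eigenbasis_def by blast
  have lin: "coef W \<phi> (\<lambda>x. \<Sum>i\<in>I. c i * h i x) j = (\<Sum>i\<in>I. c i * coef W \<phi> (h i) j)" for I :: "nat set" and c h j
    unfolding coef_def sum_distrib_left by (subst sum.swap) (simp add: mult_ac)
  show cs: "coef W \<phi> (\<lambda>x. \<Sum>i<m. c i * \<phi> i x) j = (if j < m then c j else 0)"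
    if "m \<le> card W" "j < card W" for m j c
  proof -
    have "coef W \<phi> (\<lambda>x. \<Sum>i<m. c i * \<phi> i x) j = (\<Sum>i<m. if i = j then c i else 0)"
      unfolding lin using o that by (intro sum.cong) auto
    then show ?thesis by simp
  qed
  have cong: "coef W \<phi> g j = coef W \<phi> h j" if "\<And>x. x \<in> W \<Longrightarrow> g x = h x" for g h j
    using that by (simp add: coef_def)
  have lap: "laplace F g x = (\<Sum>j<card W. (complex_of_real (lap_eig (W, F) (j + 1)) * coef W \<phi> g j) * \<phi> j x)"
    if x: "x \<in> W" for x
  proof -
    have "laplace F g x = (\<Sum>y\<in>nbrs F x. \<Sum>j<card W. coef W \<phi> g j * (\<phi> j x - \<phi> j y))"
      unfolding laplace_def
    proof (rule sum.cong)
      fix y assume "y \<in> nbrs F x"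
      then have y: "y \<in> W" using G'(7) by auto
      show "g x - g y = (\<Sum>j<card W. coef W \<phi> g j * (\<phi> j x - \<phi> j y))"
        by (subst ex[OF x], subst ex[OF y]) (simp add: sum_subtractf right_diff_distrib)
    qed simp
    also have "\<dots> = (\<Sum>j<card W. coef W \<phi> g j * laplace F (\<phi> j) x)"
      by (subst sum.swap) (simp add: laplace_def sum_distrib_left)
    also have "\<dots> = (\<Sum>j<card W. (complex_of_real (lap_eig (W, F) (j + 1)) * coef W \<phi> g j) * \<phi> j x)"
      using B x by (intro sum.cong) (auto simp: eigenbasis_def)
    finally show ?thesis .
  qed
  show cl: "coef W \<phi> (laplace F g) j = complex_of_real (lap_eig (W, F) (j + 1)) * coef W \<phi> g j" if "j < card W" for j
    using cong[OF lap] cs[of "card W" j] that by simp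
  have pars: "(\<Sum>x\<in>W. cnj (g x) * h x) = (\<Sum>j<card W. cnj (coef W \<phi> g j) * coef W \<phi> h j)" for h
  proof -
    have "(\<Sum>x\<in>W. cnj (g x) * h x) = (\<Sum>x\<in>W. \<Sum>j<card W. coef W \<phi> h j * (cnj (g x) * \<phi> j x))"
      using ex[of _ h] by (intro sum.cong) (auto simp: sum_distrib_left mult_ac)
    also have "\<dots> = (\<Sum>j<card W. coef W \<phi> h j * (\<Sum>x\<in>W. cnj (g x) * \<phi> j x))"
      by (subst sum.swap) (simp add: sum_distrib_left)
    also have "\<dots> = (\<Sum>j<card W. cnj (coef W \<phi> g j) * coef W \<phi> h j)"
      by (simp add: coef_def mult_ac)
    finally show ?thesis .
  qed
  have ns: "cnj z * z = complex_of_real ((cmod z)\<^sup>2)" for z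
    by (simp add: complex_norm_square mult.commute del: of_real_power)
  have "complex_of_real (sqnorm W g) = (\<Sum>x\<in>W. cnj (g x) * g x)"
    by (simp add: sqnorm_def ns)
  also have "\<dots> = complex_of_real (\<Sum>j<card W. (cmod (coef W \<phi> g j))\<^sup>2)"
    unfolding pars by (simp add: ns)
  finally show "sqnorm W g = (\<Sum>j<card W. (cmod (coef W \<phi> g j))\<^sup>2)" using of_real_eq_iff by blast
  have "complex_of_real (energy F g) = (\<Sum>j<card W. cnj (coef W \<phi> g j) * coef W \<phi> (laplace F g) j)"
    unfolding green[OF G] by (rule pars)
  also have "\<dots> = complex_of_real (\<Sum>j<card W. lap_eig (W, F) (j + 1) * (cmod (coef W \<phi> g j))\<^sup>2)"
    unfolding of_real_sum
  proof (rule sum.cong)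
    fix j assume "j \<in> {..<card W}"
    then have "cnj (coef W \<phi> g j) * coef W \<phi> (laplace F g) j
        = complex_of_real (lap_eig (W, F) (j + 1)) * (cnj (coef W \<phi> g j) * coef W \<phi> g j)"
      using cl[of j] by simp
    then show "cnj (coef W \<phi> g j) * coef W \<phi> (laplace F g) j
        = complex_of_real (lap_eig (W, F) (j + 1) * (cmod (coef W \<phi> g j))\<^sup>2)"
      unfolding ns by simp
  qed simp
  finally show "energy F g = (\<Sum>j<card W. lap_eig (W, F) (j + 1) * (cmod (coef W \<phi> g j))\<^sup>2)"
    using of_real_eq_iff by blast
qed

section \<open>Min-max estimates from test spaces\<close>

lemma lap_eig_mono:
  assumes "finite_graph W F" "1 \<le> i" "i \<le> j" "j \<le> card W"
  shows "lap_eig (W, F) i \<le> lap_eig (W, F) j"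
  unfolding lap_eig_def using lap_spectrum[OF assms(1)] assms(2-4) by (intro sorted_nth_mono) auto

lemma coef_combination:
  "coef W \<phi> (\<lambda>x. \<Sum>j<i. c j * \<psi> j x) m = (\<Sum>j<i. coef W \<phi> (\<psi> j) m * c j)"
  unfolding coef_def sum_distrib_left sum_distrib_right by (subst sum.swap) (simp add: mult_ac)

text \<open>Courant-Fischer: some nontrivial combination of \<open>i\<close> test functions is
  orthogonal to the first \<open>i - 1\<close> eigenfunctions, and its Rayleigh quotient is at least
  eigenvalue number \<open>i\<close>. Positivity of the norm in \<open>test\<close> stands in for
  linear independence of the \<open>\<psi> j\<close>.\<close>

lemma lap_eig_le:
  assumes G: "finite_graph W F" and i: "1 \<le> i" "i \<le> card W"
    and test: "\<And>c. \<exists>j<i. c j \<noteq> 0 \<Longrightarrow> sqnorm W (\<lambda>x. \<Sum>j<i. c j * \<psi> j x) > 0 \<and>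
      energy F (\<lambda>x. \<Sum>j<i. c j * \<psi> j x) \<le> K * sqnorm W (\<lambda>x. \<Sum>j<i. c j * \<psi> j x)"
  shows "lap_eig (W, F) i \<le> K"
proof -
  obtain \<phi> where B: "eigenbasis W F \<phi>" using lap_spectrum(3)[OF G] by auto
  have "i - 1 < i" using i by simp
  from homogeneous_solution[OF this, of "\<lambda>m j. coef W \<phi> (\<psi> j) m"]
  obtain c where c: "\<exists>j<i. c j \<noteq> 0" "\<And>m. m < i - 1 \<Longrightarrow> (\<Sum>j<i. coef W \<phi> (\<psi> j) m * c j) = 0" by blast
  define g where "g = (\<lambda>x. \<Sum>j<i. c j * \<psi> j x)"
  have z: "coef W \<phi> g m = 0" if "m < i - 1" for m
    unfolding g_def coef_combination using c(2)[OF that] .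
  have "lap_eig (W, F) i * sqnorm W g = (\<Sum>j<card W. lap_eig (W, F) i * (cmod (coef W \<phi> g j))\<^sup>2)"
    unfolding sqnorm_coef[OF G B] by (simp add: sum_distrib_left)
  also have "\<dots> \<le> energy F g"
    unfolding energy_coef[OF G B]
  proof (rule sum_mono)
    fix j assume "j \<in> {..<card W}"
    then show "lap_eig (W, F) i * (cmod (coef W \<phi> g j))\<^sup>2 \<le> lap_eig (W, F) (j + 1) * (cmod (coef W \<phi> g j))\<^sup>2"
      using z[of j] lap_eig_mono[OF G i(1), of "j + 1"] by (cases "j < i - 1") (auto intro!: mult_right_mono)
  qed
  also have "\<dots> \<le> K * sqnorm W g" using test[OF c(1)] by (simp add: g_def)
  finally show ?thesis using test[OF c(1)] by (simp add: g_def)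
qed

text \<open>The dual argument: the combination is made orthogonal to the last \<open>i - 1\<close>
  eigenfunctions, whose zero-based indices start at \<open>card W - i + 1\<close>.\<close>

lemma lap_eig_ge:
  assumes G: "finite_graph W F" and i: "1 \<le> i" "i \<le> card W"
    and test: "\<And>c. \<exists>j<i. c j \<noteq> 0 \<Longrightarrow> sqnorm W (\<lambda>x. \<Sum>j<i. c j * \<psi> j x) > 0 \<and>
      energy F (\<lambda>x. \<Sum>j<i. c j * \<psi> j x) \<ge> K * sqnorm W (\<lambda>x. \<Sum>j<i. c j * \<psi> j x)"
  shows "lap_eig (W, F) (card W - i + 1) \<ge> K"
proof -
  obtain \<phi> where B: "eigenbasis W F \<phi>" using lap_spectrum(3)[OF G] by auto
  let ?k = "card W - i + 1"
  have "i - 1 < i" using i by simp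
  from homogeneous_solution[OF this, of "\<lambda>m j. coef W \<phi> (\<psi> j) (m + ?k)"]
  obtain c where c: "\<exists>j<i. c j \<noteq> 0" "\<And>m. m < i - 1 \<Longrightarrow> (\<Sum>j<i. coef W \<phi> (\<psi> j) (m + ?k) * c j) = 0" by blast
  define g where "g = (\<lambda>x. \<Sum>j<i. c j * \<psi> j x)"
  have z: "coef W \<phi> g m = 0" if "?k \<le> m" "m < card W" for m
    unfolding g_def coef_combination using c(2)[of "m - ?k"] that i by simp
  have "K * sqnorm W g \<le> energy F g" using test[OF c(1)] by (simp add: g_def)
  also have "\<dots> \<le> (\<Sum>j<card W. lap_eig (W, F) ?k * (cmod (coef W \<phi> g j))\<^sup>2)"
    unfolding energy_coef[OF G B]
  proof (rule sum_mono)
    fix j assume j: "j \<in> {..<card W}"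
    show "lap_eig (W, F) (j + 1) * (cmod (coef W \<phi> g j))\<^sup>2 \<le> lap_eig (W, F) ?k * (cmod (coef W \<phi> g j))\<^sup>2"
      using z[of j] j lap_eig_mono[OF G, of "j + 1" ?k] i by (cases "j < ?k") (auto intro!: mult_right_mono)
  qed
  also have "\<dots> = lap_eig (W, F) ?k * sqnorm W g"
    unfolding sqnorm_coef[OF G B] by (simp add: sum_distrib_left)
  finally show ?thesis using test[OF c(1)] by (simp add: g_def)
qed

section \<open>Pieces and their gluing\<close>

text \<open>Label an element by the number of steps from a base point \<open>r0\<close>. The orbit
  of \<open>r0\<close> is the whole set, so the first return time \<open>c\<close> is the
  cardinality, and one more step adds 1 modulo \<open>c\<close>.\<close>

lemma single_cycle_enumeration:
  assumes fin: "finite S" and S: "S \<noteq> {}" and s: "bij_betw s S S"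
    and cyc: "\<forall>r\<in>S. \<forall>r'\<in>S. \<exists>n. (s ^^ n) r = r'"
  shows "\<exists>l. bij_betw l S {..<card S} \<and> (\<forall>r\<in>S. l (s r) = (l r + 1) mod card S)"
proof -
  obtain r0 where r0: "r0 \<in> S" using S by auto
  have inS: "(s ^^ n) r \<in> S" if "r \<in> S" for n r
    using that s by (induction n) (auto simp: bij_betw_def)
  have inj: "(s ^^ m) r0 = (s ^^ n) r0 \<Longrightarrow> m \<le> n \<Longrightarrow> (s ^^ (n - m)) r0 = r0" for m n
  proof (induction m arbitrary: n)
    case (Suc m)
    then obtain n' where n: "n = Suc n'" by (cases n) auto
    have "s ((s ^^ m) r0) = s ((s ^^ n') r0)" using Suc.prems(1) n by simp
    then have "(s ^^ m) r0 = (s ^^ n') r0"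
      using s inS[OF r0] by (auto simp: bij_betw_def inj_on_def)
    then show ?case using Suc n by simp
  qed auto
  have "\<exists>n>0. (s ^^ n) r0 = r0"
  proof -
    have "\<not> inj (\<lambda>n. (s ^^ n) r0)"
    proof
      assume "inj (\<lambda>n. (s ^^ n) r0)"
      moreover have "finite (range (\<lambda>n. (s ^^ n) r0))"
        by (rule finite_subset[OF _ fin]) (use inS[OF r0] in auto)
      ultimately have "finite (UNIV :: nat set)" by (rule finite_imageD[rotated])
      then show False by simp
    qed
    then obtain m n where "m \<noteq> n" "(s ^^ m) r0 = (s ^^ n) r0" by (auto simp: inj_def)
    then show ?thesis using inj[of m n] inj[of n m] by (cases "m < n") (metis zero_less_diff less_imp_le, metis linorder_neqE_nat zero_less_diff less_imp_le)
  qed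
  define c where "c = (LEAST n. n > 0 \<and> (s ^^ n) r0 = r0)"
  have c: "c > 0" "(s ^^ c) r0 = r0" and cmin: "\<And>n. n > 0 \<Longrightarrow> (s ^^ n) r0 = r0 \<Longrightarrow> c \<le> n"
    using LeastI_ex[OF \<open>\<exists>n>0. (s ^^ n) r0 = r0\<close>] Least_le[of "\<lambda>n. n > 0 \<and> (s ^^ n) r0 = r0"] unfolding c_def by auto
  have md: "(s ^^ (n mod c)) r0 = (s ^^ n) r0" for n
    by (rule funpow_mod_eq[OF c(2)])
  have bij: "bij_betw (\<lambda>n. (s ^^ n) r0) {..<c} S"
    unfolding bij_betw_def
  proof
    show "inj_on (\<lambda>n. (s ^^ n) r0) {..<c}"
    proof (rule linorder_inj_onI')
      fix m n assume mn: "m \<in> {..<c}" "n \<in> {..<c}" "m < n"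
      show "(s ^^ m) r0 \<noteq> (s ^^ n) r0"
      proof
        assume "(s ^^ m) r0 = (s ^^ n) r0"
        then have "(s ^^ (n - m)) r0 = r0" using inj mn by simp
        then show False using cmin[of "n - m"] mn by simp
      qed
    qed
    show "(\<lambda>n. (s ^^ n) r0) ` {..<c} = S"
    proof
      show "S \<subseteq> (\<lambda>n. (s ^^ n) r0) ` {..<c}"
      proof
        fix r assume "r \<in> S"
        then obtain n where "(s ^^ n) r0 = r" using cyc r0 by blast
        then have "(s ^^ (n mod c)) r0 = r" using md by simp
        then show "r \<in> (\<lambda>n. (s ^^ n) r0) ` {..<c}" using c(1) by (intro image_eqI[of _ _ "n mod c"]) auto
      qed
    qed (use inS[OF r0] in auto)
  qed
  have cS: "card S = c" using bij_betw_same_card[OF bij] by simp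
  define l where "l = the_inv_into {..<c} (\<lambda>n. (s ^^ n) r0)"
  have l: "bij_betw l S {..<c}" unfolding l_def by (rule bij_betw_the_inv_into[OF bij])
  have ls: "l ((s ^^ n) r0) = n" if "n < c" for n
    unfolding l_def using bij that by (auto simp: bij_betw_def intro!: the_inv_into_f_f)
  have "l (s r) = (l r + 1) mod c" if rS: "r \<in> S" for r
  proof -
    obtain n where n: "n < c" "r = (s ^^ n) r0" 
    proof -
      have "r \<in> (\<lambda>n. (s ^^ n) r0) ` {..<c}" using bij rS by (simp only: bij_betw_def)
      then show thesis using that by blast
    qed
    have "s r = (s ^^ ((n + 1) mod c)) r0" unfolding md using n by simp
    then show ?thesis using ls[of "(n + 1) mod c"] ls[OF n(1)] n c(1) by simp
  qed
  then show ?thesis using l cS by auto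
qed

text \<open>Makes the choice inside \<open>GC3\<close> and \<open>GC4\<close> meaningful. The bounds
  themselves are proved for an arbitrary labelling.\<close>

lemma compatible_labelling_exists:
  assumes "orientation V E \<sigma>" "regular V E d" "d > 0"
  shows "compatible_labelling V E \<sigma> d (SOME L. compatible_labelling V E \<sigma> d L)"
proof (rule someI_ex[of "compatible_labelling V E \<sigma> d"])
  have "\<exists>l. bij_betw l (nbrs E p) {..<d} \<and> (\<forall>r\<in>nbrs E p. l (\<sigma> p r) = (l r + 1) mod d)" if "p \<in> V" for p
  proof -
    have "card (nbrs E p) = d" using assms(2) that by (auto simp: regular_def deg_def)
    moreover from this have "finite (nbrs E p)" "nbrs E p \<noteq> {}" using assms(3) by (auto intro: card_ge_0_finite)
    ultimately show ?thesis
      using single_cycle_enumeration[of "nbrs E p" "\<sigma> p"] assms(1) that unfolding orientation_def by metis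
  qed
  then obtain L where "\<And>p. p \<in> V \<Longrightarrow> bij_betw (L p) (nbrs E p) {..<d} \<and> (\<forall>r\<in>nbrs E p. L p (\<sigma> p r) = (L p r + 1) mod d)"
    by metis
  then show "\<exists>L. compatible_labelling V E \<sigma> d L" unfolding compatible_labelling_def by blast
qed

text \<open>Tiles are abstract labels, \<open>pos\<close> gives their vertex sets in the plane.
  \<open>rot\<close> turns the region by one side and \<open>mir\<close> is the half-turn about the
  midpoint of side 0. The gluing is defined across side 1, which is why \<open>pos_sig\<close>
  carries \<open>rot\<close> on both sides. \<open>cross_unique\<close> says that a tile of the
  piece belongs to the neighbouring piece across at most one side; it keeps the gluing classes
  small.\<close>

locale gc_system =
  fixes V :: "'v set" and E :: "('v \<times> 'v) set" and d :: nat and L :: "'v \<Rightarrow> 'v \<Rightarrow> nat"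
    and pos :: "'t \<Rightarrow> complex set" and P :: "'t set" and rot mir :: "'t \<Rightarrow> 't"
    and adj :: "'t \<Rightarrow> 't \<Rightarrow> bool" and rho sig :: "complex \<Rightarrow> complex"
  assumes graph: "finite_graph V E"
    and lab: "p \<in> V \<Longrightarrow> bij_betw (L p) (nbrs E p) {..<d}"
    and d_pos: "d > 0"
    and pos_inj: "inj pos"
    and pos_rot: "rho ` pos t = pos (rot t)"
    and pos_sig: "sig ` pos (rot t) = pos (rot (mir t))"
    and rot_d: "(rot ^^ d) t = t"
    and mir_mir [simp]: "mir (mir t) = t"
    and P_rot: "rot t \<in> P \<longleftrightarrow> t \<in> P"
    and finP: "finite P"
    and adj_pos: "adj t u \<longleftrightarrow> t \<noteq> u \<and> card (pos t \<inter> pos u) = 2"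
    and adj_rot: "adj (rot t) (rot u) \<longleftrightarrow> adj t u"
    and adj_mir: "adj (mir t) (mir u) \<longleftrightarrow> adj t u"
    and cross_unique: "\<lbrakk>t \<in> P; i < d; j < d; mir ((rot ^^ i) t) \<in> P; mir ((rot ^^ j) t) \<in> P\<rbrakk> \<Longrightarrow> i = j"
begin

lemma adj_sym: "adj t u \<longleftrightarrow> adj u t"
  by (auto simp: adj_pos Int_commute)

lemma adj_neq: "adj t u \<Longrightarrow> t \<noteq> u"
  by (auto simp: adj_pos)

lemma pos_eq [simp]: "pos t = pos u \<longleftrightarrow> t = u"
  using pos_inj by (auto simp: inj_def)

lemma rot_pow_P: "(rot ^^ n) t \<in> P \<longleftrightarrow> t \<in> P"
  by (induction n) (auto simp: P_rot)

lemma rot_pow_adj: "adj ((rot ^^ n) t) ((rot ^^ n) u) \<longleftrightarrow> adj t u"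
  by (induction n) (auto simp: adj_rot)

lemma rot_pow_mod: "(rot ^^ (n mod d)) t = (rot ^^ n) t"
  by (rule funpow_mod_eq[OF rot_d])

lemma rot_inj: "rot t = rot u \<longleftrightarrow> t = u"
proof
  assume "rot t = rot u"
  then have "(rot ^^ (d - 1)) (rot t) = (rot ^^ (d - 1)) (rot u)" by simp
  then have "(rot ^^ (Suc (d - 1))) t = (rot ^^ (Suc (d - 1))) u" by (simp only: funpow_Suc_right o_apply)
  then show "t = u" using rot_d d_pos by simp
qed simp

text \<open>The rotation bringing side \<open>j\<close> of the region to side \<open>0\<close>.\<close>

definition turn :: "nat \<Rightarrow> 't \<Rightarrow> 't" where
  "turn j t = (rot ^^ ((d - j) mod d)) t"

lemma turn_P [simp]: "turn j t \<in> P \<longleftrightarrow> t \<in> P"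
  by (simp add: turn_def rot_pow_P)

lemma turn_adj [simp]: "adj (turn j t) (turn j u) \<longleftrightarrow> adj t u"
  by (simp add: turn_def rot_pow_adj)

lemma rot_turn [simp]: "j < d \<Longrightarrow> (rot ^^ j) (turn j t) = t"
proof -
  assume "j < d"
  have "(rot ^^ j) (turn j t) = (rot ^^ (j + (d - j))) t"
    unfolding turn_def rot_pow_mod by (simp add: funpow_add)
  then show ?thesis using \<open>j < d\<close> rot_d by simp
qed

lemma turn_rot [simp]: "j < d \<Longrightarrow> turn j ((rot ^^ j) t) = t"
proof -
  assume "j < d"
  have "turn j ((rot ^^ j) t) = (rot ^^ ((d - j) + j)) t"
    unfolding turn_def rot_pow_mod by (simp add: funpow_add)
  then show ?thesis using \<open>j < d\<close> rot_d by simp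
qed

lemma turn_inj: "j < d \<Longrightarrow> turn j t = turn j u \<longleftrightarrow> t = u"
  by (metis rot_turn)

lemma pos_rot_pow: "(rho ^^ n) ` pos t = pos ((rot ^^ n) t)"
proof (induction n)
  case (Suc n)
  have "(rho ^^ Suc n) ` pos t = rho ` (rho ^^ n) ` pos t" by (simp add: image_comp)
  then show ?case by (simp add: Suc pos_rot)
qed simp

text \<open>The exponent in \<open>gc_place\<close> brings side \<open>j\<close> to side 1, one
  rotation more than bringing it to side 0. The outer \<open>rot\<close> is common to both ends of
  an edge and cancels by injectivity.\<close>

lemma rot_pow_turn: "j < d \<Longrightarrow> (rot ^^ ((Suc d - j) mod d)) t = rot (turn j t)"
proof -
  assume "j < d"
  then have "Suc d - j = Suc (d - j)" by simp
  then show ?thesis unfolding turn_def rot_pow_mod by simp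
qed

lemma edgeD: "(p, q) \<in> E \<Longrightarrow> p \<in> V \<and> q \<in> V \<and> p \<noteq> q \<and> (q, p) \<in> E"
  using finite_graphD[OF graph] by (auto simp: sym_def irrefl_def)

lemma lab_less: "(p, q) \<in> E \<Longrightarrow> L p q < d"
  using lab[of p] edgeD[of p q] by (auto simp: bij_betw_def nbrs_def)

lemma lab_inj: "(p, q) \<in> E \<Longrightarrow> (p, r) \<in> E \<Longrightarrow> L p q = L p r \<Longrightarrow> q = r"
  using lab[of p] edgeD[of p q] by (auto simp: bij_betw_def nbrs_def inj_on_def)

lemma nbr_exists:
  assumes "p \<in> V" "j < d"
  obtains q where "(p, q) \<in> E" "L p q = j"
proof -
  have "j \<in> L p ` nbrs E p" using lab[OF assms(1)] assms(2) by (auto simp: bij_betw_def)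
  then show thesis using that by (auto simp: nbrs_def)
qed

lemma place_own: "(p, q) \<in> E \<Longrightarrow> gc_place rho sig d L p q (p, pos t) = pos (rot (turn (L p q) t))"
  by (simp add: gc_place_def pos_rot_pow rot_pow_turn lab_less)

lemma place_other: "(p, q) \<in> E \<Longrightarrow> gc_place rho sig d L p q (q, pos t) = pos (rot (mir (turn (L q p) t)))"
proof -
  assume pq: "(p, q) \<in> E"
  have "gc_place rho sig d L p q (q, pos t) = sig ` (rho ^^ ((d + 1 - L q p) mod d)) ` pos t"
    using edgeD[OF pq] by (auto simp: gc_place_def image_comp)
  then show ?thesis using edgeD[OF pq] lab_less[of q p] by (simp add: pos_rot_pow rot_pow_turn pos_sig)
qed

lemma pos_rot_eq: "pos (rot t) = pos (rot u) \<longleftrightarrow> t = u"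
  by (simp add: rot_inj)

abbreviation "raw \<equiv> gc_raw V (pos ` P)"
abbreviation "glue \<equiv> gc_glue E (pos ` P) rho sig d L V"
abbreviation "req \<equiv> gc_equiv E (pos ` P) rho sig d L V"

text \<open>Equality of positions once the edge \<open>pq\<close> lies on side 0 of both regions;
  the piece of \<open>q\<close> is then seen through \<open>mir\<close>.\<close>

definition glued :: "'v \<Rightarrow> 't \<Rightarrow> 'v \<Rightarrow> 't \<Rightarrow> bool" where
  "glued p t q u \<longleftrightarrow> (p, q) \<in> E \<and> turn (L p q) t = mir (turn (L q p) u)"

lemma glued_sym: "glued p t q u \<longleftrightarrow> glued q u p t"
  unfolding glued_def using edgeD by (metis mir_mir)

text \<open>By \<open>cross_unique\<close> the tile \<open>t\<close> meets another piece across one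
  side only. This determines the label of the edge, hence the neighbour, hence the partner
  tile.\<close>

lemma glued_unique:
  assumes "t \<in> P" "u \<in> P" "u' \<in> P" "glued p t q u" "glued p t q' u'"
  shows "q = q' \<and> u = u'"
proof -
  have m: "mir (turn (L p q) t) = turn (L q p) u" "mir (turn (L p q') t) = turn (L q' p) u'"
    and e: "(p, q) \<in> E" "(p, q') \<in> E"
    using assms(4,5) by (auto simp: glued_def)
  have "(d - L p q) mod d = (d - L p q') mod d"
  proof (rule cross_unique[OF assms(1)])
    show "mir ((rot ^^ ((d - L p q) mod d)) t) \<in> P" "mir ((rot ^^ ((d - L p q') mod d)) t) \<in> P"
      using m assms(2,3) unfolding turn_def[symmetric] by auto
  qed (use d_pos in auto)
  moreover have "(d - j) mod d = (if j = 0 then 0 else d - j)" if "j < d" for j using that by auto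
  ultimately have "L p q = L p q'" using lab_less[OF e(1)] lab_less[OF e(2)] by (auto split: if_splits)
  then have qq: "q = q'" using lab_inj e by blast
  then have "turn (L q p) u = turn (L q p) u'" using m by simp
  then have "u = u'" using edgeD[OF e(1)] lab_less turn_inj by blast
  then show ?thesis using qq by simp
qed

lemma mem_glue:
  "(x, y) \<in> glue \<longleftrightarrow> (\<exists>p t q u. x = (p, pos t) \<and> y = (q, pos u) \<and> p \<in> V \<and> q \<in> V \<and> t \<in> P \<and> u \<in> P \<and> glued p t q u)"
  (is "?l \<longleftrightarrow> ?r")
proof
  assume ?l
  then obtain p t q u where "x = (p, pos t)" "y = (q, pos u)" "p \<in> V" "q \<in> V" "t \<in> P" "u \<in> P" "(p, q) \<in> E"
    "gc_place rho sig d L p q x = gc_place rho sig d L p q y"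
    by (auto simp: gc_glue_def gc_raw_def)
  then show ?r using place_own place_other pos_rot_eq by (auto simp: glued_def)
next
  assume ?r
  then obtain p t q u where "x = (p, pos t)" "y = (q, pos u)" "p \<in> V" "q \<in> V" "t \<in> P" "u \<in> P" "glued p t q u"
    by blast
  then show ?l unfolding gc_glue_def gc_raw_def
    using place_own[of p q t] place_other[of p q u] by (auto simp: glued_def)
qed

lemma mem_raw: "x \<in> raw \<longleftrightarrow> (\<exists>p t. x = (p, pos t) \<and> p \<in> V \<and> t \<in> P)"
  by (auto simp: gc_raw_def)

lemma glue_converse: "glue \<union> glue\<inverse> = glue"
  using glued_sym by (auto simp: mem_glue converse_iff; blast)

text \<open>The transitive closure adds nothing: the glue relation is symmetric, and by
  \<open>glued_unique\<close> a second step returns to the start.\<close>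

lemma mem_req:
  "(x, y) \<in> req \<longleftrightarrow> x \<in> raw \<and> y \<in> raw \<and> (x = y \<or> (x, y) \<in> glue)"
proof -
  have "x = y \<or> (x, y) \<in> glue" if "(x, y) \<in> glue\<^sup>*"
    using that
  proof (induction rule: rtrancl_induct)
    case (step y z)
    from step.IH show ?case
    proof
      assume "(x, y) \<in> glue"
      with step.hyps(2) obtain p t q u p' t' where *: "x = (p, pos t)" "y = (q, pos u)" "z = (p', pos t')"
        "t \<in> P" "u \<in> P" "t' \<in> P" "glued p t q u" "glued q u p' t'"
        unfolding mem_glue by auto
      then show ?thesis using glued_unique[of u t t' q p p'] glued_sym by auto
    qed (use step.hyps in auto)
  qed auto
  then show ?thesis unfolding gc_equiv_def glue_converse by auto
qed

lemma equiv_req: "equiv raw req"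
proof (rule equivI)
  show "req \<subseteq> raw \<times> raw" by (auto simp: mem_req)
  show "refl_on raw req" by (auto simp: refl_on_def mem_req)
  show "sym req" using glue_converse by (auto simp: sym_def mem_req)
  show "trans req"
    unfolding gc_equiv_def by (auto intro!: transI)
qed

definition cl :: "'v \<Rightarrow> 't \<Rightarrow> ('v \<times> complex set) set" where
  "cl p t = req `` {(p, pos t)}"

lemma cl_eq:
  assumes "p \<in> V" "q \<in> V" "t \<in> P" "u \<in> P"
  shows "cl p t = cl q u \<longleftrightarrow> (p = q \<and> t = u) \<or> glued p t q u"
proof -
  have "cl p t = cl q u \<longleftrightarrow> ((p, pos t), (q, pos u)) \<in> req"
    unfolding cl_def using assms by (intro eq_equiv_class_iff[OF equiv_req]) (auto simp: mem_raw)
  also have "\<dots> \<longleftrightarrow> (p = q \<and> t = u) \<or> glued p t q u"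
    using assms by (auto simp: mem_req mem_raw mem_glue)
  finally show ?thesis .
qed

section \<open>The glued graph in the picture along one edge of X\<close>

abbreviation "G \<equiv> gc_graph (pos ` P) rho sig d L V E"
abbreviation "W \<equiv> fst G"
abbreviation "F \<equiv> snd G"

lemma W_eq: "W = {cl p t | p t. p \<in> V \<and> t \<in> P}"
  by (auto simp: gc_graph_def Let_def quotient_def cl_def gc_raw_def)

lemma cl_W: "p \<in> V \<Longrightarrow> t \<in> P \<Longrightarrow> cl p t \<in> W"
  by (auto simp: W_eq)

text \<open>The vertex seen at tile \<open>t\<close> when \<open>p\<close> is placed with the edge \<open>pq\<close> on side \<open>0\<close> and
  \<open>q\<close> is placed across that side.\<close>

definition pic :: "'v \<Rightarrow> 'v \<Rightarrow> 't \<Rightarrow> ('v \<times> complex set) set" where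
  "pic p q t = (if t \<in> P then cl p ((rot ^^ (L p q)) t) else cl q ((rot ^^ (L q p)) (mir t)))"

lemma pic_own: "t \<in> P \<Longrightarrow> pic p q t = cl p ((rot ^^ (L p q)) t)"
  by (simp add: pic_def)

text \<open>If \<open>t\<close> and \<open>mir t\<close> are both in \<open>P\<close>, the tile is
  seen from both ends and glued, so the two branches of \<open>pic\<close> agree.\<close>

lemma pic_other:
  assumes "(p, q) \<in> E" "mir t \<in> P"
  shows "pic p q t = cl q ((rot ^^ (L q p)) (mir t))"
proof (cases "t \<in> P")
  case True
  have "glued p ((rot ^^ (L p q)) t) q ((rot ^^ (L q p)) (mir t))"
    using assms edgeD[OF assms(1)] by (simp add: glued_def lab_less)
  then show ?thesis using True assms edgeD[OF assms(1)] by (simp add: pic_own cl_eq rot_pow_P)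
qed (simp add: pic_def)

lemma pic_turn: "(p, q) \<in> E \<Longrightarrow> t \<in> P \<Longrightarrow> pic p q (turn (L p q) t) = cl p t"
  by (simp add: pic_own lab_less)

lemma pic_flip: "(p, q) \<in> E \<Longrightarrow> t \<in> P \<or> mir t \<in> P \<Longrightarrow> pic q p (mir t) = pic p q t"
  using edgeD[of p q] pic_own[of t p q] pic_other[of q p "mir t"] pic_own[of "mir t" q p] pic_other[of p q t]
  by (auto simp: rot_pow_P)

lemma cl_mem:
  assumes "p \<in> V" "t \<in> P" "x \<in> cl p t"
  shows "\<exists>q u. x = (q, pos u) \<and> q \<in> V \<and> u \<in> P \<and> cl p t = cl q u"
proof -
  have "((p, pos t), x) \<in> req" using assms by (simp add: cl_def)
  then obtain q u where "x = (q, pos u)" "q \<in> V" "u \<in> P" by (auto simp: mem_req mem_raw)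
  then show ?thesis using equiv_class_eq[OF equiv_req] \<open>((p, pos t), x) \<in> req\<close> unfolding cl_def by blast
qed

lemma self_mem_cl: "p \<in> V \<Longrightarrow> t \<in> P \<Longrightarrow> (p, pos t) \<in> cl p t"
  by (auto simp: cl_def mem_req mem_raw)

lemma placed_adj: "pos (rot t) \<noteq> pos (rot u) \<and> card (pos (rot t) \<inter> pos (rot u)) = 2 \<longleftrightarrow> adj t u"
  unfolding adj_rot[symmetric, of t u] adj_pos[of "rot t" "rot u"] by simp

lemma mem_F_raw:
  "(X, Y) \<in> F \<longleftrightarrow> X \<in> W \<and> Y \<in> W \<and> X \<noteq> Y \<and>
     (\<exists>p q x y. (p, q) \<in> E \<and> x \<in> X \<and> y \<in> Y \<and> fst x \<in> {p, q} \<and> fst y \<in> {p, q} \<and>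
                  gc_place rho sig d L p q x \<noteq> gc_place rho sig d L p q y \<and>
                  card (gc_place rho sig d L p q x \<inter> gc_place rho sig d L p q y) = 2)"
  by (simp add: gc_graph_def Let_def)

text \<open>A raw vertex placed for the edge \<open>pq\<close> is a tile of the picture along
  \<open>pq\<close>, and up to a common rotation the overlap condition on vertex sets is
  \<open>adj\<close>. Edges can thus be handled as adjacent tiles in one picture.\<close>

lemma mem_F:
  "(X, Y) \<in> F \<longleftrightarrow> X \<noteq> Y \<and> (\<exists>p q t u. (p, q) \<in> E \<and> (t \<in> P \<or> mir t \<in> P) \<and> (u \<in> P \<or> mir u \<in> P) \<and>
     adj t u \<and> X = pic p q t \<and> Y = pic p q u)" (is "?l \<longleftrightarrow> ?r")
proof
  assume ?l
  then obtain p q x y where XY: "X \<in> W" "Y \<in> W" "X \<noteq> Y" and pq: "(p, q) \<in> E" and xy: "x \<in> X" "y \<in> Y"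
    "fst x \<in> {p, q}" "fst y \<in> {p, q}"
    and pl: "gc_place rho sig d L p q x \<noteq> gc_place rho sig d L p q y"
    "card (gc_place rho sig d L p q x \<inter> gc_place rho sig d L p q y) = 2"
    unfolding mem_F_raw by (elim conjE exE)
  have *: "\<exists>t. (t \<in> P \<or> mir t \<in> P) \<and> X = pic p q t \<and> gc_place rho sig d L p q x = pos (rot t)"
    if X: "X \<in> W" and x: "x \<in> X" "fst x \<in> {p, q}" for X x
  proof -
    obtain r u where ru: "x = (r, pos u)" "r \<in> V" "u \<in> P" "X = cl r u"
      using X x cl_mem unfolding W_eq by blast
    from x(2) ru consider "r = p" | "r = q" by auto
    then show ?thesis
    proof cases
      case 1
      then show ?thesis using ru pq place_own[OF pq, of u]
        by (intro exI[of _ "turn (L p q) u"]) (auto simp: pic_turn)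
    next
      case 2
      then show ?thesis using ru pq place_other[OF pq, of u] pic_other[OF pq, of "mir (turn (L q p) u)"] edgeD[OF pq]
        by (intro exI[of _ "mir (turn (L q p) u)"]) (auto simp: lab_less)
    qed
  qed
  obtain t where t: "t \<in> P \<or> mir t \<in> P" "X = pic p q t" "gc_place rho sig d L p q x = pos (rot t)"
    using *[OF XY(1) xy(1,3)] by blast
  obtain u where u: "u \<in> P \<or> mir u \<in> P" "Y = pic p q u" "gc_place rho sig d L p q y = pos (rot u)"
    using *[OF XY(2) xy(2,4)] by blast
  have "adj t u" using pl placed_adj[of t u] unfolding t(3) u(3) by simp
  then show ?r using XY(3) pq t u by blast
next
  assume ?r
  then obtain p q t u where XY: "X \<noteq> Y" and pq: "(p, q) \<in> E" and tu: "t \<in> P \<or> mir t \<in> P" "u \<in> P \<or> mir u \<in> P"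
     "adj t u" "X = pic p q t" "Y = pic p q u" by blast
  have *: "\<exists>x\<in>pic p q t. pic p q t \<in> W \<and> fst x \<in> {p, q} \<and> gc_place rho sig d L p q x = pos (rot t)"
    if "t \<in> P \<or> mir t \<in> P" for t
  proof (cases "t \<in> P")
    case True
    then show ?thesis using place_own[OF pq, of "(rot ^^ (L p q)) t"] edgeD[OF pq] lab_less[OF pq]
      by (intro bexI[of _ "(p, pos ((rot ^^ (L p q)) t))"]) (auto simp: pic_own rot_pow_P intro: cl_W self_mem_cl)
  next
    case False
    then have "mir t \<in> P" using that by simp
    then show ?thesis using place_other[OF pq, of "(rot ^^ (L q p)) (mir t)"] edgeD[OF pq] lab_less[of q p]
      by (intro bexI[of _ "(q, pos ((rot ^^ (L q p)) (mir t)))"]) (auto simp: pic_other[OF pq] rot_pow_P intro: cl_W self_mem_cl)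
  qed
  from *[OF tu(1)] *[OF tu(2)] obtain x y where xy: "x \<in> X" "y \<in> Y" "X \<in> W" "Y \<in> W" "fst x \<in> {p, q}" "fst y \<in> {p, q}"
    "gc_place rho sig d L p q x = pos (rot t)" "gc_place rho sig d L p q y = pos (rot u)"
    unfolding tu by blast
  have "\<exists>p q x y. (p, q) \<in> E \<and> x \<in> X \<and> y \<in> Y \<and> fst x \<in> {p, q} \<and> fst y \<in> {p, q} \<and>
                  gc_place rho sig d L p q x \<noteq> gc_place rho sig d L p q y \<and>
                  card (gc_place rho sig d L p q x \<inter> gc_place rho sig d L p q y) = 2"
    using tu(3) placed_adj[of t u] pq xy(1,2,5,6)
    by (intro exI[of _ p] exI[of _ q] exI[of _ x] exI[of _ y]) (simp only: xy(7,8) simp_thms)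
  then show ?l using xy(3,4) XY unfolding mem_F_raw by blast
qed

lemma mem_FI:
  assumes "X \<noteq> Y" "(p, q) \<in> E" "t \<in> P \<or> mir t \<in> P" "u \<in> P \<or> mir u \<in> P" "adj t u" "X = pic p q t" "Y = pic p q u"
  shows "(X, Y) \<in> F"
  using assms unfolding mem_F by blast

lemma finite_graph_G: "finite_graph W F"
  unfolding finite_graph_def
proof (intro conjI)
  have "W = (\<lambda>(p, t). cl p t) ` (V \<times> P)" by (auto simp: W_eq)
  then show "finite W" using finite_graphD(1)[OF graph] finP by simp
  show "F \<subseteq> W \<times> W" by (auto simp: gc_graph_def Let_def)
  show "irrefl F" by (auto simp: gc_graph_def Let_def irrefl_def)
  show "sym F" unfolding sym_def mem_F using adj_sym by blast
qed

end

section \<open>Lifting functions to the glued graph\<close>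

lemma sum_Un_le:
  fixes h :: "'a \<Rightarrow> real"
  assumes "finite A" "finite B" "\<And>x. 0 \<le> h x"
  shows "sum h (A \<union> B) \<le> sum h A + sum h B"
  using sum.union_inter[OF assms(1,2), of h] sum_nonneg[of "A \<inter> B" h] assms(3) by simp

text \<open>Used for tiles centred on a side, which are met from both ends of their edge;
  \<open>s\<close> exchanges the two descriptions.\<close>

lemma sum_le_two_to_one:
  fixes h :: "'b \<Rightarrow> real"
  assumes fin: "finite A" and h: "\<And>x. 0 \<le> h x"
    and fib: "\<And>a a'. a \<in> A \<Longrightarrow> a' \<in> A \<Longrightarrow> g a = g a' \<Longrightarrow> a' = a \<or> a' = s a"
  shows "(\<Sum>a\<in>A. h (g a)) \<le> 2 * (\<Sum>b\<in>g ` A. h b)"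
proof -
  have "(\<Sum>a\<in>A. h (g a)) = (\<Sum>b\<in>g ` A. \<Sum>a\<in>{a \<in> A. g a = b}. h (g a))"
    by (rule sum.image_gen[OF fin])
  also have "\<dots> \<le> (\<Sum>b\<in>g ` A. 2 * h b)"
  proof (rule sum_mono)
    fix b assume "b \<in> g ` A"
    then obtain a where a: "a \<in> A" "g a = b" by auto
    have "{a' \<in> A. g a' = b} \<subseteq> {a, s a}"
    proof
      fix x assume "x \<in> {a' \<in> A. g a' = b}"
      then show "x \<in> {a, s a}" using fib[OF a(1), of x] a(2) by auto
    qed
    then have "card {a' \<in> A. g a' = b} \<le> card {a, s a}" by (intro card_mono) auto
    also have "\<dots> \<le> 2" by (simp add: card_insert_if)
    finally have "real (card {a' \<in> A. g a' = b}) * h b \<le> 2 * h b" using h by (intro mult_right_mono) auto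
    moreover have "(\<Sum>a\<in>{a \<in> A. g a = b}. h (g a)) = real (card {a' \<in> A. g a' = b}) * h b" by simp
    ultimately show "(\<Sum>a\<in>{a \<in> A. g a = b}. h (g a)) \<le> 2 * h b" by simp
  qed
  finally show ?thesis by (simp add: sum_distrib_left)
qed

text \<open>\<open>Own\<close> are the tiles assigned to the region itself, \<open>Tie\<close> those
  centred on side 0 (none for triangles); ties on other sides are reached through
  \<open>rot\<close>. \<open>cover\<close> assigns every other tile of the piece to a neighbour or
  makes it a tie, \<open>far_adj\<close> says that adjacent tiles beyond different sides are both
  ties, and \<open>cross_adj\<close> treats adjacent tiles that no single piece contains.\<close>

locale gc_owned = gc_system V E d L pos P rot mir adj rho sig
  for V :: "'v set" and E d L and pos :: "'t \<Rightarrow> complex set" and P rot mir adj rho sig +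
  fixes Own Tie :: "'t set"
  assumes Own_P: "Own \<subseteq> P" and Own_rot: "rot t \<in> Own \<longleftrightarrow> t \<in> Own"
    and Own_mir: "t \<in> Own \<Longrightarrow> mir t \<notin> Own"
    and Tie_P: "Tie \<subseteq> P" and Tie_mir: "mir t \<in> Tie \<longleftrightarrow> t \<in> Tie"
    and Tie_Own: "t \<in> Tie \<Longrightarrow> t \<notin> Own"
    and cover: "t \<in> P \<Longrightarrow> t \<notin> Own \<Longrightarrow> \<exists>j<d. mir ((rot ^^ j) t) \<in> Own \<or> (rot ^^ j) t \<in> Tie"
    and far_adj: "\<lbrakk>adj t u; t \<in> P; u \<in> P; i < d; j < d; i \<noteq> j;
        mir ((rot ^^ i) t) \<in> Own \<or> (rot ^^ i) t \<in> Tie; mir ((rot ^^ j) u) \<in> Own \<or> (rot ^^ j) u \<in> Tie\<rbrakk>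
      \<Longrightarrow> (rot ^^ i) t \<in> Tie \<and> (rot ^^ j) u \<in> Tie"
    and tie_adj: "t \<in> Tie \<Longrightarrow> u \<in> Tie \<Longrightarrow> \<not> adj t u"
    and cross_adj: "adj t u \<Longrightarrow> t \<in> P \<Longrightarrow> mir u \<in> P \<Longrightarrow> u \<in> P \<or> mir t \<in> P \<or> (t \<in> Own \<and> mir u \<in> Own)"
begin

lemma rot_pow_Own: "(rot ^^ n) t \<in> Own \<longleftrightarrow> t \<in> Own"
  by (induction n) (auto simp: Own_rot)

lemma turn_Own [simp]: "turn j t \<in> Own \<longleftrightarrow> t \<in> Own"
  by (simp add: turn_def rot_pow_Own)

lemma P_of [simp]: "t \<in> Own \<Longrightarrow> t \<in> P" "t \<in> Tie \<Longrightarrow> t \<in> P"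
  using Own_P Tie_P by auto

lemma side_inj:
  assumes "(p, q) \<in> E" "(p, r) \<in> E" "(d - L p q) mod d = (d - L p r) mod d"
  shows "q = r"
proof -
  have "(d - j) mod d = (if j = 0 then 0 else d - j)" if "j < d" for j using that by auto
  then have "L p q = L p r" using lab_less[OF assms(1)] lab_less[OF assms(2)] assms(3) by (auto split: if_splits)
  then show ?thesis using lab_inj assms by blast
qed

lemma far_cases:
  assumes "p \<in> V" "t \<in> P" "t \<notin> Own"
  shows "\<exists>q. (p, q) \<in> E \<and> (mir (turn (L p q) t) \<in> Own \<or> turn (L p q) t \<in> Tie)"
proof -
  obtain j where j: "j < d" "mir ((rot ^^ j) t) \<in> Own \<or> (rot ^^ j) t \<in> Tie" using cover assms by blast
  \<comment> \<open>An edge with label \<open>L p q\<close> is brought to side 0 by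
    \<open>d - L p q\<close> rotations, so the side that arrives there after \<open>j\<close>
    rotations has label \<open>(d - j) mod d\<close>.\<close>
  obtain q where q: "(p, q) \<in> E" "L p q = (d - j) mod d"
    using nbr_exists[OF assms(1), of "(d - j) mod d"] d_pos by auto
  have "(d - (d - j) mod d) mod d = j" using j(1) by (cases "j = 0") auto
  then have "turn (L p q) t = (rot ^^ j) t" unfolding turn_def q(2) by simp
  then show ?thesis using q(1) j(2) by metis
qed

text \<open>Glued tiles are mirror images after turning, and \<open>Own\<close> never contains a
  tile together with its mirror image. So a class has at most one owner.\<close>

lemma own_unique:
  assumes "p \<in> V" "q \<in> V" "t \<in> Own" "u \<in> Own" "cl p t = cl q u"
  shows "p = q \<and> t = u"
proof (rule ccontr)
  assume "\<not> (p = q \<and> t = u)"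
  then have "turn (L p q) t = mir (turn (L q p) u)" using assms by (auto simp: cl_eq glued_def)
  moreover have "turn (L p q) t \<in> Own" "mir (turn (L q p) u) \<notin> Own" using assms Own_mir by simp_all
  ultimately show False by simp
qed

lemma tie_glued: "(p, q) \<in> E \<Longrightarrow> glued p ((rot ^^ (L p q)) t) q ((rot ^^ (L q p)) (mir t))"
  using edgeD[of p q] by (simp add: glued_def lab_less)

text \<open>A tie is seen from the two ends of its edge and from nowhere else. The average in
  \<open>lift\<close> is symmetric in these ends and therefore independent of the choice made
  there.\<close>

lemma tie_class:
  assumes e: "(p, q) \<in> E" "(p', q') \<in> E" and t: "t \<in> Tie" "t' \<in> Tie" and eq: "pic p q t = pic p' q' t'"
  shows "(p', q', t') = (p, q, t) \<or> (p', q', t') = (q, p, mir t)"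
proof -
  define s s' where "s = (rot ^^ (L p q)) t" and "s' = (rot ^^ (L p' q')) t'"
  have P: "s \<in> P" "s' \<in> P" "mir t \<in> P" "mir t' \<in> P" using t Tie_mir by (auto simp: s_def s'_def rot_pow_P)
  have c: "cl p s = cl p' s'" using eq t by (simp add: pic_own s_def s'_def)
  note g = tie_glued[OF e(1), of t, folded s_def] tie_glued[OF e(2), of t', folded s'_def]
  from c P edgeD[OF e(1)] edgeD[OF e(2)] consider "p = p'" "s = s'" | "glued p s p' s'" by (auto simp: cl_eq)
  then show ?thesis
  proof cases
    case 1
    have u: "(rot ^^ (L q p)) (mir t) \<in> P" "(rot ^^ (L q' p')) (mir t') \<in> P" using P by (simp_all add: rot_pow_P)
    have "q = q'" using glued_unique[OF P(1) u g(1)] g(2) unfolding 1 by blast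
    moreover have "turn (L p q) s = t" "turn (L p' q') s' = t'"
      using turn_rot[OF lab_less[OF e(1)], of t] turn_rot[OF lab_less[OF e(2)], of t'] by (simp_all only: s_def s'_def)
    ultimately show ?thesis using 1 by simp
  next
    case 2
    have u: "(rot ^^ (L q p)) (mir t) \<in> P" "(rot ^^ (L q' p')) (mir t') \<in> P" using P by (simp_all add: rot_pow_P)
    have a: "q = p'" "(rot ^^ (L q p)) (mir t) = s'" using glued_unique[OF P(1) u(1) P(2) g(1) 2] by blast+
    have "glued p' s' p s" using 2 glued_sym[of p' s' p s] by simp
    then have b: "q' = p" using glued_unique[OF P(2) u(2) P(1) g(2)] by blast
    have "turn (L q p) ((rot ^^ (L q p)) (mir t)) = turn (L q p) ((rot ^^ (L q p)) t')"
      using a b by (simp add: s'_def)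
    then have "mir t = t'" using edgeD[OF e(1)] by (simp add: lab_less)
    then show ?thesis using a b by simp
  qed
qed

lemma tie_not_own:
  assumes e: "(p, q) \<in> E" and t: "t \<in> Tie" and r: "r \<in> V" "u \<in> Own"
  shows "pic p q t \<noteq> cl r u"
proof
  assume eq: "pic p q t = cl r u"
  define s where "s = (rot ^^ (L p q)) t"
  have P: "s \<in> P" "mir t \<in> P" "u \<in> P" using t r Tie_mir by (auto simp: s_def rot_pow_P)
  note g = tie_glued[OF e, of t, folded s_def]
  have "cl p s = cl r u" using eq t by (simp add: pic_own s_def)
  then consider "p = r" "s = u" | "glued p s r u" using P r edgeD[OF e] by (auto simp: cl_eq)
  then show False
  proof cases
    case 1
    then show False using t r(2) Tie_Own by (auto simp: s_def rot_pow_Own)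
  next
    case 2
    have "(rot ^^ (L q p)) (mir t) \<in> P" using P by (simp add: rot_pow_P)
    then have "(rot ^^ (L q p)) (mir t) = u" using glued_unique[OF P(1) _ P(3) g 2] by blast
    then have "mir t \<in> Own" using r(2) by (auto simp: rot_pow_Own)
    then show False using t Tie_mir Tie_Own by blast
  qed
qed

text \<open>The test function on the Goldberg--Coxeter graph: the value at the owner of a tile, and the
  average over the two ends of the edge for tiles centred on a side.\<close>

definition lift :: "('v \<Rightarrow> complex) \<Rightarrow> ('v \<times> complex set) set \<Rightarrow> complex" where
  "lift f X = (if \<exists>p t. p \<in> V \<and> t \<in> Own \<and> X = cl p t then f (SOME p. p \<in> V \<and> (\<exists>t\<in>Own. X = cl p t))
     else let pq = SOME pq. pq \<in> E \<and> (\<exists>t\<in>Tie. X = pic (fst pq) (snd pq) t)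
          in (f (fst pq) + f (snd pq)) / 2)"

text \<open>Linear because the choices inside \<open>lift\<close> depend on the class
  \<open>X\<close> and not on the function.\<close>

lemma lift_sum: "lift (\<lambda>x. \<Sum>j\<in>J. c j * g j x) X = (\<Sum>j\<in>J. c j * lift (g j) X)"
  by (cases "\<exists>p t. p \<in> V \<and> t \<in> Own \<and> X = cl p t")
    (simp_all only: lift_def Let_def if_True if_False sum.distrib sum_divide_distrib distrib_left add_divide_distrib times_divide_eq_right)

lemma lift_own: "p \<in> V \<Longrightarrow> t \<in> Own \<Longrightarrow> lift f (cl p t) = f p"
proof -
  assume pt: "p \<in> V" "t \<in> Own"
  have "(SOME p'. p' \<in> V \<and> (\<exists>u\<in>Own. cl p t = cl p' u)) = p"
  proof (rule some_equality)
    show "p \<in> V \<and> (\<exists>u\<in>Own. cl p t = cl p u)" using pt by blast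
    fix p' assume "p' \<in> V \<and> (\<exists>u\<in>Own. cl p t = cl p' u)"
    then show "p' = p" using pt own_unique[of p p' t] by auto
  qed
  then show ?thesis using pt by (auto simp: lift_def)
qed

lemma lift_pic:
  assumes e: "(p, q) \<in> E"
  shows "t \<in> Own \<Longrightarrow> lift f (pic p q t) = f p"
    and "mir t \<in> Own \<Longrightarrow> lift f (pic p q t) = f q"
    and "t \<in> Tie \<Longrightarrow> lift f (pic p q t) = (f p + f q) / 2"
proof -
  show "lift f (pic p q t) = f p" if "t \<in> Own"
    using that e edgeD[OF e] by (simp add: pic_own lift_own rot_pow_Own)
  show "lift f (pic p q t) = f q" if "mir t \<in> Own"
    using that e edgeD[OF e] by (simp add: pic_other lift_own rot_pow_Own)
  show "lift f (pic p q t) = (f p + f q) / 2" if t: "t \<in> Tie"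
  proof -
    have no: "\<not> (\<exists>r u. r \<in> V \<and> u \<in> Own \<and> pic p q t = cl r u)" using tie_not_own[OF e t] by blast
    define pq where "pq = (SOME pq. pq \<in> E \<and> (\<exists>u\<in>Tie. pic p q t = pic (fst pq) (snd pq) u))"
    have "\<exists>pq. pq \<in> E \<and> (\<exists>u\<in>Tie. pic p q t = pic (fst pq) (snd pq) u)" using e t by (intro exI[of _ "(p, q)"]) auto
    from someI_ex[OF this, folded pq_def] obtain u where u: "pq \<in> E" "u \<in> Tie" "pic p q t = pic (fst pq) (snd pq) u" by blast
    then have "(fst pq, snd pq, u) = (p, q, t) \<or> (fst pq, snd pq, u) = (q, p, mir t)"
      using tie_class[OF e _ t u(2) u(3)] by simp
    then show ?thesis using no unfolding lift_def pq_def[symmetric] Let_def by (auto simp: add.commute)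
  qed
qed

lemma lift_class_far: "(p, q) \<in> E \<Longrightarrow> t \<in> P \<Longrightarrow> mir (turn (L p q) t) \<in> Own \<Longrightarrow> lift f (cl p t) = f q"
  using lift_pic(2)[of p q "turn (L p q) t" f] by (simp add: pic_turn)

text \<open>The kinds of edges along which a lift can change: between tiles owned by the two ends of
  an edge (\<open>C1\<close>), between an owned tile and a tie (\<open>C2\<close>), and at a corner
  between ties on two sides of one region (\<open>C3\<close>, indexed by the labels of these
  sides).\<close>

definition "C1 = {(t, u). adj t u \<and> t \<in> Own \<and> mir u \<in> Own}"
definition "C2 = {(t, u). adj t u \<and> t \<in> Own \<and> u \<in> Tie}"
definition "C3 i j = {(t, u). t \<in> Tie \<and> u \<in> Tie \<and> adj ((rot ^^ i) t) ((rot ^^ j) u)}"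

text \<open>The conjunct \<open>Own \<noteq> {}\<close> excludes the first alternative when all
  tiles are ties; in that case the classification is applied to arbitrary functions and not to
  lifts.\<close>

definition crossing :: "('v \<times> complex set) set \<Rightarrow> ('v \<times> complex set) set \<Rightarrow> bool" where
  "crossing X Y \<longleftrightarrow> (\<forall>f. lift f X = lift f Y) \<and> Own \<noteq> {} \<or>
     (\<exists>p q t u. (p, q) \<in> E \<and> (t, u) \<in> C1 \<and> X = pic p q t \<and> Y = pic p q u) \<or>
     (\<exists>p q t u. (p, q) \<in> E \<and> (t, u) \<in> C2 \<and> X = pic p q t \<and> Y = pic p q u) \<or>
     (\<exists>p q t u. (p, q) \<in> E \<and> (t, u) \<in> C2 \<and> X = pic p q u \<and> Y = pic p q t) \<or>
     (\<exists>p q r t u. (p, q) \<in> E \<and> (p, r) \<in> E \<and> q \<noteq> r \<and> (t, u) \<in> C3 (L p q) (L p r) \<and> X = pic p q t \<and> Y = pic p r u)"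

lemma crossingI:
  assumes "(p, q) \<in> E"
  shows "(t, u) \<in> C1 \<Longrightarrow> crossing (pic p q t) (pic p q u)"
    and "(t, u) \<in> C2 \<Longrightarrow> crossing (pic p q t) (pic p q u)"
    and "(t, u) \<in> C2 \<Longrightarrow> crossing (pic p q u) (pic p q t)"
    and "(p, r) \<in> E \<Longrightarrow> q \<noteq> r \<Longrightarrow> (t, u) \<in> C3 (L p q) (L p r) \<Longrightarrow> crossing (pic p q t) (pic p r u)"
  using assms unfolding crossing_def by blast+

text \<open>Each tile is owned by \<open>p\<close>, owned by a neighbour of \<open>p\<close>, or a
  tie with one. If two different neighbours are involved, \<open>far_adj\<close> leaves only a pair
  of ties. If it is the same neighbour, the lift is constant or the edge is a \<open>C2\<close> edge
  seen from that neighbour.\<close>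

lemma crossing_same:
  assumes p: "p \<in> V" and tu: "t \<in> P" "u \<in> P" "adj t u"
  shows "crossing (cl p t) (cl p u)"
proof -
  have C1I: "crossing (cl p t) (cl p u)"
    if "(p, q) \<in> E" "t \<in> Own" "mir (turn (L p q) u) \<in> Own" for q
  proof -
    have "(turn (L p q) t, turn (L p q) u) \<in> C1" using that tu by (simp add: C1_def)
    from crossingI(1)[OF that(1) this] show ?thesis using that tu by (simp add: pic_turn)
  qed
  have C1I': "crossing (cl p t) (cl p u)"
    if q: "(p, q) \<in> E" "u \<in> Own" "mir (turn (L p q) t) \<in> Own" for q
  proof -
    have "(mir (turn (L p q) t), mir (turn (L p q) u)) \<in> C1" using that tu by (simp add: C1_def adj_mir)
    moreover have "pic q p (mir (turn (L p q) t)) = cl p t" "pic q p (mir (turn (L p q) u)) = cl p u"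
      using q tu by (simp_all add: pic_flip pic_turn)
    ultimately show ?thesis using edgeD[OF q(1)] crossingI(1)[of q p] by metis
  qed
  have C2I: "crossing (cl p t) (cl p u)"
    if "(p, q) \<in> E" "t \<in> Own" "turn (L p q) u \<in> Tie" for q
  proof -
    have "(turn (L p q) t, turn (L p q) u) \<in> C2" using that tu by (simp add: C2_def)
    from crossingI(2)[OF that(1) this] show ?thesis using that tu by (simp add: pic_turn)
  qed
  have C2I': "crossing (cl p t) (cl p u)"
    if "(p, q) \<in> E" "u \<in> Own" "turn (L p q) t \<in> Tie" for q
  proof -
    have "(turn (L p q) u, turn (L p q) t) \<in> C2" using that tu adj_sym[of t u] by (simp add: C2_def)
    from crossingI(3)[OF that(1) this] show ?thesis using that tu by (simp add: pic_turn)
  qed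
  show ?thesis
  proof (cases "t \<in> Own"; cases "u \<in> Own")
    assume "t \<in> Own" "u \<in> Own"
    then show ?thesis by (auto simp: crossing_def lift_own p)
  next
    assume "t \<in> Own" "u \<notin> Own"
    then show ?thesis using far_cases[OF p tu(2)] C1I C2I by blast
  next
    assume "t \<notin> Own" "u \<in> Own"
    then show ?thesis using far_cases[OF p tu(1)] C1I' C2I' by blast
  next
    assume no: "t \<notin> Own" "u \<notin> Own"
    obtain q where q: "(p, q) \<in> E" "mir (turn (L p q) t) \<in> Own \<or> turn (L p q) t \<in> Tie"
      using far_cases[OF p tu(1) no(1)] by blast
    obtain r where r: "(p, r) \<in> E" "mir (turn (L p r) u) \<in> Own \<or> turn (L p r) u \<in> Tie"
      using far_cases[OF p tu(2) no(2)] by blast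
    show ?thesis
    proof (cases "q = r")
      case False
      then have "(d - L p q) mod d \<noteq> (d - L p r) mod d" using side_inj q(1) r(1) by blast
      then have "turn (L p q) t \<in> Tie \<and> turn (L p r) u \<in> Tie"
        using far_adj[OF tu(3,1,2) _ _ _ q(2)[unfolded turn_def] r(2)[unfolded turn_def]] d_pos
        by (simp add: turn_def)
      then have "(turn (L p q) t, turn (L p r) u) \<in> C3 (L p q) (L p r)"
        using tu q r by (simp add: C3_def lab_less)
      from crossingI(4)[OF q(1) r(1) False this] show ?thesis using q(1) r(1) tu by (simp add: pic_turn)
    next
      case True
      show ?thesis
      proof (cases "mir (turn (L p q) t) \<in> Own")
        case t: True
        show ?thesis
        proof (cases "mir (turn (L p q) u) \<in> Own")
          case True
          then show ?thesis unfolding crossing_def using lift_class_far[OF q(1) tu(1) t] lift_class_far[OF q(1) tu(2)] by auto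
        next
          case False
          then have u: "turn (L p q) u \<in> Tie" using r \<open>q = r\<close> by auto
          have "(mir (turn (L p q) t), mir (turn (L p q) u)) \<in> C2" using t u tu Tie_mir by (simp add: C2_def adj_mir)
          moreover have "pic q p (mir (turn (L p q) t)) = cl p t" "pic q p (mir (turn (L p q) u)) = cl p u"
            using q tu by (simp_all add: pic_flip pic_turn)
          ultimately show ?thesis using edgeD[OF q(1)] crossingI(2)[of q p] by metis
        qed
      next
        case False
        then have t: "turn (L p q) t \<in> Tie" using q by auto
        show ?thesis
        proof (cases "mir (turn (L p q) u) \<in> Own")
          case True
          have "(mir (turn (L p q) u), mir (turn (L p q) t)) \<in> C2" using True t tu Tie_mir adj_sym[of t u] by (simp add: C2_def adj_mir)
          moreover have "pic q p (mir (turn (L p q) t)) = cl p t" "pic q p (mir (turn (L p q) u)) = cl p u"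
            using q tu by (simp_all add: pic_flip pic_turn)
          ultimately show ?thesis using edgeD[OF q(1)] crossingI(3)[of q p] by metis
        next
          case False
          then have "turn (L p q) u \<in> Tie" using r \<open>q = r\<close> by auto
          then have "\<not> adj (turn (L p q) t) (turn (L p q) u)" by (rule tie_adj[OF t])
          then show ?thesis using tu(3) by simp
        qed
      qed
    qed
  qed
qed

text \<open>Either one of the two pieces contains both tiles, or each tile is in one piece only and
  \<open>cross_adj\<close> makes the pair a \<open>C1\<close> edge.\<close>

lemma crossing_edge:
  assumes "(X, Y) \<in> F"
  shows "crossing X Y"
proof -
  obtain p q t u where pq: "(p, q) \<in> E" and tu: "t \<in> P \<or> mir t \<in> P" "u \<in> P \<or> mir u \<in> P" "adj t u"
    and XY: "X = pic p q t" "Y = pic p q u"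
    using assms unfolding mem_F by blast
  have same: "crossing X Y" if "t \<in> P" "u \<in> P"
    using crossing_same[of p "(rot ^^ (L p q)) t" "(rot ^^ (L p q)) u"] that tu(3) edgeD[OF pq] XY
    by (simp add: pic_own rot_pow_P rot_pow_adj)
  have same': "crossing X Y" if "mir t \<in> P" "mir u \<in> P"
    using crossing_same[of q "(rot ^^ (L q p)) (mir t)" "(rot ^^ (L q p)) (mir u)"] that tu(3) edgeD[OF pq] XY pq
    by (simp add: pic_other rot_pow_P rot_pow_adj adj_mir)
  consider "t \<in> P" "u \<in> P" | "mir t \<in> P" "mir u \<in> P" | "t \<in> P" "mir u \<in> P" "u \<notin> P" "mir t \<notin> P" |
    "mir t \<in> P" "u \<in> P" "t \<notin> P" "mir u \<notin> P"
    using tu by blast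
  then show ?thesis
  proof cases
    case 3
    then have "(t, u) \<in> C1" using cross_adj[OF tu(3)] tu(3) by (auto simp: C1_def)
    then show ?thesis using crossingI(1)[OF pq] XY by blast
  next
    case 4
    then have "u \<in> Own" "mir t \<in> Own" using cross_adj[of u t] tu(3) adj_sym by auto
    then have "(mir t, mir u) \<in> C1" using tu(3) by (simp add: C1_def adj_mir)
    then show ?thesis using crossingI(1)[of q p] edgeD[OF pq] XY pic_flip[OF pq tu(1)] pic_flip[OF pq tu(2)] by metis
  qed (use same same' in auto)
qed

section \<open>Energy of a lifted function\<close>

definition "Pairs = {(p, q, r). (p, q) \<in> E \<and> (p, r) \<in> E \<and> q \<noteq> r}"

lemma finite_sets: "finite Own" "finite Tie" "finite C1" "finite C2" "finite (C3 i j)" "finite Pairs" "finite E"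
proof -
  show *: "finite Own" "finite Tie" using Own_P Tie_P finP finite_subset by auto
  have "C1 \<subseteq> Own \<times> mir ` Own" by (auto simp: C1_def intro!: image_eqI[where x = "mir _"])
  then show "finite C1" using * by (meson finite_SigmaI finite_imageI finite_subset)
  have "C2 \<subseteq> Own \<times> Tie" "C3 i j \<subseteq> Tie \<times> Tie" by (auto simp: C2_def C3_def)
  then show "finite C2" "finite (C3 i j)" using * by (meson finite_SigmaI finite_subset)+
  have "Pairs \<subseteq> V \<times> V \<times> V" using edgeD by (auto simp: Pairs_def)
  then show "finite Pairs" using finite_graphD(1)[OF graph] by (meson finite_SigmaI finite_subset)
  show "finite E" using finite_graphD(5)[OF graph] .
qed

definition tie_set :: "('v \<times> 'v \<times> 'v \<times> 't \<times> 't) set" where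
  "tie_set = {(p, q, r, t, u). (p, q, r) \<in> Pairs \<and> (t, u) \<in> C3 (L p q) (L p r)}"

lemma finite_tie_set: "finite tie_set"
proof -
  have "tie_set \<subseteq> V \<times> V \<times> V \<times> Tie \<times> Tie" using edgeD by (auto simp: tie_set_def Pairs_def C3_def)
  then show ?thesis using finite_graphD(1)[OF graph] finite_sets by (meson finite_SigmaI finite_subset)
qed

lemma sum_C:
  assumes "finite C" "\<And>p q t u. (p, q) \<in> E \<Longrightarrow> (t, u) \<in> C \<Longrightarrow> h (g ((p, q), (t, u))) = a * (cmod (f p - f q))\<^sup>2"
  shows "(\<Sum>x\<in>E \<times> C. h (g x)) = real (card C) * a * (2 * energy E f)"
proof -
  have "(\<Sum>x\<in>E \<times> C. h (g x)) = (\<Sum>e\<in>E. \<Sum>c\<in>C. h (g (e, c)))"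
    by (simp add: sum.cartesian_product case_prod_unfold)
  also have "\<dots> = (\<Sum>(p, q)\<in>E. \<Sum>c\<in>C. a * (cmod (f p - f q))\<^sup>2)"
  proof (rule sum.cong)
    fix e assume "e \<in> E"
    then obtain p q where e: "e = (p, q)" "(p, q) \<in> E" by (cases e) auto
    have "(\<Sum>c\<in>C. h (g (e, c))) = (\<Sum>c\<in>C. a * (cmod (f p - f q))\<^sup>2)"
    proof (rule sum.cong)
      fix c assume "c \<in> C"
      then show "h (g (e, c)) = a * (cmod (f p - f q))\<^sup>2" using assms(2)[OF e(2), of "fst c" "snd c"] e(1) by simp
    qed simp
    then show "(\<Sum>c\<in>C. h (g (e, c))) = (case e of (p, q) \<Rightarrow> \<Sum>c\<in>C. a * (cmod (f p - f q))\<^sup>2)" using e by simp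
  qed simp
  finally show ?thesis by (simp add: energy_def sum_distrib_left case_prod_unfold mult_ac)
qed

text \<open>The lift jumps by \<open>f p - f q\<close> on \<open>C1\<close>, by half of this on
  \<open>C2\<close> and by \<open>(f q - f r) / 2\<close> between ties. \<open>C1\<close> covers
  both directions of an edge through the reversed edge \<open>qp\<close> of \<open>X\<close>,
  whereas \<open>C2\<close> needs both \<open>g1\<close> and \<open>g2\<close>; two terms with
  factor 1/4 give the weight 1/2. Counting an edge repeatedly only weakens an upper bound.\<close>

lemma energy_lift:
  "energy F (lift f) \<le> (real (card C1) + real (card C2) / 2) * energy E f +
     (\<Sum>(p, q, r, t, u)\<in>tie_set. (cmod (f q - f r))\<^sup>2) / 8"
proof -
  define h where "h = (\<lambda>(X, Y). (cmod (lift f X - lift f Y))\<^sup>2)"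
  have h0: "0 \<le> h x" for x by (simp add: h_def case_prod_unfold)
  define g1 where "g1 = (\<lambda>((p, q), (t, u)). (pic p q t, pic p q u))"
  define g2 where "g2 = (\<lambda>((p, q), (t, u)). (pic p q u, pic p q t))"
  define g3 where "g3 = (\<lambda>(p, q, r, t, u). (pic p q t, pic p r u))"
  \<comment> \<open>Edges falling under the first alternative of \<open>crossing\<close> carry no
    energy and are removed beforehand.\<close>
  define F0 where "F0 = {e \<in> F. h e \<noteq> 0}"
  have "F0 \<subseteq> g1 ` (E \<times> C1) \<union> g1 ` (E \<times> C2) \<union> g2 ` (E \<times> C2) \<union> g3 ` tie_set" (is "_ \<subseteq> ?B")
  proof
    fix x assume x: "x \<in> F0"
    obtain X Y where [simp]: "x = (X, Y)" by fastforce
    have "(X, Y) \<in> F" "\<not> (\<forall>f. lift f X = lift f Y)" using x by (auto simp: F0_def h_def)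
    with crossing_edge[of X Y] consider
      p q t u where "(p, q) \<in> E" "(t, u) \<in> C1" "X = pic p q t" "Y = pic p q u" |
      p q t u where "(p, q) \<in> E" "(t, u) \<in> C2" "X = pic p q t" "Y = pic p q u" |
      p q t u where "(p, q) \<in> E" "(t, u) \<in> C2" "X = pic p q u" "Y = pic p q t" |
      p q r t u where "(p, q) \<in> E" "(p, r) \<in> E" "q \<noteq> r" "(t, u) \<in> C3 (L p q) (L p r)" "X = pic p q t" "Y = pic p r u"
      unfolding crossing_def by blast
    then show "x \<in> ?B"
    proof cases
      case 1
      then have "x \<in> g1 ` (E \<times> C1)" by (intro image_eqI[of _ _ "((p, q), (t, u))"]) (auto simp: g1_def)
      then show ?thesis by blast
    next
      case 2
      then have "x \<in> g1 ` (E \<times> C2)" by (intro image_eqI[of _ _ "((p, q), (t, u))"]) (auto simp: g1_def)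
      then show ?thesis by blast
    next
      case 3
      then have "x \<in> g2 ` (E \<times> C2)" by (intro image_eqI[of _ _ "((p, q), (t, u))"]) (auto simp: g2_def)
      then show ?thesis by blast
    next
      case 4
      then have "x \<in> g3 ` tie_set" by (intro image_eqI[of _ _ "(p, q, r, t, u)"]) (auto simp: g3_def tie_set_def Pairs_def)
      then show ?thesis by blast
    qed
  qed
  note fin = finite_sets finite_tie_set
  have il: "sum h (g ` A) \<le> (\<Sum>a\<in>A. h (g a))" if "finite A" for A :: "'x set" and g
    using sum_image_le[OF that, of h g] h0 by (simp add: o_def)
  have "2 * energy F (lift f) = sum h F" by (simp add: energy_def h_def case_prod_unfold)
  also have "\<dots> = sum h F0"
    unfolding F0_def using finite_graphD(5)[OF finite_graph_G] by (intro sum.mono_neutral_right) auto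
  also have "\<dots> \<le> sum h ?B" by (rule sum_mono2) (use fin h0 \<open>F0 \<subseteq> ?B\<close> in auto)
  also have "\<dots> \<le> sum h (g1 ` (E \<times> C1) \<union> g1 ` (E \<times> C2) \<union> g2 ` (E \<times> C2)) + sum h (g3 ` tie_set)"
    by (rule sum_Un_le) (simp_all add: fin h0)
  also have "\<dots> \<le> sum h (g1 ` (E \<times> C1) \<union> g1 ` (E \<times> C2)) + sum h (g2 ` (E \<times> C2)) + sum h (g3 ` tie_set)"
    by (rule add_right_mono, rule sum_Un_le) (simp_all add: fin h0)
  also have "\<dots> \<le> sum h (g1 ` (E \<times> C1)) + sum h (g1 ` (E \<times> C2)) + sum h (g2 ` (E \<times> C2)) + sum h (g3 ` tie_set)"
    by (rule add_right_mono, rule add_right_mono, rule sum_Un_le) (simp_all add: fin h0)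
  also have "\<dots> \<le> (\<Sum>x\<in>E \<times> C1. h (g1 x)) + (\<Sum>x\<in>E \<times> C2. h (g1 x)) + (\<Sum>x\<in>E \<times> C2. h (g2 x)) + (\<Sum>x\<in>tie_set. h (g3 x))"
    by (intro add_mono il) (use fin in auto)
  also have "(\<Sum>x\<in>E \<times> C1. h (g1 x)) = real (card C1) * 1 * (2 * energy E f)"
  proof (rule sum_C)
    fix p q t u assume "(p, q) \<in> E" "(t, u) \<in> C1"
    then show "h (g1 ((p, q), (t, u))) = 1 * (cmod (f p - f q))\<^sup>2" by (auto simp: g1_def h_def C1_def lift_pic)
  qed (rule fin)
  also have "(\<Sum>x\<in>E \<times> C2. h (g1 x)) = real (card C2) * (1/4) * (2 * energy E f)"
  proof (rule sum_C)
    fix p q t u assume "(p, q) \<in> E" "(t, u) \<in> C2"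
    then have "h (g1 ((p, q), (t, u))) = (cmod (f p - (f p + f q) / 2))\<^sup>2" by (auto simp: g1_def h_def C2_def lift_pic)
    also have "f p - (f p + f q) / 2 = (f p - f q) / 2" by (simp add: field_simps)
    finally show "h (g1 ((p, q), (t, u))) = 1/4 * (cmod (f p - f q))\<^sup>2" by (simp add: norm_divide power_divide)
  qed (auto simp: fin)
  also have "(\<Sum>x\<in>E \<times> C2. h (g2 x)) = real (card C2) * (1/4) * (2 * energy E f)"
  proof (rule sum_C)
    fix p q t u assume "(p, q) \<in> E" "(t, u) \<in> C2"
    then have "h (g2 ((p, q), (t, u))) = (cmod ((f p + f q) / 2 - f p))\<^sup>2" by (auto simp: g2_def h_def C2_def lift_pic)
    also have "(f p + f q) / 2 - f p = - (f p - f q) / 2" by (simp add: field_simps)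
    finally show "h (g2 ((p, q), (t, u))) = 1/4 * (cmod (f p - f q))\<^sup>2" by (simp add: norm_divide power_divide norm_minus_commute)
  qed (auto simp: fin)
  also have "(\<Sum>x\<in>tie_set. h (g3 x)) = (\<Sum>(p, q, r, t, u)\<in>tie_set. (cmod (f q - f r))\<^sup>2 / 4)"
  proof (rule sum.cong)
    fix x assume x: "x \<in> tie_set"
    obtain p q r t u where [simp]: "x = (p, q, r, t, u)" by (cases x) auto
    have "h (g3 x) = (cmod ((f p + f q) / 2 - (f p + f r) / 2))\<^sup>2"
      using x by (auto simp: g3_def h_def tie_set_def Pairs_def C3_def lift_pic)
    also have "(f p + f q) / 2 - (f p + f r) / 2 = (f q - f r) / 2" by (simp add: field_simps)
    finally show "h (g3 x) = (case x of (p, q, r, t, u) \<Rightarrow> (cmod (f q - f r))\<^sup>2 / 4)" by (simp add: norm_divide power_divide)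
  qed simp
  also have "\<dots> = (\<Sum>(p, q, r, t, u)\<in>tie_set. (cmod (f q - f r))\<^sup>2) / 4"
    by (simp add: sum_divide_distrib case_prod_unfold)
  finally show ?thesis by (simp add: algebra_simps)
qed

section \<open>Norm of a lifted function\<close>

lemma inj_own: "inj_on (\<lambda>(p, t). cl p t) (V \<times> Own)"
  using own_unique by (auto simp: inj_on_def)

lemma own_sub: "(\<lambda>(p, t). cl p t) ` (V \<times> Own) \<subseteq> W"
  using cl_W by auto

lemma sum_own: "(\<Sum>X\<in>(\<lambda>(p, t). cl p t) ` (V \<times> Own). (cmod (lift f X))\<^sup>2) = real (card Own) * sqnorm V f"
proof -
  have "(\<Sum>X\<in>(\<lambda>(p, t). cl p t) ` (V \<times> Own). (cmod (lift f X))\<^sup>2) = (\<Sum>(p, t)\<in>V \<times> Own. (cmod (f p))\<^sup>2)"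
    by (subst sum.reindex[OF inj_own]) (auto simp: lift_own intro!: sum.cong)
  also have "\<dots> = (\<Sum>p\<in>V. \<Sum>t\<in>Own. (cmod (f p))\<^sup>2)" by (simp only: sum.cartesian_product)
  finally show ?thesis by (simp add: sqnorm_def sum_distrib_left)
qed

lemma sqnorm_lift: "sqnorm W (lift f) \<ge> real (card Own) * sqnorm V f"
  unfolding sum_own[symmetric] sqnorm_def[of W]
  by (rule sum_mono2) (use finite_graphD(1)[OF finite_graph_G] own_sub in auto)

lemma card_W_ge: "Own \<noteq> {} \<Longrightarrow> card V \<le> card W"
proof -
  assume "Own \<noteq> {}"
  then have "card V * 1 \<le> card V * card Own" using finite_sets(1) by (intro mult_left_mono) (auto simp: Suc_le_eq card_gt_0_iff)
  also have "\<dots> = card ((\<lambda>(p, t). cl p t) ` (V \<times> Own))" by (simp add: card_image[OF inj_own] card_cartesian_product)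
  also have "\<dots> \<le> card W" by (rule card_mono[OF finite_graphD(1)[OF finite_graph_G] own_sub])
  finally show ?thesis by simp
qed

lemma tie_sub: "(\<lambda>((p, q), t). pic p q t) ` (E \<times> Tie) \<subseteq> W"
  using cl_W edgeD by (auto simp: pic_own rot_pow_P)

lemma tie_sum_le:
  fixes h :: "('v \<times> complex set) set \<Rightarrow> real"
  assumes "\<And>x. 0 \<le> h x"
  shows "(\<Sum>((p, q), t)\<in>E \<times> Tie. h (pic p q t)) \<le> 2 * (\<Sum>X\<in>(\<lambda>((p, q), t). pic p q t) ` (E \<times> Tie). h X)"
proof -
  define g where "g = (\<lambda>((p, q), t). pic p q t)"
  define s :: "('v \<times> 'v) \<times> 't \<Rightarrow> ('v \<times> 'v) \<times> 't" where "s = (\<lambda>((p, q), t). ((q, p), mir t))"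
  have "(\<Sum>x\<in>E \<times> Tie. h (g x)) \<le> 2 * (\<Sum>X\<in>g ` (E \<times> Tie). h X)"
  proof (rule sum_le_two_to_one[where s = s])
    fix a a' :: "('v \<times> 'v) \<times> 't" assume a: "a \<in> E \<times> Tie" "a' \<in> E \<times> Tie" "g a = g a'"
    obtain p q t where [simp]: "a = ((p, q), t)" by (cases a) auto
    obtain p' q' t' where [simp]: "a' = ((p', q'), t')" by (cases a') auto
    show "a' = a \<or> a' = s a"
      using tie_class[of p q p' q' t t'] a by (auto simp: g_def s_def)
  qed (use finite_sets assms in auto)
  then show ?thesis by (simp add: g_def case_prod_unfold)
qed

lemma deg_card: "p \<in> V \<Longrightarrow> card (nbrs E p) = d"
  using bij_betw_same_card[OF lab] by simp

lemma edge_sum_fst: "(\<Sum>(p, q)\<in>E. (cmod (f p))\<^sup>2) = real d * sqnorm V f"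
  by (simp add: edge_sum_eq[OF graph] deg_card sqnorm_def sum_distrib_left)

text \<open>By the parallelogram law, averaging loses a quarter of the squared difference against
  the mean of the squares, which sums to a multiple of the energy of \<open>f\<close>. Each tie is
  shared by two vertices of \<open>X\<close>, whence \<open>d * card Tie / 2\<close> of them per
  vertex.\<close>

lemma sqnorm_lift_ties:
  "sqnorm W (lift f) \<ge> (real (card Own) + real d * real (card Tie) / 2) * sqnorm V f - real (card Tie) / 4 * energy E f"
proof -
  let ?A = "(\<lambda>(p, t). cl p t) ` (V \<times> Own)" and ?B = "(\<lambda>((p, q), t). pic p q t) ` (E \<times> Tie)"
  have disj: "?A \<inter> ?B = {}" using tie_not_own by fastforce
  have fin: "finite ?A" "finite ?B" using finite_sets finite_graphD(1)[OF graph] by auto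
  have par: "(cmod ((a + b) / 2))\<^sup>2 = (cmod a)\<^sup>2 / 2 + (cmod b)\<^sup>2 / 2 - (cmod (a - b))\<^sup>2 / 4" for a b :: complex
  proof -
    have "(cmod (a + b))\<^sup>2 + (cmod (a - b))\<^sup>2 = 2 * (cmod a)\<^sup>2 + 2 * (cmod b)\<^sup>2"
      unfolding cmod_power2 by (simp add: power2_eq_square algebra_simps)
    then show ?thesis by (simp add: norm_divide power_divide)
  qed
  have sw: "(\<Sum>(p, q)\<in>E. (cmod (f q))\<^sup>2) = real d * sqnorm V f"
    using edge_sum_swap[OF graph, of "\<lambda>p q. (cmod (f p))\<^sup>2"] edge_sum_fst[of f] by simp
  have "(\<Sum>((p, q), t)\<in>E \<times> Tie. (cmod (lift f (pic p q t)))\<^sup>2) = (\<Sum>(p, q)\<in>E. \<Sum>t\<in>Tie. (cmod (lift f (pic p q t)))\<^sup>2)"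
    by (simp add: sum.cartesian_product case_prod_unfold)
  also have "\<dots> = (\<Sum>(p, q)\<in>E. real (card Tie) * ((cmod (f p))\<^sup>2 / 2 + (cmod (f q))\<^sup>2 / 2 - (cmod (f p - f q))\<^sup>2 / 4))"
    by (rule sum.cong) (auto simp: lift_pic par[symmetric])
  also have "\<dots> = real (card Tie) * ((\<Sum>(p, q)\<in>E. (cmod (f p))\<^sup>2) / 2 + (\<Sum>(p, q)\<in>E. (cmod (f q))\<^sup>2) / 2 - energy E f / 2)"
    by (simp add: energy_def sum_distrib_left sum_divide_distrib sum.distrib sum_subtractf case_prod_unfold algebra_simps)
  also have "\<dots> = real (card Tie) * (real d * sqnorm V f - energy E f / 2)"
    unfolding sw edge_sum_fst by simp
  finally have "real (card Tie) * (real d * sqnorm V f - energy E f / 2) \<le> 2 * (\<Sum>X\<in>?B. (cmod (lift f X))\<^sup>2)"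
    using tie_sum_le[of "\<lambda>X. (cmod (lift f X))\<^sup>2"] by simp
  moreover have "(\<Sum>X\<in>?A. (cmod (lift f X))\<^sup>2) + (\<Sum>X\<in>?B. (cmod (lift f X))\<^sup>2) \<le> sqnorm W (lift f)"
    unfolding sum.union_disjoint[OF fin disj, symmetric] sqnorm_def
    using own_sub tie_sub finite_graphD(1)[OF finite_graph_G] by (intro sum_mono2) auto
  ultimately show ?thesis unfolding sum_own by (simp add: algebra_simps)
qed

end

section \<open>Eigenvalue bounds from test functions\<close>

text \<open>The variance identity. With \<open>a q = f p - f q\<close> over the neighbours of
  \<open>p\<close>, the subtracted sum is the Laplacian of \<open>f\<close> at
  \<open>p\<close>.\<close>

lemma sum_pair_diff:
  fixes a :: "'b \<Rightarrow> complex"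
  shows "(\<Sum>q\<in>S. \<Sum>r\<in>S. (cmod (a q - a r))\<^sup>2) = 2 * real (card S) * (\<Sum>q\<in>S. (cmod (a q))\<^sup>2) - 2 * (cmod (\<Sum>q\<in>S. a q))\<^sup>2"
proof -
  have e: "(cmod (x - y))\<^sup>2 = (cmod x)\<^sup>2 + (cmod y)\<^sup>2 - 2 * (Re x * Re y + Im x * Im y)" for x y
    unfolding cmod_power2 by (simp add: power2_eq_square algebra_simps)
  have "(\<Sum>q\<in>S. \<Sum>r\<in>S. Re (a q) * Re (a r) + Im (a q) * Im (a r)) = (cmod (\<Sum>q\<in>S. a q))\<^sup>2"
    unfolding cmod_power2 by (simp add: power2_eq_square sum.distrib sum_product)
  then show ?thesis
    by (simp add: e sum.distrib sum_subtractf sum_distrib_left[symmetric])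
qed

text \<open>The third identity serves squares with \<open>k = l\<close>, where the norm of the
  Laplacian enters the energy bound.\<close>

lemma low_space:
  assumes G: "finite_graph V E" and B: "eigenbasis V E \<phi>" and i: "i \<le> card V"
  defines "f \<equiv> \<lambda>c x. \<Sum>j<i. c j * \<phi> j x"
  shows "sqnorm V (f c) = (\<Sum>j<i. (cmod (c j))\<^sup>2)"
    and "energy E (f c) = (\<Sum>j<i. lap_eig (V, E) (j + 1) * (cmod (c j))\<^sup>2)"
    and "sqnorm V (laplace E (f c)) = (\<Sum>j<i. (lap_eig (V, E) (j + 1))\<^sup>2 * (cmod (c j))\<^sup>2)"
proof -
  note B' = eigenbasis_expand[OF G B]
  have cf: "coef V \<phi> (f c) j = (if j < i then c j else 0)" if "j < card V" for j
    unfolding f_def using B'(4)[OF i that] .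
  have s: "(\<Sum>j<card V. h j * (cmod (coef V \<phi> (f c) j))\<^sup>2) = (\<Sum>j<i. h j * (cmod (c j))\<^sup>2)" for h
    using i by (intro sum.mono_neutral_cong_right) (auto simp: cf)
  show "sqnorm V (f c) = (\<Sum>j<i. (cmod (c j))\<^sup>2)" unfolding B'(1) using s[of "\<lambda>_. 1"] by simp
  show "energy E (f c) = (\<Sum>j<i. lap_eig (V, E) (j + 1) * (cmod (c j))\<^sup>2)"
    unfolding B'(2) using s[of "\<lambda>j. lap_eig (V, E) (j + 1)"] .
  have "sqnorm V (laplace E (f c)) = (\<Sum>j<card V. (lap_eig (V, E) (j + 1))\<^sup>2 * (cmod (coef V \<phi> (f c) j))\<^sup>2)"
    unfolding B'(1) by (rule sum.cong) (auto simp: B'(3) norm_mult power_mult_distrib)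
  then show "sqnorm V (laplace E (f c)) = (\<Sum>j<i. (lap_eig (V, E) (j + 1))\<^sup>2 * (cmod (c j))\<^sup>2)"
    using s by simp
qed

lemma low_space_bounds:
  assumes G: "finite_graph V E" and B: "eigenbasis V E \<phi>" and i: "i \<le> card V" and c: "\<exists>j<i. c j \<noteq> 0"
  defines "f \<equiv> \<lambda>x. \<Sum>j<i. c j * \<phi> j x"
  shows "sqnorm V f > 0" and "energy E f \<le> lap_eig (V, E) i * sqnorm V f"
proof -
  note l = low_space[OF G B i, of c, folded f_def]
  obtain j where "j < i" "c j \<noteq> 0" using c by auto
  then show "sqnorm V f > 0" unfolding l(1) by (intro sum_pos2[of _ j]) auto
  show "energy E f \<le> lap_eig (V, E) i * sqnorm V f"
    unfolding l(1,2) sum_distrib_left using i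
    by (intro sum_mono mult_right_mono lap_eig_mono[OF G]) auto
qed

lemma energy_nonneg: "0 \<le> energy E f"
  unfolding energy_def by (simp add: case_prod_unfold sum_nonneg)

text \<open>The energy of a normalized eigenfunction is its eigenvalue; the upper bound then comes
  from |x - y|^2 <= 2 |x|^2 + 2 |y|^2 on every edge.\<close>

lemma lap_eig_bounds:
  assumes G: "finite_graph V E" and i: "1 \<le> i" "i \<le> card V"
  shows "0 \<le> lap_eig (V, E) i"
    and "(\<And>p. p \<in> V \<Longrightarrow> card (nbrs E p) \<le> d) \<Longrightarrow> lap_eig (V, E) i \<le> 2 * real d"
proof -
  obtain \<phi> where B: "eigenbasis V E \<phi>" using lap_spectrum(3)[OF G] by auto
  define c where "c j = (if j = i - 1 then 1 else 0 :: complex)" for j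
  define f where "f = (\<lambda>x. \<Sum>j<i. c j * \<phi> j x)"
  note l = low_space[OF G B i(2), of c, folded f_def]
  have s: "(\<Sum>j<i. h j * (cmod (c j))\<^sup>2) = h (i - 1)" for h
  proof -
    have "(\<Sum>j<i. h j * (cmod (c j))\<^sup>2) = (\<Sum>j<i. if j = i - 1 then h j else 0)"
      by (rule sum.cong) (auto simp: c_def)
    then show ?thesis using i by simp
  qed
  have "sqnorm V f = 1" using l(1) s[of "\<lambda>_. 1"] by simp
  moreover have e: "energy E f = lap_eig (V, E) i" using l(2) s[of "\<lambda>j. lap_eig (V, E) (j + 1)"] i by simp
  ultimately show "0 \<le> lap_eig (V, E) i" using energy_nonneg[of E f] by simp
  assume d: "\<And>p. p \<in> V \<Longrightarrow> card (nbrs E p) \<le> d"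
  have "energy E f \<le> (\<Sum>(p, q)\<in>E. 2 * (cmod (f p))\<^sup>2 + 2 * (cmod (f q))\<^sup>2) / 2"
    unfolding energy_def
  proof (rule divide_right_mono[OF sum_mono])
    fix e assume "e \<in> E"
    have par: "(cmod (x - y))\<^sup>2 + (cmod (x + y))\<^sup>2 = 2 * (cmod x)\<^sup>2 + 2 * (cmod y)\<^sup>2" for x y
      unfolding cmod_power2 by (simp add: power2_eq_square algebra_simps)
    have "(cmod (x - y))\<^sup>2 \<le> 2 * (cmod x)\<^sup>2 + 2 * (cmod y)\<^sup>2" for x y
      using par[of x y] zero_le_power2[of "cmod (x + y)"] by linarith
    then show "(case e of (x, y) \<Rightarrow> (cmod (f x - f y))\<^sup>2) \<le> (case e of (p, q) \<Rightarrow> 2 * (cmod (f p))\<^sup>2 + 2 * (cmod (f q))\<^sup>2)"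
      by (auto simp: case_prod_unfold)
  qed simp
  also have "\<dots> = (\<Sum>(p, q)\<in>E. (cmod (f p))\<^sup>2) + (\<Sum>(p, q)\<in>E. (cmod (f q))\<^sup>2)"
    by (simp add: sum.distrib case_prod_unfold sum_distrib_left[symmetric] sum_divide_distrib[symmetric] add_divide_distrib)
  also have "(\<Sum>(p, q)\<in>E. (cmod (f q))\<^sup>2) = (\<Sum>(p, q)\<in>E. (cmod (f p))\<^sup>2)"
    by (rule edge_sum_swap[OF G])
  also have "(\<Sum>(p, q)\<in>E. (cmod (f p))\<^sup>2) = (\<Sum>p\<in>V. real (card (nbrs E p)) * (cmod (f p))\<^sup>2)"
    by (simp add: edge_sum_eq[OF G])
  also have "\<dots> \<le> (\<Sum>p\<in>V. real d * (cmod (f p))\<^sup>2)"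
    using d by (intro sum_mono mult_right_mono) auto
  finally have "energy E f \<le> 2 * (real d * sqnorm V f)" by (simp add: sqnorm_def sum_distrib_left)
  then show "lap_eig (V, E) i \<le> 2 * real d" using e \<open>sqnorm V f = 1\<close> by simp
qed

text \<open>Multiplying by a sign that alternates along edges turns differences into sums.\<close>

lemma energy_alternating:
  assumes G: "finite_graph W F" and e: "\<And>X Y. (X, Y) \<in> F \<Longrightarrow> \<epsilon> X = - \<epsilon> Y" and u: "\<And>X. cmod (\<epsilon> X) = 1"
    and D: "\<And>X. X \<in> W \<Longrightarrow> real D \<le> card (nbrs F X)"
  shows "energy F (\<lambda>X. \<epsilon> X * g X) \<ge> 2 * real D * sqnorm W g - energy F g"
proof -
  have "(cmod (\<epsilon> X * g X - \<epsilon> Y * g Y))\<^sup>2 = 2 * (cmod (g X))\<^sup>2 + 2 * (cmod (g Y))\<^sup>2 - (cmod (g X - g Y))\<^sup>2"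
    if "(X, Y) \<in> F" for X Y
  proof -
    have "\<epsilon> X * g X - \<epsilon> Y * g Y = \<epsilon> X * (g X + g Y)" using e[OF that] by (simp add: algebra_simps)
    then have "(cmod (\<epsilon> X * g X - \<epsilon> Y * g Y))\<^sup>2 = (cmod (g X + g Y))\<^sup>2" using u by (simp add: norm_mult)
    moreover have "(cmod (x + y))\<^sup>2 = 2 * (cmod x)\<^sup>2 + 2 * (cmod y)\<^sup>2 - (cmod (x - y))\<^sup>2" for x y
      unfolding cmod_power2 by (simp add: power2_eq_square algebra_simps)
    ultimately show ?thesis by simp
  qed
  then have "(\<Sum>(X, Y)\<in>F. (cmod (\<epsilon> X * g X - \<epsilon> Y * g Y))\<^sup>2)
     = (\<Sum>(X, Y)\<in>F. 2 * (cmod (g X))\<^sup>2 + 2 * (cmod (g Y))\<^sup>2 - (cmod (g X - g Y))\<^sup>2)"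
    by (intro sum.cong) auto
  also have "\<dots> = 2 * (\<Sum>(X, Y)\<in>F. (cmod (g X))\<^sup>2) + 2 * (\<Sum>(X, Y)\<in>F. (cmod (g Y))\<^sup>2) - 2 * energy F g"
    by (simp add: energy_def sum.distrib sum_subtractf sum_distrib_left[symmetric] case_prod_unfold)
  also have "(\<Sum>(X, Y)\<in>F. (cmod (g Y))\<^sup>2) = (\<Sum>(X, Y)\<in>F. (cmod (g X))\<^sup>2)"
    by (rule edge_sum_swap[OF G])
  also have "(\<Sum>(X, Y)\<in>F. (cmod (g X))\<^sup>2) = (\<Sum>X\<in>W. real (card (nbrs F X)) * (cmod (g X))\<^sup>2)"
    by (simp add: edge_sum_eq[OF G])
  finally have *: "energy F (\<lambda>X. \<epsilon> X * g X) = 2 * (\<Sum>X\<in>W. real (card (nbrs F X)) * (cmod (g X))\<^sup>2) - energy F g"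
    by (simp add: energy_def)
  have "real D * sqnorm W g \<le> (\<Sum>X\<in>W. real (card (nbrs F X)) * (cmod (g X))\<^sup>2)"
    unfolding sqnorm_def sum_distrib_left using D by (intro sum_mono mult_right_mono) auto
  then show ?thesis unfolding * by simp
qed

context gc_system
begin

text \<open>Without gluing (the case \<open>l = 0\<close>) the pieces are disjoint, so extending one function on
  the piece by zero gives \<open>card V\<close> orthogonal test functions; edges between pieces only
  increase the energy.\<close>

lemma lap_eig_ge_piece:
  assumes no: "\<And>t. t \<in> P \<Longrightarrow> mir t \<notin> P" and i: "1 \<le> i" "i \<le> card V"
    and h0: "\<exists>t\<in>P. h t \<noteq> (0 :: real)"
    and h: "2 * K * (\<Sum>t\<in>P. (h t)\<^sup>2) \<le> (\<Sum>t\<in>P. \<Sum>u\<in>{u \<in> P. adj t u}. (h t - h u)\<^sup>2)"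
  shows "lap_eig G (card W - i + 1) \<ge> K"
proof -
  note GW = finite_graphD[OF finite_graph_G]
  have ng: "\<not> glued p t q u" if "t \<in> P" "u \<in> P" for p t q u
  proof
    assume "glued p t q u"
    then have "mir (turn (L q p) u) = turn (L p q) t" by (simp add: glued_def)
    then have "mir (turn (L q p) u) \<in> P" using that(1) by simp
    then show False using no[of "turn (L q p) u"] that(2) by simp
  qed
  have cle: "cl p t = cl q u \<longleftrightarrow> p = q \<and> t = u" if "p \<in> V" "q \<in> V" "t \<in> P" "u \<in> P" for p q t u
    using cl_eq[OF that] ng that by auto
  \<comment> \<open>\<open>H c\<close> is the multiple \<open>c p\<close> of \<open>h\<close> on the
    piece of \<open>p\<close>. Nothing is glued here, so classes correspond one to one to pairs
    \<open>(p, t)\<close>.\<close>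
  define H where "H c X = (let pt = SOME pt. pt \<in> V \<times> P \<and> X = cl (fst pt) (snd pt)
     in c (fst pt) * complex_of_real (h (snd pt)))" for c :: "'v \<Rightarrow> complex" and X
  have H: "H c (cl p t) = c p * complex_of_real (h t)" if "p \<in> V" "t \<in> P" for c p t
  proof -
    have "(SOME pt. pt \<in> V \<times> P \<and> cl p t = cl (fst pt) (snd pt)) = (p, t)"
    proof (rule some_equality)
      fix pt assume "pt \<in> V \<times> P \<and> cl p t = cl (fst pt) (snd pt)"
      then show "pt = (p, t)" using cle[of p "fst pt" t "snd pt"] that by (cases pt) auto
    qed (use that in auto)
    then show ?thesis by (simp add: H_def)
  qed
  have finV: "finite V" using finite_graphD(1)[OF graph] .
  have Wim: "W = (\<lambda>(p, t). cl p t) ` (V \<times> P)" by (auto simp: W_eq)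
  have inj: "inj_on (\<lambda>(p, t). cl p t) (V \<times> P)" using cle by (auto simp: inj_on_def)
  have cW: "card V \<le> card W"
  proof -
    have "card V * 1 \<le> card V * card P" using finP h0 by (intro mult_left_mono) (auto simp: Suc_le_eq card_gt_0_iff)
    then show ?thesis unfolding Wim card_image[OF inj] card_cartesian_product by simp
  qed
  have sq: "sqnorm W (H c) = (\<Sum>p\<in>V. (cmod (c p))\<^sup>2) * (\<Sum>t\<in>P. (h t)\<^sup>2)" for c
  proof -
    have "sqnorm W (H c) = (\<Sum>(p, t)\<in>V \<times> P. (cmod (H c (cl p t)))\<^sup>2)"
      unfolding sqnorm_def Wim sum.reindex[OF inj] by (simp add: case_prod_unfold)
    also have "\<dots> = (\<Sum>(p, t)\<in>V \<times> P. (cmod (c p))\<^sup>2 * (h t)\<^sup>2)"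
      by (rule sum.cong) (auto simp: H norm_mult power_mult_distrib)
    finally show ?thesis by (simp add: sum_product sum.cartesian_product)
  qed
  define Q where "Q = Sigma P (\<lambda>t. {u \<in> P. adj t u})"
  have finQ: "finite Q" unfolding Q_def using finP by auto
  define g where "g = (\<lambda>(p, (t, u)). (cl p t, cl p u))"
  have injg: "inj_on g (V \<times> Q)" using cle by (auto simp: inj_on_def g_def Q_def)
  have gF: "g ` (V \<times> Q) \<subseteq> F"
  proof
    fix e assume "e \<in> g ` (V \<times> Q)"
    then obtain p t u where p: "p \<in> V" and tu: "t \<in> P" "u \<in> P" "adj t u" and e: "e = (cl p t, cl p u)"
      by (auto simp: g_def Q_def)
    obtain q where q: "(p, q) \<in> E" using nbr_exists[OF p d_pos] by blast
    have "cl p t \<noteq> cl p u" using cle p tu adj_neq by auto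
    moreover have "cl p t = pic p q (turn (L p q) t)" "cl p u = pic p q (turn (L p q) u)"
      using q tu by (simp_all add: pic_turn)
    ultimately show "e \<in> F"
      unfolding e using q tu by (intro mem_FI[of _ _ p q "turn (L p q) t" "turn (L p q) u"]) simp_all
  qed
  have en: "energy F (H c) \<ge> K * sqnorm W (H c)" for c
  proof -
    have "2 * K * sqnorm W (H c) = (\<Sum>p\<in>V. (cmod (c p))\<^sup>2) * (2 * K * (\<Sum>t\<in>P. (h t)\<^sup>2))" by (simp add: sq)
    also have "\<dots> \<le> (\<Sum>p\<in>V. (cmod (c p))\<^sup>2) * (\<Sum>t\<in>P. \<Sum>u\<in>{u \<in> P. adj t u}. (h t - h u)\<^sup>2)"
      by (rule mult_left_mono[OF h]) (simp add: sum_nonneg)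
    also have "(\<Sum>t\<in>P. \<Sum>u\<in>{u \<in> P. adj t u}. (h t - h u)\<^sup>2) = (\<Sum>(t, u)\<in>Q. (h t - h u)\<^sup>2)"
      unfolding Q_def using finP by (intro sum.Sigma) auto
    also have "(\<Sum>p\<in>V. (cmod (c p))\<^sup>2) * \<dots> = (\<Sum>(p, (t, u))\<in>V \<times> Q. (cmod (c p))\<^sup>2 * (h t - h u)\<^sup>2)"
      by (simp add: sum_product sum.cartesian_product case_prod_unfold)
    also have "\<dots> = (\<Sum>x\<in>V \<times> Q. (\<lambda>(X, Y). (cmod (H c X - H c Y))\<^sup>2) (g x))"
    proof (rule sum.cong)
      fix x assume x: "x \<in> V \<times> Q"
      then obtain p t u where "x = (p, (t, u))" "p \<in> V" "t \<in> P" "u \<in> P" by (auto simp: Q_def)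
      then show "(case x of (p, (t, u)) \<Rightarrow> (cmod (c p))\<^sup>2 * (h t - h u)\<^sup>2) = (\<lambda>(X, Y). (cmod (H c X - H c Y))\<^sup>2) (g x)"
        by (simp add: g_def H right_diff_distrib[symmetric] norm_mult power_mult_distrib of_real_diff[symmetric] del: of_real_diff)
    qed simp
    also have "\<dots> = (\<Sum>x\<in>g ` (V \<times> Q). (\<lambda>(X, Y). (cmod (H c X - H c Y))\<^sup>2) x)"
      by (simp add: sum.reindex[OF injg])
    also have "\<dots> \<le> (\<Sum>x\<in>F. (\<lambda>(X, Y). (cmod (H c X - H c Y))\<^sup>2) x)"
      using GW(5) gF by (intro sum_mono2) auto
    finally show ?thesis by (simp add: energy_def)
  qed
  obtain e where e: "bij_betw e {..<card V} V"
    using ex_bij_betw_nat_finite[OF finV] by (auto simp: atLeast0LessThan)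
  define \<psi> where "\<psi> j = H (\<lambda>p. if p = e j then 1 else 0)" for j
  have comb: "(\<lambda>X. \<Sum>j<i. c j * \<psi> j X) = H (\<lambda>p. \<Sum>j<i. if p = e j then c j else 0)" for c
    by (rule ext) (auto simp: \<psi>_def H_def Let_def sum_distrib_right intro!: sum.cong)
  show ?thesis
  proof (rule lap_eig_ge[where W = W and F = F and \<psi> = \<psi>, unfolded prod.collapse])
    show "finite_graph W F" "1 \<le> i" "i \<le> card W" using finite_graph_G i cW by auto
    fix c :: "nat \<Rightarrow> complex" assume "\<exists>j<i. c j \<noteq> 0"
    then obtain j where j: "j < i" "c j \<noteq> 0" by auto
    define c' where "c' p = (\<Sum>j<i. if p = e j then c j else 0)" for p
    have "c' (e j) = (\<Sum>j'<i. if j' = j then c j' else 0)"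
      unfolding c'_def using e j i by (intro sum.cong) (auto simp: bij_betw_def inj_on_def)
    then have "c' (e j) \<noteq> 0" using j by simp
    moreover have "e j \<in> V" using e j i by (auto simp: bij_betw_def)
    ultimately have "(\<Sum>p\<in>V. (cmod (c' p))\<^sup>2) > 0" using finV by (intro sum_pos2[of _ "e j"]) auto
    moreover have "(\<Sum>t\<in>P. (h t)\<^sup>2) > 0"
    proof -
      obtain t where "t \<in> P" "h t \<noteq> 0" using h0 by auto
      then show ?thesis using finP by (intro sum_pos2[of _ t]) auto
    qed
    ultimately show "0 < sqnorm W (\<lambda>X. \<Sum>j<i. c j * \<psi> j X) \<and>
        K * sqnorm W (\<lambda>X. \<Sum>j<i. c j * \<psi> j X) \<le> energy F (\<lambda>X. \<Sum>j<i. c j * \<psi> j X)"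
      unfolding comb c'_def[symmetric] using en[of c'] by (simp add: sq)
  qed
qed

end

context gc_owned
begin

text \<open>Lifting multiplies the Rayleigh quotient by at most the number of crossings per edge
  over the number of owned tiles per vertex, and \<open>K\<close> bounds this ratio. The empty
  \<open>tie_set\<close> means that no ties meet at corners.\<close>

lemma lap_eig_lift:
  assumes T: "tie_set = {}" and O: "Own \<noteq> {}" and i: "1 \<le> i" "i \<le> card V"
    and K: "real (card C1) + real (card C2) / 2 \<le> K * real (card Own)"
  shows "lap_eig G i \<le> K * lap_eig (V, E) i"
proof -
  obtain \<phi> where B: "eigenbasis V E \<phi>" using lap_spectrum(3)[OF graph] by auto
  define \<psi> where "\<psi> j = lift (\<phi> j)" for j
  have O': "real (card Own) > 0" using O finite_sets(1) by (simp add: card_gt_0_iff)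
  have lam: "0 \<le> lap_eig (V, E) i" by (rule lap_eig_bounds(1)[OF graph i])
  show ?thesis
  proof (rule lap_eig_le[where W = W and F = F and \<psi> = \<psi>, unfolded prod.collapse])
    show "finite_graph W F" "1 \<le> i" "i \<le> card W" using finite_graph_G i card_W_ge[OF O] by auto
    fix c :: "nat \<Rightarrow> complex" assume c: "\<exists>j<i. c j \<noteq> 0"
    define f where "f = (\<lambda>x. \<Sum>j<i. c j * \<phi> j x)"
    note l = low_space_bounds[OF graph B i(2) c, folded f_def]
    have g: "(\<lambda>X. \<Sum>j<i. c j * \<psi> j X) = lift f" unfolding f_def \<psi>_def by (rule ext) (rule lift_sum[symmetric])
    have n: "real (card Own) * sqnorm V f \<le> sqnorm W (lift f)" by (rule sqnorm_lift)
    have "energy F (lift f) \<le> (real (card C1) + real (card C2) / 2) * energy E f"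
      using energy_lift[of f] T by simp
    also have "\<dots> \<le> (real (card C1) + real (card C2) / 2) * (lap_eig (V, E) i * sqnorm V f)"
      using l(2) by (intro mult_left_mono) auto
    also have "\<dots> \<le> K * real (card Own) * (lap_eig (V, E) i * sqnorm V f)"
      using l(1) lam by (intro mult_right_mono[OF K]) auto
    also have "\<dots> = (K * lap_eig (V, E) i) * (real (card Own) * sqnorm V f)" by simp
    also have "\<dots> \<le> (K * lap_eig (V, E) i) * sqnorm W (lift f)"
    proof (rule mult_left_mono[OF n])
      have "0 \<le> K * real (card Own)" by (rule order_trans[OF _ K]) simp
      then have "0 \<le> K" using O' by (simp add: zero_le_mult_iff)
      then show "0 \<le> K * lap_eig (V, E) i" using lam by simp
    qed
    finally show "0 < sqnorm W (\<lambda>X. \<Sum>j<i. c j * \<psi> j X) \<and>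
        energy F (\<lambda>X. \<Sum>j<i. c j * \<psi> j X) \<le> K * lap_eig (V, E) i * sqnorm W (\<lambda>X. \<Sum>j<i. c j * \<psi> j X)"
      unfolding g using n mult_pos_pos[OF O' l(1)] by simp
  qed
qed

lemma lap_eig_lift_alternating:
  assumes T: "tie_set = {}" and O: "Own \<noteq> {}" and i: "1 \<le> i" "i \<le> card V"
    and K: "real (card C1) + real (card C2) / 2 \<le> K * real (card Own)"
    and e: "\<And>X Y. (X, Y) \<in> F \<Longrightarrow> \<epsilon> X = - \<epsilon> Y" and u: "\<And>X. cmod (\<epsilon> X) = 1"
    and D: "\<And>X. X \<in> W \<Longrightarrow> real D \<le> card (nbrs F X)"
  shows "lap_eig G (card W - i + 1) \<ge> 2 * real D - K * lap_eig (V, E) i"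
proof -
  obtain \<phi> where B: "eigenbasis V E \<phi>" using lap_spectrum(3)[OF graph] by auto
  define \<psi> where "\<psi> j X = \<epsilon> X * lift (\<phi> j) X" for j X
  have O': "real (card Own) > 0" using O finite_sets(1) by (simp add: card_gt_0_iff)
  have lam: "0 \<le> lap_eig (V, E) i" by (rule lap_eig_bounds(1)[OF graph i])
  show ?thesis
  proof (rule lap_eig_ge[where W = W and F = F and \<psi> = \<psi>, unfolded prod.collapse])
    show "finite_graph W F" "1 \<le> i" "i \<le> card W" using finite_graph_G i card_W_ge[OF O] by auto
    fix c :: "nat \<Rightarrow> complex" assume c: "\<exists>j<i. c j \<noteq> 0"
    define f where "f = (\<lambda>x. \<Sum>j<i. c j * \<phi> j x)"
    note l = low_space_bounds[OF graph B i(2) c, folded f_def]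
    have g: "(\<lambda>X. \<Sum>j<i. c j * \<psi> j X) = (\<lambda>X. \<epsilon> X * lift f X)"
      unfolding f_def \<psi>_def lift_sum by (simp add: sum_distrib_left mult_ac)
    have n: "real (card Own) * sqnorm V f \<le> sqnorm W (lift f)" by (rule sqnorm_lift)
    have sq: "sqnorm W (\<lambda>X. \<epsilon> X * lift f X) = sqnorm W (lift f)"
      using u by (simp add: sqnorm_def norm_mult)
    have "energy F (lift f) \<le> (real (card C1) + real (card C2) / 2) * energy E f"
      using energy_lift[of f] T by simp
    also have "\<dots> \<le> (real (card C1) + real (card C2) / 2) * (lap_eig (V, E) i * sqnorm V f)"
      using l(2) by (intro mult_left_mono) auto
    also have "\<dots> \<le> K * real (card Own) * (lap_eig (V, E) i * sqnorm V f)"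
      using l(1) lam by (intro mult_right_mono[OF K]) auto
    also have "\<dots> = (K * lap_eig (V, E) i) * (real (card Own) * sqnorm V f)" by simp
    also have "\<dots> \<le> (K * lap_eig (V, E) i) * sqnorm W (lift f)"
    proof (rule mult_left_mono[OF n])
      have "0 \<le> K * real (card Own)" by (rule order_trans[OF _ K]) simp
      then have "0 \<le> K" using O' by (simp add: zero_le_mult_iff)
      then show "0 \<le> K * lap_eig (V, E) i" using lam by simp
    qed
    finally have "energy F (lift f) \<le> (K * lap_eig (V, E) i) * sqnorm W (lift f)" .
    then have "(2 * real D - K * lap_eig (V, E) i) * sqnorm W (lift f) \<le> energy F (\<lambda>X. \<epsilon> X * lift f X)"
      using energy_alternating[where \<epsilon> = \<epsilon> and g = "lift f", OF finite_graph_G e u D] by (simp add: algebra_simps)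
    then show "0 < sqnorm W (\<lambda>X. \<Sum>j<i. c j * \<psi> j X) \<and>
        (2 * real D - K * lap_eig (V, E) i) * sqnorm W (\<lambda>X. \<Sum>j<i. c j * \<psi> j X) \<le> energy F (\<lambda>X. \<Sum>j<i. c j * \<psi> j X)"
      unfolding g sq using n mult_pos_pos[OF O' l(1)] by simp
  qed
qed

text \<open>Two given sides carry at most one pair of adjacent ties, so the tile components can be
  forgotten. The sum is then enlarged to all pairs of neighbours, which makes the variance identity
  applicable.\<close>

lemma sum_tie_set_le:
  fixes h :: "'v \<Rightarrow> 'v \<Rightarrow> 'v \<Rightarrow> real"
  assumes C3: "\<And>i j. card (C3 i j) \<le> 1" and h: "\<And>p q r. 0 \<le> h p q r"
  shows "(\<Sum>(p, q, r, t, u)\<in>tie_set. h p q r) \<le> (\<Sum>p\<in>V. \<Sum>q\<in>nbrs E p. \<Sum>r\<in>nbrs E p. h p q r)"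
proof -
  define \<pi> where "\<pi> = (\<lambda>(p, q, r, t :: 't, u :: 't). (p :: 'v, q :: 'v, r :: 'v))"
  have c1: "x = y" if "x \<in> C3 i j" "y \<in> C3 i j" for x y i j
    using C3[of i j] that finite_sets(5)[of i j] by (auto simp: card_le_Suc0_iff_eq)
  have inj: "inj_on \<pi> tie_set"
  proof (rule inj_onI)
    fix x y assume x: "x \<in> tie_set" and y: "y \<in> tie_set" and eq: "\<pi> x = \<pi> y"
    obtain p q r t u where [simp]: "x = (p, q, r, t, u)" by (cases x) auto
    obtain p' q' r' t' u' where [simp]: "y = (p', q', r', t', u')" by (cases y) auto
    show "x = y" using x y eq c1[of "(t, u)" "L p q" "L p r" "(t', u')"] by (auto simp: tie_set_def \<pi>_def)
  qed
  have "(\<Sum>(p, q, r, t, u)\<in>tie_set. h p q r) = (\<Sum>(p, q, r)\<in>\<pi> ` tie_set. h p q r)"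
    by (subst sum.reindex[OF inj]) (simp add: \<pi>_def case_prod_unfold)
  also have "\<dots> \<le> (\<Sum>(p, q, r)\<in>Sigma V (\<lambda>p. nbrs E p \<times> nbrs E p). h p q r)"
  proof (rule sum_mono2)
    show "finite (Sigma V (\<lambda>p. nbrs E p \<times> nbrs E p))" using finite_graphD[OF graph] by auto
    show "\<pi> ` tie_set \<subseteq> Sigma V (\<lambda>p. nbrs E p \<times> nbrs E p)"
      using edgeD by (fastforce simp: \<pi>_def tie_set_def Pairs_def nbrs_def)
  qed (auto simp: h)
  also have "\<dots> = (\<Sum>p\<in>V. \<Sum>(q, r)\<in>nbrs E p \<times> nbrs E p. h p q r)"
    using finite_graphD[OF graph] by (subst sum.Sigma) (auto simp: case_prod_unfold)
  also have "\<dots> = (\<Sum>p\<in>V. \<Sum>q\<in>nbrs E p. \<Sum>r\<in>nbrs E p. h p q r)"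
    by (simp only: sum.cartesian_product)
  finally show ?thesis .
qed

text \<open>The variance identity at every vertex turns the corner terms into a multiple of the
  energy minus the norm of the Laplacian. The negative term is kept because the case
  \<open>k = l\<close> of squares is tight.\<close>

lemma energy_lift_ties:
  assumes C3: "\<And>i j. card (C3 i j) \<le> 1"
  shows "energy F (lift f) \<le> (real (card C1) + real (card C2) / 2 + real d / 2) * energy E f - sqnorm V (laplace E f) / 4"
proof -
  have "(\<Sum>(p, q, r, t, u)\<in>tie_set. (cmod (f q - f r))\<^sup>2) \<le> (\<Sum>p\<in>V. \<Sum>q\<in>nbrs E p. \<Sum>r\<in>nbrs E p. (cmod (f q - f r))\<^sup>2)"
    by (rule sum_tie_set_le[OF C3]) auto
  also have "\<dots> = (\<Sum>p\<in>V. 2 * real d * (\<Sum>q\<in>nbrs E p. (cmod (f p - f q))\<^sup>2) - 2 * (cmod (laplace E f p))\<^sup>2)"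
  proof (rule sum.cong)
    fix p assume p: "p \<in> V"
    have "(\<Sum>q\<in>nbrs E p. \<Sum>r\<in>nbrs E p. (cmod (f q - f r))\<^sup>2)
       = (\<Sum>q\<in>nbrs E p. \<Sum>r\<in>nbrs E p. (cmod ((f p - f q) - (f p - f r)))\<^sup>2)"
      by (simp add: norm_minus_commute)
    then show "(\<Sum>q\<in>nbrs E p. \<Sum>r\<in>nbrs E p. (cmod (f q - f r))\<^sup>2)
       = 2 * real d * (\<Sum>q\<in>nbrs E p. (cmod (f p - f q))\<^sup>2) - 2 * (cmod (laplace E f p))\<^sup>2"
      unfolding sum_pair_diff deg_card[OF p] laplace_def .
  qed simp
  also have "\<dots> = 4 * real d * energy E f - 2 * sqnorm V (laplace E f)"
    by (simp add: sum_subtractf sum_distrib_left[symmetric] energy_def edge_sum_eq[OF graph, symmetric] sqnorm_def)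
  finally show ?thesis using energy_lift[of f] by (simp add: algebra_simps)
qed

text \<open>Without owned tiles every edge joins two ties at a corner, for any \<open>g\<close> and
  not just for lifts. The variance identity with its negative term dropped bounds each Rayleigh
  quotient by \<open>2 * d\<close>; it is used for squares with \<open>k = l = 1\<close>.\<close>

lemma energy_all_ties:
  assumes O: "Own = {}" and C3: "\<And>i j. card (C3 i j) \<le> 1" and T: "Tie = {t0}"
  shows "energy F g \<le> 2 * real d * sqnorm W g"
proof -
  define k where "k = (\<lambda>(p, q, r, t :: 't, u :: 't). (pic p q t, pic p r u))"
  have C: "C1 = {}" "C2 = {}" unfolding C1_def C2_def using O by auto
  have tt: "t = t0" "u = t0" if "(p, q, r, t, u) \<in> tie_set" for p q r t u
    using that T unfolding tie_set_def C3_def by auto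
  have sub: "F \<subseteq> k ` tie_set"
  proof
    fix e assume e: "e \<in> F"
    obtain X Y where [simp]: "e = (X, Y)" by fastforce
    have "crossing X Y" using crossing_edge e by simp
    then obtain p q r t u where "(p, q) \<in> E" "(p, r) \<in> E" "q \<noteq> r" "(t, u) \<in> C3 (L p q) (L p r)" "X = pic p q t" "Y = pic p r u"
      unfolding crossing_def C using O by blast
    then show "e \<in> k ` tie_set" by (intro image_eqI[of _ _ "(p, q, r, t, u)"]) (auto simp: k_def tie_set_def Pairs_def)
  qed
  define a where "a p q = g (pic p q t0)" for p q
  have "2 * energy F g = (\<Sum>(X, Y)\<in>F. (cmod (g X - g Y))\<^sup>2)" by (simp add: energy_def)
  also have "\<dots> \<le> (\<Sum>(X, Y)\<in>k ` tie_set. (cmod (g X - g Y))\<^sup>2)"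
    using finite_tie_set sub by (intro sum_mono2) auto
  also have "\<dots> \<le> (\<Sum>x\<in>tie_set. (\<lambda>(X, Y). (cmod (g X - g Y))\<^sup>2) (k x))"
    using sum_image_le[OF finite_tie_set, of "\<lambda>(X, Y). (cmod (g X - g Y))\<^sup>2" k] by (auto simp: o_def case_prod_unfold)
  also have "\<dots> = (\<Sum>(p, q, r, t, u)\<in>tie_set. (cmod (a p q - a p r))\<^sup>2)"
    by (rule sum.cong) (auto simp: k_def a_def dest: tt)
  also have "\<dots> \<le> (\<Sum>p\<in>V. \<Sum>q\<in>nbrs E p. \<Sum>r\<in>nbrs E p. (cmod (a p q - a p r))\<^sup>2)"
    by (rule sum_tie_set_le[OF C3]) auto
  also have "\<dots> \<le> (\<Sum>p\<in>V. 2 * real d * (\<Sum>q\<in>nbrs E p. (cmod (a p q))\<^sup>2))"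
    by (rule sum_mono) (simp add: sum_pair_diff deg_card)
  also have "\<dots> = 2 * real d * (\<Sum>(p, q)\<in>E. (cmod (a p q))\<^sup>2)"
    by (simp add: edge_sum_eq[OF graph] sum_distrib_left)
  also have "(\<Sum>(p, q)\<in>E. (cmod (a p q))\<^sup>2) = (\<Sum>((p, q), t)\<in>E \<times> Tie. (cmod (g (pic p q t)))\<^sup>2)"
  proof -
    have "(\<Sum>((p, q), t)\<in>E \<times> Tie. (cmod (g (pic p q t)))\<^sup>2) = (\<Sum>e\<in>E. \<Sum>t\<in>Tie. (cmod (g (pic (fst e) (snd e) t)))\<^sup>2)"
      by (simp add: sum.cartesian_product case_prod_unfold)
    then show ?thesis by (simp add: T a_def case_prod_unfold)
  qed
  also have "\<dots> \<le> 2 * (\<Sum>X\<in>(\<lambda>((p, q), t). pic p q t) ` (E \<times> Tie). (cmod (g X))\<^sup>2)"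
    by (rule tie_sum_le) auto
  also have "\<dots> \<le> 2 * sqnorm W g"
    unfolding sqnorm_def using tie_sub finite_graphD(1)[OF finite_graph_G] by (intro mult_left_mono sum_mono2) auto
  finally show ?thesis by (simp add: mult_left_mono)
qed

end

section \<open>Triangular pieces: combinatorics\<close>

text \<open>The tile \<open>(a, b, t)\<close> is one of the two triangles of the unit rhombus at \<open>a + b\<omega>\<close>: the upward
  one for \<open>t = False\<close>, the downward one for \<open>t = True\<close>. Side \<open>0\<close> of the region runs from \<open>0\<close> to \<open>k + l\<omega>\<close>;
  up to positive factors, \<open>(b + 1) * k - a * l\<close> is the largest height of a vertex of the tile above
  that side and \<open>height\<close> the height of the centre of the rhombus.\<close>

type_synonym tri = "int \<times> int \<times> bool"

locale region =
  fixes k l :: int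
  assumes l0: "0 \<le> l" and lk: "l \<le> k" and k0: "0 < k"
begin

definition "height a b = (2 * b + 1) * k - (2 * a + 1) * l"

lemma height_mir: "height (k - 1 - a) (l - 1 - b) = - height a b"
  by (simp add: height_def algebra_simps)

lemma height_above: "0 \<le> height a b \<Longrightarrow> a * l < (b + 1) * k"
proof -
  assume "0 \<le> height a b"
  then have "2 * (a * l) + l + k \<le> 2 * ((b + 1) * k)" by (simp add: height_def algebra_simps)
  then show ?thesis using l0 k0 by linarith
qed

lemma above_mir: "(k - 1 - a) * l < (l - 1 - b + 1) * k \<longleftrightarrow> b * k < (a + 1) * l"
  by (simp add: algebra_simps)

lemma below_of_height: "height a b \<le> 0 \<Longrightarrow> b * k < (a + 1) * l"
  using height_above[of "k - 1 - a" "l - 1 - b"] unfolding height_mir above_mir by simp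

text \<open>Consecutive columns of a row differ in height by \<open>2 * l\<close>, the length of the
  half-open window.\<close>

lemma height_row: "- 2 * l < height a b \<Longrightarrow> height a b \<le> 0 \<Longrightarrow> - 2 * l < height a' b \<Longrightarrow> height a' b \<le> 0 \<Longrightarrow> a = a'"
proof -
  assume h: "- 2 * l < height a b" "height a b \<le> 0" "- 2 * l < height a' b" "height a' b \<le> 0"
  have "height a b - height a' b = 2 * ((a' - a) * l)" by (simp add: height_def algebra_simps)
  then have 1: "(a' - a) * l < 1 * l" "(- 1) * l < (a' - a) * l" using h by linarith+
  have "a' - a < 1" using 1(1) l0 unfolding mult_less_cancel_right by auto
  moreover have "- 1 < a' - a" using 1(2) l0 unfolding mult_less_cancel_right by auto
  ultimately show "a = a'" by simp
qed

text \<open>Consecutive rows of a column differ in height by \<open>2 * k\<close>. The closed window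
  of this length can hold two of them, and the parity of \<open>b\<close> separates these.\<close>

lemma height_column:
  assumes "0 \<le> height a b" "height a b \<le> 2 * k" "0 \<le> height a b'" "height a b' \<le> 2 * k" "b mod 2 = b' mod 2"
  shows "b = b'"
proof -
  have "height a b - height a b' = 2 * ((b - b') * k)" by (simp add: height_def algebra_simps)
  then have 1: "(b - b') * k \<le> 1 * k" "(- 1) * k \<le> (b - b') * k" using assms by linarith+
  have "b - b' \<le> 1" using 1(1) k0 unfolding mult_le_cancel_right by auto
  moreover have "- 1 \<le> b - b'" using 1(2) k0 unfolding mult_le_cancel_right by auto
  ultimately show ?thesis using assms(5) by presburger
qed

lemma card_columns:
  defines "S \<equiv> {(a, b). 0 \<le> a \<and> a < k \<and> 0 \<le> height a b \<and> height a b \<le> 2 * k}"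
  shows "finite S" "int (card S) \<le> 2 * k"
proof -
  have inj: "inj_on (\<lambda>(a, b). (a, b mod 2)) S"
  proof (rule inj_onI)
    fix x y assume "x \<in> S" "y \<in> S" and eq: "(\<lambda>(a, b). (a, b mod 2)) x = (\<lambda>(a, b). (a, b mod 2)) y"
    then obtain a b c d where xy: "x = (a, b)" "y = (c, d)" "0 \<le> height a b" "height a b \<le> 2 * k"
      "0 \<le> height c d" "height c d \<le> 2 * k" unfolding S_def by blast
    then have "a = c" "b mod 2 = d mod 2" using eq by auto
    then show "x = y" using height_column[of a b d] xy by simp
  qed
  have im: "(\<lambda>(a, b). (a, b mod 2)) ` S \<subseteq> {0..<k} \<times> {0..<2}" by (auto simp: S_def)
  show "finite S" by (rule finite_imageD[OF finite_subset[OF im] inj]) simp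
  have "card S \<le> card ({0..<k} \<times> {0..<2 :: int})" by (rule card_inj_on_le[OF inj im]) simp
  then show "int (card S) \<le> 2 * k" using k0 by (simp add: card_cartesian_product)
qed

lemma card_rows:
  defines "S \<equiv> {(a, b). 0 \<le> b \<and> b < l \<and> - 2 * l < height a b \<and> height a b \<le> 0}"
  shows "finite S" "int (card S) \<le> l"
proof -
  have inj: "inj_on snd S"
  proof (rule inj_onI)
    fix x y assume "x \<in> S" "y \<in> S" and eq: "snd x = snd y"
    then obtain a b c d where xy: "x = (a, b)" "y = (c, d)" "- 2 * l < height a b" "height a b \<le> 0"
      "- 2 * l < height c d" "height c d \<le> 0" unfolding S_def by blast
    then have "b = d" using eq by auto
    then show "x = y" using height_row[of a b c] xy by simp
  qed
  have im: "snd ` S \<subseteq> {0..<l}" by (auto simp: S_def)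
  show "finite S" by (rule finite_imageD[OF finite_subset[OF im] inj]) simp
  have "card S \<le> card {0..<l}" by (rule card_inj_on_le[OF inj im]) simp
  then show "int (card S) \<le> l" using l0 by simp
qed

end

locale hex = region
begin

text \<open>The maps w -> z + \<omega>^2 w and w -> z - w with z = k + l \<omega>, written on tiles.
  The half-turn \<open>mir\<close> exchanges upward and downward triangles.\<close>

definition rot :: "tri \<Rightarrow> tri" where
  "rot = (\<lambda>(a, b, t). (k - 1 - a - b - of_bool t, l + a, t))"
definition mir :: "tri \<Rightarrow> tri" where
  "mir = (\<lambda>(a, b, t). (k - 1 - a, l - 1 - b, \<not> t))"
definition above :: "tri \<Rightarrow> bool" where
  "above = (\<lambda>(a, b, t). a * l < (b + 1) * k)"
definition hgt :: "tri \<Rightarrow> int" where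
  "hgt = (\<lambda>(a, b, t). height a b)"
text \<open>Ownership across side 0 is decided by the centre of the surrounding rhombus, which keeps
  both of its triangles together unless that centre lies on the side. Such a rhombus is split: its
  upward triangle counts as above. As \<open>mir\<close> negates the height and exchanges the types,
  exactly one of \<open>x\<close> and \<open>mir x\<close> is mine, and no ties remain.\<close>

definition mine :: "tri \<Rightarrow> bool" where
  "mine = (\<lambda>(a, b, t). if t then 0 < height a b else 0 \<le> height a b)"
definition P :: "tri set" where
  "P = {x. above x \<and> above (rot x) \<and> above (rot (rot x))}"
definition Own :: "tri set" where
  "Own = {x. mine x \<and> mine (rot x) \<and> mine (rot (rot x))}"
text \<open>\<open>box\<close> is the parallelogram with sides \<open>k\<close> and \<open>l\<close>
  whose diagonal is side 0, and \<open>inner\<close> is the triangle of side \<open>k - l\<close> in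
  the middle of the region. Three half parallelograms and the inner triangle account for k^2 + k l +
  l^2 = 3 k l + (k - l)^2.\<close>

definition box :: "tri \<Rightarrow> bool" where
  "box = (\<lambda>(a, b, t). 0 \<le> a \<and> a < k \<and> 0 \<le> b \<and> b < l)"
definition inner :: "tri \<Rightarrow> bool" where
  "inner = (\<lambda>(a, b, t). 0 \<le> a \<and> l \<le> b \<and> a + b + 1 + of_bool t \<le> k)"
definition adj :: "tri \<Rightarrow> tri \<Rightarrow> bool" where
  "adj = (\<lambda>(a, b, t) (a', b', t').
     \<not> t \<and> t' \<and> (a', b') \<in> {(a, b), (a - 1, b), (a, b - 1)} \<or>
     t \<and> \<not> t' \<and> (a, b) \<in> {(a', b'), (a' - 1, b'), (a', b' - 1)})"

lemmas tile_defs = rot_def mir_def above_def hgt_def mine_def box_def inner_def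

lemma rot3: "rot (rot (rot x)) = x"
  by (cases x) (simp add: rot_def)

lemma mir_mir: "mir (mir x) = x"
  by (cases x) (simp add: mir_def)

lemma rot_inj: "rot x = rot y \<longleftrightarrow> x = y"
  by (metis rot3)

lemma rot_pow3: "(rot ^^ 3) x = x"
  by (simp add: eval_nat_numeral rot3)

lemma P_rot: "rot x \<in> P \<longleftrightarrow> x \<in> P"
  by (auto simp: P_def rot3)

lemma Own_rot: "rot x \<in> Own \<longleftrightarrow> x \<in> Own"
  by (auto simp: Own_def rot3)

lemma rot_pow_P: "(rot ^^ n) x \<in> P \<longleftrightarrow> x \<in> P"
  by (induction n) (auto simp: P_rot)

lemma adj_sym: "adj x y \<longleftrightarrow> adj y x"
  by (cases x; cases y) (auto simp: adj_def)

lemma adj_rot: "adj (rot x) (rot y) \<longleftrightarrow> adj x y"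
  by (cases x; cases y) (auto simp: adj_def rot_def)

lemma adj_mir: "adj (mir x) (mir y) \<longleftrightarrow> adj x y"
  by (cases x; cases y) (auto simp: adj_def mir_def)

lemma rot_pow_adj: "adj ((rot ^^ n) x) ((rot ^^ n) y) \<longleftrightarrow> adj x y"
  by (induction n) (auto simp: adj_rot)

lemma mine_above: "mine x \<Longrightarrow> above x"
  using height_above by (cases x) (auto simp: tile_defs split: if_splits)

lemma Own_P: "Own \<subseteq> P"
  unfolding Own_def P_def using mine_above by blast

lemma P_above: "x \<in> P \<Longrightarrow> above x"
  by (simp add: P_def)

lemma mine_mir: "mine (mir x) \<longleftrightarrow> \<not> mine x"
  by (cases x) (auto simp: mine_def mir_def height_mir)

lemma not_mine_below: "\<not> mine x \<Longrightarrow> above (mir x)"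
  using mine_above mine_mir by blast

lemma box_mir: "box (mir x) \<longleftrightarrow> box x"
  by (cases x) (auto simp: box_def mir_def)

lemma box_rot: "box x \<Longrightarrow> \<not> box (rot x)"
  by (cases x) (auto simp: box_def rot_def)

lemma box_unique: "box ((rot ^^ i) x) \<Longrightarrow> box ((rot ^^ j) x) \<Longrightarrow> i < 3 \<Longrightarrow> j < 3 \<Longrightarrow> i = j"
  using box_rot[of x] box_rot[of "rot x"] box_rot[of "rot (rot x)"]
  by (auto simp: eval_nat_numeral less_Suc_eq rot3)

text \<open>A tile of the piece that reaches below side 0 stays in the parallelogram over this side:
  leaving it at either end would violate the conditions at the other two sides.\<close>

lemma crossing_box:
  assumes "x \<in> P" "above (mir x)"
  shows "box x"
proof -
  obtain a b t where x: "x = (a, b, t)" by (cases x)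
  define \<tau> :: int where "\<tau> = of_bool t"
  have \<tau>: "0 \<le> \<tau>" "\<tau> \<le> 1" by (auto simp: \<tau>_def)
  \<comment> \<open>\<open>above\<close> for \<open>x\<close>, \<open>rot x\<close>,
    \<open>rot (rot x)\<close> and \<open>mir x\<close>, multiplied out.\<close>
  have 1: "a * l < (b + 1) * k" and 2: "0 < (a + 1) * (k + l) + (b + \<tau>) * l"
    and 3: "0 < (k - a - \<tau>) * k + (l - b) * (k + l)" and 4: "b * k < (a + 1) * l"
    using assms unfolding x P_def above_def rot_def mir_def \<tau>_def by (auto simp: algebra_simps)
  have "0 \<le> a"
  proof (rule ccontr)
    assume "\<not> 0 \<le> a"
    then have "(a + 1) * l \<le> 0" "(a + 1) * (k + l) \<le> 0" using l0 k0 by (auto intro: mult_nonpos_nonneg)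
    then have "b * k < 0" using 4 by simp
    then have "b < 0" using k0 by (simp add: mult_less_0_iff)
    then have "(b + \<tau>) * l \<le> 0" using \<tau> l0 by (auto intro: mult_nonpos_nonneg)
    then show False using 2 \<open>(a + 1) * (k + l) \<le> 0\<close> by simp
  qed
  then have "0 < (b + 1) * k" using 1 mult_nonneg_nonneg[OF \<open>0 \<le> a\<close> l0] by linarith
  then have b: "0 \<le> b" using k0 by (simp add: zero_less_mult_iff)
  have "a < k"
  proof (rule ccontr)
    assume a: "\<not> a < k"
    have "(k - a - \<tau>) * k \<le> 0" using a \<tau> k0 by (auto intro: mult_nonpos_nonneg)
    then have "0 < (l - b) * (k + l)" using 3 by simp
    then have "b + 1 \<le> l" using k0 l0 by (simp add: zero_less_mult_iff)
    then have "(b + 1) * k \<le> l * k" using k0 by (intro mult_right_mono) auto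
    moreover have "k * l \<le> a * l" using a l0 by (intro mult_right_mono) auto
    ultimately show False using 1 by (simp add: mult.commute)
  qed
  have "(a + 1) * l \<le> k * l" using \<open>a < k\<close> l0 by (intro mult_right_mono) auto
  then have "b * k < l * k" using 4 by (simp add: mult.commute)
  then have "b < l" using k0 by simp
  then show ?thesis using \<open>0 \<le> a\<close> \<open>a < k\<close> b by (simp add: x box_def)
qed

text \<open>Tiles of the box are clear of the other two sides, so that within the box ownership
  depends on side 0 alone.\<close>

lemma box_mine:
  assumes "box x"
  shows "mine (rot x)" "mine (rot (rot x))"
proof -
  obtain a b t where x: "x = (a, b, t)" by (cases x)
  define \<tau> :: int where "\<tau> = of_bool t"
  have \<tau>: "0 \<le> \<tau>" "\<tau> \<le> 1" by (auto simp: \<tau>_def)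
  have ab: "0 \<le> a" "a < k" "0 \<le> b" "b < l" using assms by (auto simp: x box_def)
  have p: "0 \<le> a * k" "0 \<le> a * l" "0 \<le> b * l" "0 \<le> \<tau> * l" "0 \<le> k * (k - 1 - a)" "0 \<le> (k + l) * (l - 1 - b)"
    "\<tau> * k \<le> 1 * k"
    using ab \<tau> k0 l0 by (auto intro!: mult_nonneg_nonneg mult_right_mono)
  have "height (k - 1 - a - b - \<tau>) (l + a) = 2 * (a * k) + k + l + 2 * (a * l) + 2 * (b * l) + 2 * (\<tau> * l)"
    by (simp add: height_def algebra_simps)
  also have "\<dots> > 0" using p l0 k0 by linarith
  finally show "mine (rot x)" by (auto simp: x rot_def mine_def \<tau>_def)
  have "height (b - l) (l + (k - 1 - a - b - \<tau>)) = 2 * (k * (k - 1 - a)) + 2 * ((k + l) * (l - 1 - b)) + 3 * k + l - 2 * (\<tau> * k)"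
    by (simp add: height_def algebra_simps)
  also have "\<dots> > 0" using p l0 k0 by linarith
  finally have "height (b - l) (l + (k - 1 - a - b - \<tau>)) > 0" .
  moreover have "rot (rot x) = (b - l, l + (k - 1 - a - b - \<tau>), t)" by (simp add: x rot_def \<tau>_def)
  ultimately show "mine (rot (rot x))" by (auto simp: mine_def)
qed

lemma box_P: "box x \<Longrightarrow> above x \<Longrightarrow> x \<in> P"
  using box_mine mine_above by (auto simp: P_def)

lemma box_Own: "box x \<Longrightarrow> mine x \<Longrightarrow> x \<in> Own"
  using box_mine by (auto simp: Own_def)

lemma cross_unique:
  assumes "x \<in> P" "i < 3" "j < 3" "mir ((rot ^^ i) x) \<in> P" "mir ((rot ^^ j) x) \<in> P"
  shows "i = j"
proof -
  have "box ((rot ^^ n) x)" if "mir ((rot ^^ n) x) \<in> P" for n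
    using crossing_box[OF _ P_above[OF that]] assms(1) rot_pow_P by blast
  then show ?thesis using box_unique assms by blast
qed

lemma Own_mir: "x \<in> Own \<Longrightarrow> mir x \<notin> Own"
  using mine_mir by (auto simp: Own_def)

lemma not_mine_mir_Own:
  assumes "x \<in> P" "\<not> mine x"
  shows "mir x \<in> Own"
  using crossing_box[OF assms(1) not_mine_below[OF assms(2)]] assms(2) box_Own box_mir mine_mir by blast

lemma cover: "x \<in> P \<Longrightarrow> x \<notin> Own \<Longrightarrow> \<exists>j<3. mir ((rot ^^ j) x) \<in> Own"
proof -
  assume x: "x \<in> P" "x \<notin> Own"
  then consider "\<not> mine x" | "\<not> mine (rot x)" | "\<not> mine (rot (rot x))" by (auto simp: Own_def)
  then show ?thesis
  proof cases
    case 1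
    then show ?thesis using not_mine_mir_Own[OF x(1)] by (intro exI[of _ 0]) simp
  next
    case 2
    then show ?thesis using not_mine_mir_Own[of "rot x"] x by (intro exI[of _ 1]) (simp add: P_rot)
  next
    case 3
    then show ?thesis using not_mine_mir_Own[of "rot (rot x)"] x
      by (intro exI[of _ 2]) (simp add: P_rot eval_nat_numeral)
  qed
qed

lemma far_box:
  assumes "x \<in> P" "mir x \<in> Own"
  shows "box x" "\<not> mine x"
proof -
  have "mine (mir x)" using assms(2) by (simp add: Own_def)
  then show "\<not> mine x" by (simp add: mine_mir)
  then show "box x" using crossing_box[OF assms(1)] not_mine_below by blast
qed

text \<open>The neighbours of an upward triangle lie in its own rhombus, the one to the left and the
  one below. Negative height excludes the first column, and in the bottom row the neighbour below is
  not in the piece.\<close>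

lemma far_up_adj:
  assumes "box (a, b, False)" "\<not> mine (a, b, False)" "adj (a, b, False) y" "y \<in> P"
  shows "box y"
proof -
  have ab: "0 \<le> a" "a < k" "0 \<le> b" "b < l" "height a b < 0" using assms by (auto simp: box_def mine_def)
  have "a \<noteq> 0"
  proof
    assume "a = 0"
    moreover have "1 * k \<le> (2 * b + 1) * k" using ab k0 by (intro mult_right_mono) auto
    ultimately show False using ab(5) lk by (simp add: height_def)
  qed
  then have "0 < a * l" using ab by (intro mult_pos_pos) auto
  then have "y \<noteq> (a, - 1, True)" using assms(4) by (auto simp: P_def above_def)
  then show ?thesis using assms(3) ab \<open>a \<noteq> 0\<close> by (cases y) (auto simp: adj_def box_def)
qed

text \<open>One of two adjacent triangles points upward, and by symmetry it may be the first. Then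
  \<open>far_up_adj\<close> puts the other into the same box, so triangles produce no pairs beyond
  different sides.\<close>

lemma far_adj:
  assumes xy: "adj x y" "x \<in> P" "y \<in> P" and ij: "i < 3" "j < 3"
    and far: "mir ((rot ^^ i) x) \<in> Own" "mir ((rot ^^ j) y) \<in> Own"
  shows "i = j"
proof -
  have *: "i = j" if "adj x y" "x \<in> P" "y \<in> P" "i < 3" "j < 3" "mir ((rot ^^ i) x) \<in> Own" "mir ((rot ^^ j) y) \<in> Own"
    and up: "\<not> snd (snd x)" for x y i j
  proof -
    have b: "box ((rot ^^ i) x)" "\<not> mine ((rot ^^ i) x)" using far_box that by (auto simp: rot_pow_P)
    have bj: "box ((rot ^^ j) y)" using far_box that by (auto simp: rot_pow_P)
    have "snd (snd ((rot ^^ i) x)) = snd (snd x)"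
      by (induction i) (auto simp: rot_def case_prod_unfold)
    then obtain a b where ab: "(rot ^^ i) x = (a, b, False)" using up by (cases "(rot ^^ i) x") auto
    have "box ((rot ^^ i) y)"
    proof (rule far_up_adj[of a b])
      show "adj (a, b, False) ((rot ^^ i) y)" using that(1) unfolding ab[symmetric] by (simp add: rot_pow_adj)
    qed (use b ab that in \<open>auto simp: rot_pow_P\<close>)
    then show ?thesis using box_unique[OF _ bj] that by blast
  qed
  show ?thesis
  proof (cases "snd (snd x)")
    case True
    then have "\<not> snd (snd y)" using xy(1) by (auto simp: adj_def case_prod_unfold)
    then show ?thesis using *[of y x j i] assms adj_sym by auto
  next
    case False
    then show ?thesis using *[of x y i j] assms by auto
  qed
qed

lemma l0_Own: "l = 0 \<Longrightarrow> P = Own"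
proof -
  assume l: "l = 0"
  have "above x \<longleftrightarrow> mine x" for x
  proof -
    obtain a b t where x: "x = (a, b, t)" by (cases x)
    show ?thesis unfolding x above_def mine_def height_def prod.case
      using l k0 by (auto simp: zero_less_mult_iff zero_le_mult_iff)
  qed
  then show ?thesis by (simp add: P_def Own_def)
qed

lemma no_crossing_l0: "l = 0 \<Longrightarrow> x \<in> P \<Longrightarrow> mir x \<notin> P"
proof
  assume "l = 0" "x \<in> P" "mir x \<in> P"
  then have "box x" using crossing_box P_above by blast
  then show False unfolding box_def using \<open>l = 0\<close> by auto
qed

text \<open>Otherwise \<open>x\<close> lies weakly above and \<open>y\<close> weakly below the line
  of side 0, so their common edge lies on it. The side then follows a lattice line, which forces
  \<open>l = 0\<close>.\<close>

lemma cross_adj: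
  assumes "adj x y" "x \<in> P" "mir y \<in> P"
  shows "y \<in> P \<or> mir x \<in> P \<or> (l = 0 \<and> x \<in> Own \<and> mir y \<in> Own)"
proof (cases "above y \<or> above (mir x)")
  case True
  then show ?thesis
  proof
    assume y: "above y"
    then have "box y" using crossing_box[OF assms(3)] by (simp add: mir_mir box_mir)
    then show ?thesis using box_P y by blast
  next
    assume "above (mir x)"
    then show ?thesis using crossing_box[OF assms(2)] box_P box_mir by blast
  qed
next
  case False
  obtain a b t where x: "x = (a, b, t)" by (cases x)
  obtain c d s where y: "y = (c, d, s)" by (cases y)
  have "above x" "above (mir y)" using assms by (auto simp: P_def)
  then have i: "(a + 1) * l \<le> b * k" "(d + 1) * k \<le> c * l"
    using False by (auto simp: x y above_def mir_def above_mir not_less algebra_simps)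
  have "l = 0"
  proof -
    consider "c \<le> a + 1" "d = b" | "c = a" "b \<le> d + 1" using assms(1) by (auto simp: x y adj_def)
    then show ?thesis
    proof cases
      case 1
      then have "c * l \<le> (a + 1) * l" using l0 by (intro mult_right_mono) auto
      then show ?thesis using i 1 k0 by (simp add: algebra_simps)
    next
      case 2
      then have "b * k \<le> (d + 1) * k" using k0 by (intro mult_right_mono) auto
      then show ?thesis using i 2 l0 by (simp add: algebra_simps)
    qed
  qed
  then show ?thesis using assms l0_Own by auto
qed

text \<open>The side lines of the inner triangle, prolonged like a pinwheel, cut the plane into this
  triangle and three rotated copies of the sector \<open>0 \<le> a\<close>,
  \<open>b < l\<close>.\<close>

lemma region_cases: "\<exists>j<3. inner ((rot ^^ j) x) \<or> (case (rot ^^ j) x of (a, b, t) \<Rightarrow> 0 \<le> a \<and> b < l)"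
proof -
  obtain a b t where x: "x = (a, b, t)" by (cases x)
  define \<tau> :: int where "\<tau> = of_bool t"
  have \<tau>: "0 \<le> \<tau>" "\<tau> \<le> 1" by (auto simp: \<tau>_def)
  have r: "rot x = (k - 1 - a - b - \<tau>, l + a, t)" "rot (rot x) = (b - l, l + (k - 1 - a - b - \<tau>), t)"
    by (simp_all add: x rot_def \<tau>_def)
  consider "inner x" | "0 \<le> a" "b < l" | "a < 0" "a + b + \<tau> \<le> k - 1" | "l \<le> b" "k \<le> a + b + \<tau>"
  proof -
    have "inner x \<or> (0 \<le> a \<and> b < l) \<or> (a < 0 \<and> a + b + \<tau> \<le> k - 1) \<or> (l \<le> b \<and> k \<le> a + b + \<tau>)"
      using lk \<tau> unfolding x inner_def prod.case \<tau>_def[symmetric] by presburger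
    then show thesis using that by blast
  qed
  then show ?thesis
  proof cases
    case 1
    then show ?thesis by (intro exI[of _ 0]) simp
  next
    case 2
    then show ?thesis by (intro exI[of _ 0]) (simp add: x)
  next
    case 3
    then show ?thesis by (intro exI[of _ 1]) (simp add: r)
  next
    case 4
    moreover have "(rot ^^ 2) x = rot (rot x)" by (simp add: eval_nat_numeral)
    ultimately show ?thesis by (intro exI[of _ 2]) (simp add: r(2))
  qed
qed

lemma bottom_box:
  assumes "above (a, b, t)" "0 \<le> a" "b < l"
  shows "box (a, b, t)"
proof -
  have 1: "a * l < (b + 1) * k" using assms by (simp add: above_def)
  have "0 \<le> a * l" using assms l0 by simp
  then have "0 < (b + 1) * k" using 1 by simp
  then have b: "0 \<le> b" using k0 by (simp add: zero_less_mult_iff)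
  have "(b + 1) * k \<le> l * k" using assms k0 by (intro mult_right_mono) auto
  then have "a * l < k * l" using 1 by (simp add: mult.commute)
  then have "a < k" using l0 by (simp add: mult_less_cancel_right)
  then show ?thesis using assms b by (simp add: box_def)
qed

lemma finite_P: "finite P"
proof -
  define B :: "tri set" where "B = {0..k} \<times> {0..k} \<times> UNIV"
  have sub: "\<exists>j<3. (rot ^^ j) x \<in> B" if x: "x \<in> P" for x
  proof -
    obtain j where j: "j < 3" "inner ((rot ^^ j) x) \<or> (case (rot ^^ j) x of (a, b, t) \<Rightarrow> 0 \<le> a \<and> b < l)"
      using region_cases[of x] by (elim exE conjE)
    obtain a b t where abt: "(rot ^^ j) x = (a, b, t)" by (cases "(rot ^^ j) x")
    have "(a, b, t) \<in> P" using x rot_pow_P[of j x] unfolding abt by simp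
    then have "above (a, b, t)" by (rule P_above)
    have "(a, b, t) \<in> B"
    proof (cases "inner (a, b, t)")
      case True
      then show ?thesis using lk l0 by (auto simp: B_def inner_def of_bool_def split: if_splits)
    next
      case False
      then have "box (a, b, t)" using j(2) bottom_box[OF \<open>above (a, b, t)\<close>] unfolding abt by simp
      then show ?thesis using lk by (auto simp: B_def box_def)
    qed
    then show ?thesis using j(1) abt by metis
  qed
  have "P \<subseteq> B \<union> rot ` B \<union> rot ` rot ` B"
  proof
    fix x assume "x \<in> P"
    then obtain j where j: "j < 3" "(rot ^^ j) x \<in> B" using sub by blast
    then have "j = 0 \<or> j = 1 \<or> j = 2" by auto
    then consider "x \<in> B" | "rot x \<in> B" | "rot (rot x) \<in> B"
      using j(2) by (auto simp: eval_nat_numeral simp del: split_paired_All)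
    then show "x \<in> B \<union> rot ` B \<union> rot ` rot ` B"
    proof cases
      case 2
      then have "rot (rot (rot x)) \<in> rot ` rot ` B" by blast
      then show ?thesis by (simp add: rot3)
    next
      case 3
      then have "rot (rot (rot x)) \<in> rot ` B" by blast
      then show ?thesis by (simp add: rot3)
    qed auto
  qed
  moreover have "finite (B \<union> rot ` B \<union> rot ` rot ` B)" by (simp add: B_def)
  ultimately show ?thesis by (rule finite_subset)
qed

section \<open>Counting the owned triangles\<close>

lemma inner_rot: "inner x \<Longrightarrow> inner (rot x)"
  by (cases x) (auto simp: inner_def rot_def)

lemma inner_mine: "inner x \<Longrightarrow> mine x"
proof -
  assume i: "inner x"
  obtain a b t where x: "x = (a, b, t)" by (cases x)
  have ab: "0 \<le> a" "l \<le> b" "a + b + 1 \<le> k" using i by (auto simp: x inner_def of_bool_def split: if_splits)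
  have "l * k \<le> b * k" "(a + 1) * l \<le> k * l" using ab k0 l0 by (auto intro!: mult_right_mono)
  moreover have "(a + 1) * l = a * l + l" "k * l = l * k" by (simp_all add: algebra_simps)
  ultimately have "2 * (a * l) + l < 2 * (b * k) + k" using k0 l0 by linarith
  then have "0 < height a b" by (simp add: height_def algebra_simps)
  then show ?thesis by (simp add: x mine_def)
qed

lemma inner_Own: "inner x \<Longrightarrow> x \<in> Own"
  using inner_mine inner_rot by (simp add: Own_def)

lemma inner_not_box: "inner x \<Longrightarrow> \<not> box x"
  by (cases x) (auto simp: inner_def box_def)

text \<open>\<open>H\<close> is the owned half of the box. Its three rotated copies and the inner
  triangle are disjoint and owned.\<close>

lemma card_Own: "k\<^sup>2 + k * l + l\<^sup>2 \<le> int (card Own)"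
proof -
  have finO: "finite Own" using Own_P finite_P finite_subset by blast
  define H where "H = {x. box x \<and> mine x}"
  have HO: "H \<subseteq> Own" using box_Own by (auto simp: H_def)
  have finH: "finite H" using HO finO finite_subset by blast
  \<comment> \<open>One of \<open>x\<close> and \<open>mir x\<close> is mine, so \<open>H\<close>
    has at least half of the \<open>2 * k * l\<close> triangles of the box.\<close>
  have "{x. box x} \<subseteq> H \<union> mir ` H"
  proof
    fix x assume x: "x \<in> {x. box x}"
    show "x \<in> H \<union> mir ` H"
    proof (cases "mine x")
      case False
      then have "mir x \<in> H" using x box_mir mine_mir by (simp add: H_def)
      then have "mir (mir x) \<in> mir ` H" by blast
      then show ?thesis by (simp add: mir_mir)
    qed (use x in \<open>simp add: H_def\<close>)
  qed
  then have "card {x. box x} \<le> card (H \<union> mir ` H)" using finH by (intro card_mono) auto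
  also have "\<dots> \<le> card H + card H" using card_Un_le[of H "mir ` H"] card_image_le[OF finH, of mir] by linarith
  finally have "card {x. box x} \<le> 2 * card H" by simp
  moreover have "{x. box x} = {0..<k} \<times> {0..<l} \<times> UNIV" by (auto simp: box_def)
  then have "int (card {x. box x}) = 2 * (k * l)" using k0 l0 by (simp add: card_cartesian_product)
  ultimately have cH: "k * l \<le> int (card H)" by simp
  define n where "n = k - l"
  \<comment> \<open>Folds a square of side \<open>n\<close> along its antidiagonal onto the upward
    and downward tiles of the inner triangle, which gives the count \<open>n * n\<close>.\<close>
  define j where "j = (\<lambda>(x, y). if x + y < n then (x, l + y, False) else (n - 1 - x, l + n - 1 - y, True))"
  have "inj_on j ({0..<n} \<times> {0..<n})" by (auto simp: inj_on_def j_def split: if_splits)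
  moreover have "j ` ({0..<n} \<times> {0..<n}) \<subseteq> {x. inner x}" by (auto simp: j_def inner_def n_def split: if_splits)
  moreover have finI: "finite {x. inner x}" using finO inner_Own finite_subset by (metis mem_Collect_eq subsetI)
  ultimately have "card ({0..<n} \<times> {0..<n}) \<le> card {x. inner x}" by (metis card_inj_on_le)
  moreover have "int (card ({0..<n} \<times> {0..<n})) = (k - l) * (k - l)" using lk by (simp add: card_cartesian_product n_def)
  ultimately have cI: "(k - l) * (k - l) \<le> int (card {x. inner x})" by linarith
  have dis1: "H \<inter> rot ` H = {}" using box_rot by (auto simp: H_def)
  have dis2: "(H \<union> rot ` H) \<inter> rot ` rot ` H = {}"
  proof -
    have "H \<inter> rot ` rot ` H = {}"
    proof (rule ccontr)
      assume "H \<inter> rot ` rot ` H \<noteq> {}"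
      then obtain x where "x \<in> H" "rot (rot x) \<in> H" by auto
      then show False using box_rot[of "rot (rot x)"] by (simp add: H_def rot3)
    qed
    moreover have "rot ` H \<inter> rot ` rot ` H = {}"
    proof (rule ccontr)
      assume "rot ` H \<inter> rot ` rot ` H \<noteq> {}"
      then obtain x y where "x \<in> H" "y \<in> rot ` H" "rot x = rot y" by blast
      then show False using dis1 rot_inj by blast
    qed
    ultimately show ?thesis by blast
  qed
  have inn: "inner x" if "inner (rot x)" for x using inner_rot[OF inner_rot[OF that]] by (simp add: rot3)
  have dis3: "(H \<union> rot ` H \<union> rot ` rot ` H) \<inter> {x. inner x} = {}"
    unfolding H_def using inner_not_box inn by blast
  have cr: "card (rot ` A) = card A" for A by (rule card_image) (auto simp: inj_on_def rot_inj)
  have "card (H \<union> rot ` H \<union> rot ` rot ` H \<union> {x. inner x}) = card H + card H + card H + card {x. inner x}"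
    using finH finI dis1 dis2 dis3 by (simp add: card_Un_disjoint cr)
  moreover have "H \<union> rot ` H \<union> rot ` rot ` H \<union> {x. inner x} \<subseteq> Own"
    using HO inner_Own Own_rot by blast
  ultimately have "card H + card H + card H + card {x. inner x} \<le> card Own" using card_mono[OF finO] by metis
  then have "3 * (k * l) + (k - l) * (k - l) \<le> int (card Own)" using cH cI by linarith
  then show ?thesis by (simp add: power2_eq_square algebra_simps)
qed

section \<open>Edges crossing a side of the triangle\<close>

definition cut :: "(tri \<times> tri) set" where
  "cut = {(x, y). adj x y \<and> x \<in> Own \<and> mir y \<in> Own}"

text \<open>The boundary between two pieces is crossed at most twice in every column and at most once in
  every row of the parallelogram along the side.\<close>

lemma cut_cases:
  assumes "(x, y) \<in> cut"
  shows "(\<exists>a b. x = (a, b, False) \<and> y = (a, b - 1, True) \<and> 0 \<le> a \<and> a < k \<and> 0 \<le> height a b \<and> height a b \<le> 2 * k) \<or>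
    (\<exists>a b. x = (a, b, False) \<and> y = (a, b, True) \<and> 0 \<le> b \<and> b < l \<and> height a b = 0) \<or>
    (\<exists>a b. x = (a - 1, b, True) \<and> y = (a, b, False) \<and> 0 \<le> b \<and> b < l \<and> - 2 * l < height a b \<and> height a b < 0)"
proof -
  obtain a b t where x: "x = (a, b, t)" by (cases x)
  obtain c d s where y: "y = (c, d, s)" by (cases y)
  have xy: "adj x y" "mine x" "\<not> mine y" "x \<in> P"
    using assms Own_P mine_mir by (auto simp: cut_def Own_def simp del: split_paired_All split_paired_Ex)
  have st: "height (a - 1) b = height a b + 2 * l" "height a (b - 1) = height a b - 2 * k" for a b
    by (simp_all add: height_def algebra_simps)
  show ?thesis
  proof (cases t)
    case False
    then have h: "0 \<le> height a b" "height c d \<le> 0" and s: s and cd: "(c, d) \<in> {(a, b), (a - 1, b), (a, b - 1)}"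
      using xy by (auto simp: x y mine_def adj_def split: if_splits)
    from cd consider "c = a" "d = b" | "c = a - 1" "d = b" | "c = a" "d = b - 1" by auto
    then show ?thesis
    proof cases
      case 1
      then have h0: "height a b = 0" using h by simp
      then have "above (mir x)" using below_of_height[of a b] by (simp add: x above_def mir_def above_mir[simplified])
      then have "box x" using crossing_box[OF xy(4)] by blast
      then show ?thesis using h0 1 False s by (auto simp: x y box_def)
    next
      case 2
      \<comment> \<open>A step to the left raises the height by \<open>2 * l\<close>, so both
        heights are 0 and \<open>l = 0\<close>; but \<open>(2 * b + 1) * k\<close> never
        vanishes.\<close>
      then have "l = 0" "height a b = 0" using h st(1)[of a b] l0 by auto
      then have "(2 * b + 1) * k = 0" unfolding height_def by simp
      then have "2 * b + 1 = 0" using k0 by simp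
      then show ?thesis by presburger
    next
      case 3
      then have h2: "height a b \<le> 2 * k" using h st(2)[of a b] by simp
      have 1: "a * l < (b + 1) * k" and 2: "0 < (a + 1) * (k + l) + b * l"
        and 3: "0 < (k - a) * k + (l - b) * (k + l)"
        using xy(4) False unfolding x P_def above_def rot_def by (auto simp: algebra_simps)
      have "0 \<le> a"
      proof (rule ccontr)
        assume a: "\<not> 0 \<le> a"
        then have "(a + 1) * (k + l) \<le> 0" using l0 k0 by (auto intro: mult_nonpos_nonneg)
        then have "0 < b * l" using 2 by simp
        then have "1 \<le> b" using l0 by (simp add: zero_less_mult_iff)
        then have "3 * k \<le> (2 * b + 1) * k" using k0 by (intro mult_right_mono) auto
        moreover have "(2 * a + 1) * l \<le> 0" using a l0 by (auto intro: mult_nonpos_nonneg)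
        ultimately show False using h2 k0 unfolding height_def by linarith
      qed
      moreover have "a < k"
      proof (rule ccontr)
        assume a: "\<not> a < k"
        have "(k - a) * k \<le> 0" using a k0 by (auto intro: mult_nonpos_nonneg)
        then have "0 < (l - b) * (k + l)" using 3 by simp
        then have "b + 1 \<le> l" using k0 l0 by (simp add: zero_less_mult_iff)
        then have "(b + 1) * k \<le> l * k" using k0 by (intro mult_right_mono) auto
        moreover have "k * l \<le> a * l" using a l0 by (intro mult_right_mono) auto
        ultimately show False using 1 by (simp add: mult.commute)
      qed
      ultimately show ?thesis using 3 h h2 False s \<open>c = a\<close> \<open>d = b - 1\<close> by (auto simp: x y)
    qed
  next
    case True
    then have h: "0 < height a b" "height c d < 0" and s: "\<not> s" and cd: "(a, b) \<in> {(c, d), (c - 1, d), (c, d - 1)}"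
      using xy by (auto simp: x y mine_def adj_def split: if_splits)
    from cd consider "a = c" "b = d" | "a = c - 1" "b = d" | "a = c" "b = d - 1" by auto
    then show ?thesis
    proof cases
      case 2
      then have h2: "- 2 * l < height c d" using h st(1)[of c d] by simp
      have "2 * (b * k) + k < 2 * (c * l) + l" using h(2) 2 by (simp add: height_def algebra_simps)
      then have "b * k < (a + 1) * l" using 2 lk by (simp add: algebra_simps)
      then have "above (mir x)" by (simp add: x above_def mir_def above_mir[simplified])
      then have "box x" using crossing_box[OF xy(4)] by blast
      then show ?thesis using h h2 2 True s by (auto simp: x y box_def)
    qed (use h st[of c d] k0 in auto)
  qed
qed

text \<open>Two crossings in each of the \<open>k\<close> columns and one in each of the
  \<open>l\<close> rows; \<open>l \<le> k\<close> turns \<open>2 * k + l\<close> into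
  \<open>3 * k\<close>.\<close>

lemma card_cut: "finite cut" "int (card cut) \<le> 3 * k"
proof -
  define S1 where "S1 = {(a, b). 0 \<le> a \<and> a < k \<and> 0 \<le> height a b \<and> height a b \<le> 2 * k}"
  define S2 where "S2 = {(a, b). 0 \<le> b \<and> b < l \<and> - 2 * l < height a b \<and> height a b \<le> 0}"
  define f :: "int \<times> int \<Rightarrow> tri \<times> tri" where "f = (\<lambda>(a, b). ((a, b, False), (a, b - 1, True)))"
  \<comment> \<open>A row has only one \<open>a\<close> in the window. Height 0 stands for a
    crossing inside the rhombus at \<open>(a, b)\<close>, negative height for a crossing from the
    rhombus to its left.\<close>
  define g :: "int \<times> int \<Rightarrow> tri \<times> tri" where
    "g = (\<lambda>(a, b). if height a b = 0 then ((a, b, False), (a, b, True)) else ((a - 1, b, True), (a, b, False)))"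
  note c = card_columns[folded S1_def] card_rows[folded S2_def]
  have sub: "cut \<subseteq> f ` S1 \<union> g ` S2"
  proof
    fix z assume z: "z \<in> cut"
    obtain x y where xy: "z = (x, y)" by (cases z)
    from cut_cases[OF z[unfolded xy]] show "z \<in> f ` S1 \<union> g ` S2"
    proof (elim disjE exE conjE)
      fix a b assume "x = (a, b, False)" "y = (a, b - 1, True)" "0 \<le> a" "a < k" "0 \<le> height a b" "height a b \<le> 2 * k"
      then have "z \<in> f ` S1" by (intro image_eqI[of _ _ "(a, b)"]) (simp_all add: xy f_def S1_def)
      then show ?thesis by blast
    next
      fix a b assume "x = (a, b, False)" "y = (a, b, True)" "0 \<le> b" "b < l" "height a b = 0"
      then have "z \<in> g ` S2" by (intro image_eqI[of _ _ "(a, b)"]) (simp_all add: xy g_def S2_def)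
      then show ?thesis by blast
    next
      fix a b assume "x = (a - 1, b, True)" "y = (a, b, False)" "0 \<le> b" "b < l" "- 2 * l < height a b" "height a b < 0"
      then have "z \<in> g ` S2" by (intro image_eqI[of _ _ "(a, b)"]) (simp_all add: xy g_def S2_def)
      then show ?thesis by blast
    qed
  qed
  have fin: "finite (f ` S1)" "finite (g ` S2)" using c by simp_all
  then show "finite cut" using finite_subset[OF sub] by simp
  have "card cut \<le> card (f ` S1 \<union> g ` S2)" using fin by (intro card_mono[OF _ sub]) simp
  also have "\<dots> \<le> card S1 + card S2"
    using card_Un_le[of "f ` S1" "g ` S2"] card_image_le[OF c(1), of f] card_image_le[OF c(3), of g] by linarith
  finally show "int (card cut) \<le> 3 * k" using c lk by linarith
qed

end

section \<open>Triangular pieces: geometry\<close>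

lemma Re_omega [simp]: "Re \<omega> = 1 / 2" and Im_omega [simp]: "Im \<omega> = sqrt 3 / 2"
  by (simp_all add: \<omega>_def cos_60 sin_60)

lemma omega_sq: "\<omega> * \<omega> = \<omega> - 1"
  by (simp add: complex_eq_iff field_simps)

lemma omega_sq': "\<omega> * (\<omega> * c) = \<omega> * c - c"
  unfolding mult.assoc[symmetric] omega_sq by (simp add: algebra_simps)

lemma tlat_eq [simp]: "tlat a b = tlat c d \<longleftrightarrow> a = c \<and> b = d"
  by (auto simp: tlat_def complex_eq_iff)

lemma affine_convex_hull:
  fixes m :: complex
  shows "(\<lambda>w. c + m * w) ` (convex hull S) = convex hull ((\<lambda>w. c + m * w) ` S)"
proof -
  have lin: "linear ((*) m)" by (simp add: bounded_linear.linear bounded_linear_mult_right)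
  have "(\<lambda>w. c + m * w) ` X = (+) c ` ((*) m ` X)" for X by (simp add: image_image)
  then show ?thesis by (simp add: convex_hull_translation convex_hull_linear_image[OF lin])
qed

lemma affine_interior:
  fixes m :: complex
  assumes "m \<noteq> 0"
  shows "(\<lambda>w. c + m * w) ` interior S = interior ((\<lambda>w. c + m * w) ` S)"
proof -
  have lin: "linear ((*) m)" by (simp add: bounded_linear.linear bounded_linear_mult_right)
  have inj: "inj ((*) m)" using assms by (simp add: inj_on_def)
  have "(\<lambda>w. c + m * w) ` X = (+) c ` ((*) m ` X)" for X by (simp add: image_image)
  then show ?thesis by (simp add: interior_translation interior_injective_linear_image[OF lin inj])
qed

definition meets :: "complex set \<Rightarrow> complex set \<Rightarrow> bool" where
  "meets T S \<longleftrightarrow> convex hull S \<inter> interior (convex hull T) \<noteq> {}"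

lemma meets_affine:
  assumes "m \<noteq> 0" "(\<lambda>w. c + m * w) ` T = T"
  shows "meets T ((\<lambda>w. c + m * w) ` S) \<longleftrightarrow> meets T S"
proof -
  let ?A = "\<lambda>w. c + m * w"
  have inj: "inj ?A" using assms by (simp add: inj_on_def)
  have "interior (convex hull T) = ?A ` interior (convex hull T)"
    using assms affine_interior[OF assms(1), of c "convex hull T"] affine_convex_hull[of c m T] by simp
  then have "convex hull (?A ` S) \<inter> interior (convex hull T) = ?A ` (convex hull S) \<inter> ?A ` interior (convex hull T)"
    by (simp add: affine_convex_hull)
  also have "\<dots> = ?A ` (convex hull S \<inter> interior (convex hull T))" by (rule image_Int[OF inj, symmetric])
  finally show ?thesis by (simp add: meets_def)
qed

text \<open>The signed distance from the line through \<open>0\<close> and \<open>z\<close>, scaled by the norm of \<open>z\<close>.\<close>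

definition side_height :: "complex \<Rightarrow> complex \<Rightarrow> real" where
  "side_height z w = Im (cnj z * w)"

lemma side_height_inner: "side_height z w = inner (\<i> * z) w"
  by (simp add: side_height_def inner_complex_def algebra_simps)

text \<open>Separation: otherwise the hull of \<open>S\<close> lies in the closed lower half-plane
  and the interior of the hull of \<open>T\<close> in the open upper one.\<close>

lemma meets_side_height:
  assumes "z \<noteq> 0" "meets T S" "\<And>w. w \<in> T \<Longrightarrow> 0 \<le> side_height z w"
  shows "\<exists>w\<in>S. 0 < side_height z w"
proof (rule ccontr)
  assume "\<not> (\<exists>w\<in>S. 0 < side_height z w)"
  then have "S \<subseteq> {w. inner (\<i> * z) w \<le> 0}" by (auto simp: side_height_inner not_less)
  then have S: "convex hull S \<subseteq> {w. inner (\<i> * z) w \<le> 0}"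
    by (rule hull_minimal) (rule convex_halfspace_le)
  have "T \<subseteq> {w. inner (\<i> * z) w \<ge> 0}" using assms(3) by (auto simp: side_height_inner)
  then have "convex hull T \<subseteq> {w. inner (\<i> * z) w \<ge> 0}"
    by (rule hull_minimal) (rule convex_halfspace_ge)
  then have "interior (convex hull T) \<subseteq> interior {w. inner (\<i> * z) w \<ge> 0}" by (rule interior_mono)
  also have "\<dots> = {w. inner (\<i> * z) w > 0}" using assms(1) by (intro interior_halfspace_ge) simp
  finally show False using S assms(2) by (force simp: meets_def)
qed

lemma continuous_side_height [continuous_intros]:
  "continuous_on A f \<Longrightarrow> continuous_on A (\<lambda>w. side_height z (f w))"
  unfolding side_height_def by (intro continuous_intros)

text \<open>The three side heights divided by their constant sum \<open>M\<close> are the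
  barycentric coordinates of \<open>w\<close>, and their positivity is an open condition.\<close>

lemma interior_triangle:
  fixes z w :: complex
  defines "\<rho> \<equiv> (\<lambda>w. z + \<omega>\<^sup>2 * w)"
  assumes "z \<noteq> 0" "0 < side_height z w" "0 < side_height z (\<rho> w)" "0 < side_height z (\<rho> (\<rho> w))"
  shows "w \<in> interior (convex hull {0, z, \<omega> * z})"
proof -
  define U where "U = {w. 0 < side_height z w} \<inter> {w. 0 < side_height z (\<rho> w)} \<inter> {w. 0 < side_height z (\<rho> (\<rho> w))}"
  have "open U"
    unfolding U_def \<rho>_def by (intro open_Int open_Collect_less continuous_intros)
  have o2: "\<omega>\<^sup>2 = \<omega> - 1" by (simp add: power2_eq_square omega_sq)
  define M where "M = (cmod z)\<^sup>2 * (sqrt 3 / 2)"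
  have M: "0 < M" using assms(2) by (simp add: M_def)
  have s: "sqrt 3 * sqrt 3 = 3" by simp
  have zz: "(cmod z)\<^sup>2 = Re z * Re z + Im z * Im z" using cmod_power2[of z] by (simp only: power2_eq_square)
  have sum: "side_height z w + side_height z (\<rho> w) + side_height z (\<rho> (\<rho> w)) = M" for w
    unfolding side_height_def \<rho>_def o2 M_def zz by (simp add: algebra_simps)
  have comb: "of_real M * w = of_real (side_height z (\<rho> w)) * z + of_real (side_height z w) * (\<omega> * z)" for w
    unfolding side_height_def \<rho>_def o2 M_def zz complex_eq_iff by (simp add: algebra_simps)
  have "U \<subseteq> convex hull {0, z, \<omega> * z}"
  proof
    fix w assume w: "w \<in> U"
    have "w = (side_height z (\<rho> (\<rho> w)) / M) *\<^sub>R 0 + (side_height z (\<rho> w) / M) *\<^sub>R z + (side_height z w / M) *\<^sub>R (\<omega> * z)"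
    proof -
      have "of_real M * w = of_real M * ((side_height z (\<rho> w) / M) *\<^sub>R z + (side_height z w / M) *\<^sub>R (\<omega> * z))"
        unfolding comb[of w] using M by (simp add: scaleR_conv_of_real algebra_simps)
      then show ?thesis using M by simp
    qed
    moreover have "side_height z (\<rho> (\<rho> w)) / M + side_height z (\<rho> w) / M + side_height z w / M = 1"
      using sum[of w] M by (simp add: add_divide_distrib[symmetric])
    moreover have nn: "0 \<le> side_height z (\<rho> (\<rho> w)) / M" "0 \<le> side_height z (\<rho> w) / M" "0 \<le> side_height z w / M"
      using w M by (simp_all add: U_def)
    ultimately show "w \<in> convex hull {0, z, \<omega> * z}"
      unfolding convex_hull_3 using nn by blast
  qed
  then have "U \<subseteq> interior (convex hull {0, z, \<omega> * z})" using \<open>open U\<close> by (rule interior_maximal)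
  moreover have "w \<in> U" using assms by (simp add: U_def)
  ultimately show ?thesis by blast
qed

context hex
begin

definition z :: complex where "z = tlat k l"
definition rho :: "complex \<Rightarrow> complex" where "rho = (\<lambda>w. z + \<omega>\<^sup>2 * w)"
definition sig :: "complex \<Rightarrow> complex" where "sig = (\<lambda>w. (1 + \<omega>) * z - w)"
definition verts :: "tri \<Rightarrow> (int \<times> int) set" where
  "verts = (\<lambda>(a, b, t). if t then {(a + 1, b), (a, b + 1), (a + 1, b + 1)} else {(a, b), (a + 1, b), (a, b + 1)})"
definition pos :: "tri \<Rightarrow> complex set" where
  "pos x = (\<lambda>(a, b). tlat a b) ` verts x"

lemma z_nonzero: "z \<noteq> 0"
proof
  assume "z = 0"
  then have "tlat k l = tlat 0 0" by (simp add: z_def tlat_def)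
  then show False using k0 by simp
qed

lemma tl_inj: "inj (\<lambda>(a, b). tlat a b)"
  by (auto simp: inj_def)

lemma rho_tlat: "rho (tlat a b) = tlat (k - a - b) (l + a)"
  by (simp add: rho_def z_def tlat_def power2_eq_square omega_sq' algebra_simps)

lemma rho_pos: "rho ` pos x = pos (rot x)"
  by (cases x) (auto simp: pos_def verts_def rot_def rho_tlat insert_commute algebra_simps)

text \<open>Conjugation by \<open>rho\<close> carries the half-turn about the midpoint of side 0 to
  the half-turn about the midpoint of side 1.\<close>

lemma sig_rho: "sig (rho w) = rho (z - w)"
  by (simp add: sig_def rho_def power2_eq_square omega_sq' omega_sq algebra_simps)

lemma minus_pos: "(\<lambda>w. z - w) ` pos x = pos (mir x)"
proof -
  have "z - tlat a b = tlat (k - a) (l - b)" for a b by (simp add: z_def tlat_def algebra_simps)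
  then show ?thesis by (cases x) (auto simp: pos_def verts_def mir_def insert_commute algebra_simps)
qed

lemma sig_pos: "sig ` pos (rot x) = pos (rot (mir x))"
proof -
  have "sig ` pos (rot x) = rho ` (\<lambda>w. z - w) ` pos x" by (simp add: rho_pos[symmetric] image_image sig_rho)
  then show ?thesis by (simp add: minus_pos rho_pos)
qed

text \<open>The first coordinates of the vertices sum to \<open>3 * a + 1\<close> or
  \<open>3 * a + 2\<close>, likewise the second ones, so residues modulo 3 reveal the type and
  quotients the position.\<close>

lemma verts_inj: "verts x = verts y \<longleftrightarrow> x = y"
proof
  assume eq: "verts x = verts y"
  obtain a b t where x: "x = (a, b, t)" by (cases x)
  obtain c d s where y: "y = (c, d, s)" by (cases y)
  have s: "(\<Sum>p\<in>verts (a, b, t). fst p) = 3 * a + (if t then 2 else 1)"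
    "(\<Sum>p\<in>verts (a, b, t). snd p) = 3 * b + (if t then 2 else 1)" for a b t
    by (auto simp: verts_def)
  have "3 * a + (if t then 2 else 1) = 3 * c + (if s then 2 else 1)"
    "3 * b + (if t then 2 else 1) = 3 * d + (if s then 2 else 1)"
    using s[of a b t] s[of c d s] eq by (simp_all add: x y)
  then show "x = y" unfolding x y by (cases t; cases s; simp; presburger)
qed simp

lemma pos_inj: "inj pos"
  unfolding inj_def pos_def inj_image_eq_iff[OF tl_inj] by (simp add: verts_inj del: split_paired_All)

text \<open>The assumption is a check of finitely many relative positions, made inside the proof of
  the concluding theorem.\<close>

lemma adj_pos:
  assumes "\<And>x y. adj x y \<longleftrightarrow> x \<noteq> y \<and> card (verts x \<inter> verts y) = 2"
  shows "adj x y \<longleftrightarrow> x \<noteq> y \<and> card (pos x \<inter> pos y) = 2"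
proof -
  have "pos x \<inter> pos y = (\<lambda>(a, b). tlat a b) ` (verts x \<inter> verts y)"
    unfolding pos_def by (rule image_Int[OF tl_inj, symmetric])
  then have "card (pos x \<inter> pos y) = card (verts x \<inter> verts y)"
    using card_image[OF inj_on_subset[OF tl_inj subset_UNIV]] by metis
  then show ?thesis using assms by simp
qed

lemma unit_triangles_eq: "unit_triangles = range pos"
proof -
  have "pos (a, b, False) = {tlat a b, tlat (a + 1) b, tlat a (b + 1)}"
    "pos (a, b, True) = {tlat (a + 1) b, tlat a (b + 1), tlat (a + 1) (b + 1)}" for a b
    by (auto simp: pos_def verts_def)
  then show ?thesis unfolding unit_triangles_def
    by (auto simp: image_iff) (metis (full_types))+
qed

abbreviation "T \<equiv> {0, z, \<omega> * z}"

lemma rho_T: "rho ` T = T"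
proof -
  have 1: "1 + \<omega>\<^sup>2 = \<omega>" and 3: "\<omega>\<^sup>2 * \<omega> = - 1" by (simp_all add: power2_eq_square omega_sq algebra_simps)
  have "rho 0 = z" "rho z = \<omega> * z" "rho (\<omega> * z) = 0"
  proof -
    show "rho 0 = z" by (simp add: rho_def)
    have "rho z = (1 + \<omega>\<^sup>2) * z" by (simp add: rho_def algebra_simps)
    then show "rho z = \<omega> * z" by (simp add: 1)
    have "rho (\<omega> * z) = (1 + \<omega>\<^sup>2 * \<omega>) * z" by (simp add: rho_def algebra_simps)
    then show "rho (\<omega> * z) = 0" by (simp add: 3)
  qed
  then show ?thesis by auto
qed

lemma meets_rot: "meets T (pos (rot x)) \<longleftrightarrow> meets T (pos x)"
proof -
  have "\<omega> \<noteq> 0" by (simp add: complex_eq_iff)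
  then show ?thesis
    using meets_affine[of "\<omega>\<^sup>2" z T "pos x"] rho_T rho_pos[of x] by (simp add: rho_def)
qed

lemma meets_rot_pow: "meets T (pos ((rot ^^ n) x)) \<longleftrightarrow> meets T (pos x)"
  by (induction n) (auto simp: meets_rot)

lemma side_height_tlat: "side_height z (tlat a b) = sqrt 3 / 2 * real_of_int (b * k - a * l)"
  by (simp add: side_height_def z_def tlat_def algebra_simps)

lemma side_height_T: "w \<in> T \<Longrightarrow> 0 \<le> side_height z w"
proof -
  have "side_height z (\<omega> * z) = sqrt 3 / 2 * ((Re z)\<^sup>2 + (Im z)\<^sup>2)"
    by (simp add: side_height_def power2_eq_square algebra_simps)
  then have "0 \<le> side_height z (\<omega> * z)" by (simp only:) simp
  then show "w \<in> T \<Longrightarrow> 0 \<le> side_height z w" by (auto simp: side_height_def)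
qed

lemma meets_above:
  assumes "meets T (pos x)"
  shows "above x"
proof -
  obtain a b t where x: "x = (a, b, t)" by (cases x)
  from meets_side_height[OF z_nonzero assms side_height_T]
  obtain w where "w \<in> pos x" "0 < side_height z w" by blast
  then obtain c d where cd: "(c, d) \<in> verts x" "0 < side_height z (tlat c d)" by (auto simp: pos_def)
  then have "0 < real_of_int (d * k - c * l)" by (simp add: side_height_tlat zero_less_mult_iff)
  then have "0 < d * k - c * l" by linarith
  moreover have "d \<le> b + 1" "a \<le> c" using cd(1) by (auto simp: x verts_def split: if_splits)
  then have "d * k \<le> (b + 1) * k" "a * l \<le> c * l" using k0 l0 by (auto intro!: mult_right_mono)
  ultimately show ?thesis by (simp add: x above_def)
qed

definition cen :: "tri \<Rightarrow> complex" where
  "cen = (\<lambda>(a, b, t). if t then (tlat (a + 1) b + tlat a (b + 1) + tlat (a + 1) (b + 1)) / 3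
     else (tlat a b + tlat (a + 1) b + tlat a (b + 1)) / 3)"

lemma cen_hull: "cen x \<in> convex hull (pos x)"
proof -
  have *: "(p + q + r) / 3 \<in> convex hull {p, q, r}" for p q r :: complex
    unfolding convex_hull_3
    by (rule CollectI, rule exI[of _ "1/3"], rule exI[of _ "1/3"], rule exI[of _ "1/3"])
      (simp add: scaleR_conv_of_real field_simps)
  show ?thesis by (cases x) (auto simp: cen_def pos_def verts_def *)
qed

lemma rho_cen: "rho (cen x) = cen (rot x)"
proof -
  have r: "rho ((p + q + r) / 3) = (rho p + rho q + rho r) / 3" for p q r
    by (simp add: rho_def field_simps)
  obtain a b t where x: "x = (a, b, t)" by (cases x)
  show ?thesis
    unfolding x cen_def prod.case if_distrib[of rho] r rho_tlat by (simp add: rot_def algebra_simps)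
qed

lemma inner_cen: "inner x \<Longrightarrow> 0 < side_height z (cen x)"
proof -
  assume i: "inner x"
  obtain a b t where x: "x = (a, b, t)" by (cases x)
  have ab: "0 \<le> a" "l \<le> b" "a + b + 1 \<le> k" using i by (auto simp: x inner_def of_bool_def split: if_splits)
  have "l * k \<le> b * k" "(a + 1) * l \<le> k * l" using ab k0 l0 by (auto intro!: mult_right_mono)
  moreover have "(a + 1) * l = a * l + l" "k * l = l * k" by (simp_all add: algebra_simps)
  ultimately have *: "a * l + l \<le> b * k" by linarith
  define \<tau> :: int where "\<tau> = (if t then 2 else 1)"
  have eq: "side_height z (cen x) = sqrt 3 / 6 * real_of_int (3 * (b * k - a * l) + \<tau> * (k - l))"
  proof -
    have lin: "side_height z ((p + q + r) / 3) = (side_height z p + side_height z q + side_height z r) / 3" for p q r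
    proof -
      have "cnj z * ((p + q + r) / 3) = (cnj z * p + cnj z * q + cnj z * r) / 3"
        by (simp add: distrib_left add_divide_distrib)
      then show ?thesis by (simp add: side_height_def)
    qed
    show ?thesis
      unfolding x cen_def prod.case if_distrib[of "side_height z"] lin side_height_tlat
      by (simp add: \<tau>_def field_simps)
  qed
  have t0: "0 \<le> \<tau> * (k - l)" using lk by (simp add: \<tau>_def)
  have "0 < 3 * (b * k - a * l) + \<tau> * (k - l)"
  proof (cases "l = 0")
    case True
    have "0 < \<tau> * k" "0 \<le> b * k" using k0 ab True by (auto simp: \<tau>_def)
    then show ?thesis using True by simp
  next
    case False
    then have "0 < 3 * (b * k - a * l)" using * l0 by simp
    then show ?thesis using t0 by (rule add_pos_nonneg)
  qed
  then show ?thesis unfolding eq by (simp only: zero_less_mult_iff of_int_0_less_iff) simp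
qed

text \<open>The tile is rotated into the inner triangle or the box. The common point with the
  interior is its barycentre in the first case and its vertex highest above side 0,
  \<open>tlat a (b + 1)\<close>, in the second.\<close>

lemma P_meets:
  assumes "x \<in> P"
  shows "meets T (pos x)"
proof -
  obtain j where j: "j < 3" "inner ((rot ^^ j) x) \<or> (case (rot ^^ j) x of (a, b, t) \<Rightarrow> 0 \<le> a \<and> b < l)"
    using region_cases[of x] by (elim exE conjE)
  define y where "y = (rot ^^ j) x"
  have y: "y \<in> P" using assms by (simp add: y_def rot_pow_P)
  obtain a b t where abt: "y = (a, b, t)" by (cases y)
  have "meets T (pos y)"
  proof (cases "inner y")
    case True
    have "cen y \<in> interior (convex hull T)"
      using True inner_rot inner_cen z_nonzero
      by (intro interior_triangle) (simp_all add: rho_def[symmetric] fun_cong[OF rho_def, symmetric] rho_cen)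
    then show ?thesis using cen_hull[of y] by (auto simp: meets_def)
  next
    case False
    have ab: "0 \<le> a" "b < l" using j(2) False unfolding y_def[symmetric] abt by auto
    have "box y" using bottom_box[OF _ ab] P_above[OF y] by (simp add: abt)
    then have b: "0 \<le> b" "a < k" by (simp_all add: abt box_def)
    have 1: "0 < (b + 1) * k - a * l" using P_above[OF y] by (simp add: abt above_def)
    have p: "0 \<le> a * k" "0 \<le> a * l" "0 < (b + 1) * l" "0 < k * (k - a)" "0 \<le> (k + l) * (l - 1 - b)"
      using ab b k0 l0 by (auto intro!: mult_nonneg_nonneg mult_pos_pos)
    have r1: "rho (tlat a (b + 1)) = tlat (k - a - (b + 1)) (l + a)" by (simp add: rho_tlat)
    have r2: "rho (rho (tlat a (b + 1))) = tlat (b + 1 - l) (l + (k - a - (b + 1)))" by (simp add: rho_tlat)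
    have "(l + a) * k - (k - a - (b + 1)) * l = a * k + a * l + (b + 1) * l" by (simp add: algebra_simps)
    then have 2: "0 < (l + a) * k - (k - a - (b + 1)) * l" using p by linarith
    have "(l + (k - a - (b + 1))) * k - (b + 1 - l) * l = k * (k - a) + (k + l) * (l - 1 - b)" by (simp add: algebra_simps)
    then have 3: "0 < (l + (k - a - (b + 1))) * k - (b + 1 - l) * l" using p by linarith
    have pos3: "0 < sqrt 3 / 2 * real_of_int i" if "0 < i" for i using that by simp
    have "tlat a (b + 1) \<in> interior (convex hull T)"
    proof (rule interior_triangle[OF z_nonzero])
      show "0 < side_height z (tlat a (b + 1))" unfolding side_height_tlat by (rule pos3[OF 1])
      show "0 < side_height z (z + \<omega>\<^sup>2 * tlat a (b + 1))"
        using r1 unfolding rho_def by (simp only: side_height_tlat pos3[OF 2])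
      show "0 < side_height z (z + \<omega>\<^sup>2 * (z + \<omega>\<^sup>2 * tlat a (b + 1)))"
        using r2 unfolding rho_def by (simp only: side_height_tlat pos3[OF 3])
    qed
    moreover have "tlat a (b + 1) \<in> pos y" by (auto simp: abt pos_def verts_def)
    then have "tlat a (b + 1) \<in> convex hull (pos y)" by (rule hull_inc)
    ultimately show ?thesis by (auto simp: meets_def)
  qed
  then show ?thesis by (simp add: y_def meets_rot_pow)
qed

lemma piece_eq: "{S \<in> unit_triangles. convex hull S \<inter> interior (convex hull T) \<noteq> {}} = pos ` P"
proof -
  have "meets T (pos x) \<longleftrightarrow> x \<in> P" for x
  proof
    assume m: "meets T (pos x)"
    then have "meets T (pos (rot x))" "meets T (pos (rot (rot x)))" by (simp_all only: meets_rot)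
    then show "x \<in> P" using m meets_above unfolding P_def by blast
  qed (rule P_meets)
  then show ?thesis unfolding unit_triangles_eq meets_def[symmetric] by blast
qed

end

lemma hex_gc_owned:
  assumes h: "hex k l" and G: "finite_graph V E"
    and A: "\<And>x y. hex.adj x y \<longleftrightarrow> x \<noteq> y \<and> card (hex.verts x \<inter> hex.verts y) = 2"
    and L: "\<And>p. p \<in> V \<Longrightarrow> bij_betw (L p) (nbrs E p) {..<3}"
  shows "gc_owned V E 3 L (hex.pos) (hex.P k l) (hex.rot k l) (hex.mir k l) hex.adj (hex.rho k l) (hex.sig k l) (hex.Own k l) {}"
proof -
  interpret hex k l by (rule h)
  show ?thesis
  \<comment> \<open>Goals are numbered in the order of the locale assumptions: 14 is
    \<open>cross_unique\<close>, 21 \<open>cover\<close>, 22 \<open>far_adj\<close> and 24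
    \<open>cross_adj\<close>.\<close>
  proof (intro gc_owned.intro gc_system.intro gc_owned_axioms.intro, goal_cases)
    case (22 t u i j)
    then show ?case using far_adj[of t u i j] by blast
  next
    case (21 t)
    then show ?case using cover[of t] by simp
  next
    case (24 t u)
    then show ?case using cross_adj[of t u] by blast
  next
    case (14 t i j)
    then show ?case by (rule cross_unique)
  qed (fact G L pos_inj rho_pos sig_pos rot_pow3 mir_mir P_rot finite_P adj_pos[OF A] adj_rot adj_mir
      Own_P Own_rot Own_mir | simp)+
qed

section \<open>Trivalent graphs\<close>

context hex
begin

text \<open>Towards the degree of the glued graph: the lattice neighbour under a tile, if it does
  not rise above side 0, must belong to the piece across this side. For \<open>b = 0\<close> it lies
  under the box and is checked directly; otherwise its mirror image is handled by
  \<open>box_P\<close>.\<close>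

lemma far_nbr_up:
  assumes t: "(a, b, False) \<in> P" and na: "\<not> above (a, b - 1, True)"
  shows "mir (a, b - 1, True) \<in> P" "l = 0 \<or> box (a, b, False)"
proof -
  have 1: "a * l < (b + 1) * k" and 2: "0 < (a + 1) * (k + l) + b * l" and 3: "0 < (k - a) * k + (l - b) * (k + l)"
    using t unfolding P_def above_def rot_def by (auto simp: algebra_simps)
  have 4: "b * k \<le> a * l" using na by (simp add: above_def)
  show lb: "l = 0 \<or> box (a, b, False)"
  proof (cases "l = 0")
    case False
    then have "b * k < (a + 1) * l" using 4 l0 by (simp add: algebra_simps)
    then have "above (mir (a, b, False))" by (simp add: above_def mir_def above_mir[simplified])
    then show ?thesis using crossing_box[OF t] by blast
  qed simp
  have a: "0 \<le> a \<and> a < k \<and> 0 \<le> b"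
  proof (cases "l = 0")
    case True
    then show ?thesis using 1 2 3 4 k0 by (auto simp: zero_less_mult_iff mult_le_0_iff)
  next
    case False
    then show ?thesis using lb by (simp add: box_def)
  qed
  show "mir (a, b - 1, True) \<in> P"
  proof (cases "b = 0")
    case False
    then have "box (a, b - 1, True)" using lb a 4 k0 by (auto simp: box_def mult_le_0_iff)
    moreover have "above (mir (a, b - 1, True))"
    proof -
      have "(b - 1) * k < (a + 1) * l" using 4 l0 k0 by (simp add: algebra_simps)
      then show ?thesis by (simp add: above_def mir_def algebra_simps)
    qed
    ultimately show ?thesis using box_P box_mir by blast
  next
    case True
    have p: "0 \<le> a * l" "0 < (k - a) * k" "0 < (a + 1) * k" using a l0 k0 by auto
    have q: "(k - 1 - a) * l \<le> k * l" using a l0 by (intro mult_right_mono) auto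
    show ?thesis
      unfolding P_def True
    proof (intro CollectI conjI)
      show "above (mir (a, 0 - 1, True))" using q k0 by (simp add: above_def mir_def algebra_simps)
      have "0 < (k - a) * (k + l) + l * l" using a k0 l0 by (intro add_pos_nonneg mult_pos_pos) auto
      then show "above (rot (mir (a, 0 - 1, True)))" by (simp add: above_def mir_def rot_def algebra_simps)
      show "above (rot (rot (mir (a, 0 - 1, True))))" using p by (simp add: above_def mir_def rot_def algebra_simps)
    qed
  qed
qed

text \<open>From an owned tile the piece can be left through side 0 only downwards from an upward
  triangle; every other neighbour still rises above the side.\<close>

lemma far_nbr:
  assumes t: "t \<in> Own" and y: "adj t y" "\<not> above y"
  shows "mir y \<in> P" "l = 0 \<or> box t"
proof -
  obtain a b s where ts: "t = (a, b, s)" by (cases t)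
  obtain c d r where yr: "y = (c, d, r)" by (cases y)
  have a: "above t" using t Own_P P_above by blast
  have m: "mine t" using t by (simp add: Own_def)
  have 1: "a * l < (b + 1) * k" using a by (simp add: ts above_def)
  have up: "s = False \<and> y = (a, b - 1, True)"
  proof (cases s)
    case True
    then have "0 < height a b" using m by (simp add: ts mine_def)
    then have 2: "2 * (a * l) + l < 2 * (b * k) + k" by (simp add: height_def algebra_simps)
    from True y(1) have r: "\<not> r" "(a, b) \<in> {(c, d), (c - 1, d), (c, d - 1)}" by (auto simp: ts yr adj_def)
    then consider "c = a" "d = b" | "c = a + 1" "d = b" | "c = a" "d = b + 1" by auto
    then have "above y"
    proof cases
      case 3
      then show ?thesis using 1 k0 by (simp add: yr above_def algebra_simps)
    qed (use 1 2 lk in \<open>simp_all add: yr above_def algebra_simps\<close>)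
    then show ?thesis using y(2) by simp
  next
    case False
    then have r: r "(c, d) \<in> {(a, b), (a - 1, b), (a, b - 1)}" using y(1) by (auto simp: ts yr adj_def)
    moreover have "(c, d) \<noteq> (a, b)" using 1 y(2) by (auto simp: yr above_def)
    moreover have "(c, d) \<noteq> (a - 1, b)" using 1 y(2) l0 by (auto simp: yr above_def algebra_simps)
    ultimately show ?thesis using False by (auto simp: yr)
  qed
  have "(a, b, False) \<in> P" using t Own_P up ts by blast
  then show "mir y \<in> P" "l = 0 \<or> box t" using far_nbr_up[of a b] y(2) up ts by auto
qed

lemma own_nbr:
  assumes t: "t \<in> Own" and y: "adj t y" "y \<notin> P"
  shows "\<exists>j<3. mir ((rot ^^ j) y) \<in> P \<and> (l = 0 \<or> box ((rot ^^ j) t))"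
proof -
  have e: "(rot ^^ 0) x = x" "(rot ^^ 1) x = rot x" "(rot ^^ 2) x = rot (rot x)" for x by (simp_all add: eval_nat_numeral)
  have "\<exists>j<3. \<not> above ((rot ^^ j) y)"
  proof (rule ccontr)
    assume "\<not> (\<exists>j<3. \<not> above ((rot ^^ j) y))"
    then have *: "above ((rot ^^ j) y)" if "j < 3" for j using that by blast
    have "above ((rot ^^ 0) y)" "above ((rot ^^ 1) y)" "above ((rot ^^ 2) y)" by (rule *, simp)+
    then show False using y(2) unfolding P_def e by blast
  qed
  then obtain j where j: "j < 3" "\<not> above ((rot ^^ j) y)" by blast
  have "(rot ^^ j) t \<in> Own" using t by (induction j) (auto simp: Own_rot)
  from far_nbr[OF this _ j(2)] show ?thesis using j(1) y(1) by (auto simp: rot_pow_adj)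
qed

lemma card_adj: "card {y. adj t y} = 3" "finite {y. adj t y}"
proof -
  obtain a b s where t: "t = (a, b, s)" by (cases t)
  have "{y. adj t y} = (if s then {(a, b, False), (a + 1, b, False), (a, b + 1, False)}
     else {(a, b, True), (a - 1, b, True), (a, b - 1, True)})"
    unfolding t by (auto simp: adj_def)
  then show "card {y. adj t y} = 3" "finite {y. adj t y}" by auto
qed

text \<open>The type is a 2-colouring of the tiles that rotations keep and that \<open>mir\<close>
  and adjacency reverse.\<close>

lemma tri_type: "snd (snd (rot x)) = snd (snd x)" "snd (snd (mir x)) = (\<not> snd (snd x))"
  "adj x y \<Longrightarrow> snd (snd x) = (\<not> snd (snd y))"
  by (cases x; cases y; auto simp: rot_def mir_def adj_def)+

lemma tri_type_pow: "snd (snd ((rot ^^ n) x)) = snd (snd x)"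
  by (induction n) (auto simp: tri_type)

end

locale hex_graph = hex k l + gc_owned V E 3 L hex.pos "hex.P k l" "hex.rot k l" "hex.mir k l" hex.adj
    "hex.rho k l" "hex.sig k l" "hex.Own k l" "{}"
  for k l V E L
begin

lemma tie_set_empty: "tie_set = {}"
  by (auto simp: tie_set_def C3_def)

lemma C1_cut: "C1 = hex.cut k l"
  by (simp add: C1_def cut_def)

lemma cut_bound:
  "real (card C1) + real (card C2) / 2 \<le> 3 * real_of_int k / real_of_int (k\<^sup>2 + k * l + l\<^sup>2) * real (card Own)"
  "Own \<noteq> {}"
proof -
  define N where "N = k\<^sup>2 + k * l + l\<^sup>2"
  have N: "0 < N" using k0 l0 by (simp add: N_def add_pos_nonneg)
  have O: "N \<le> int (card Own)" using card_Own by (simp add: N_def)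
  show "Own \<noteq> {}" using O N by auto
  have "C2 = {}" by (auto simp: C2_def)
  moreover have "int (card C1) \<le> 3 * k" unfolding C1_cut by (rule card_cut)
  then have "real (card C1) \<le> 3 * real_of_int k" by linarith
  moreover have "1 \<le> real (card Own) / real_of_int N" using O N by (simp add: le_divide_eq)
  then have "3 * real_of_int k * 1 \<le> 3 * real_of_int k * (real (card Own) / real_of_int N)"
    using k0 by (intro mult_left_mono) auto
  ultimately show "real (card C1) + real (card C2) / 2 \<le> 3 * real_of_int k / real_of_int (k\<^sup>2 + k * l + l\<^sup>2) * real (card Own)"
    unfolding N_def[symmetric] by simp
qed

lemma upper: "1 \<le> i \<Longrightarrow> i \<le> card V \<Longrightarrow>
    lap_eig G i \<le> 3 * real_of_int k / real_of_int (k\<^sup>2 + k * l + l\<^sup>2) * lap_eig (V, E) i"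
  by (rule lap_eig_lift[OF tie_set_empty cut_bound(2) _ _ cut_bound(1)])

lemma own_rep:
  assumes "X \<in> W"
  shows "\<exists>p t. p \<in> V \<and> t \<in> Own \<and> X = cl p t"
proof -
  obtain p t where pt: "p \<in> V" "t \<in> P" "X = cl p t" using assms unfolding W_eq by blast
  show ?thesis
  proof (cases "t \<in> Own")
    case True
    then show ?thesis using pt by blast
  next
    case False
    then obtain q where q: "(p, q) \<in> E" "mir (turn (L p q) t) \<in> Own" using far_cases[OF pt(1,2)] by blast
    have "X = pic p q (turn (L p q) t)" using q pt by (simp add: pic_turn)
    also have "\<dots> = cl q ((rot ^^ (L q p)) (mir (turn (L p q) t)))" using q by (simp add: pic_other)
    finally show ?thesis using q edgeD[OF q(1)] gc_owned.rot_pow_Own[OF gc_owned_axioms] by blast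
  qed
qed

lemma cl_neq_same: "p \<in> V \<Longrightarrow> t \<in> P \<Longrightarrow> u \<in> P \<Longrightarrow> cl p t = cl p u \<Longrightarrow> t = u"
  using edgeD by (auto simp: cl_eq glued_def)

text \<open>The classes of the three lattice neighbours of an owned tile have to be distinct. Two
  neighbours outside the piece lie across the same side if \<open>l > 0\<close>, by
  \<open>box_unique\<close>; if \<open>l = 0\<close> they may lie across different sides, but then
  no tiles are glued.\<close>

lemma degree_ge:
  assumes "X \<in> W"
  shows "3 \<le> card (nbrs F X)"
proof -
  obtain p t where pt: "p \<in> V" "t \<in> Own" "X = cl p t" using own_rep[OF assms] by blast
  have tP: "t \<in> P" using pt(2) Own_P by blast
  have far: "\<exists>q. (p, q) \<in> E \<and> mir (turn (L p q) y) \<in> P \<and> (l = 0 \<or> hex.box k l (turn (L p q) t))"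
    if y: "adj t y" "y \<notin> P" for y
  proof -
    obtain j where j: "j < 3" "mir ((rot ^^ j) y) \<in> P" "l = 0 \<or> hex.box k l ((rot ^^ j) t)"
      using own_nbr[OF pt(2) y] by blast
    obtain q where q: "(p, q) \<in> E" "L p q = (3 - j) mod 3"
      using nbr_exists[OF pt(1), of "(3 - j) mod 3"] by auto
    have "(3 - (3 - j) mod 3) mod 3 = j" using j(1) by (cases "j = 0") auto
    then have "turn (L p q) x = (rot ^^ j) x" for x unfolding turn_def q(2) by simp
    then show ?thesis using q(1) j by metis
  qed
  \<comment> \<open>\<open>Q y\<close> is the vertex of \<open>X\<close> across whose edge
    \<open>y\<close> lies, \<open>u y\<close> the tile in its piece and \<open>\<nu> y\<close> the
    resulting class.\<close>
  define Q where "Q y = (SOME q. (p, q) \<in> E \<and> mir (turn (L p q) y) \<in> P \<and> (l = 0 \<or> hex.box k l (turn (L p q) t)))" for y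
  have Q: "(p, Q y) \<in> E" "mir (turn (L p (Q y)) y) \<in> P" "l = 0 \<or> hex.box k l (turn (L p (Q y)) t)"
    if "adj t y" "y \<notin> P" for y
    using someI_ex[OF far[OF that], folded Q_def] by blast+
  define u where "u y = (rot ^^ (L (Q y) p)) (mir (turn (L p (Q y)) y))" for y
  define \<nu> where "\<nu> y = (if y \<in> P then cl p y else cl (Q y) (u y))" for y
  have uP: "u y \<in> P" if "adj t y" "y \<notin> P" for y
    using Q(2)[OF that] unfolding u_def by (simp add: gc_system.rot_pow_P[OF gc_system_axioms])
  have tu: "mir (turn (L (Q y) p) (u y)) = turn (L p (Q y)) y" if "adj t y" "y \<notin> P" for y
    using Q(1)[OF that] edgeD[OF Q(1)[OF that]] lab_less[of "Q y" p] unfolding u_def by (simp add: mir_mir)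
  have mixed: "\<nu> y \<noteq> cl p x" if y: "adj t y" "y \<notin> P" and x: "x \<in> P" for x y
  proof
    assume "\<nu> y = cl p x"
    then have "cl p x = cl (Q y) (u y)" using y by (simp add: \<nu>_def)
    then have "turn (L p (Q y)) x = mir (turn (L (Q y) p) (u y))"
      using pt(1) x uP[OF y] edgeD[OF Q(1)[OF y]] by (auto simp: cl_eq glued_def)
    then have "x = y" using tu[OF y] turn_inj[OF lab_less[OF Q(1)[OF y]]] by simp
    then show False using x y by simp
  qed
  have im: "\<nu> ` {y. adj t y} \<subseteq> nbrs F X"
  proof
    fix Y assume "Y \<in> \<nu> ` {y. adj t y}"
    then obtain y where y: "adj t y" "Y = \<nu> y" by blast
    have "(X, Y) \<in> F"
    proof (cases "y \<in> P")
      case True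
      obtain q where q: "(p, q) \<in> E" using nbr_exists[OF pt(1), of 0] by auto
      have "X \<noteq> Y" using cl_neq_same[OF pt(1) tP True] adj_neq[OF y(1)] pt y True by (auto simp: \<nu>_def)
      moreover have "X = pic p q (turn (L p q) t)" "Y = pic p q (turn (L p q) y)"
        using q tP True pt y by (simp_all add: pic_turn \<nu>_def)
      ultimately show ?thesis
        using q tP True y(1) by (intro mem_FI[of _ _ p q "turn (L p q) t" "turn (L p q) y"]) simp_all
    next
      case False
      note Qy = Q[OF y(1) False]
      have "X \<noteq> Y" using mixed[OF y(1) False tP] pt y by auto
      moreover have "X = pic p (Q y) (turn (L p (Q y)) t)" using Qy(1) tP pt by (simp add: pic_turn)
      moreover have "Y = pic p (Q y) (turn (L p (Q y)) y)"
        using Qy(1,2) y False by (simp add: pic_other \<nu>_def u_def)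
      ultimately show ?thesis
        using Qy(1,2) tP y(1) by (intro mem_FI[of _ _ p "Q y" "turn (L p (Q y)) t" "turn (L p (Q y)) y"]) simp_all
    qed
    then show "Y \<in> nbrs F X" by (simp add: nbrs_def)
  qed
  have inj: "inj_on \<nu> {y. adj t y}"
  proof (rule inj_onI)
    fix x y assume "x \<in> {y. adj t y}" "y \<in> {y. adj t y}" and eq: "\<nu> x = \<nu> y"
    then have x: "adj t x" and y: "adj t y" by auto
    show "x = y"
    proof (cases "x \<in> P"; cases "y \<in> P")
      assume "x \<in> P" "y \<in> P"
      then show ?thesis using eq cl_neq_same[OF pt(1)] by (simp add: \<nu>_def)
    next
      assume "x \<in> P" "y \<notin> P"
      then show ?thesis using eq mixed[OF y \<open>y \<notin> P\<close> \<open>x \<in> P\<close>] by (simp add: \<nu>_def)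
    next
      assume "x \<notin> P" "y \<in> P"
      then show ?thesis using eq mixed[OF x \<open>x \<notin> P\<close> \<open>y \<in> P\<close>] by (simp add: \<nu>_def)
    next
      assume n: "x \<notin> P" "y \<notin> P"
      note Qx = Q[OF x n(1)] and Qy = Q[OF y n(2)]
      have c: "cl (Q x) (u x) = cl (Q y) (u y)" using eq n by (simp add: \<nu>_def)
      note V = edgeD[OF Qx(1)] edgeD[OF Qy(1)]
      have QQ: "Q x = Q y"
      proof (rule ccontr)
        assume ne: "Q x \<noteq> Q y"
        show False
        proof (cases "l = 0")
          case True
          have "glued (Q x) (u x) (Q y) (u y)" using c ne V uP[OF x n(1)] uP[OF y n(2)] by (simp add: cl_eq)
          then have "turn (L (Q x) (Q y)) (u x) = mir (turn (L (Q y) (Q x)) (u y))" by (simp add: glued_def)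
          moreover have "turn (L (Q x) (Q y)) (u x) \<in> P" "turn (L (Q y) (Q x)) (u y) \<in> P"
            using uP[OF x n(1)] uP[OF y n(2)] by simp_all
          ultimately show False using no_crossing_l0[OF True] by metis
        next
          case False
          then have "hex.box k l (turn (L p (Q x)) t)" "hex.box k l (turn (L p (Q y)) t)" using Qx(3) Qy(3) by auto
          then have "(3 - L p (Q x)) mod 3 = (3 - L p (Q y)) mod 3"
            unfolding turn_def by (rule box_unique) auto
          then show False using side_inj[OF Qx(1) Qy(1)] ne by blast
        qed
      qed
      then have "u x = u y" using c cl_neq_same uP x y n V by metis
      then have "turn (L p (Q x)) x = turn (L p (Q x)) y" using tu[OF x n(1)] tu[OF y n(2)] QQ by simp
      then show ?thesis using turn_inj[OF lab_less[OF Qx(1)]] by blast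
    qed
  qed
  have "card {y. adj t y} \<le> card (nbrs F X)"
    by (rule card_inj_on_le[OF inj im finite_graphD(6)[OF finite_graph_G]])
  then show ?thesis by (simp add: card_adj)
qed

text \<open>The sign compares the colour of the vertex of \<open>X\<close> with the type of the
  tile. Gluing changes both, so the sign is a function of the class; in the picture along one edge,
  adjacency changes the type alone.\<close>

lemma bipartite_lower:
  assumes A: "\<forall>(p, q)\<in>E. (p \<in> A \<longleftrightarrow> q \<notin> A)" and i: "1 \<le> i" "i \<le> card V"
  shows "lap_eig G (card W - i + 1) \<ge> 6 - 3 * real_of_int k / real_of_int (k\<^sup>2 + k * l + l\<^sup>2) * lap_eig (V, E) i"
proof -
  have A': "p \<in> A \<longleftrightarrow> q \<notin> A" if "(p, q) \<in> E" for p q using A that by auto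
  define \<epsilon> :: "('a \<times> complex set) set \<Rightarrow> complex" where
    "\<epsilon> X = (if \<exists>p t. p \<in> V \<and> t \<in> P \<and> X = cl p t \<and> (p \<in> A \<longleftrightarrow> snd (snd t)) then 1 else - 1)" for X
  have tt: "snd (snd (turn j x)) = snd (snd x)" for j x unfolding turn_def by (rule tri_type_pow)
  have \<epsilon>: "\<epsilon> (cl p t) = (if p \<in> A \<longleftrightarrow> snd (snd t) then 1 else - 1)" if pt: "p \<in> V" "t \<in> P" for p t
  proof -
    have "(p \<in> A \<longleftrightarrow> snd (snd t)) \<longleftrightarrow> (q \<in> A \<longleftrightarrow> snd (snd u))" if qu: "q \<in> V" "u \<in> P" "cl p t = cl q u" for q u
    proof -
      from qu pt consider "p = q" "t = u" | "(p, q) \<in> E" "turn (L p q) t = mir (turn (L q p) u)"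
        by (auto simp: cl_eq glued_def)
      then show ?thesis
      proof cases
        case 2
        have "snd (snd t) = snd (snd (turn (L p q) t))" by (simp add: tt)
        also have "\<dots> = (\<not> snd (snd u))" unfolding 2 by (simp add: tri_type tt)
        finally show ?thesis using A'[OF 2(1)] by blast
      qed simp
    qed
    then show ?thesis using pt unfolding \<epsilon>_def by metis
  qed
  have pic: "\<epsilon> (pic p q t) = (if p \<in> A \<longleftrightarrow> snd (snd t) then 1 else - 1)" if e: "(p, q) \<in> E" and t: "t \<in> P \<or> mir t \<in> P" for p q t
  proof (cases "t \<in> P")
    case True
    then show ?thesis using edgeD[OF e] by (simp add: pic_own \<epsilon> gc_system.rot_pow_P[OF gc_system_axioms] tri_type_pow)
  next
    case False
    then have "mir t \<in> P" using t by simp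
    then show ?thesis using edgeD[OF e] A'[OF e]
      by (simp add: pic_other[OF e] \<epsilon> gc_system.rot_pow_P[OF gc_system_axioms] tri_type_pow tri_type)
  qed
  have alt: "\<epsilon> X = - \<epsilon> Y" if XY: "(X, Y) \<in> F" for X Y
  proof -
    obtain p q t u where "(p, q) \<in> E" "t \<in> P \<or> mir t \<in> P" "u \<in> P \<or> mir u \<in> P" "adj t u" "X = pic p q t" "Y = pic p q u"
      using XY unfolding mem_F by blast
    then show ?thesis using tri_type(3)[of t u] by (simp add: pic)
  qed
  have u: "cmod (\<epsilon> X) = 1" for X by (simp add: \<epsilon>_def)
  have D: "real 3 \<le> card (nbrs F X)" if "X \<in> W" for X using degree_ge[OF that] by linarith
  show ?thesis
    using lap_eig_lift_alternating[OF tie_set_empty cut_bound(2) i cut_bound(1) alt u D] by simp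
qed

end

lemma hex_graphI:
  assumes k: "0 < k" "l \<le> k" and G: "finite_graph V E" and L: "compatible_labelling V E \<sigma> 3 L"
    and A: "\<And>x y. hex.adj x y \<longleftrightarrow> x \<noteq> y \<and> card (hex.verts x \<inter> hex.verts y) = 2"
  shows "hex_graph (int k) (int l) V E L"
    and "gc_graph (gc3_piece k l) (\<lambda>w. gc3_z k l + \<omega>\<^sup>2 * w) (\<lambda>w. (1 + \<omega>) * gc3_z k l - w) 3 L V E
      = gc_graph (hex.pos ` hex.P (int k) (int l)) (hex.rho (int k) (int l)) (hex.sig (int k) (int l)) 3 L V E"
proof -
  have h: "hex (int k) (int l)" using k by (simp add: hex_def region_def)
  interpret hex "int k" "int l" by (rule h)
  have z: "gc3_z k l = z" by (simp add: gc3_z_def z_def tlat_def)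
  have "gc_owned V E 3 L pos P rot mir adj rho sig Own {}"
    using hex_gc_owned[OF h G A, of L] L by (simp add: compatible_labelling_def)
  then show "hex_graph (int k) (int l) V E L" using h by (simp add: hex_graph_def)
  show "gc_graph (gc3_piece k l) (\<lambda>w. gc3_z k l + \<omega>\<^sup>2 * w) (\<lambda>w. (1 + \<omega>) * gc3_z k l - w) 3 L V E
      = gc_graph (pos ` P) rho sig 3 L V E"
    unfolding gc3_piece_def z piece_eq[symmetric] rho_def sig_def ..
qed

section \<open>An eigenfunction on the triangular piece\<close>

text \<open>Summation by parts; for an eigenfunction the right-hand side is twice the eigenvalue
  times the norm.\<close>

lemma sum_edge_squares:
  fixes h :: "'t \<Rightarrow> real"
  assumes "finite P" "\<And>t u. adj t u \<longleftrightarrow> adj u t"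
  shows "(\<Sum>t\<in>P. \<Sum>u\<in>{u \<in> P. adj t u}. (h t - h u)\<^sup>2) = 2 * (\<Sum>t\<in>P. h t * (\<Sum>u\<in>{u \<in> P. adj t u}. h t - h u))"
proof -
  have f: "(\<Sum>u\<in>{u \<in> P. adj t u}. g u) = (\<Sum>u\<in>P. if adj t u then g u else 0)" for t and g :: "'t \<Rightarrow> real"
    using sum.inter_filter[OF assms(1), of g "adj t"] .
  have "(\<Sum>t\<in>P. \<Sum>u\<in>P. if adj t u then (h t - h u)\<^sup>2 else 0)
     = (\<Sum>t\<in>P. \<Sum>u\<in>P. (if adj t u then h t * (h t - h u) else 0) + (if adj t u then h u * (h u - h t) else 0))"
    by (intro sum.cong refl) (simp add: power2_eq_square algebra_simps)
  also have "\<dots> = (\<Sum>t\<in>P. \<Sum>u\<in>P. if adj t u then h t * (h t - h u) else 0)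
      + (\<Sum>t\<in>P. \<Sum>u\<in>P. if adj t u then h u * (h u - h t) else 0)"
    by (simp only: sum.distrib)
  also have "(\<Sum>t\<in>P. \<Sum>u\<in>P. if adj t u then h u * (h u - h t) else 0) = (\<Sum>t\<in>P. \<Sum>u\<in>P. if adj t u then h t * (h t - h u) else 0)"
    by (subst sum.swap) (intro sum.cong refl, simp add: assms(2))
  also have "\<dots> + \<dots> = 2 * \<dots>" by simp
  also have "(\<Sum>t\<in>P. \<Sum>u\<in>P. if adj t u then h t * (h t - h u) else 0)
     = (\<Sum>t\<in>P. h t * (\<Sum>u\<in>P. if adj t u then h t - h u else 0))"
    by (simp add: sum_distrib_left if_distrib cong: if_cong)
  finally show ?thesis unfolding f .
qed

text \<open>The Dirichlet ground state of the equilateral triangle, sampled at the tile centres with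
  phases \<open>\<plusminus>\<psi>/2\<close> on the two kinds of tiles and opposite signs on them, is a Neumann eigenfunction of the
  triangular piece.\<close>

lemma triangle_phase:
  fixes \<theta> :: real
  assumes \<theta>: "0 < \<theta>" "\<theta> \<le> pi"
  obtains \<psi> where "sqrt (5 + 4 * cos \<theta>) * cos \<psi> = 2 + cos \<theta>" "sqrt (5 + 4 * cos \<theta>) * sin \<psi> = - sin \<theta>"
    "sin (\<theta> / 2 + 3 * \<psi> / 2) \<noteq> 0" "0 < sqrt (5 + 4 * cos \<theta>)"
proof -
  \<comment> \<open>Its modulus \<open>s\<close> and argument \<open>\<psi>\<close> turn
    \<open>2 * sin \<beta> + sin (\<beta> - \<theta>)\<close> into the single sine
    \<open>s * sin (\<beta> + \<psi>)\<close>.\<close>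
  define u where "u = 2 + cis (- \<theta>)"
  define s where "s = sqrt (5 + 4 * cos \<theta>)"
  define \<psi> where "\<psi> = Arg u"
  have c1: "- 1 \<le> cos \<theta>" by simp
  have "(cmod u)\<^sup>2 = 5 + 4 * cos \<theta>"
    using sin_cos_squared_add[of \<theta>] unfolding u_def cmod_power2 by (simp add: power2_eq_square algebra_simps)
  then have s: "cmod u = s" unfolding s_def by (metis norm_ge_zero real_sqrt_unique)
  have "Re u = 2 + cos \<theta>" by (simp add: u_def)
  then have "Re u > 0" using c1 by linarith
  then have u0: "u \<noteq> 0" by auto
  then have s0: "0 < s" using s by (metis zero_less_norm_iff)
  have "u = of_real s * cis \<psi>" unfolding \<psi>_def s[symmetric] using u0 by (metis rcis_cmod_Arg rcis_def)
  then have 1: "s * cos \<psi> = 2 + cos \<theta>" "s * sin \<psi> = - sin \<theta>"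
    unfolding u_def by (simp_all add: complex_eq_iff)
  \<comment> \<open>The phase of the eigenfunction at a corner tile;
    \<open>sin \<eta> \<noteq> 0\<close> is what makes the eigenfunction nonzero. The double angle
    is read off from the cube of \<open>u\<close>: if \<open>sin \<eta> = 0\<close>, its imaginary
    part forces \<open>\<theta> = pi\<close>, where the real part is -1 although it should be
    positive.\<close>
  define \<eta> where "\<eta> = \<theta> / 2 + 3 * \<psi> / 2"
  have e: "of_real (s ^ 3) * cis (2 * \<eta>) = 8 * cis \<theta> + 12 + 6 * cis (- \<theta>) + cis (- 2 * \<theta>)"
  proof -
    have "2 * \<eta> = \<theta> + (\<psi> + (\<psi> + \<psi>))" by (simp add: \<eta>_def)
    then have "cis (2 * \<eta>) = cis \<theta> * (cis \<psi> * (cis \<psi> * cis \<psi>))" by (simp only: cis_mult)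
    then have "of_real (s ^ 3) * cis (2 * \<eta>) = cis \<theta> * (of_real s * cis \<psi>) ^ 3"
      by (simp add: power3_eq_cube mult_ac)
    also have "\<dots> = cis \<theta> * (2 + cis (- \<theta>)) ^ 3" using \<open>u = of_real s * cis \<psi>\<close> by (simp add: u_def)
    also have "\<dots> = 8 * cis \<theta> + 12 * (cis \<theta> * cis (- \<theta>)) + 6 * (cis \<theta> * cis (- \<theta>)) * cis (- \<theta>)
        + (cis \<theta> * cis (- \<theta>)) * (cis (- \<theta>) * cis (- \<theta>))"
      by (simp add: power3_eq_cube algebra_simps)
    finally show ?thesis by (simp add: cis_mult)
  qed
  have "sin \<eta> \<noteq> 0"
  proof
    assume z: "sin \<eta> = 0"
    have "s ^ 3 * sin (2 * \<eta>) = 2 * sin \<theta> * (1 - cos \<theta>)"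
      using arg_cong[OF e, of Im] sin_double[of \<theta>] by (simp add: algebra_simps)
    then have "sin \<theta> * (1 - cos \<theta>) = 0" using z by (simp add: sin_double)
    moreover have "cos \<theta> < 1" using \<theta> cos_monotone_0_pi[of 0 \<theta>] by simp
    ultimately have "sin \<theta> = 0" by simp
    then have "\<theta> = pi" using \<theta> sin_gt_zero[of \<theta>] by (cases "\<theta> < pi") auto
    moreover have "s ^ 3 * cos (2 * \<eta>) = 14 * cos \<theta> + 12 + cos (2 * \<theta>)"
      using arg_cong[OF e, of Re] by simp
    ultimately have "s ^ 3 * cos (2 * \<eta>) = - 1" by simp
    moreover have "cos (2 * \<eta>) = 1" using z by (simp add: cos_double_sin)
    ultimately show False using s0 zero_less_power[OF s0, of 3] by simp
  qed
  then show thesis using that[of \<psi>] 1 s0 unfolding \<eta>_def s_def by blast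
qed

context hex
begin

lemma triangle_eigenfunction:
  assumes l: "l = 0" and k: "2 \<le> k"
  defines "K \<equiv> 3 + sqrt (5 + 4 * cos (2 * pi / real_of_int k))"
  shows "\<exists>h. (\<exists>t\<in>P. h t \<noteq> 0) \<and>
    2 * K * (\<Sum>t\<in>P. (h t)\<^sup>2) \<le> (\<Sum>t\<in>P. \<Sum>u\<in>{u \<in> P. adj t u}. (h t - h u)\<^sup>2)"
proof -
  define \<theta> where "\<theta> = 2 * pi / real_of_int k"
  have \<theta>k: "\<theta> * real_of_int k = 2 * pi" using k by (simp add: \<theta>_def)
  have \<theta>: "0 < \<theta>" "\<theta> \<le> pi" using k by (simp_all add: \<theta>_def field_simps)
  define s where "s = sqrt (5 + 4 * cos \<theta>)"
  obtain \<psi> where psi: "s * cos \<psi> = 2 + cos \<theta>" "s * sin \<psi> = - sin \<theta>" "sin (\<theta> / 2 + 3 * \<psi> / 2) \<noteq> 0" "0 < s"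
    using triangle_phase[OF \<theta>] unfolding s_def by blast
  \<comment> \<open>\<open>w\<close> serves upward and \<open>v\<close> downward triangles. Both
    recursions \<open>vw\<close> and \<open>wv\<close> have the factor \<open>s\<close>, which
    produces the eigenvalue \<open>3 + s\<close>; \<open>refl\<close> rests on
    \<open>\<theta> * k = 2 * pi\<close>.\<close>
  define w where "w x = sin (\<theta> * (real_of_int x + 1 / 2) + \<psi> / 2)" for x :: int
  define v where "v x = sin (\<theta> * (real_of_int x + 1 / 2) - \<psi> / 2)" for x :: int
  have I1: "2 * sin \<beta> + sin (\<beta> - \<theta>) = s * sin (\<beta> + \<psi>)" for \<beta>
  proof -
    have "s * sin (\<beta> + \<psi>) = sin \<beta> * (s * cos \<psi>) + cos \<beta> * (s * sin \<psi>)" by (simp add: sin_add algebra_simps)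
    then show ?thesis unfolding psi by (simp add: sin_diff algebra_simps)
  qed
  have I2: "2 * sin \<beta> + sin (\<beta> + \<theta>) = s * sin (\<beta> - \<psi>)" for \<beta>
  proof -
    have "s * sin (\<beta> - \<psi>) = sin \<beta> * (s * cos \<psi>) - cos \<beta> * (s * sin \<psi>)" by (simp add: sin_diff algebra_simps)
    then show ?thesis unfolding psi by (simp add: sin_add algebra_simps)
  qed
  have vw: "2 * v x + v (x - 1) = s * w x" for x
  proof -
    have "\<theta> * (real_of_int (x - 1) + 1 / 2) - \<psi> / 2 = \<theta> * (real_of_int x + 1 / 2) - \<psi> / 2 - \<theta>"
      "\<theta> * (real_of_int x + 1 / 2) + \<psi> / 2 = \<theta> * (real_of_int x + 1 / 2) - \<psi> / 2 + \<psi>"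
      by (simp_all add: algebra_simps)
    then show ?thesis using I1[of "\<theta> * (real_of_int x + 1 / 2) - \<psi> / 2"] unfolding v_def w_def by (simp only:)
  qed
  have wv: "2 * w x + w (x + 1) = s * v x" for x
  proof -
    have "\<theta> * (real_of_int (x + 1) + 1 / 2) + \<psi> / 2 = \<theta> * (real_of_int x + 1 / 2) + \<psi> / 2 + \<theta>"
      "\<theta> * (real_of_int x + 1 / 2) - \<psi> / 2 = \<theta> * (real_of_int x + 1 / 2) + \<psi> / 2 - \<psi>"
      by (simp_all add: algebra_simps)
    then show ?thesis using I2[of "\<theta> * (real_of_int x + 1 / 2) + \<psi> / 2"] unfolding v_def w_def by (simp only:)
  qed
  have refl: "w y = - v x" if "x + y = k - 1" for x y
  proof -
    have "real_of_int y = real_of_int k - 1 - real_of_int x" using that by linarith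
    then have "\<theta> * (real_of_int y + 1 / 2) + \<psi> / 2 = \<theta> * (real_of_int k - real_of_int x - 1 / 2) + \<psi> / 2"
      by simp
    also have "\<dots> = 2 * pi - (\<theta> * (real_of_int x + 1 / 2) - \<psi> / 2)" using \<theta>k by (simp add: algebra_simps)
    finally show ?thesis unfolding w_def v_def by (simp only: sin_2pi_minus)
  qed
  have v1: "v (- 1) = - w 0"
  proof -
    have "\<theta> * (real_of_int (- 1) + 1 / 2) - \<psi> / 2 = - (\<theta> * (real_of_int 0 + 1 / 2) + \<psi> / 2)" by simp
    then show ?thesis unfolding v_def w_def by (simp only: sin_minus)
  qed
  \<comment> \<open>The three arguments are integer barycentric coordinates, with sum
    \<open>k - 1\<close> on upward and \<open>k - 2\<close> on downward tiles. The sign on downward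
    tiles moves the wave to the upper end of the spectrum.\<close>
  define h :: "tri \<Rightarrow> real" where "h = (\<lambda>(a, b, t). if t then - (v a + v b + v (k - 2 - a - b)) else w a + w b + w (k - 1 - a - b))"
  have P: "(a, b, t) \<in> P \<longleftrightarrow> 0 \<le> a \<and> 0 \<le> b \<and> a + b + of_bool t \<le> k - 1" for a b t
  proof -
    have pk: "0 < x * k \<longleftrightarrow> 0 < x" for x using k0 by (simp add: zero_less_mult_iff)
    have "(a, b, t) \<in> P \<longleftrightarrow> a * l < (b + 1) * k \<and> (k - 1 - a - b - of_bool t) * l < (l + a + 1) * k \<and>
       (k - 1 - (k - 1 - a - b - of_bool t) - (l + a) - of_bool t) * l < (l + (k - 1 - a - b - of_bool t) + 1) * k"
      by (simp add: P_def above_def rot_def)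
    also have "\<dots> \<longleftrightarrow> 0 < b + 1 \<and> 0 < 0 + a + 1 \<and> 0 < 0 + (k - 1 - a - b - of_bool t) + 1"
      by (simp only: l mult_zero_right pk)
    finally show ?thesis by auto
  qed
  \<comment> \<open>The Neumann condition: a neighbour missing from the piece would carry the same
    value, so sums may run over all three lattice neighbours.\<close>
  have virt: "h (a, b, True) = h (a', b', False)"
    if inP: "(a', b', False) \<in> P" and ad: "adj (a', b', False) (a, b, True)" and nP: "(a, b, True) \<notin> P" for a b a' b'
  proof -
    have c: "(a, b) \<in> {(a', b'), (a' - 1, b'), (a', b' - 1)}" using ad by (auto simp: adj_def)
    consider "a = a'" "b = b'" "a' + b' = k - 1" | "a = - 1" "a' = 0" "b = b'" | "a = a'" "b = - 1" "b' = 0"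
    proof -
      have "(a = a' \<and> b = b' \<and> a' + b' = k - 1) \<or> (a = - 1 \<and> a' = 0 \<and> b = b') \<or> (a = a' \<and> b = - 1 \<and> b' = 0)"
        using c inP nP unfolding P insert_iff prod.inject empty_iff of_bool_eq by presburger
      then show thesis using that by blast
    qed
    then show ?thesis
    proof cases
      case 1
      then have "w b = - v a" "w a = - v b" using refl[of a b] refl[of b a] by auto
      moreover have e: "k - 2 - a' - b' = - 1" "k - 1 - a' - b' = 0" using 1 by linarith+
      have "v (k - 2 - a' - b') = - w (k - 1 - a' - b')" unfolding e by (rule v1)
      ultimately show ?thesis using 1 v1 by (simp add: h_def)
    next
      case 2
      then have "w (k - 1 - b) = - v b" "w b = - v (k - 1 - b)" using refl[of b "k - 1 - b"] refl[of "k - 1 - b" b] by auto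
      moreover have "k - 2 - a - b = k - 1 - b" using 2 by auto
      ultimately show ?thesis using 2 v1 by (simp add: h_def)
    next
      case 3
      then have "w (k - 1 - a) = - v a" "w a = - v (k - 1 - a)" using refl[of a "k - 1 - a"] refl[of "k - 1 - a" a] by auto
      moreover have "v (k - a' - 1) = v (k - 1 - a')" by (rule arg_cong[where f = v]) linarith
      ultimately show ?thesis using 3 v1 by (simp add: h_def)
    qed
  qed
  have eig: "(\<Sum>u\<in>{u \<in> P. adj t u}. h t - h u) = (3 + s) * h t" if tP: "t \<in> P" for t
  proof -
    obtain a b r where t: "t = (a, b, r)" by (cases t)
    have "(\<Sum>u\<in>{u \<in> P. adj t u}. h t - h u) = (\<Sum>u\<in>{u. adj t u}. h t - h u)"
    proof (rule sum.mono_neutral_left)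
      show "finite {u. adj t u}" by (rule card_adj)
      show "\<forall>u\<in>{u. adj t u} - {u \<in> P. adj t u}. h t - h u = 0"
      proof
        fix u assume "u \<in> {u. adj t u} - {u \<in> P. adj t u}"
        then have u: "adj t u" "u \<notin> P" by auto
        obtain c d q where uc: "u = (c, d, q)" by (cases u)
        have "\<not> r"
        proof
          assume r
          then have "u \<in> P" using u(1) tP unfolding uc t P by (auto simp: adj_def)
          then show False using u(2) by simp
        qed
        then have q using u(1) by (auto simp: t uc adj_def)
        then show "h t - h u = 0" using virt[of a b c d] tP u \<open>\<not> r\<close> by (simp add: t uc)
      qed
    qed auto
    also have "\<dots> = (3 + s) * h t"
    proof (cases r)
      case False
      have "{u. adj t u} = {(a, b, True), (a - 1, b, True), (a, b - 1, True)}" using False by (auto simp: t adj_def)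
      then have "(\<Sum>u\<in>{u. adj t u}. h t - h u) = 3 * h t - (h (a, b, True) + h (a - 1, b, True) + h (a, b - 1, True))" by simp
      moreover have "h (a, b, True) + h (a - 1, b, True) + h (a, b - 1, True)
         = - ((2 * v a + v (a - 1)) + (2 * v b + v (b - 1)) + (2 * v (k - 1 - a - b) + v (k - 1 - a - b - 1)))"
        by (simp add: h_def algebra_simps)
      ultimately show ?thesis unfolding vw using False by (simp add: t h_def algebra_simps)
    next
      case True
      have "{u. adj t u} = {(a, b, False), (a + 1, b, False), (a, b + 1, False)}" using True by (auto simp: t adj_def)
      then have "(\<Sum>u\<in>{u. adj t u}. h t - h u) = 3 * h t - (h (a, b, False) + h (a + 1, b, False) + h (a, b + 1, False))" by simp
      moreover have "h (a, b, False) + h (a + 1, b, False) + h (a, b + 1, False)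
         = (2 * w a + w (a + 1)) + (2 * w b + w (b + 1)) + (2 * w (k - 2 - a - b) + w (k - 2 - a - b + 1))"
        by (simp add: h_def algebra_simps)
      ultimately show ?thesis unfolding wv using True by (simp add: t h_def algebra_simps)
    qed
    finally show ?thesis .
  qed
  have "(\<Sum>t\<in>P. \<Sum>u\<in>{u \<in> P. adj t u}. (h t - h u)\<^sup>2) = 2 * (\<Sum>t\<in>P. h t * (\<Sum>u\<in>{u \<in> P. adj t u}. h t - h u))"
    by (rule sum_edge_squares[OF finite_P adj_sym])
  also have "\<dots> = 2 * (\<Sum>t\<in>P. (3 + s) * (h t)\<^sup>2)"
    by (simp add: eig power2_eq_square mult_ac)
  finally have E: "(\<Sum>t\<in>P. \<Sum>u\<in>{u \<in> P. adj t u}. (h t - h u)\<^sup>2) = 2 * K * (\<Sum>t\<in>P. (h t)\<^sup>2)"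
    by (simp add: sum_distrib_left[symmetric] K_def s_def \<theta>_def)
  \<comment> \<open>The corner tile has coordinates \<open>k - 1\<close>, 0 and 0. Here the
    nonvanishing from \<open>triangle_phase\<close> is used.\<close>
  have "h (k - 1, 0, False) = s * sin (\<theta> / 2 + 3 * \<psi> / 2)"
  proof -
    have a: "w (k - 1) = - v 0" using refl[of 0 "k - 1"] by simp
    have "h (k - 1, 0, False) = 2 * w 0 - v 0" by (simp add: h_def a)
    also have "\<dots> = 2 * sin (\<theta> / 2 + \<psi> / 2) + sin (- (\<theta> / 2 - \<psi> / 2))" by (simp add: w_def v_def sin_diff sin_add)
    also have "- (\<theta> / 2 - \<psi> / 2) = \<theta> / 2 + \<psi> / 2 - \<theta>" by simp
    also have "2 * sin (\<theta> / 2 + \<psi> / 2) + sin (\<theta> / 2 + \<psi> / 2 - \<theta>) = s * sin (\<theta> / 2 + \<psi> / 2 + \<psi>)" by (rule I1)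
    also have "\<theta> / 2 + \<psi> / 2 + \<psi> = \<theta> / 2 + 3 * \<psi> / 2" by simp
    finally show ?thesis .
  qed
  then have "h (k - 1, 0, False) \<noteq> 0" using psi by simp
  moreover have "(k - 1, 0, False) \<in> P" using k by (simp add: P)
  ultimately have "\<exists>t\<in>P. h t \<noteq> 0" by blast
  then show ?thesis using E by (intro exI[of _ h]) simp
qed

end

lemma (in hex_graph) triangle_lower:
  assumes "l = 0" "2 \<le> k" "1 \<le> i" "i \<le> card V"
  shows "lap_eig G (card W - i + 1) \<ge> 3 + sqrt (5 + 4 * cos (2 * pi / real_of_int k))"
proof -
  obtain h where h: "\<exists>t\<in>P. h t \<noteq> 0"
    "2 * (3 + sqrt (5 + 4 * cos (2 * pi / real_of_int k))) * (\<Sum>t\<in>P. (h t)\<^sup>2) \<le> (\<Sum>t\<in>P. \<Sum>u\<in>{u \<in> P. adj t u}. (h t - h u)\<^sup>2)"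
    using triangle_eigenfunction[OF assms(1,2)] by blast
  show ?thesis by (rule lap_eig_ge_piece[OF no_crossing_l0[OF assms(1)] assms(3,4) h])
qed

section \<open>Square pieces: combinatorics\<close>

text \<open>The pair \<open>(a, b)\<close> is the unit square with lower left corner \<open>a + b\<i>\<close>, and \<open>height a b\<close> is twice the
  height of its centre above side \<open>0\<close>. Unlike triangles, squares can have their centre on a side of the
  region; these tiles are shared by two pieces, belong to neither, and form \<open>Tie\<close>.\<close>

type_synonym cell = "int \<times> int"

locale sq = region
begin

definition rot :: "cell \<Rightarrow> cell" where "rot = (\<lambda>(a, b). (k - 1 - b, l + a))"
definition mir :: "cell \<Rightarrow> cell" where "mir = (\<lambda>(a, b). (k - 1 - a, l - 1 - b))"
definition above :: "cell \<Rightarrow> bool" where "above = (\<lambda>(a, b). a * l < (b + 1) * k)"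
definition hgt :: "cell \<Rightarrow> int" where "hgt = (\<lambda>(a, b). height a b)"
definition P :: "cell set" where
  "P = {x. above x \<and> above (rot x) \<and> above (rot (rot x)) \<and> above (rot (rot (rot x)))}"
definition Own :: "cell set" where
  "Own = {x. 0 < hgt x \<and> 0 < hgt (rot x) \<and> 0 < hgt (rot (rot x)) \<and> 0 < hgt (rot (rot (rot x)))}"
definition Tie :: "cell set" where "Tie = {x \<in> P. hgt x = 0}"
text \<open>\<open>box\<close> is the rectangle with side 0 as diagonal, \<open>inner\<close> the
  square of side \<open>k - l\<close> in the middle of the region. Four half rectangles and the
  inner square account for k^2 + l^2 = 2 k l + (k - l)^2.\<close>

definition box :: "cell \<Rightarrow> bool" where "box = (\<lambda>(a, b). 0 \<le> a \<and> a < k \<and> 0 \<le> b \<and> b < l)"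
definition inner :: "cell \<Rightarrow> bool" where "inner = (\<lambda>(a, b). 0 \<le> a \<and> a < k - l \<and> l \<le> b \<and> b < k)"
definition adj :: "cell \<Rightarrow> cell \<Rightarrow> bool" where
  "adj = (\<lambda>(a, b) (c, d). (c, d) \<in> {(a + 1, b), (a - 1, b), (a, b + 1), (a, b - 1)})"

lemma rot4: "rot (rot (rot (rot x))) = x"
  by (cases x) (simp add: rot_def)

lemma mir_mir: "mir (mir x) = x"
  by (cases x) (simp add: mir_def)

lemma rot_inj: "rot x = rot y \<longleftrightarrow> x = y"
  by (metis rot4)

lemma rot_powers: "(rot ^^ 0) x = x" "(rot ^^ 1) x = rot x" "(rot ^^ 2) x = rot (rot x)"
  "(rot ^^ 3) x = rot (rot (rot x))" "(rot ^^ 4) x = x"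
  by (simp_all add: eval_nat_numeral rot4)

lemma less4: "j < 4 \<longleftrightarrow> j = 0 \<or> j = 1 \<or> j = 2 \<or> j = (3 :: nat)"
  by auto

lemma P_rot: "rot x \<in> P \<longleftrightarrow> x \<in> P"
  by (auto simp: P_def rot4)

lemma Own_rot: "rot x \<in> Own \<longleftrightarrow> x \<in> Own"
  by (auto simp: Own_def rot4)

lemma rot_pow_P: "(rot ^^ n) x \<in> P \<longleftrightarrow> x \<in> P"
  by (induction n) (auto simp: P_rot)

lemma adj_sym: "adj x y \<longleftrightarrow> adj y x"
  by (cases x; cases y) (auto simp: adj_def)

lemma adj_rot: "adj (rot x) (rot y) \<longleftrightarrow> adj x y"
  by (cases x; cases y) (auto simp: adj_def rot_def)

lemma adj_mir: "adj (mir x) (mir y) \<longleftrightarrow> adj x y"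
  by (cases x; cases y) (auto simp: adj_def mir_def)

lemma rot_pow_adj: "adj ((rot ^^ n) x) ((rot ^^ n) y) \<longleftrightarrow> adj x y"
  by (induction n) (auto simp: adj_rot)

lemma hgt_above: "0 \<le> hgt x \<Longrightarrow> above x"
  using height_above by (cases x) (auto simp: hgt_def above_def)

lemma hgt_mir: "hgt (mir x) = - hgt x"
  by (cases x) (simp add: hgt_def mir_def height_mir)

lemma Own_P: "Own \<subseteq> P"
  unfolding Own_def P_def using hgt_above[OF less_imp_le] by blast

lemma P_above: "x \<in> P \<Longrightarrow> above x"
  by (simp add: P_def)

lemma hgt_below: "hgt x \<le> 0 \<Longrightarrow> above (mir x)"
  using hgt_above[of "mir x"] by (simp add: hgt_mir)

lemma box_mir: "box (mir x) \<longleftrightarrow> box x"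
  by (cases x) (auto simp: box_def mir_def)

lemma box_rot: "box x \<Longrightarrow> \<not> box (rot x)"
  by (cases x) (auto simp: box_def rot_def)

lemma box_rot2: "box x \<Longrightarrow> \<not> box (rot (rot x))"
  using lk by (cases x) (auto simp: box_def rot_def)

lemma box_unique: "box ((rot ^^ i) x) \<Longrightarrow> box ((rot ^^ j) x) \<Longrightarrow> i < 4 \<Longrightarrow> j < 4 \<Longrightarrow> i = j"
  using box_rot[of x] box_rot[of "rot x"] box_rot[of "rot (rot x)"] box_rot[of "rot (rot (rot x))"]
    box_rot2[of x] box_rot2[of "rot x"]
  unfolding less4 by (elim disjE) (simp_all add: rot_powers rot4)

lemma crossing_box:
  assumes "x \<in> P" "above (mir x)"
  shows "box x"
proof -
  obtain a b where x: "x = (a, b)" by (cases x)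
  have 1: "a * l < (b + 1) * k" and 2: "0 < (a + 1) * k + (b + 1) * l"
    and 3: "0 < (k - a) * k + (l - b) * l" and 4: "b * k < (a + 1) * l"
    using assms unfolding x P_def above_def rot_def mir_def by (auto simp: algebra_simps)
  have "0 \<le> a"
  proof (rule ccontr)
    assume "\<not> 0 \<le> a"
    then have p: "(a + 1) * l \<le> 0" "(a + 1) * k \<le> 0" using l0 k0 by (auto intro: mult_nonpos_nonneg)
    then have "b * k < 0" using 4 by simp
    then have "b < 0" using k0 by (simp add: mult_less_0_iff)
    then have "(b + 1) * l \<le> 0" using l0 by (auto intro: mult_nonpos_nonneg)
    then show False using 2 p by simp
  qed
  then have "0 < (b + 1) * k" using 1 mult_nonneg_nonneg[OF \<open>0 \<le> a\<close> l0] by linarith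
  then have b: "0 \<le> b" using k0 by (simp add: zero_less_mult_iff)
  have "a < k"
  proof (rule ccontr)
    assume a: "\<not> a < k"
    have "(k - a) * k \<le> 0" using a k0 by (auto intro: mult_nonpos_nonneg)
    then have "0 < (l - b) * l" using 3 by simp
    then have "b + 1 \<le> l" using l0 by (simp add: zero_less_mult_iff)
    then have "(b + 1) * k \<le> l * k" using k0 by (intro mult_right_mono) auto
    moreover have "k * l \<le> a * l" using a l0 by (intro mult_right_mono) auto
    ultimately show False using 1 by (simp add: mult.commute)
  qed
  have "(a + 1) * l \<le> k * l" using \<open>a < k\<close> l0 by (intro mult_right_mono) auto
  then have "b * k < l * k" using 4 by (simp add: mult.commute)
  then have "b < l" using k0 by simp
  then show ?thesis using \<open>0 \<le> a\<close> \<open>a < k\<close> b by (simp add: x box_def)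
qed

lemma box_hgt:
  assumes "box x"
  shows "0 < hgt (rot x)" "0 < hgt (rot (rot x))" "0 < hgt (rot (rot (rot x)))"
proof -
  obtain a b where x: "x = (a, b)" by (cases x)
  have ab: "0 \<le> a" "a < k" "0 \<le> b" "b < l" using assms by (auto simp: x box_def)
  have p: "0 \<le> a * k" "0 \<le> a * l" "0 \<le> b * l" "0 \<le> k * (k - 1 - a)" "0 \<le> l * (l - 1 - b)" "0 \<le> l * l"
    "0 \<le> k * (k - 1 - b)"
    using ab k0 l0 lk by (auto intro!: mult_nonneg_nonneg)
  have "hgt (rot x) = 2 * (a * k) + k + l + 2 * (b * l)"
    by (simp add: x rot_def hgt_def height_def algebra_simps)
  then show "0 < hgt (rot x)" using p k0 l0 by linarith
  have "hgt (rot (rot x)) = 2 * (k * (k - 1 - b)) + k + l + 2 * (l * l) + 2 * (a * l)"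
    by (simp add: x rot_def hgt_def height_def algebra_simps)
  then show "0 < hgt (rot (rot x))" using p k0 l0 by linarith
  have "hgt (rot (rot (rot x))) = 2 * (k * (k - 1 - a)) + 2 * (l * (l - 1 - b)) + k + l"
    by (simp add: x rot_def hgt_def height_def algebra_simps)
  then show "0 < hgt (rot (rot (rot x)))" using p k0 l0 by linarith
qed

lemma box_P: "box x \<Longrightarrow> above x \<Longrightarrow> x \<in> P"
  using box_hgt hgt_above by (simp add: P_def less_imp_le)

lemma box_Own: "box x \<Longrightarrow> 0 < hgt x \<Longrightarrow> x \<in> Own"
  using box_hgt by (simp add: Own_def)

lemma Tie_iff: "x \<in> Tie \<longleftrightarrow> box x \<and> hgt x = 0"
proof
  assume "x \<in> Tie"
  then have "x \<in> P" "hgt x = 0" by (simp_all add: Tie_def)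
  then show "box x \<and> hgt x = 0" using crossing_box hgt_below by simp
next
  assume "box x \<and> hgt x = 0"
  then show "x \<in> Tie" using box_P hgt_above by (simp add: Tie_def)
qed

lemma Tie_mir: "mir x \<in> Tie \<longleftrightarrow> x \<in> Tie"
  by (simp add: Tie_iff box_mir hgt_mir)

lemma Tie_Own: "x \<in> Tie \<Longrightarrow> x \<notin> Own"
  by (simp add: Tie_def Own_def)

lemma cross_unique:
  assumes "x \<in> P" "i < 4" "j < 4" "mir ((rot ^^ i) x) \<in> P" "mir ((rot ^^ j) x) \<in> P"
  shows "i = j"
proof -
  have "box ((rot ^^ n) x)" if "mir ((rot ^^ n) x) \<in> P" for n
    using crossing_box[OF _ P_above[OF that]] assms(1) rot_pow_P by blast
  then show ?thesis using box_unique assms by blast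
qed

lemma Own_mir: "x \<in> Own \<Longrightarrow> mir x \<notin> Own"
  by (simp add: Own_def hgt_mir)

lemma low_cases:
  assumes "x \<in> P" "hgt x \<le> 0"
  shows "mir x \<in> Own \<or> x \<in> Tie"
proof -
  have "box x" using crossing_box[OF assms(1) hgt_below[OF assms(2)]] .
  then show ?thesis using assms(2) box_Own[of "mir x"] by (cases "hgt x = 0") (simp_all add: Tie_iff box_mir hgt_mir)
qed

lemma cover: "x \<in> P \<Longrightarrow> x \<notin> Own \<Longrightarrow> \<exists>j<4. mir ((rot ^^ j) x) \<in> Own \<or> (rot ^^ j) x \<in> Tie"
proof -
  assume x: "x \<in> P" "x \<notin> Own"
  have "\<exists>j<4. hgt ((rot ^^ j) x) \<le> 0"
  proof (rule ccontr)
    assume "\<not> (\<exists>j<4. hgt ((rot ^^ j) x) \<le> 0)"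
    then have *: "0 < hgt ((rot ^^ j) x)" if "j < 4" for j using that by (meson not_le)
    have "0 < hgt ((rot ^^ 0) x)" "0 < hgt ((rot ^^ 1) x)" "0 < hgt ((rot ^^ 2) x)" "0 < hgt ((rot ^^ 3) x)" by (rule *, simp)+
    then show False using x(2) unfolding Own_def rot_powers by blast
  qed
  then show ?thesis using low_cases x(1) rot_pow_P by blast
qed

lemma far_box:
  assumes "x \<in> P" "mir x \<in> Own \<or> x \<in> Tie"
  shows "box x" "hgt x \<le> 0"
proof -
  show h: "hgt x \<le> 0" using assms(2) by (auto simp: Own_def Tie_def hgt_mir)
  show "box x" using crossing_box[OF assms(1) hgt_below[OF h]] .
qed

text \<open>To step from the lower half of the box into the lower half of the box over another side
  is possible only at an end of side 0. There the height condition reads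
  \<open>(2 * c + 1) * k \<le> l\<close>, hence \<open>k = l\<close> and \<open>c = 0\<close>, which
  leaves the two listed corner pairs.\<close>

lemma far_tie:
  assumes t: "box t" "hgt t \<le> 0" and u: "u \<in> P" "adj t u" and m: "m < 4" "m \<noteq> 0"
    and mu: "box ((rot ^^ m) u)" "hgt ((rot ^^ m) u) \<le> 0"
  shows "k = l \<and> (m = 1 \<and> t = (0, 0) \<and> u = (- 1, 0) \<and> (rot ^^ m) u = (k - 1, l - 1) \<or>
    m = 3 \<and> t = (k - 1, l - 1) \<and> u = (k - 1, l) \<and> (rot ^^ m) u = (0, 0))"
proof -
  obtain a b where tt: "t = (a, b)" by (cases t)
  have ab: "0 \<le> a" "a < k" "0 \<le> b" "b < l" "height a b \<le> 0" using t by (auto simp: tt box_def hgt_def)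
  have nb: "\<not> box u" using box_unique[of 0 u m] mu m by auto
  have first: "k = l \<and> c = 0" if "height 0 c \<le> 0" "0 \<le> c" for c
  proof -
    have h: "(2 * c + 1) * k \<le> l" using that(1) by (simp add: height_def)
    moreover have "1 * k \<le> (2 * c + 1) * k" using that(2) k0 by (intro mult_right_mono) auto
    ultimately have "k = l" using lk by simp
    then have "(2 * c + 1) * k \<le> 1 * k" using h by simp
    then have "2 * c + 1 \<le> 1" using k0 unfolding mult_le_cancel_right by auto
    then show ?thesis using \<open>k = l\<close> that(2) by simp
  qed
  have pu: "above u" using P_above u(1) .
  have "u = (a + 1, b) \<or> u = (a - 1, b) \<or> u = (a, b + 1) \<or> u = (a, b - 1)"
    using u(2) by (cases u) (simp add: tt adj_def)
  moreover have "\<not> box (a + 1, b) \<Longrightarrow> a = k - 1" "\<not> box (a - 1, b) \<Longrightarrow> a = 0"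
    "\<not> box (a, b + 1) \<Longrightarrow> b = l - 1" "\<not> box (a, b - 1) \<Longrightarrow> b = 0"
    using ab by (simp_all add: box_def)
  ultimately consider "u = (a + 1, b)" "a = k - 1" | "u = (a - 1, b)" "a = 0"
    | "u = (a, b + 1)" "b = l - 1" | "u = (a, b - 1)" "b = 0"
    using nb by blast
  then show ?thesis
  proof cases
    case 1
    then have "k * l < (b + 1) * k" using pu by (simp add: above_def)
    then have "l < b + 1" using k0 by (simp add: mult.commute)
    then show ?thesis using ab by simp
  next
    case 2
    then have kl: "k = l" "b = 0" using first[of b] ab by auto
    have ru: "rot u = (k - 1, l - 1)" using 2 kl unfolding rot_def by simp
    then have "box ((rot ^^ 1) u)" using k0 lk kl(1) unfolding box_def by simp
    then have "m = 1" using box_unique[of 1 u m] mu m by simp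
    then have "(rot ^^ m) u = (k - 1, l - 1)" using ru by simp
    moreover have "t = (0, 0)" "u = (- 1, 0)" using 2 kl tt by auto
    ultimately show ?thesis using \<open>m = 1\<close> kl(1) by blast
  next
    case 3
    have r: "rot u = (k - 1 - l, l + a)" "rot (rot u) = (k - 1 - (l + a), k - 1)" "rot (rot (rot u)) = (0, k - 1 - a)"
      using 3 by (simp_all add: rot_def)
    have "\<not> box (rot u)" unfolding r(1) box_def using ab lk by simp
    moreover have "\<not> box (rot (rot u))" unfolding r(2) box_def using ab lk by simp
    ultimately have m3: "m = 3" using m mu(1) unfolding less4 by (auto simp: rot_powers simp del: One_nat_def)
    have ru: "(rot ^^ m) u = (0, k - 1 - a)" using r(3) by (simp only: m3 rot_powers)
    then have "height 0 (k - 1 - a) \<le> 0" using mu(2) unfolding ru hgt_def by simp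
    then have kl: "k = l" "a = k - 1" using first[of "k - 1 - a"] ab by auto
    then have "(rot ^^ m) u = (0, 0)" "t = (k - 1, l - 1)" "u = (k - 1, l)" using 3 tt ru by simp_all
    then show ?thesis using kl(1) m3 by blast
  next
    case 4
    then have "a * l < 0" using pu by (simp add: above_def)
    then show ?thesis using ab l0 by (simp add: mult_less_0_iff)
  qed
qed

lemma corner_tie: "k = l \<Longrightarrow> (0, 0) \<in> Tie \<and> (k - 1, l - 1) \<in> Tie"
  using k0 unfolding Tie_iff box_def hgt_def height_def prod.case by (simp add: algebra_simps)

text \<open>Rotates the first tile beyond side 0, with the second one \<open>m\<close> rotations
  further; this is the situation of \<open>far_tie\<close>.\<close>

lemma shift_far:
  assumes xy: "adj x y" "y \<in> P" and ij: "i < 4" "j < 4" "i \<noteq> j"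
  shows "\<exists>m. m < 4 \<and> m \<noteq> 0 \<and> (rot ^^ j) y = (rot ^^ m) ((rot ^^ i) y) \<and> adj ((rot ^^ i) x) ((rot ^^ i) y) \<and>
    (rot ^^ i) y \<in> P \<and> m = (j + 4 - i) mod 4"
proof -
  define m where "m = (j + 4 - i) mod 4"
  have "(rot ^^ m) ((rot ^^ i) y) = (rot ^^ (m + i)) y" by (simp add: funpow_add)
  also have "\<dots> = (rot ^^ ((m + i) mod 4)) y" by (rule funpow_mod_eq[symmetric]) (rule rot_powers)
  also have "(m + i) mod 4 = j" using ij by (auto simp: m_def less4)
  finally have e: "(rot ^^ j) y = (rot ^^ m) ((rot ^^ i) y)" by simp
  have "m < 4" "m \<noteq> 0" using ij by (auto simp: m_def less4)
  then show ?thesis using e xy rot_pow_adj rot_pow_P m_def by blast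
qed

lemma far_adj:
  assumes xy: "adj x y" "x \<in> P" "y \<in> P" and ij: "i < 4" "j < 4" "i \<noteq> j"
    and far: "mir ((rot ^^ i) x) \<in> Own \<or> (rot ^^ i) x \<in> Tie" "mir ((rot ^^ j) y) \<in> Own \<or> (rot ^^ j) y \<in> Tie"
  shows "(rot ^^ i) x \<in> Tie \<and> (rot ^^ j) y \<in> Tie"
proof -
  obtain m where m: "m < 4" "m \<noteq> 0" "(rot ^^ j) y = (rot ^^ m) ((rot ^^ i) y)"
    "adj ((rot ^^ i) x) ((rot ^^ i) y)" "(rot ^^ i) y \<in> P"
    using shift_far[OF xy(1,3) ij] by blast
  have "(rot ^^ i) x \<in> P" "(rot ^^ j) y \<in> P" using xy by (simp_all add: rot_pow_P)
  note f = far_box[OF this(1) far(1)] far_box[OF this(2) far(2)]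
  from far_tie[OF f(1,2) m(5,4,1,2) f(3,4)[unfolded m(3)]] show ?thesis
    unfolding m(3) using corner_tie by metis
qed

lemma l_pos_of_Tie: "x \<in> Tie \<Longrightarrow> 0 < l"
  by (cases x) (auto simp: Tie_iff box_def)

text \<open>Adjacent squares differ in height by \<open>2 * k\<close> or \<open>2 * l\<close>, and a
  tie exists only for \<open>l > 0\<close>.\<close>

lemma tie_adj: "x \<in> Tie \<Longrightarrow> y \<in> Tie \<Longrightarrow> \<not> adj x y"
  using l_pos_of_Tie[of x] k0
  by (cases x; cases y) (auto simp: Tie_iff adj_def hgt_def height_def algebra_simps)

text \<open>Squares centred on two different sides of the region are adjacent only at a corner, and only for \<open>k = l\<close>.\<close>

lemma far_pairs_card:
  "card {(t, u). t \<in> Tie \<and> u \<in> Tie \<and> adj ((rot ^^ i) t) ((rot ^^ j) u)} \<le> 1"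
  "l < k \<Longrightarrow> {(t, u). t \<in> Tie \<and> u \<in> Tie \<and> adj ((rot ^^ i) t) ((rot ^^ j) u)} = {}"
proof -
  \<comment> \<open>Rotations inverse to \<open>i\<close> and \<open>j\<close> modulo 4; their
    difference decides which corner pair can occur.\<close>
  define i' j' where "i' = (4 - i mod 4) mod 4" and "j' = (4 - j mod 4) mod 4"
  have red: "(rot ^^ i) t = (rot ^^ (i mod 4)) t" for i t by (rule funpow_mod_eq[symmetric]) (rule rot_powers)
  have inv: "(rot ^^ ((4 - n mod 4) mod 4)) ((rot ^^ n) t) = t" for n t
  proof -
    have "(rot ^^ ((4 - n mod 4) mod 4)) ((rot ^^ n) t) = (rot ^^ ((4 - n mod 4) mod 4 + n)) t" by (simp add: funpow_add)
    also have "\<dots> = (rot ^^ (((4 - n mod 4) mod 4 + n) mod 4)) t" by (rule red)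
    also have "((4 - n mod 4) mod 4 + n) mod 4 = ((4 - n mod 4) mod 4 + n mod 4) mod 4"
      by (rule mod_add_right_eq[symmetric])
    also have "\<dots> = 0" using less4[of "n mod 4"] by auto
    finally show ?thesis by simp
  qed
  define C where "C = {(t, u). t \<in> Tie \<and> u \<in> Tie \<and> adj ((rot ^^ i) t) ((rot ^^ j) u)}"
  have *: "k = l \<and> (t, u) = (if (j' + 4 - i') mod 4 = 1 then ((0, 0), (k - 1, l - 1)) else ((k - 1, l - 1), (0, 0)))"
    if tu: "(t, u) \<in> C" for t u
  proof -
    have T: "t \<in> Tie" "u \<in> Tie" "adj ((rot ^^ i) t) ((rot ^^ j) u)" using tu by (auto simp: C_def)
    define x y where "x = (rot ^^ i) t" and "y = (rot ^^ j) u"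
    have e: "t = (rot ^^ i') x" "u = (rot ^^ j') y" by (simp_all add: x_def y_def i'_def j'_def inv)
    have yP: "y \<in> P" using T(2) by (simp add: y_def rot_pow_P Tie_def)
    have a: "adj x y" using T(3) by (simp add: x_def y_def)
    have ne: "i' \<noteq> j'"
    proof
      assume "i' = j'"
      then have "adj t u" using a unfolding e by (simp add: rot_pow_adj)
      then show False using tie_adj T by blast
    qed
    have l4: "i' < 4" "j' < 4" by (simp_all add: i'_def j'_def)
    obtain m where m: "m < 4" "m \<noteq> 0" "u = (rot ^^ m) ((rot ^^ i') y)" "adj t ((rot ^^ i') y)" "(rot ^^ i') y \<in> P"
      "m = (j' + 4 - i') mod 4"
      using shift_far[OF a yP l4 ne] unfolding e[symmetric] by blast
    have b: "box t" "hgt t \<le> 0" "box u" "hgt u \<le> 0" using T by (simp_all add: Tie_iff)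
    have "k = l \<and> (m = 1 \<and> t = (0, 0) \<and> u = (k - 1, l - 1) \<or> m = 3 \<and> t = (k - 1, l - 1) \<and> u = (0, 0))"
      using far_tie[OF b(1,2) m(5,4,1,2) b(3,4)[unfolded m(3)]] unfolding m(3)[symmetric] by blast
    moreover have "(1 :: nat) \<noteq> 3" by simp
    ultimately show ?thesis unfolding m(6)[symmetric] by (elim conjE disjE) simp_all
  qed
  show "l < k \<Longrightarrow> {(t, u). t \<in> Tie \<and> u \<in> Tie \<and> adj ((rot ^^ i) t) ((rot ^^ j) u)} = {}"
    using * unfolding C_def[symmetric] by (metis equals0I less_irrefl prod.collapse)
  have "C \<subseteq> {if (j' + 4 - i') mod 4 = 1 then ((0, 0), (k - 1, l - 1)) else ((k - 1, l - 1), (0, 0))}"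
    (is "_ \<subseteq> {?c}")
  proof
    fix p assume "p \<in> C"
    moreover obtain t u where "p = (t, u)" by (cases p)
    ultimately show "p \<in> {?c}" using *[of t u] by blast
  qed
  then have "card C \<le> card {?c}" by (intro card_mono) simp_all
  then have "card C \<le> 1" by simp
  then show "card {(t, u). t \<in> Tie \<and> u \<in> Tie \<and> adj ((rot ^^ i) t) ((rot ^^ j) u)} \<le> 1" unfolding C_def .
qed

lemma l0_Own: "l = 0 \<Longrightarrow> P = Own"
proof -
  assume l: "l = 0"
  have "above x \<longleftrightarrow> 0 < hgt x" for x
  proof -
    obtain a b where x: "x = (a, b)" by (cases x)
    show ?thesis unfolding x above_def hgt_def height_def prod.case
      using l k0 by (auto simp: zero_less_mult_iff)
  qed
  then show ?thesis by (simp add: P_def Own_def)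
qed

lemma no_crossing_l0: "l = 0 \<Longrightarrow> x \<in> P \<Longrightarrow> mir x \<notin> P"
proof
  assume "l = 0" "x \<in> P" "mir x \<in> P"
  then have "box x" using crossing_box P_above by blast
  then show False unfolding box_def using \<open>l = 0\<close> by auto
qed

lemma cross_adj:
  assumes "adj x y" "x \<in> P" "mir y \<in> P"
  shows "y \<in> P \<or> mir x \<in> P \<or> (x \<in> Own \<and> mir y \<in> Own)"
proof (cases "above y \<or> above (mir x)")
  case True
  then show ?thesis
  proof
    assume y: "above y"
    then have "box y" using crossing_box[OF assms(3)] by (simp add: mir_mir box_mir)
    then show ?thesis using box_P y by blast
  next
    assume "above (mir x)"
    then show ?thesis using crossing_box[OF assms(2)] box_P box_mir by blast
  qed
next
  case False
  obtain a b where x: "x = (a, b)" by (cases x)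
  obtain c d where y: "y = (c, d)" by (cases y)
  have "above x" "above (mir y)" using assms P_above by auto
  then have i: "(a + 1) * l \<le> b * k" "(d + 1) * k \<le> c * l"
    using False by (auto simp: x y above_def mir_def above_mir not_less algebra_simps)
  have "l = 0"
  proof -
    consider "c \<le> a + 1" "d = b" | "c = a" "b \<le> d + 1" using assms(1) by (auto simp: x y adj_def)
    then show ?thesis
    proof cases
      case 1
      then have "c * l \<le> (a + 1) * l" using l0 by (intro mult_right_mono) auto
      then show ?thesis using i 1 k0 by (simp add: algebra_simps)
    next
      case 2
      then have "b * k \<le> (d + 1) * k" using k0 by (intro mult_right_mono) auto
      then show ?thesis using i 2 l0 by (simp add: algebra_simps)
    qed
  qed
  then show ?thesis using assms l0_Own by auto
qed

lemma region_cases: "\<exists>j<4. inner ((rot ^^ j) x) \<or> (case (rot ^^ j) x of (a, b) \<Rightarrow> 0 \<le> a \<and> b < l)"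
proof -
  obtain a b where x: "x = (a, b)" by (cases x)
  have r: "rot x = (k - 1 - b, l + a)" "rot (rot x) = (k - 1 - (l + a), l + (k - 1 - b))"
    "rot (rot (rot x)) = (b - l, k - 1 - a)"
    by (simp_all add: x rot_def)
  have "inner x \<or> (0 \<le> a \<and> b < l) \<or> (a < 0 \<and> b \<le> k - 1) \<or> (a \<le> k - 1 - l \<and> k \<le> b) \<or> (l \<le> b \<and> k - l \<le> a)"
    using lk unfolding x inner_def prod.case by presburger
  then consider "inner x" | "0 \<le> a" "b < l" | "a < 0" "b \<le> k - 1" | "a \<le> k - 1 - l" "k \<le> b" | "l \<le> b" "k - l \<le> a" by blast
  then show ?thesis
  proof cases
    case 1
    then show ?thesis by (intro exI[of _ 0]) simp
  next
    case 2
    then show ?thesis by (intro exI[of _ 0]) (simp add: x)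
  next
    case 3
    then show ?thesis by (intro exI[of _ 1]) (simp add: r)
  next
    case 4
    then show ?thesis by (intro exI[of _ 2]) (simp only: rot_powers r(2), simp)
  next
    case 5
    then show ?thesis by (intro exI[of _ 3]) (simp only: rot_powers r(3), simp)
  qed
qed

lemma bottom_box:
  assumes "above (a, b)" "0 \<le> a" "b < l"
  shows "box (a, b)"
proof -
  have 1: "a * l < (b + 1) * k" using assms by (simp add: above_def)
  have "0 \<le> a * l" using assms l0 by simp
  then have "0 < (b + 1) * k" using 1 by simp
  then have b: "0 \<le> b" using k0 by (simp add: zero_less_mult_iff)
  have "(b + 1) * k \<le> l * k" using assms k0 by (intro mult_right_mono) auto
  then have "a * l < k * l" using 1 by (simp add: mult.commute)
  then have "a < k" using l0 by (simp add: mult_less_cancel_right)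
  then show ?thesis using assms b by (simp add: box_def)
qed

lemma P_cases: "x \<in> P \<Longrightarrow> \<exists>j<4. inner ((rot ^^ j) x) \<or> box ((rot ^^ j) x)"
proof -
  assume x: "x \<in> P"
  obtain j where j: "j < 4" "inner ((rot ^^ j) x) \<or> (case (rot ^^ j) x of (a, b) \<Rightarrow> 0 \<le> a \<and> b < l)"
    using region_cases[of x] by (elim exE conjE)
  obtain a b where ab: "(rot ^^ j) x = (a, b)" by (cases "(rot ^^ j) x")
  have "(a, b) \<in> P" using x rot_pow_P[of j x] unfolding ab by simp
  then have "above (a, b)" by (rule P_above)
  then have "inner (a, b) \<or> box (a, b)" using j(2) bottom_box[of a b] unfolding ab by auto
  then show ?thesis using j(1) ab by metis
qed

lemma inner_rot: "inner x \<Longrightarrow> inner (rot x)"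
  by (cases x) (auto simp: inner_def rot_def)

lemma finite_P: "finite P"
proof -
  define B :: "cell set" where "B = {0..k} \<times> {0..k}"
  have sub: "x \<in> B" if "inner x \<or> box x" for x
    using that lk l0 by (cases x) (auto simp: B_def inner_def box_def)
  have "P \<subseteq> B \<union> rot ` B \<union> rot ` rot ` B \<union> rot ` rot ` rot ` B"
  proof
    fix x assume "x \<in> P"
    then obtain j where "j < 4" "(rot ^^ j) x \<in> B" using P_cases sub by blast
    then consider "x \<in> B" | "rot x \<in> B" | "rot (rot x) \<in> B" | "rot (rot (rot x)) \<in> B"
      unfolding less4 by (elim disjE) (simp_all add: rot_powers)
    then show "x \<in> B \<union> rot ` B \<union> rot ` rot ` B \<union> rot ` rot ` rot ` B"
    proof cases
      case 2
      then have "rot (rot (rot (rot x))) \<in> rot ` rot ` rot ` B" by blast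
      then show ?thesis by (simp add: rot4)
    next
      case 3
      then have "rot (rot (rot (rot x))) \<in> rot ` rot ` B" by blast
      then show ?thesis by (simp add: rot4)
    next
      case 4
      then have "rot (rot (rot (rot x))) \<in> rot ` B" by blast
      then show ?thesis by (simp add: rot4)
    qed auto
  qed
  moreover have "finite (B \<union> rot ` B \<union> rot ` rot ` B \<union> rot ` rot ` rot ` B)" by (simp add: B_def)
  ultimately show ?thesis by (rule finite_subset)
qed

section \<open>Counting owned and tied squares\<close>

lemma inner_hgt: "inner x \<Longrightarrow> 0 < hgt x"
proof -
  assume i: "inner x"
  obtain a b where x: "x = (a, b)" by (cases x)
  have ab: "0 \<le> a" "l \<le> b" "a + 1 \<le> k" using i l0 by (auto simp: x inner_def)
  have 1: "l * k \<le> b * k" "(a + 1) * l \<le> k * l" using ab k0 l0 by (auto intro!: mult_right_mono)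
  have "(a + 1) * l = a * l + l" "k * l = l * k" by (simp_all add: algebra_simps)
  then have "2 * (a * l) + l < 2 * (b * k) + k" using 1 k0 l0 by linarith
  then show ?thesis by (simp add: x hgt_def height_def algebra_simps)
qed

lemma inner_Own: "inner x \<Longrightarrow> x \<in> Own"
  using inner_hgt inner_rot by (simp add: Own_def)

lemma inner_not_box: "inner x \<Longrightarrow> \<not> box x"
  by (cases x) (auto simp: inner_def box_def)

text \<open>The box consists of \<open>H\<close>, its mirror image and the ties. Each of the four
  sides thus contributes half a box up to half of its ties, whence the summand
  \<open>2 * card Tie\<close>.\<close>

lemma card_Own: "k\<^sup>2 + l\<^sup>2 \<le> int (card Own) + 2 * int (card Tie)"
proof -
  have finO: "finite Own" using Own_P finite_P finite_subset by blast
  have finT: "finite Tie" using finite_P by (simp add: Tie_def)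
  define H where "H = {x. box x \<and> 0 < hgt x}"
  have HO: "H \<subseteq> Own" using box_Own by (auto simp: H_def)
  have finH: "finite H" using HO finO finite_subset by blast
  have "{x. box x} \<subseteq> H \<union> mir ` H \<union> Tie"
  proof
    fix x assume x: "x \<in> {x. box x}"
    then consider "x \<in> H" | "x \<in> Tie" | "mir x \<in> H"
      by (cases "hgt x = 0"; cases "0 < hgt x") (auto simp: H_def Tie_iff box_mir hgt_mir)
    then show "x \<in> H \<union> mir ` H \<union> Tie"
    proof cases
      case 3
      then have "mir (mir x) \<in> mir ` H" by blast
      then show ?thesis by (simp add: mir_mir)
    qed auto
  qed
  then have "card {x. box x} \<le> card (H \<union> mir ` H \<union> Tie)" using finH finT by (intro card_mono) auto
  also have "\<dots> \<le> card H + card H + card Tie"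
    using card_Un_le[of "H \<union> mir ` H" Tie] card_Un_le[of H "mir ` H"] card_image_le[OF finH, of mir] by linarith
  finally have "card {x. box x} \<le> 2 * card H + card Tie" by simp
  moreover have "{x. box x} = {0..<k} \<times> {0..<l}" by (auto simp: box_def)
  then have "int (card {x. box x}) = k * l" using k0 l0 by (simp add: card_cartesian_product)
  ultimately have cH: "k * l \<le> 2 * int (card H) + int (card Tie)" by simp
  have "{x. inner x} = {0..<k - l} \<times> {l..<k}" by (auto simp: inner_def)
  then have cI: "int (card {x. inner x}) = (k - l) * (k - l)" and finI: "finite {x. inner x}"
    using lk by (simp_all add: card_cartesian_product)
  have dH: "(rot ^^ i) ` H \<inter> (rot ^^ j) ` H = {}" if "i < j" "j < 4" for i j
  proof (rule ccontr)
    assume "(rot ^^ i) ` H \<inter> (rot ^^ j) ` H \<noteq> {}"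
    then obtain x y where xy: "x \<in> H" "y \<in> H" "(rot ^^ i) x = (rot ^^ j) y" by blast
    have "(rot ^^ j) y = (rot ^^ i) ((rot ^^ (j - i)) y)" using that funpow_add[of i "j - i" rot] by simp
    moreover have "inj (rot ^^ i)" using rot_inj by (intro inj_fn) (simp add: inj_def)
    ultimately have "x = (rot ^^ (j - i)) y" using xy(3) by (metis injD)
    then have "box ((rot ^^ (j - i)) y)" "box ((rot ^^ 0) y)" using xy by (simp_all add: H_def)
    then show False using box_unique[of "j - i" y 0] that by fastforce
  qed
  have inn: "inner x" if "inner (rot x)" for x
    using inner_rot[OF inner_rot[OF inner_rot[OF that]]] by (simp add: rot4)
  have rH: "(rot ^^ n) ` H \<subseteq> Own" "(rot ^^ n) ` H \<inter> {x. inner x} = {}" "card ((rot ^^ n) ` H) = card H" for n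
  proof -
    have "(rot ^^ n) x \<in> Own" if "x \<in> Own" for x using that by (induction n) (auto simp: Own_rot)
    then show "(rot ^^ n) ` H \<subseteq> Own" using HO by blast
    have "inner x" if "inner ((rot ^^ n) x)" for x using that by (induction n) (auto intro: inn)
    then show "(rot ^^ n) ` H \<inter> {x. inner x} = {}" using inner_not_box unfolding H_def by blast
    have "inj (rot ^^ n)" using rot_inj by (intro inj_fn) (simp add: inj_def)
    then show "card ((rot ^^ n) ` H) = card H" by (intro card_image) (rule inj_on_subset, auto)
  qed
  have "card ((rot ^^ 0) ` H \<union> (rot ^^ 1) ` H \<union> (rot ^^ 2) ` H \<union> (rot ^^ 3) ` H \<union> {x. inner x})
      = card H + card H + card H + card H + card {x. inner x}"
  proof -
    have f: "finite ((rot ^^ n) ` H)" for n using finH by simp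
    have d: "(rot ^^ 0) ` H \<inter> (rot ^^ 1) ` H = {}" "((rot ^^ 0) ` H \<union> (rot ^^ 1) ` H) \<inter> (rot ^^ 2) ` H = {}"
      "((rot ^^ 0) ` H \<union> (rot ^^ 1) ` H \<union> (rot ^^ 2) ` H) \<inter> (rot ^^ 3) ` H = {}"
      using dH[of 0 1] dH[of 0 2] dH[of 1 2] dH[of 0 3] dH[of 1 3] dH[of 2 3]
      by (simp_all add: Int_Un_distrib2 del: funpow_0 funpow.simps)
    have d2: "((rot ^^ 0) ` H \<union> (rot ^^ 1) ` H \<union> (rot ^^ 2) ` H \<union> (rot ^^ 3) ` H) \<inter> {x. inner x} = {}"
      using rH(2) by blast
    show ?thesis
      using card_Un_disjoint[OF _ finI d2] card_Un_disjoint[OF _ f d(3)] card_Un_disjoint[OF _ f d(2)] card_Un_disjoint[OF f f d(1)]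
      by (simp only: finite_Un f rH(3) simp_thms)
  qed
  moreover have "(rot ^^ 0) ` H \<union> (rot ^^ 1) ` H \<union> (rot ^^ 2) ` H \<union> (rot ^^ 3) ` H \<union> {x. inner x} \<subseteq> Own"
    using rH(1) inner_Own by blast
  ultimately have "card H + card H + card H + card H + card {x. inner x} \<le> card Own" using card_mono[OF finO] by metis
  then have "4 * int (card H) + (k - l) * (k - l) \<le> int (card Own)" using cI by linarith
  moreover have "(k - l) * (k - l) + 2 * (k * l) = k\<^sup>2 + l\<^sup>2" by (simp add: power2_eq_square algebra_simps)
  ultimately show ?thesis using cH by linarith
qed

text \<open>Each row of the box has at most one square of height 0. Height 0 means
  \<open>(2 * b + 1) * k = (2 * a + 1) * l\<close>, so \<open>k\<close> and \<open>l\<close> have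
  the same parity; this is what pays for ties when \<open>l < k\<close>.\<close>

lemma card_Tie: "finite Tie" "int (card Tie) \<le> l" "Tie \<noteq> {} \<Longrightarrow> even (k - l)"
proof -
  show fin: "finite Tie" using finite_P by (simp add: Tie_def)
  have "Tie \<subseteq> {(a, b). 0 \<le> b \<and> b < l \<and> - 2 * l < height a b \<and> height a b \<le> 0}" (is "_ \<subseteq> ?R")
  proof
    fix x assume "x \<in> Tie"
    moreover obtain a b where "x = (a, b)" by (cases x)
    ultimately show "x \<in> ?R" by (simp add: Tie_iff box_def hgt_def)
  qed
  then have "card Tie \<le> card ?R" by (rule card_mono[OF card_rows(1)])
  then show "int (card Tie) \<le> l" using card_rows(2) by linarith
  assume "Tie \<noteq> {}"
  then obtain x where x: "x \<in> Tie" by blast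
  obtain a b where "x = (a, b)" by (cases x)
  then have "height a b = 0" using x by (simp add: Tie_def hgt_def)
  then have "(2 * b + 1) * k = (2 * a + 1) * l" by (simp add: height_def)
  then have "even ((2 * b + 1) * k) \<longleftrightarrow> even ((2 * a + 1) * l)" by simp
  then show "even (k - l)" by simp
qed

section \<open>Edges crossing a side of the square\<close>

definition cut :: "(cell \<times> cell) set" where
  "cut = {(x, y). adj x y \<and> x \<in> Own \<and> (mir y \<in> Own \<or> y \<in> Tie)}"

text \<open>For \<open>k = l\<close> the last column and the first row drop out, because the tile
  above such a crossing is centred on another side and hence not owned.\<close>

lemma cut_cases:
  assumes "(x, y) \<in> cut"
  shows "(\<exists>a b. x = (a, b) \<and> y = (a, b - 1) \<and> 0 \<le> a \<and> a < k - of_bool (k = l) \<and> 0 < height a b \<and> height a b \<le> 2 * k) \<or>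
    (\<exists>a b. x = (a - 1, b) \<and> y = (a, b) \<and> of_bool (k = l) \<le> b \<and> b < l \<and> - 2 * l < height a b \<and> height a b \<le> 0)"
proof -
  obtain a b where x: "x = (a, b)" by (cases x)
  obtain c d where y: "y = (c, d)" by (cases y)
  have xO: "x \<in> Own" and xP: "x \<in> P" and yP: "mir y \<in> P" and ad: "adj x y"
    using assms Own_P Tie_mir[of y] unfolding cut_def Tie_def by blast+
  have h: "0 < height a b" "height c d \<le> 0"
    using assms by (auto simp: cut_def Own_def Tie_def x y hgt_def mir_def height_mir)
  have st: "height (a + 1) b = height a b - 2 * l" "height (a - 1) b = height a b + 2 * l"
    "height a (b - 1) = height a b - 2 * k" "height a (b + 1) = height a b + 2 * k" for a b
    by (simp_all add: height_def algebra_simps)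
  from ad consider "c = a + 1" "d = b" | "c = a - 1" "d = b" | "c = a" "d = b + 1" | "c = a" "d = b - 1"
    by (auto simp: x y adj_def)
  then show ?thesis
  proof cases
    case 1
    then have h2: "- 2 * l < height c d" using h st(1)[of a b] by simp
    have "2 * (c * l) < 2 * ((d + 1) * k)"
      using h2 lk k0 unfolding height_def by (simp add: algebra_simps)
    then have "above y" by (simp add: y above_def)
    then have "box y" using crossing_box[OF yP] by (simp add: mir_mir box_mir)
    then have b: "0 \<le> b" "b < l" using 1 by (simp_all add: y box_def)
    have "b \<noteq> 0" if "k = l"
    proof
      assume "b = 0"
      then have "height c d = - 2 * (c * l)" using 1(2) \<open>k = l\<close> unfolding height_def by (simp add: algebra_simps)
      then have "0 * l \<le> c * l" "c * l < 1 * l" using h2 h(2) by linarith+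
      moreover have "0 < l" using b by simp
      ultimately have "0 \<le> c" "c < 1" by (simp_all add: zero_le_mult_iff)
      then have "x = (- 1, 0)" using 1 \<open>b = 0\<close> by (simp add: x)
      then have "hgt (rot x) = 0" using \<open>k = l\<close> unfolding rot_def hgt_def height_def by simp
      then show False using xO by (simp add: Own_def)
    qed
    then show ?thesis using 1 h h2 b by (auto simp: x y)
  next
    case 4
    then have h2: "height a b \<le> 2 * k" using h st(3)[of a b] by simp
    have 1: "a * l < (b + 1) * k" and 3: "0 < (k - a) * k + (l - b) * l"
      using xP unfolding x P_def above_def rot_def by (auto simp: algebra_simps)
    have 2: "0 < (a + 1) * k + b * l"
      using yP 4 unfolding y P_def above_def rot_def mir_def by (auto simp: algebra_simps)
    have a0: "0 \<le> a"
    proof (rule ccontr)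
      assume a: "\<not> 0 \<le> a"
      then have "(a + 1) * k \<le> 0" using k0 by (auto intro: mult_nonpos_nonneg)
      then have "0 < b * l" using 2 by simp
      then have "1 \<le> b" using l0 by (simp add: zero_less_mult_iff)
      then have "3 * k \<le> (2 * b + 1) * k" using k0 by (intro mult_right_mono) auto
      moreover have "(2 * a + 1) * l \<le> 0" using a l0 by (auto intro: mult_nonpos_nonneg)
      ultimately show False using h2 k0 unfolding height_def by linarith
    qed
    have ak: "a < k"
    proof (rule ccontr)
      assume a: "\<not> a < k"
      have "(k - a) * k \<le> 0" using a k0 by (auto intro: mult_nonpos_nonneg)
      then have "0 < (l - b) * l" using 3 by simp
      then have "b + 1 \<le> l" using l0 by (simp add: zero_less_mult_iff)
      then have "(b + 1) * k \<le> l * k" using k0 by (intro mult_right_mono) auto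
      moreover have "k * l \<le> a * l" using a l0 by (intro mult_right_mono) auto
      ultimately show False using 1 by (simp add: mult.commute)
    qed
    have "a \<noteq> k - 1" if kl: "k = l"
    proof
      assume a: "a = k - 1"
      have hh: "height a b = 2 * ((b - a) * k)" using kl unfolding height_def by (simp add: algebra_simps)
      then have "0 < (b - a) * k" "(b - a) * k \<le> 1 * k" using h(1) h2 by linarith+
      then have "0 < b - a" "b - a \<le> 1" using k0 by (simp_all add: zero_less_mult_iff mult_le_cancel_right)
      then have "b = k" using a by simp
      then have "hgt (rot (rot (rot x))) = 0" using a kl unfolding x rot_def hgt_def height_def by simp
      then show False using xO by (simp add: Own_def)
    qed
    then show ?thesis using 4 a0 ak h h2 by (auto simp: x y)
  qed (use h st[of a b] l0 k0 in auto)
qed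

text \<open>The column window is half-open here, unlike for triangles, so there is one crossing per
  column and one per row. The two crossings saved for \<open>k = l\<close> make room for the term
  \<open>d / 2 = 2\<close> that corner pairs add in \<open>energy_lift_ties\<close>.\<close>

lemma card_cut: "finite cut" "int (card cut) \<le> k + l" "k = l \<Longrightarrow> int (card cut) \<le> 2 * (k - 1)"
proof -
  define e :: int where "e = of_bool (k = l)"
  define S1 where "S1 = {(a, b). 0 \<le> a \<and> a < k - e \<and> 0 < height a b \<and> height a b \<le> 2 * k}"
  define S2 where "S2 = {(a, b). e \<le> b \<and> b < l \<and> - 2 * l < height a b \<and> height a b \<le> 0}"
  define f :: "int \<times> int \<Rightarrow> cell \<times> cell" where "f = (\<lambda>(a, b). ((a, b), (a, b - 1)))"
  define g :: "int \<times> int \<Rightarrow> cell \<times> cell" where "g = (\<lambda>(a, b). ((a - 1, b), (a, b)))"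
  have i1: "inj_on fst S1"
  proof (rule inj_onI)
    fix x y assume "x \<in> S1" "y \<in> S1" and eq: "fst x = fst y"
    then obtain a b c d where xy: "x = (a, b)" "y = (c, d)" "0 < height a b" "height a b \<le> 2 * k"
      "0 < height c d" "height c d \<le> 2 * k" unfolding S1_def by blast
    have "a = c" using eq xy by simp
    have "height a b - height a d = 2 * ((b - d) * k)" by (simp add: height_def algebra_simps)
    then have 1: "(b - d) * k < 1 * k" "(- 1) * k < (b - d) * k" using xy(3-6) unfolding \<open>a = c\<close> by linarith+
    have "b - d < 1" using 1(1) k0 unfolding mult_less_cancel_right by auto
    moreover have "- 1 < b - d" using 1(2) k0 unfolding mult_less_cancel_right by auto
    ultimately show "x = y" using xy \<open>a = c\<close> by simp
  qed
  have i2: "inj_on snd S2"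
  proof (rule inj_onI)
    fix x y assume "x \<in> S2" "y \<in> S2" and eq: "snd x = snd y"
    then obtain a b c d where xy: "x = (a, b)" "y = (c, d)" "- 2 * l < height a b" "height a b \<le> 0"
      "- 2 * l < height c d" "height c d \<le> 0" unfolding S2_def by blast
    then have "b = d" using eq by auto
    then show "x = y" using height_row[of a b c] xy by simp
  qed
  have m1: "fst ` S1 \<subseteq> {0..<k - e}" and m2: "snd ` S2 \<subseteq> {e..<l}" by (auto simp: S1_def S2_def)
  have fin: "finite S1" "finite S2"
    using finite_imageD[OF finite_subset[OF m1] i1] finite_imageD[OF finite_subset[OF m2] i2] by simp_all
  have c: "card S1 \<le> nat (k - e)" "card S2 \<le> nat (l - e)"
    using card_inj_on_le[OF i1 m1] card_inj_on_le[OF i2 m2] by simp_all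
  have sub: "cut \<subseteq> f ` S1 \<union> g ` S2"
  proof
    fix z assume z: "z \<in> cut"
    obtain x y where xy: "z = (x, y)" by (cases z)
    from cut_cases[OF z[unfolded xy]] show "z \<in> f ` S1 \<union> g ` S2"
    proof (elim disjE exE conjE)
      fix a b assume "x = (a, b)" "y = (a, b - 1)" "0 \<le> a" "a < k - of_bool (k = l)" "0 < height a b" "height a b \<le> 2 * k"
      then have "z \<in> f ` S1" by (intro image_eqI[of _ _ "(a, b)"]) (simp_all add: xy f_def S1_def e_def)
      then show ?thesis by blast
    next
      fix a b assume "x = (a - 1, b)" "y = (a, b)" "of_bool (k = l) \<le> b" "b < l" "- 2 * l < height a b" "height a b \<le> 0"
      then have "z \<in> g ` S2" by (intro image_eqI[of _ _ "(a, b)"]) (simp_all add: xy g_def S2_def e_def)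
      then show ?thesis by blast
    qed
  qed
  have fin': "finite (f ` S1)" "finite (g ` S2)" using fin by simp_all
  then show "finite cut" using finite_subset[OF sub] by simp
  have "card cut \<le> card (f ` S1 \<union> g ` S2)" using fin' by (intro card_mono[OF _ sub]) simp
  also have "\<dots> \<le> card S1 + card S2"
    using card_Un_le[of "f ` S1" "g ` S2"] card_image_le[OF fin(1), of f] card_image_le[OF fin(2), of g] by linarith
  also have "\<dots> \<le> nat (k - e) + nat (l - e)" using c by simp
  finally have *: "int (card cut) \<le> int (nat (k - e)) + int (nat (l - e))" by (simp only: of_nat_add[symmetric] of_nat_le_iff)
  have "0 \<le> e" by (simp add: e_def)
  then show "int (card cut) \<le> k + l" using * k0 l0 by linarith
  show "k = l \<Longrightarrow> int (card cut) \<le> 2 * (k - 1)" using * k0 by (simp add: e_def)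
qed

text \<open>The region is a square whose sides are diagonals of unit squares, so every tile of the
  piece is centred on a side.\<close>

lemma unit_case: "k = 1 \<Longrightarrow> l = 1 \<Longrightarrow> Own = {} \<and> Tie = {(0, 0)}"
proof
  assume kl: "k = 1" "l = 1"
  have b: "box x \<longleftrightarrow> x = (0, 0)" for x
    using kl unfolding box_def by (cases x) auto
  have h: "hgt (0, 0) = 0" using kl unfolding hgt_def height_def by simp
  have "x \<in> Tie \<longleftrightarrow> x = (0, 0)" for x unfolding Tie_iff b using h by blast
  then show "Tie = {(0, 0)}" by blast
  show "Own = {}"
  proof (rule ccontr)
    assume "Own \<noteq> {}"
    then obtain x where x: "x \<in> Own" by blast
    then obtain j where "j < 4" "inner ((rot ^^ j) x) \<or> box ((rot ^^ j) x)" using P_cases Own_P by blast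
    moreover have "\<not> inner y" for y using kl unfolding inner_def by auto
    ultimately have "(rot ^^ j) x = (0, 0)" using b by blast
    moreover have "(rot ^^ j) x \<in> Own" using x by (induction j) (auto simp: Own_rot)
    ultimately show False using h by (simp add: Own_def)
  qed
qed

end

section \<open>Square pieces: geometry\<close>

lemma slat_eq [simp]: "slat a b = slat c d \<longleftrightarrow> a = c \<and> b = d"
  by (auto simp: slat_def complex_eq_iff)

text \<open>\<open>\<alpha>\<close> and \<open>\<beta>\<close> are the coordinates of
  \<open>w\<close> along the directions of \<open>z\<close> and \<open>\<i> * z\<close>. Opposite
  side heights sum to \<open>M\<close>, which bounds both by 1, and \<open>w\<close> is reached by
  interpolating along one direction and then the other.\<close>

lemma interior_square:
  fixes z w :: complex
  defines "\<rho> \<equiv> (\<lambda>w. z + \<i> * w)"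
  assumes "z \<noteq> 0" "0 < side_height z w" "0 < side_height z (\<rho> w)" "0 < side_height z (\<rho> (\<rho> w))"
    "0 < side_height z (\<rho> (\<rho> (\<rho> w)))"
  shows "w \<in> interior (convex hull {0, z, (1 + \<i>) * z, \<i> * z})"
proof -
  define T where "T = {0, z, (1 + \<i>) * z, \<i> * z}"
  define U where "U = {w. 0 < side_height z w} \<inter> {w. 0 < side_height z (\<rho> w)} \<inter> {w. 0 < side_height z (\<rho> (\<rho> w))}
    \<inter> {w. 0 < side_height z (\<rho> (\<rho> (\<rho> w)))}"
  have "open U"
    unfolding U_def \<rho>_def by (intro open_Int open_Collect_less continuous_intros)
  define M where "M = Re z * Re z + Im z * Im z"
  have M: "0 < M"
    using assms(2) unfolding M_def power2_eq_square[symmetric] by (simp add: sum_power2_gt_zero_iff complex_eq_iff)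
  have opp: "side_height z w + side_height z (\<rho> (\<rho> w)) = M" for w
    unfolding side_height_def \<rho>_def M_def by (simp add: algebra_simps)
  have comb: "of_real M * w = of_real (side_height z (\<rho> w)) * z + of_real (side_height z w) * (\<i> * z)" for w
    unfolding side_height_def \<rho>_def M_def complex_eq_iff by (simp add: algebra_simps)
  have "U \<subseteq> convex hull T"
  proof
    fix w assume w: "w \<in> U"
    define \<alpha> \<beta> where "\<alpha> = side_height z (\<rho> w) / M" and "\<beta> = side_height z w / M"
    have le: "0 \<le> \<alpha>" "\<alpha> \<le> 1" "0 \<le> \<beta>" "\<beta> \<le> 1"
      using w M opp[of w] opp[of "\<rho> w"] by (auto simp: U_def \<alpha>_def \<beta>_def)
    have "of_real M * w = of_real M * (of_real \<alpha> * z + of_real \<beta> * (\<i> * z))"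
      unfolding comb[of w] using M by (simp add: \<alpha>_def \<beta>_def algebra_simps)
    then have e: "w = of_real \<alpha> * z + of_real \<beta> * (\<i> * z)" using M by simp
    have T: "t \<in> convex hull T" if "t \<in> T" for t using that by (rule hull_inc)
    have c: "(1 - u) *\<^sub>R a + u *\<^sub>R b \<in> convex hull T"
      if "a \<in> convex hull T" "b \<in> convex hull T" "0 \<le> u" "u \<le> 1" for a b u
      using that by (intro convexD_alt) simp_all
    have "(1 - \<beta>) *\<^sub>R ((1 - \<alpha>) *\<^sub>R 0 + \<alpha> *\<^sub>R z) + \<beta> *\<^sub>R ((1 - \<alpha>) *\<^sub>R (\<i> * z) + \<alpha> *\<^sub>R ((1 + \<i>) * z)) \<in> convex hull T"
      by (intro c T le) (simp_all add: T_def)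
    also have "(1 - \<beta>) *\<^sub>R ((1 - \<alpha>) *\<^sub>R 0 + \<alpha> *\<^sub>R z) + \<beta> *\<^sub>R ((1 - \<alpha>) *\<^sub>R (\<i> * z) + \<alpha> *\<^sub>R ((1 + \<i>) * z)) = w"
      unfolding e by (simp add: scaleR_conv_of_real algebra_simps)
    finally show "w \<in> convex hull T" .
  qed
  then have "U \<subseteq> interior (convex hull T)" using \<open>open U\<close> by (rule interior_maximal)
  moreover have "w \<in> U" using assms by (simp add: U_def)
  ultimately show ?thesis unfolding T_def by blast
qed

context sq
begin

definition z :: complex where "z = slat k l"
definition rho :: "complex \<Rightarrow> complex" where "rho = (\<lambda>w. z + \<i> * w)"
definition sig :: "complex \<Rightarrow> complex" where "sig = (\<lambda>w. (2 + \<i>) * z - w)"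
definition verts :: "cell \<Rightarrow> (int \<times> int) set" where
  "verts = (\<lambda>(a, b). {(a, b), (a + 1, b), (a + 1, b + 1), (a, b + 1)})"
definition pos :: "cell \<Rightarrow> complex set" where
  "pos x = (\<lambda>(a, b). slat a b) ` verts x"

lemma z_nonzero: "z \<noteq> 0"
proof
  assume "z = 0"
  then have "slat k l = slat 0 0" by (simp add: z_def slat_def)
  then show False using k0 by simp
qed

lemma slat_inj: "inj (\<lambda>(a, b). slat a b)"
  by (auto simp: inj_def)

lemma rho_slat: "rho (slat a b) = slat (k - b) (l + a)"
  by (simp add: rho_def z_def slat_def algebra_simps)

lemma rho_pos: "rho ` pos x = pos (rot x)"
  by (cases x) (auto simp: pos_def verts_def rot_def rho_slat insert_commute algebra_simps)

lemma sig_rho: "sig (rho w) = rho (z - w)"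
  by (simp add: sig_def rho_def algebra_simps)

lemma minus_pos: "(\<lambda>w. z - w) ` pos x = pos (mir x)"
proof -
  have "z - slat a b = slat (k - a) (l - b)" for a b by (simp add: z_def slat_def algebra_simps)
  then show ?thesis by (cases x) (auto simp: pos_def verts_def mir_def insert_commute algebra_simps)
qed

lemma sig_pos: "sig ` pos (rot x) = pos (rot (mir x))"
proof -
  have "sig ` pos (rot x) = rho ` (\<lambda>w. z - w) ` pos x" by (simp add: rho_pos[symmetric] image_image sig_rho)
  then show ?thesis by (simp add: minus_pos rho_pos)
qed

lemma verts_inj: "verts x = verts y \<longleftrightarrow> x = y"
proof
  assume eq: "verts x = verts y"
  obtain a b where x: "x = (a, b)" by (cases x)
  obtain c d where y: "y = (c, d)" by (cases y)
  have s: "(\<Sum>p\<in>verts (a, b). fst p) = 4 * a + 2" "(\<Sum>p\<in>verts (a, b). snd p) = 4 * b + 2" for a b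
    by (simp_all add: verts_def)
  show "x = y" using s[of a b] s[of c d] eq by (simp add: x y)
qed simp

lemma pos_inj: "inj pos"
  unfolding inj_def pos_def inj_image_eq_iff[OF slat_inj] by (simp add: verts_inj del: split_paired_All)

lemma adj_pos:
  assumes "\<And>x y. adj x y \<longleftrightarrow> x \<noteq> y \<and> card (verts x \<inter> verts y) = 2"
  shows "adj x y \<longleftrightarrow> x \<noteq> y \<and> card (pos x \<inter> pos y) = 2"
proof -
  have "pos x \<inter> pos y = (\<lambda>(a, b). slat a b) ` (verts x \<inter> verts y)"
    unfolding pos_def by (rule image_Int[OF slat_inj, symmetric])
  then have "card (pos x \<inter> pos y) = card (verts x \<inter> verts y)"
    using card_image[OF inj_on_subset[OF slat_inj subset_UNIV]] by metis
  then show ?thesis using assms by simp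
qed

lemma unit_squares_eq: "unit_squares = range pos"
proof -
  have "pos (a, b) = {slat a b, slat (a + 1) b, slat (a + 1) (b + 1), slat a (b + 1)}" for a b
    by (simp add: pos_def verts_def)
  then show ?thesis unfolding unit_squares_def by (auto simp: image_iff) metis
qed

abbreviation "T \<equiv> {0, z, (1 + \<i>) * z, \<i> * z}"

lemma rho_T: "rho ` T = T"
proof -
  have "rho 0 = z" "rho z = (1 + \<i>) * z" "rho ((1 + \<i>) * z) = \<i> * z" "rho (\<i> * z) = 0"
    by (simp_all add: rho_def algebra_simps)
  then show ?thesis by auto
qed

lemma meets_rot: "meets T (pos (rot x)) \<longleftrightarrow> meets T (pos x)"
  using meets_affine[of \<i> z T "pos x"] rho_T rho_pos[of x] by (simp add: rho_def)

lemma meets_rot_pow: "meets T (pos ((rot ^^ n) x)) \<longleftrightarrow> meets T (pos x)"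
  by (induction n) (auto simp: meets_rot)

lemma side_height_slat: "side_height z (slat a b) = real_of_int (b * k - a * l)"
  by (simp add: side_height_def z_def slat_def algebra_simps)

lemma side_height_T: "w \<in> T \<Longrightarrow> 0 \<le> side_height z w"
proof -
  have "side_height z (\<i> * z) = (Re z)\<^sup>2 + (Im z)\<^sup>2" "side_height z ((1 + \<i>) * z) = (Re z)\<^sup>2 + (Im z)\<^sup>2"
    by (simp_all add: side_height_def power2_eq_square algebra_simps)
  then have "0 \<le> side_height z (\<i> * z)" "0 \<le> side_height z ((1 + \<i>) * z)" by (simp_all only:) simp_all
  then show "w \<in> T \<Longrightarrow> 0 \<le> side_height z w" by (auto simp: side_height_def)
qed

lemma meets_above:
  assumes "meets T (pos x)"
  shows "above x"
proof -
  obtain a b where x: "x = (a, b)" by (cases x)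
  from meets_side_height[OF z_nonzero assms side_height_T]
  obtain w where "w \<in> pos x" "0 < side_height z w" by blast
  then obtain c d where cd: "(c, d) \<in> verts x" "0 < side_height z (slat c d)" by (auto simp: pos_def)
  then have "0 < d * k - c * l" by (simp only: side_height_slat of_int_0_less_iff)
  moreover have "d \<le> b + 1" "a \<le> c" using cd(1) by (auto simp: x verts_def)
  then have "d * k \<le> (b + 1) * k" "a * l \<le> c * l" using k0 l0 by (auto intro!: mult_right_mono)
  ultimately show ?thesis by (simp add: x above_def)
qed

definition cen :: "cell \<Rightarrow> complex" where
  "cen = (\<lambda>(a, b). slat a b + (1 + \<i>) / 2)"

lemma cen_hull: "cen x \<in> convex hull (pos x)"
proof -
  obtain a b where x: "x = (a, b)" by (cases x)
  have "(1 - 1 / 2) *\<^sub>R slat a b + (1 / 2) *\<^sub>R slat (a + 1) (b + 1) \<in> convex hull (pos x)"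
    by (intro convexD_alt hull_inc) (simp_all add: x pos_def verts_def)
  moreover have "(1 - 1 / 2) *\<^sub>R slat a b + (1 / 2) *\<^sub>R slat (a + 1) (b + 1) = cen x"
    by (simp add: x cen_def slat_def scaleR_conv_of_real field_simps)
  ultimately show ?thesis by simp
qed

lemma rho_cen: "rho (cen x) = cen (rot x)"
  by (cases x) (simp add: cen_def rot_def rho_def z_def slat_def field_simps)

lemma side_height_cen: "side_height z (cen x) = real_of_int (hgt x) / 2"
  by (cases x) (simp add: side_height_def cen_def hgt_def height_def z_def slat_def field_simps)

lemma P_meets:
  assumes "x \<in> P"
  shows "meets T (pos x)"
proof -
  obtain j where j: "inner ((rot ^^ j) x) \<or> box ((rot ^^ j) x)" using P_cases[OF assms] by blast
  define y where "y = (rot ^^ j) x"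
  have y: "y \<in> P" using assms by (simp add: y_def rot_pow_P)
  have "meets T (pos y)"
  proof (cases "inner y")
    case True
    have "cen y \<in> interior (convex hull T)"
      using True inner_rot inner_hgt z_nonzero
      by (intro interior_square) (simp_all add: fun_cong[OF rho_def, symmetric] rho_cen side_height_cen)
    then show ?thesis using cen_hull[of y] by (auto simp: meets_def)
  next
    case False
    then have bx: "box y" using j by (simp add: y_def)
    obtain a b where ab: "y = (a, b)" by (cases y)
    have b: "0 \<le> a" "a < k" "0 \<le> b" "b < l" using bx by (simp_all add: ab box_def)
    have 1: "0 < (b + 1) * k - a * l" using P_above[OF y] by (simp add: ab above_def)
    have p: "0 \<le> a * k" "0 \<le> a * l" "0 < (b + 1) * l" "0 < (k - a) * k" "0 \<le> (l - 1 - b) * l" "0 \<le> k * (k - 1 - b)" "0 < l * l"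
      using b k0 lk by (auto intro!: mult_nonneg_nonneg mult_pos_pos)
    have "(l + a) * k - (k - (b + 1)) * l = a * k + (b + 1) * l" by (simp add: algebra_simps)
    then have 2: "0 < (l + a) * k - (k - (b + 1)) * l" using p by linarith
    have "(l + (k - (b + 1))) * k - (k - (l + a)) * l = k * (k - 1 - b) + l * l + a * l" by (simp add: algebra_simps)
    then have 3: "0 < (l + (k - (b + 1))) * k - (k - (l + a)) * l" using p by linarith
    have "(l + (k - (l + a))) * k - (k - (l + (k - (b + 1)))) * l = (k - a) * k + (l - 1 - b) * l" by (simp add: algebra_simps)
    then have 4: "0 < (l + (k - (l + a))) * k - (k - (l + (k - (b + 1)))) * l" using p by linarith
    have "slat a (b + 1) \<in> interior (convex hull T)"
      using z_nonzero 1 2 3 4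
      by (intro interior_square)
        (simp_all only: fun_cong[OF rho_def, symmetric] rho_slat side_height_slat of_int_0_less_iff not_False_eq_True)
    moreover have "slat a (b + 1) \<in> pos y" by (auto simp: ab pos_def verts_def)
    then have "slat a (b + 1) \<in> convex hull (pos y)" by (rule hull_inc)
    ultimately show ?thesis by (auto simp: meets_def)
  qed
  then show ?thesis by (simp add: y_def meets_rot_pow)
qed

lemma piece_eq: "{S \<in> unit_squares. convex hull S \<inter> interior (convex hull T) \<noteq> {}} = pos ` P"
proof -
  have "meets T (pos x) \<longleftrightarrow> x \<in> P" for x
  proof
    assume m: "meets T (pos x)"
    then have "meets T (pos (rot x))" "meets T (pos (rot (rot x)))" "meets T (pos (rot (rot (rot x))))"
      by (simp_all only: meets_rot)
    then show "x \<in> P" using m meets_above unfolding P_def by blast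
  qed (rule P_meets)
  then show ?thesis unfolding unit_squares_eq meets_def[symmetric] by blast
qed

lemma Tie_P: "Tie \<subseteq> P"
  by (auto simp: Tie_def)

end

lemma sq_gc_owned:
  assumes h: "sq k l" and G: "finite_graph V E"
    and A: "\<And>x y. sq.adj x y \<longleftrightarrow> x \<noteq> y \<and> card (sq.verts x \<inter> sq.verts y) = 2"
    and L: "\<And>p. p \<in> V \<Longrightarrow> bij_betw (L p) (nbrs E p) {..<4}"
  shows "gc_owned V E 4 L (sq.pos) (sq.P k l) (sq.rot k l) (sq.mir k l) sq.adj (sq.rho k l) (sq.sig k l) (sq.Own k l) (sq.Tie k l)"
proof -
  interpret sq k l by (rule h)
  show ?thesis
  proof (intro gc_owned.intro gc_system.intro gc_owned_axioms.intro, goal_cases)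
    case (22 t u i j)
    then show ?case using far_adj[of t u i j] by blast
  next
    case (21 t)
    then show ?case using cover[of t] by simp
  next
    case (24 t u)
    then show ?case using cross_adj[of t u] by blast
  next
    case (23 t u)
    then show ?case by (rule tie_adj)
  next
    case (14 t i j)
    then show ?case by (rule cross_unique)
  qed (fact G L pos_inj rho_pos sig_pos rot_powers mir_mir P_rot finite_P adj_pos[OF A] adj_rot adj_mir
      Own_P Own_rot Own_mir Tie_P Tie_mir Tie_Own | simp)+
qed

section \<open>Four-valent graphs\<close>

context sq
begin

text \<open>The product of two copies of the top Neumann eigenfunction of the path with \<open>k\<close> vertices.\<close>

lemma square_eigenfunction:
  assumes l: "l = 0"
  defines "K \<equiv> 4 + 4 * cos (pi / real_of_int k)"
  shows "\<exists>h. (\<exists>t\<in>P. h t \<noteq> 0) \<and>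
    2 * K * (\<Sum>t\<in>P. (h t)\<^sup>2) \<le> (\<Sum>t\<in>P. \<Sum>u\<in>{u \<in> P. adj t u}. (h t - h u)\<^sup>2)"
proof -
  define \<theta> where "\<theta> = pi / real_of_int k"
  have \<theta>k: "\<theta> * real_of_int k = pi" using k0 by (simp add: \<theta>_def)
  have \<theta>: "0 < \<theta>" "\<theta> \<le> pi" using k0 by (simp_all add: \<theta>_def field_simps)
  define s :: "int \<Rightarrow> real" where "s x = (if even x then 1 else - 1)" for x
  \<comment> \<open>The alternating sign replaces \<open>2 - 2 * cos \<theta>\<close> by
    \<open>2 + 2 * cos \<theta>\<close>, and sampling at half-integers makes \<open>v\<close>
    symmetric across both ends of the path (\<open>v0\<close>, \<open>vk\<close>).\<close>
  define v where "v x = s x * sin (\<theta> * (real_of_int x + 1 / 2))" for x :: int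
  have s1: "s (x + 1) = - s x" "s (x - 1) = - s x" for x by (simp_all add: s_def)
  have rec: "2 * v x - v (x - 1) - v (x + 1) = (2 + 2 * cos \<theta>) * v x" for x
  proof -
    have "\<theta> * (real_of_int (x + 1) + 1 / 2) = \<theta> * (real_of_int x + 1 / 2) + \<theta>"
      "\<theta> * (real_of_int (x - 1) + 1 / 2) = \<theta> * (real_of_int x + 1 / 2) - \<theta>"
      by (simp_all add: algebra_simps)
    then show ?thesis unfolding v_def s1 by (simp only: sin_add sin_diff) (simp add: algebra_simps)
  qed
  have v0: "v (- 1) = v 0"
  proof -
    have "\<theta> * (real_of_int (- 1) + 1 / 2) = - (\<theta> * (real_of_int 0 + 1 / 2))" by simp
    then show ?thesis unfolding v_def by (simp only: sin_minus) (simp add: s_def)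
  qed
  have vk: "v k = v (k - 1)"
  proof -
    have "\<theta> * (real_of_int k + 1 / 2) = pi + \<theta> / 2" "\<theta> * (real_of_int (k - 1) + 1 / 2) = pi - \<theta> / 2"
      using \<theta>k by (simp_all add: algebra_simps)
    then show ?thesis unfolding v_def s1 by (simp only: sin_add sin_diff) simp
  qed
  define h :: "cell \<Rightarrow> real" where "h = (\<lambda>(a, b). v a * v b)"
  have P: "(a, b) \<in> P \<longleftrightarrow> 0 \<le> a \<and> a < k \<and> 0 \<le> b \<and> b < k" for a b
  proof -
    have pk: "0 < x * k \<longleftrightarrow> 0 < x" for x using k0 by (simp add: zero_less_mult_iff)
    have "(a, b) \<in> P \<longleftrightarrow> a * l < (b + 1) * k \<and> (k - 1 - b) * l < (l + a + 1) * k \<and>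
        (k - 1 - (l + a)) * l < (l + (k - 1 - b) + 1) * k \<and>
        (k - 1 - (l + (k - 1 - b))) * l < (l + (k - 1 - (l + a)) + 1) * k"
      by (simp add: P_def above_def rot_def)
    also have "\<dots> \<longleftrightarrow> 0 < b + 1 \<and> 0 < 0 + a + 1 \<and> 0 < 0 + (k - 1 - b) + 1 \<and> 0 < 0 + (k - 1 - (0 + a)) + 1"
      by (simp only: l mult_zero_right pk)
    finally show ?thesis by auto
  qed
  have sum: "(\<Sum>u\<in>{u \<in> P. adj t u}. h t - h u) = K * h t" if t: "t \<in> P" for t
  proof -
    obtain a b where ab: "t = (a, b)" by (cases t)
    note t' = t[unfolded ab P]
    define N where "N = {(a + 1, b), (a - 1, b), (a, b + 1), (a, b - 1)}"
    have "(\<Sum>u\<in>{u \<in> P. adj t u}. h t - h u) = (\<Sum>u\<in>N. h t - h u)"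
    proof (rule sum.mono_neutral_left)
      show "finite N" by (simp add: N_def)
      show sub: "{u \<in> P. adj t u} \<subseteq> N" by (auto simp: ab N_def adj_def)
      \<comment> \<open>A neighbour outside the piece would carry the same value and contributes
        nothing.\<close>
      have N: "u \<in> P \<or> h u = h t" if "u \<in> N" for u
      proof -
        from that consider "u = (a + 1, b)" | "u = (a - 1, b)" | "u = (a, b + 1)" | "u = (a, b - 1)" by (auto simp: N_def)
        then show ?thesis
        proof cases
          case 1
          then show ?thesis using t' vk by (cases "a + 1 = k") (auto simp: P h_def ab)
        next
          case 2
          then show ?thesis using t' v0 by (cases "a = 0") (auto simp: P h_def ab)
        next
          case 3
          then show ?thesis using t' vk by (cases "b + 1 = k") (auto simp: P h_def ab)
        next
          case 4
          then show ?thesis using t' v0 by (cases "b = 0") (auto simp: P h_def ab)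
        qed
      qed
      have "adj t u" if "u \<in> N" for u using that by (auto simp: ab N_def adj_def)
      then show "\<forall>u\<in>N - {u \<in> P. adj t u}. h t - h u = 0" using N by fastforce
    qed
    also have "\<dots> = v b * (2 * v a - v (a - 1) - v (a + 1)) + v a * (2 * v b - v (b - 1) - v (b + 1))"
      by (simp add: N_def h_def ab algebra_simps)
    also have "\<dots> = K * h t" unfolding rec by (simp add: K_def \<theta>_def[symmetric] h_def ab algebra_simps)
    finally show ?thesis .
  qed
  have "(\<Sum>t\<in>P. \<Sum>u\<in>{u \<in> P. adj t u}. (h t - h u)\<^sup>2) = 2 * (\<Sum>t\<in>P. h t * (K * h t))"
    unfolding sum_edge_squares[OF finite_P adj_sym] using sum by simp
  also have "\<dots> = 2 * K * (\<Sum>t\<in>P. (h t)\<^sup>2)"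
    by (simp add: sum_distrib_left power2_eq_square mult_ac)
  finally have e: "2 * K * (\<Sum>t\<in>P. (h t)\<^sup>2) \<le> (\<Sum>t\<in>P. \<Sum>u\<in>{u \<in> P. adj t u}. (h t - h u)\<^sup>2)" by simp
  have "0 < sin (\<theta> / 2)" using \<theta> by (intro sin_gt_zero) simp_all
  then have "h (0, 0) \<noteq> 0" by (simp add: h_def v_def s_def)
  moreover have "(0, 0) \<in> P" using k0 by (simp add: P)
  ultimately show ?thesis using e by blast
qed

end

locale sq_graph = sq k l + gc_owned V E 4 L sq.pos "sq.P k l" "sq.rot k l" "sq.mir k l" sq.adj
    "sq.rho k l" "sq.sig k l" "sq.Own k l" "sq.Tie k l"
  for k l V E L
begin

lemma square_lower:
  assumes "l = 0" "1 \<le> i" "i \<le> card V"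
  shows "lap_eig G (card W - i + 1) \<ge> 4 + 4 * cos (pi / real_of_int k)"
proof -
  obtain h where h: "\<exists>t\<in>P. h t \<noteq> 0"
    "2 * (4 + 4 * cos (pi / real_of_int k)) * (\<Sum>t\<in>P. (h t)\<^sup>2) \<le> (\<Sum>t\<in>P. \<Sum>u\<in>{u \<in> P. adj t u}. (h t - h u)\<^sup>2)"
    using square_eigenfunction[OF assms(1)] by blast
  show ?thesis by (rule lap_eig_ge_piece[OF no_crossing_l0[OF assms(1)] assms(2,3) h])
qed

lemma C3_le: "card (C3 i j) \<le> 1"
  unfolding C3_def by (rule far_pairs_card(1))

text \<open>Edges to ties are counted with weight 1 although they carry only weight 1/2; this cruder
  count suffices.\<close>

lemma C_cut: "real (card C1) + real (card C2) / 2 \<le> real_of_int (int (card cut))"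
proof -
  have "cut = C1 \<union> C2" unfolding cut_def C1_def C2_def by blast
  moreover have "C1 \<inter> C2 = {}" unfolding C1_def C2_def using Tie_mir Tie_Own by blast
  ultimately have "card cut = card C1 + card C2" using finite_sets by (simp add: card_Un_disjoint)
  then show ?thesis by simp
qed

text \<open>The norm carried by the \<open>t\<close> ties is dropped, so (k + l) N <= 2 k (N - 2 t)
  is needed, that is 4 k t <= (k - l) N. If \<open>t > 0\<close>, then \<open>k - l\<close> is even
  and at least 2, and t <= l with 2 k l <= N gives 4 k t <= 2 N.\<close>

lemma upper_less:
  assumes lk: "l < k" and i: "1 \<le> i" "i \<le> card V"
  shows "lap_eig G i \<le> 2 * real_of_int k / real_of_int (k\<^sup>2 + l\<^sup>2) * lap_eig (V, E) i"
proof -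
  define N where "N = k\<^sup>2 + l\<^sup>2"
  have N: "0 < N" using k0 by (simp add: N_def add_pos_nonneg)
  define t where "t = int (card Tie)"
  have O: "N - 2 * t \<le> int (card Own)" using card_Own by (simp add: N_def t_def)
  have T: "tie_set = {}"
    using far_pairs_card(2)[OF lk, folded C3_def] by (auto simp: tie_set_def)
  have "4 * (k * t) \<le> (k - l) * N"
  proof (cases "Tie = {}")
    case True
    then show ?thesis using lk N by (simp add: t_def)
  next
    case False
    then have "even (k - l)" by (rule card_Tie(3))
    then have "2 \<le> k - l" using lk by presburger
    then have "2 * N \<le> (k - l) * N" using N by (intro mult_right_mono) auto
    moreover have "k * t \<le> k * l" using card_Tie(2) k0 by (intro mult_left_mono) (auto simp: t_def)
    moreover have "2 * (k * l) \<le> N"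
      using zero_le_power2[of "k - l"] by (simp add: N_def power2_eq_square algebra_simps)
    ultimately show ?thesis by linarith
  qed
  then have "(k + l) * N \<le> 2 * k * (N - 2 * t)" by (simp add: algebra_simps)
  also have "\<dots> \<le> 2 * k * int (card Own)" using O k0 by (intro mult_left_mono) auto
  finally have *: "(k + l) * N \<le> 2 * k * int (card Own)" .
  have "0 < (k + l) * N" using k0 l0 N by (intro mult_pos_pos) auto
  then have "0 < 2 * k * int (card Own)" using * by linarith
  then have O': "Own \<noteq> {}" by auto
  have "real (card C1) + real (card C2) / 2 \<le> real_of_int (k + l)"
    using C_cut card_cut(2) by (meson of_int_le_iff order_trans)
  also have "\<dots> \<le> 2 * real_of_int k / real_of_int N * real (card Own)"
  proof -
    have "real_of_int ((k + l) * N) \<le> real_of_int (2 * k * int (card Own))" using * by (simp only: of_int_le_iff)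
    then show ?thesis using N by (simp add: field_simps)
  qed
  finally show ?thesis unfolding N_def[symmetric] by (rule lap_eig_lift[OF T O' i])
qed

text \<open>For \<open>k = l\<close> the squares centred on neighbouring sides are adjacent at the corners. Both the energy
  of these edges, a combination of the energy of \<open>f\<close> and \<open>\<parallel>\<Delta>f\<parallel>\<^sup>2\<close>, and the loss of norm by averaging are diagonal
  in an eigenbasis of \<open>X\<close>, and the estimate reduces to \<open>(\<kappa> - \<mu>) (2 k - \<mu> / 4) \<ge> 0\<close> for each eigenvalue \<open>\<mu> \<le> \<kappa>\<close>.\<close>

lemma upper_diagonal_aux:
  assumes kl: "k = l" and i: "1 \<le> i" "i \<le> card V" and W: "card V \<le> card W"
    and lam: "lap_eig (V, E) i < 8 * real_of_int k"
  shows "lap_eig G i \<le> lap_eig (V, E) i / real_of_int k"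
proof -
  define K where "K = real_of_int k"
  have K: "1 \<le> K" using k0 by (simp add: K_def)
  define \<kappa> where "\<kappa> = lap_eig (V, E) i"
  obtain \<phi> where B: "eigenbasis V E \<phi>" using lap_spectrum(3)[OF graph] by auto
  define \<psi> where "\<psi> j = lift (\<phi> j)" for j
  define \<mu> where "\<mu> j = lap_eig (V, E) (j + 1)" for j
  have mu: "0 \<le> \<mu> j" "\<mu> j \<le> 8" "\<mu> j \<le> \<kappa>" if "j < i" for j
  proof -
    show "0 \<le> \<mu> j" "\<mu> j \<le> \<kappa>"
      using that i lap_eig_mono[OF graph, of "j + 1" i] lap_eig_bounds(1)[OF graph, of "j + 1"] by (auto simp: \<mu>_def \<kappa>_def)
    have "lap_eig (V, E) (j + 1) \<le> 2 * real 4"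
      using that i by (intro lap_eig_bounds(2)[OF graph]) (simp_all add: deg_card)
    then show "\<mu> j \<le> 8" by (simp add: \<mu>_def)
  qed
  have lam0: "0 \<le> \<kappa>" using lap_eig_bounds(1)[OF graph i] by (simp add: \<kappa>_def)
  have cC: "real (card C1) + real (card C2) / 2 \<le> 2 * K - 2"
  proof -
    have "real_of_int (int (card cut)) \<le> real_of_int (2 * (k - 1))" using card_cut(3)[OF kl] by (simp only: of_int_le_iff)
    then show ?thesis using C_cut by (simp add: K_def)
  qed
  have "k\<^sup>2 + k\<^sup>2 \<le> int (card Own) + 2 * int (card Tie)" using card_Own kl by simp
  then have "real_of_int (k\<^sup>2 + k\<^sup>2) \<le> real_of_int (int (card Own) + 2 * int (card Tie))" by (simp only: of_int_le_iff)
  then have cO: "2 * K\<^sup>2 \<le> real (card Own) + 2 * real (card Tie)" by (simp add: K_def)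
  have "int (card Tie) \<le> k" using card_Tie(2) lk by linarith
  then have "real_of_int (int (card Tie)) \<le> real_of_int k" by (simp only: of_int_le_iff)
  then have cT: "real (card Tie) \<le> K" by (simp add: K_def)
  show ?thesis
  proof (rule lap_eig_le[where W = W and F = F and \<psi> = \<psi>, unfolded prod.collapse])
    show "finite_graph W F" "1 \<le> i" "i \<le> card W" using finite_graph_G i W by auto
    fix c :: "nat \<Rightarrow> complex" assume c: "\<exists>j<i. c j \<noteq> 0"
    define f where "f = (\<lambda>x. \<Sum>j<i. c j * \<phi> j x)"
    define sq where "sq j = (cmod (c j))\<^sup>2" for j
    note low = low_space_bounds[OF graph B i(2) c, folded f_def \<kappa>_def]
    note ls = low_space[OF graph B i(2), of c, folded f_def sq_def \<mu>_def]
    have g: "(\<lambda>X. \<Sum>j<i. c j * \<psi> j X) = lift f" unfolding f_def \<psi>_def by (rule ext) (rule lift_sum[symmetric])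
    have e0: "0 \<le> energy E f" by (rule energy_nonneg)
    have "2 * K\<^sup>2 * sqnorm V f \<le> (real (card Own) + 2 * real (card Tie)) * sqnorm V f"
      using low(1) by (intro mult_right_mono[OF cO]) simp
    moreover have "real (card Tie) / 4 * energy E f \<le> K / 4 * energy E f"
      using e0 cT by (intro mult_right_mono) simp_all
    ultimately have n: "2 * K\<^sup>2 * sqnorm V f - K / 4 * energy E f \<le> sqnorm W (lift f)"
      using sqnorm_lift_ties[of f] by simp
    have "(real (card C1) + real (card C2) / 2 + 2) * energy E f \<le> 2 * K * energy E f"
      using cC by (intro mult_right_mono[OF _ e0]) simp
    then have en: "energy F (lift f) \<le> 2 * K * energy E f - sqnorm V (laplace E f) / 4"
      using energy_lift_ties[OF C3_le, of f] by simp
    \<comment> \<open>Averaging costs at most \<open>K * \<kappa> / 4\<close> times the norm of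
      \<open>f\<close>, and the strict bound \<open>\<kappa> < 8 * K\<close> keeps the lift from
      vanishing.\<close>
    have "K / 4 * energy E f \<le> K / 4 * (\<kappa> * sqnorm V f)" using low(2) K by (intro mult_left_mono) auto
    also have "\<dots> = K * sqnorm V f * (\<kappa> / 4)" by simp
    also have "\<dots> < K * sqnorm V f * (2 * K)" using lam K low(1) by (intro mult_strict_left_mono) (simp_all add: K_def \<kappa>_def)
    also have "\<dots> = 2 * K\<^sup>2 * sqnorm V f" by (simp add: power2_eq_square)
    finally have pos: "0 < sqnorm W (lift f)" using n by linarith
    \<comment> \<open>The second factor is nonnegative because eigenvalues of a 4-valent graph are
      at most 8 and \<open>K \<ge> 1\<close>.\<close>
    have "0 \<le> (\<Sum>j<i. (\<kappa> - \<mu> j) * (2 * K - \<mu> j / 4) * sq j)"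
    proof (rule sum_nonneg)
      fix j assume "j \<in> {..<i}"
      then have "0 \<le> \<kappa> - \<mu> j" "0 \<le> 2 * K - \<mu> j / 4" "0 \<le> sq j" using mu[of j] K by (auto simp: sq_def)
      then show "0 \<le> (\<kappa> - \<mu> j) * (2 * K - \<mu> j / 4) * sq j" by (intro mult_nonneg_nonneg)
    qed
    also have "\<dots> = (\<Sum>j<i. 2 * K * \<kappa> * sq j - \<kappa> / 4 * (\<mu> j * sq j) - 2 * K * (\<mu> j * sq j) + (\<mu> j)\<^sup>2 * sq j / 4)"
      by (intro sum.cong refl) (simp add: power2_eq_square field_simps)
    also have "\<dots> = 2 * K * \<kappa> * sqnorm V f - \<kappa> / 4 * energy E f - 2 * K * energy E f + sqnorm V (laplace E f) / 4"
      unfolding ls by (simp add: sum.distrib sum_subtractf sum_distrib_left sum_divide_distrib)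
    also have "\<dots> = \<kappa> / K * (2 * K\<^sup>2 * sqnorm V f - K / 4 * energy E f) - (2 * K * energy E f - sqnorm V (laplace E f) / 4)"
      using K by (simp add: power2_eq_square field_simps)
    finally have "2 * K * energy E f - sqnorm V (laplace E f) / 4 \<le> \<kappa> / K * (2 * K\<^sup>2 * sqnorm V f - K / 4 * energy E f)" by simp
    also have "\<dots> \<le> \<kappa> / K * sqnorm W (lift f)" using K lam0 by (intro mult_left_mono[OF n]) simp
    finally show "0 < sqnorm W (\<lambda>X. \<Sum>j<i. c j * \<psi> j X) \<and> energy F (\<lambda>X. \<Sum>j<i. c j * \<psi> j X)
        \<le> lap_eig (V, E) i / real_of_int k * sqnorm W (\<lambda>X. \<Sum>j<i. c j * \<psi> j X)"
      unfolding g using pos en by (simp add: K_def \<kappa>_def)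
  qed
qed

text \<open>As eigenvalues are at most 8, the strict hypothesis of \<open>upper_diagonal_aux\<close>
  fails only for \<open>k = 1\<close> and eigenvalue 8, where a lift may average to 0. There the
  claim is the bound 8 of \<open>energy_all_ties\<close>.\<close>

lemma upper_diagonal:
  assumes kl: "k = l" and i: "1 \<le> i" "i \<le> card V"
  shows "lap_eig G i \<le> lap_eig (V, E) i / real_of_int k"
proof -
  have lam: "lap_eig (V, E) i \<le> 8" using lap_eig_bounds(2)[OF graph i, of 4] by (simp add: deg_card)
  show ?thesis
  proof (cases "2 \<le> k")
    case True
    have "k * 1 < k * k" using True by (intro mult_strict_left_mono) auto
    moreover have "k\<^sup>2 + l\<^sup>2 = 2 * (k * k)" using kl by (simp add: power2_eq_square)
    ultimately have "0 < int (card Own)" using card_Own card_Tie(2) kl by linarith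
    then have "Own \<noteq> {}" by auto
    then show ?thesis using upper_diagonal_aux[OF kl i card_W_ge] lam True by simp
  next
    case False
    then have k: "k = 1" "l = 1" using k0 kl by auto
    note u = unit_case[OF k]
    \<comment> \<open>\<open>Own\<close> is empty, so \<open>card W\<close> is bounded by counting
      ties: the \<open>4 * card V\<close> ordered edges yield each class at most twice.\<close>
    have "(\<Sum>((p, q), t)\<in>E \<times> Tie. 1 :: real) \<le> 2 * (\<Sum>X\<in>(\<lambda>((p, q), t). pic p q t) ` (E \<times> Tie). 1)"
      by (rule tie_sum_le) simp
    also have "\<dots> \<le> 2 * (\<Sum>X\<in>W. 1)"
      using tie_sub finite_graphD(1)[OF finite_graph_G] by (intro mult_left_mono sum_mono2) auto
    also have "(\<Sum>((p, q), t)\<in>E \<times> Tie. 1 :: real) = real (card E)" using u by (simp add: case_prod_unfold card_cartesian_product)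
    also have "real (card E) = 4 * real (card V)"
      using edge_sum_fst[of "\<lambda>_. 1"] by (simp add: case_prod_unfold sqnorm_def)
    finally have W: "card V \<le> card W" by simp
    show ?thesis
    proof (cases "lap_eig (V, E) i < 8")
      case True
      then show ?thesis using upper_diagonal_aux[OF kl i W] by (simp add: k)
    next
      case False
      then have 8: "lap_eig (V, E) i / real_of_int k = 8" using lam k by simp
      obtain \<phi> where B: "eigenbasis W F \<phi>" using lap_spectrum(3)[OF finite_graph_G] by auto
      have iW: "i \<le> card W" using i W by simp
      show ?thesis
        unfolding 8
      proof (rule lap_eig_le[where W = W and F = F and \<psi> = \<phi>, unfolded prod.collapse])
        show "finite_graph W F" "1 \<le> i" "i \<le> card W" using finite_graph_G i iW by auto
        fix c :: "nat \<Rightarrow> complex" assume c: "\<exists>j<i. c j \<noteq> 0"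
        show "0 < sqnorm W (\<lambda>X. \<Sum>j<i. c j * \<phi> j X) \<and> energy F (\<lambda>X. \<Sum>j<i. c j * \<phi> j X)
            \<le> 8 * sqnorm W (\<lambda>X. \<Sum>j<i. c j * \<phi> j X)"
          using low_space_bounds(1)[OF finite_graph_G B iW c]
            energy_all_ties[OF u[THEN conjunct1] C3_le u[THEN conjunct2]] by simp
      qed
    qed
  qed
qed

lemma upper:
  assumes i: "1 \<le> i" "i \<le> card V"
  shows "lap_eig G i \<le> 2 * real_of_int k / real_of_int (k\<^sup>2 + l\<^sup>2) * lap_eig (V, E) i"
proof (cases "l < k")
  case True
  then show ?thesis using i by (rule upper_less)
next
  case False
  then have kl: "k = l" using lk by simp
  have "2 * real_of_int k / real_of_int (k\<^sup>2 + l\<^sup>2) = 1 / real_of_int k"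
    using k0 unfolding kl[symmetric] by (simp add: power2_eq_square field_simps)
  then show ?thesis using upper_diagonal[OF kl i] by simp
qed

end

lemma sq_graphI:
  assumes k: "0 < k" "l \<le> k" and G: "finite_graph V E" and L: "compatible_labelling V E \<sigma> 4 L"
    and A: "\<And>x y. sq.adj x y \<longleftrightarrow> x \<noteq> y \<and> card (sq.verts x \<inter> sq.verts y) = 2"
  shows "sq_graph (int k) (int l) V E L"
    and "gc_graph (gc4_piece k l) (\<lambda>w. gc4_z k l + \<i> * w) (\<lambda>w. (2 + \<i>) * gc4_z k l - w) 4 L V E
      = gc_graph (sq.pos ` sq.P (int k) (int l)) (sq.rho (int k) (int l)) (sq.sig (int k) (int l)) 4 L V E"
proof -
  have h: "sq (int k) (int l)" using k by (simp add: sq_def region_def)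
  interpret sq "int k" "int l" by (rule h)
  have z: "gc4_z k l = z" by (simp add: gc4_z_def z_def slat_def)
  have "gc_owned V E 4 L pos P rot mir adj rho sig Own Tie"
    using sq_gc_owned[OF h G A, of L] L by (simp add: compatible_labelling_def)
  then show "sq_graph (int k) (int l) V E L" using h by (simp add: sq_graph_def)
  show "gc_graph (gc4_piece k l) (\<lambda>w. gc4_z k l + \<i> * w) (\<lambda>w. (2 + \<i>) * gc4_z k l - w) 4 L V E
      = gc_graph (pos ` P) rho sig 4 L V E"
    unfolding gc4_piece_def z piece_eq[symmetric] rho_def sig_def ..
qed

section \<open>The eigenvalue comparison\<close>

text \<open>For \<open>k = 1\<close> and \<open>l = 0\<close> the trivalent bound would read 6 for
  all \<open>i\<close>, which is impossible at \<open>i = card V\<close>, where the index is 1 and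
  the eigenvalue 0; hence the condition \<open>2 \<le> k\<close> there.\<close>

theorem theorem1p2:
  fixes V :: "'v set" and E :: "('v \<times> 'v) set" and \<sigma> :: "'v \<Rightarrow> 'v \<Rightarrow> 'v"
    and k l :: nat
  assumes "simple_graph V E" and "connected_graph V E"
    and "regular V E 3 \<or> regular V E 4"
    and "orientation V E \<sigma>"
    and "l \<le> k" and "k \<noteq> 0"
  shows
    "(regular V E 3 \<longrightarrow> (\<forall>i\<in>{1..card V}.
        lap_eig (GC3 k l V E \<sigma>) i \<le> 3 * real k / real (k\<^sup>2 + k * l + l\<^sup>2) * lap_eig (V, E) i))
   \<and> (regular V E 4 \<longrightarrow> (\<forall>i\<in>{1..card V}.
        lap_eig (GC4 k l V E \<sigma>) i \<le> 2 * real k / real (k\<^sup>2 + l\<^sup>2) * lap_eig (V, E) i))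
   \<and> (regular V E 3 \<and> bipartite V E \<longrightarrow> (\<forall>i\<in>{1..card V}.
        lap_eig (GC3 k l V E \<sigma>) (card (fst (GC3 k l V E \<sigma>)) - i + 1)
          \<ge> 6 - 3 * real k / real (k\<^sup>2 + k * l + l\<^sup>2) * lap_eig (V, E) i))
   \<and> (l = 0 \<longrightarrow>
        (regular V E 3 \<and> 2 \<le> k \<longrightarrow> (\<forall>i\<in>{1..card V}.
           lap_eig (GC3 k 0 V E \<sigma>) (card (fst (GC3 k 0 V E \<sigma>)) - i + 1)
             \<ge> 3 + sqrt (5 + 4 * cos (2 * pi / real k))))
      \<and> (regular V E 4 \<and> even k \<longrightarrow> (\<forall>i\<in>{1..card V}.
           lap_eig (GC4 k 0 V E \<sigma>) (card (fst (GC4 k 0 V E \<sigma>)) - i + 1)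
             \<ge> 4 + 4 * cos (2 * pi / real k)))
      \<and> (regular V E 4 \<and> odd k \<longrightarrow> (\<forall>i\<in>{1..card V}.
           lap_eig (GC4 k 0 V E \<sigma>) (card (fst (GC4 k 0 V E \<sigma>)) - i + 1)
             \<ge> 4 + 4 * cos (pi / real k))))"
proof -
  \<comment> \<open>Adjacency and vertex sets do not involve \<open>k\<close> and \<open>l\<close>,
    so any instance of the locale serves. Only the offset of the two tiles matters, and offsets
    beyond 2 give disjoint vertex sets.\<close>
  have adj3: "hex.adj x y \<longleftrightarrow> x \<noteq> y \<and> card (hex.verts x \<inter> hex.verts y) = 2" for x y
  proof -
    interpret hex 1 0 by (simp add: hex_def region_def)
    obtain a b t where x: "x = (a, b, t)" by (cases x)
    obtain c d s where y: "y = (c, d, s)" by (cases y)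
    define i j where "i = c - a" and "j = d - b"
    have cd: "c = a + i" "d = b + j" by (simp_all add: i_def j_def)
    show ?thesis
    proof (cases "i \<in> {- 2, - 1, 0, 1, 2} \<and> j \<in> {- 2, - 1, 0, 1, 2}")
      case True
      then show ?thesis unfolding x y cd by (cases t; cases s) (auto simp: verts_def adj_def Int_insert_left)
    next
      case False
      then have "verts x \<inter> verts y = {}" unfolding x y cd by (cases t; cases s) (auto simp: verts_def)
      moreover have "\<not> adj x y" using False unfolding x y cd by (auto simp: adj_def)
      ultimately show ?thesis by simp
    qed
  qed
  have adj4: "sq.adj x y \<longleftrightarrow> x \<noteq> y \<and> card (sq.verts x \<inter> sq.verts y) = 2" for x y
  proof -
    interpret sq 1 0 by (simp add: sq_def region_def)
    obtain a b where x: "x = (a, b)" by (cases x)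
    obtain c d where y: "y = (c, d)" by (cases y)
    define i j where "i = c - a" and "j = d - b"
    have cd: "c = a + i" "d = b + j" by (simp_all add: i_def j_def)
    show ?thesis
    proof (cases "i \<in> {- 2, - 1, 0, 1, 2} \<and> j \<in> {- 2, - 1, 0, 1, 2}")
      case True
      then show ?thesis unfolding x y cd by (auto simp: verts_def adj_def Int_insert_left)
    next
      case False
      then have "verts x \<inter> verts y = {}" unfolding x y cd by (auto simp: verts_def)
      moreover have "\<not> adj x y" using False unfolding x y cd by (auto simp: adj_def)
      ultimately show ?thesis by simp
    qed
  qed
  have G: "finite_graph V E" using assms(1) by (simp add: simple_graph_def finite_graph_def)
  have k: "0 < k" "l \<le> k" "0 \<le> k" using assms by auto
  have c3: "real_of_int ((int k)\<^sup>2 + int k * int l + (int l)\<^sup>2) = real (k\<^sup>2 + k * l + l\<^sup>2)" for k l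
    by simp
  have c4: "real_of_int ((int k)\<^sup>2 + (int l)\<^sup>2) = real (k\<^sup>2 + l\<^sup>2)" for k l by simp
  have hex: "\<exists>L. hex_graph (int k) (int m) V E L \<and> GC3 k m V E \<sigma> =
      gc_graph (hex.pos ` hex.P (int k) (int m)) (hex.rho (int k) (int m)) (hex.sig (int k) (int m)) 3 L V E"
    if "regular V E 3" "m \<le> k" for m
    using hex_graphI[OF k(1) that(2) G compatible_labelling_exists[OF assms(4) that(1)] adj3] unfolding GC3_def by auto
  have sq: "\<exists>L. sq_graph (int k) (int m) V E L \<and> GC4 k m V E \<sigma> =
      gc_graph (sq.pos ` sq.P (int k) (int m)) (sq.rho (int k) (int m)) (sq.sig (int k) (int m)) 4 L V E"
    if "regular V E 4" "m \<le> k" for m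
    using sq_graphI[OF k(1) that(2) G compatible_labelling_exists[OF assms(4) that(1)] adj4] unfolding GC4_def by auto
  have 1: "lap_eig (GC3 k l V E \<sigma>) i \<le> 3 * real k / real (k\<^sup>2 + k * l + l\<^sup>2) * lap_eig (V, E) i"
    if r: "regular V E 3" and i: "i \<in> {1..card V}" for i
  proof -
    obtain L where L: "hex_graph (int k) (int l) V E L" "GC3 k l V E \<sigma> =
      gc_graph (hex.pos ` hex.P (int k) (int l)) (hex.rho (int k) (int l)) (hex.sig (int k) (int l)) 3 L V E"
      using hex[OF r k(2)] by blast
    show ?thesis using hex_graph.upper[OF L(1), of i] i unfolding L(2) c3 of_int_of_nat_eq by simp
  qed
  have 2: "lap_eig (GC4 k l V E \<sigma>) i \<le> 2 * real k / real (k\<^sup>2 + l\<^sup>2) * lap_eig (V, E) i"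
    if r: "regular V E 4" and i: "i \<in> {1..card V}" for i
  proof -
    obtain L where L: "sq_graph (int k) (int l) V E L" "GC4 k l V E \<sigma> =
      gc_graph (sq.pos ` sq.P (int k) (int l)) (sq.rho (int k) (int l)) (sq.sig (int k) (int l)) 4 L V E"
      using sq[OF r k(2)] by blast
    show ?thesis using sq_graph.upper[OF L(1), of i] i unfolding L(2) c4 of_int_of_nat_eq by simp
  qed
  have 3: "lap_eig (GC3 k l V E \<sigma>) (card (fst (GC3 k l V E \<sigma>)) - i + 1)
      \<ge> 6 - 3 * real k / real (k\<^sup>2 + k * l + l\<^sup>2) * lap_eig (V, E) i"
    if r: "regular V E 3" and b: "bipartite V E" and i: "i \<in> {1..card V}" for i
  proof -
    obtain L where L: "hex_graph (int k) (int l) V E L" "GC3 k l V E \<sigma> =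
      gc_graph (hex.pos ` hex.P (int k) (int l)) (hex.rho (int k) (int l)) (hex.sig (int k) (int l)) 3 L V E"
      using hex[OF r k(2)] by blast
    obtain A where "\<forall>(p, q)\<in>E. (p \<in> A \<longleftrightarrow> q \<notin> A)" using b by (auto simp: bipartite_def)
    from hex_graph.bipartite_lower[OF L(1) this, of i] show ?thesis
      using i unfolding L(2) c3 of_int_of_nat_eq by simp
  qed
  have 4: "lap_eig (GC3 k 0 V E \<sigma>) (card (fst (GC3 k 0 V E \<sigma>)) - i + 1) \<ge> 3 + sqrt (5 + 4 * cos (2 * pi / real k))"
    if r: "regular V E 3" and "2 \<le> k" and i: "i \<in> {1..card V}" for i
  proof -
    obtain L where L: "hex_graph (int k) (int 0) V E L" "GC3 k 0 V E \<sigma> =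
      gc_graph (hex.pos ` hex.P (int k) (int 0)) (hex.rho (int k) (int 0)) (hex.sig (int k) (int 0)) 3 L V E"
      using hex[OF r k(3)] by blast
    show ?thesis using hex_graph.triangle_lower[OF L(1), of i] i \<open>2 \<le> k\<close> unfolding L(2) of_int_of_nat_eq by simp
  qed
  have 5: "lap_eig (GC4 k 0 V E \<sigma>) (card (fst (GC4 k 0 V E \<sigma>)) - i + 1) \<ge> 4 + 4 * cos (pi / real k)"
    if r: "regular V E 4" and i: "i \<in> {1..card V}" for i
  proof -
    obtain L where L: "sq_graph (int k) (int 0) V E L" "GC4 k 0 V E \<sigma> =
      gc_graph (sq.pos ` sq.P (int k) (int 0)) (sq.rho (int k) (int 0)) (sq.sig (int k) (int 0)) 4 L V E"
      using sq[OF r k(3)] by blast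
    show ?thesis using sq_graph.square_lower[OF L(1), of i] i unfolding L(2) of_int_of_nat_eq by simp
  qed
  \<comment> \<open>The eigenfunction gives \<open>pi / k\<close> for every \<open>k\<close>; for
    even \<open>k\<close> the stated bound is weaker, as cosine decreases on the interval from 0 to
    pi.\<close>
  have 6: "4 + 4 * cos (2 * pi / real k) \<le> 4 + 4 * cos (pi / real k)" if "even k"
  proof -
    have "2 \<le> k" using that k by presburger
    then have "cos (2 * pi / real k) \<le> cos (pi / real k)"
      by (intro cos_monotone_0_pi_le) (simp_all add: field_simps)
    then show ?thesis by simp
  qed
  show ?thesis
    by (intro conjI impI ballI) (use 1 2 3 4 5 order_trans[OF 6 5] in blast)+
qed

end
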